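(* There exist $n_0, c_0 \in \mathbb{N}$ such that for every $n \ge n_0$ and every $\epsilon \ge c_0 \cdot \frac{1}{2^{\sqrt{\log n}}}$ (with $\epsilon \le 1$), there is a single-pass streaming algorithm that, on partially random order streams (with respect to $\epsilon$) of length $n$ over a universe $U$ of size $\mathrm{poly}(n)$, and given the $\ell_2$ norm of the stream in advance, uses $O(\log n/\epsilon)$ bits of space and, with probability at least $9/10$, outputs a set of elements that contains every $\ell_2$ $\epsilon$-heavy hitter of the stream and contains no element that is not an $\ell_2$ $(\epsilon/256)$-heavy hitter.
   Context: A stream is a sequence $x_1,\dots,x_n$ of elements of a universe $U$ with $|U| = \mathrm{poly}(n)$, given by a multiset $S$ of $n$ elements of $U$ together with a bijection $\Pi: S \to [n]$ assigning each element occurrence a position. For $i \in U$, $f_i$ denotes the number of occurrences of $i$, and $\|S\|_2 = \sqrt{\sum_{i\in U} f_i^2}$. For $0<\epsilon\le 1$, $x$ is an $\ell_2$ $\epsilon$-heavy hitter if $f_x^2 \ge \epsilon \|S\|_2^2$. Let $S^\epsilon \subseteq S$ be the sub-multiset consisting of the occurrences of $\ell_2$ $\epsilon$-heavy hitters. A partially random order stream is one in which the restricted map $\Pi|_{S^\epsilon}: S^\epsilon \to [n]$ is uniformly random (the positions of occurrences of heavy hitters are uniformly random), while the rest of the placement may be adversarial. The success probability is over this randomness and the algorithm's internal randomness. *)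

theory Defs
  imports "HOL-Probability.Probability"
begin

definition l2_norm :: "'a set \<Rightarrow> 'a multiset \<Rightarrow> real" where
  "l2_norm U S = sqrt (\<Sum>i\<in>U. (real (count S i))\<^sup>2)"

definition heavy_hitters :: "'a set \<Rightarrow> real \<Rightarrow> 'a multiset \<Rightarrow> 'a set" where
  "heavy_hitters U \<epsilon> S = {x \<in> U. (real (count S x))\<^sup>2 \<ge> \<epsilon> * (l2_norm U S)\<^sup>2}"

text \<open>The \<open>count S x\<close> many occurrences of \<open>x\<close> in the multiset \<open>S\<close> are made
  distinguishable by tagging them with \<open>0, 1, \<dots>, count S x - 1\<close>.\<close>

definition occs :: "'a multiset \<Rightarrow> ('a \<times> nat) set" where
  "occs S = {(x, j). x \<in># S \<and> j < count S x}"

definition heavy_occs :: "'a set \<Rightarrow> real \<Rightarrow> 'a multiset \<Rightarrow> ('a \<times> nat) set" where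
  "heavy_occs U \<epsilon> S = {(x, j) \<in> occs S. x \<in> heavy_hitters U \<epsilon> S}"

text \<open>A placement is a bijection from the occurrences to the positions, numbered from \<open>0\<close>.\<close>

definition placements :: "'a multiset \<Rightarrow> ('a \<times> nat \<Rightarrow> nat) set" where
  "placements S = {\<pi>. bij_betw \<pi> (occs S) {..<size S}}"

definition stream_of :: "'a multiset \<Rightarrow> ('a \<times> nat \<Rightarrow> nat) \<Rightarrow> 'a list" where
  "stream_of S \<pi> = map (\<lambda>i. fst (inv_into (occs S) \<pi> i)) [0..<size S]"

text \<open>The random placement of a partially random order stream: the positions of the heavy
  occurrences form a uniformly random injection into the set of positions. Nothing else is
  assumed about the joint distribution, so the placement of the other occurrences is
  adversarial and may depend on that of the heavy ones.\<close>

definition partially_random_order ::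
    "'a set \<Rightarrow> real \<Rightarrow> 'a multiset \<Rightarrow> ('a \<times> nat \<Rightarrow> nat) pmf \<Rightarrow> bool" where
  "partially_random_order U \<epsilon> S P \<longleftrightarrow>
     set_pmf P \<subseteq> placements S \<and>
     map_pmf (\<lambda>\<pi>. restrict \<pi> (heavy_occs U \<epsilon> S)) P =
       pmf_of_set {g \<in> heavy_occs U \<epsilon> S \<rightarrow>\<^sub>E {..<size S}. inj_on g (heavy_occs U \<epsilon> S)}"

text \<open>Single-pass randomized streaming algorithms in the usual non-uniform model. The memory is a
  bit string. Fresh coins may be tossed in every phase, but everything that is remembered
  (including random choices and the advice given to \<open>alg_init\<close>) has to be kept in memory.\<close>

record 'a stream_alg =
  alg_init :: "real \<Rightarrow> bool list pmf"
  alg_step :: "bool list \<Rightarrow> 'a \<Rightarrow> bool list pmf"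
  alg_output :: "bool list \<Rightarrow> 'a set pmf"

primrec process :: "'a stream_alg \<Rightarrow> 'a list \<Rightarrow> bool list \<Rightarrow> bool list pmf" where
  "process A [] m = return_pmf m"
| "process A (x # xs) m = bind_pmf (alg_step A m x) (process A xs)"

definition run :: "'a stream_alg \<Rightarrow> real \<Rightarrow> 'a list \<Rightarrow> 'a set pmf" where
  "run A r xs = bind_pmf (bind_pmf (alg_init A r) (process A xs)) (alg_output A)"

definition uses_space :: "'a set \<Rightarrow> 'a stream_alg \<Rightarrow> nat \<Rightarrow> bool" where
  "uses_space U A s \<longleftrightarrow>
     (\<forall>r. \<forall>m \<in> set_pmf (alg_init A r). length m = s) \<and>
     (\<forall>m x. length m = s \<longrightarrow> x \<in> U \<longrightarrow> (\<forall>m' \<in> set_pmf (alg_step A m x). length m' = s))"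

end

theory Submission
  imports Defs
begin

text \<open>
  The length \<open>n\<close> is divided into ticks, so that a heavy element, whose occurrences are at random
  positions, hits most ticks of every block of \<open>D\<close> consecutive ticks. The memory consists of
  \<open>O(log (1/\<epsilon>) / \<epsilon>)\<close> slots. A slot adopts an element whose random label names the current tick and
  keeps it as long as it keeps occurring. Instead of the element itself the slot stores only a prefix
  of its label: the longer the element has survived, the coarser the prefix, so that
  \<open>O(log n / log (1/\<epsilon>))\<close> bits per slot suffice. At stage \<open>s\<close> time is divided into cells of length
  proportional to \<open>D^s\<close>. In every cell the element is reconstructed bit by bit from signed sums over
  the elements with the stored label prefix, and then it is verified that it occurs often enough. The
  slots take turns in this within a cell, so that only one slot per stage needs a workspace of
  \<open>O(log n)\<close> bits at a time.

  An element of frequency \<open>f\<close> blocks a slot for \<open>O(f^2)\<close> pairs of a birth tick and a later tick in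
  expectation over the random turns: the pairs can be charged to pairs of occurrences, and each pair
  of occurrences is charged at a bounded number of stages. Hence the total blocking is \<open>O(F2)\<close>, most
  slots are vacant at most ticks, and a heavy element is caught and kept to the end by a given slot
  with probability at least proportional to \<open>\<epsilon>\<close>. A light element fails the verification in some cell
  of the last stage. Finally the randomness is replaced by one of polynomially many fixed seeds.
  For small \<open>n\<close> (depending on the exponent of the universe size) the stream is stored.
\<close>

section \<open>Streaming algorithms from congruences\<close>

text \<open>A slot catches a given heavy element with probability of order \<epsilon>; a union bound
  over up to 1/\<epsilon> of them forces order log(1/\<epsilon>)/\<epsilon> slots, so a slot may
  keep only order log n / log(1/\<epsilon>) bits, too few for a name. Given the clock, the label
  prefix kept at any stage takes polynomially many values in \<open>D\<close>. It admits impostors,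
  but an impostor must itself be as frequent as the age of the item demands, and few elements are.
  All union and collision bounds are paid with powers of \<open>D\<close>, which must exceed
  1/\<epsilon> and the powers of log n that occur: hence log(1/\<epsilon>) \<le> sqrt(log n) up to
  an additive constant. The norm fixes the tick length: a heavy element averages two occurrences per
  tick or more, and a test asks for one half. An element below \<epsilon>/256 averages about 3/16 or
  less, and Markov's inequality within a cell loses 8/3, so it passes a test with probability at
  most about 1/2 on average.\<close>

lemma process_deterministic:
  assumes "\<And>b x. alg_step A b x = return_pmf (g b x)"
  shows "process A xs b = return_pmf (foldl g b xs)"
  by (induction xs arbitrary: b) (simp_all add: assms bind_return_pmf)

text \<open>A streaming algorithm is determined by the equivalence relation that its memory induces on
  streams. It therefore suffices to give, for every time \<^term>\<open>t\<close>, a function \<^term>\<open>M t\<close> of the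
  stream with few values that is a congruence for reading the next element.\<close>

lemma streaming_realization:
  fixes M :: "nat \<Rightarrow> nat \<Rightarrow> nat \<Rightarrow> (nat \<Rightarrow> nat) \<Rightarrow> 's" and Out :: "nat \<Rightarrow> nat \<Rightarrow> 's \<Rightarrow> nat set"
  assumes "U \<noteq> {}" and "T > 0"
    and init: "\<And>v i X X'. M v i 0 X = M v i 0 X'"
    and cong: "\<And>v i t X X'. v \<le> V \<Longrightarrow> i < T \<Longrightarrow> t < n \<Longrightarrow> (\<And>s. X s \<in> U) \<Longrightarrow> (\<And>s. X' s \<in> U) \<Longrightarrow>
        M v i t X = M v i t X' \<Longrightarrow> X t = X' t \<Longrightarrow> M v i (Suc t) X = M v i (Suc t) X'"
    and fin: "\<And>v i t. v \<le> V \<Longrightarrow> i < T \<Longrightarrow> t \<le> n \<Longrightarrow> finite (M v i t ` {X. \<forall>s. X s \<in> U})"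
    and card: "\<And>v i t. v \<le> V \<Longrightarrow> i < T \<Longrightarrow> t \<le> n \<Longrightarrow> card (M v i t ` {X. \<forall>s. X s \<in> U}) \<le> K"
    and space: "(V + 1) * T * (n + 1) * K \<le> 2 ^ s"
  shows "\<exists>A. uses_space U A s \<and>
    (\<forall>v xs X. v \<le> V \<longrightarrow> length xs = n \<longrightarrow> (\<forall>t. X t \<in> U) \<longrightarrow> (\<forall>t<n. X t = xs ! t) \<longrightarrow>
       run A (sqrt (real v)) xs = map_pmf (\<lambda>i. Out v i (M v i n X)) (pmf_of_set {..<T}))"
proof -
  define F where "F = {X :: nat \<Rightarrow> nat. \<forall>s. X s \<in> U}"
  \<comment> \<open>The norm index \<open>v\<close>, the seed \<open>i\<close> and the clock
    \<open>t\<close> are part of the state, since the model charges for everything that is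
    remembered.\<close>
  define St where "St = (SIGMA v:{..V}. SIGMA i:{..<T}. SIGMA t:{..n}. M v i t ` F)"
  obtain u0 where u0: "u0 \<in> U" using assms(1) by blast
  have inner: "finite (SIGMA t:{..n}. M v i t ` F)" "card (SIGMA t:{..n}. M v i t ` F) \<le> (n+1) * K"
    if "v \<le> V" "i < T" for v i
  proof -
    show "finite (SIGMA t:{..n}. M v i t ` F)" using fin that by (intro finite_SigmaI) (auto simp: F_def)
    have "card (SIGMA t:{..n}. M v i t ` F) = (\<Sum>t\<le>n. card (M v i t ` F))"
      using fin that by (subst card_SigmaI) (auto simp: F_def)
    also have "\<dots> \<le> (\<Sum>t\<le>n. K)" using card that by (intro sum_mono) (auto simp: F_def)
    finally show "card (SIGMA t:{..n}. M v i t ` F) \<le> (n+1) * K" by simp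
  qed
  have mid: "finite (SIGMA i:{..<T}. SIGMA t:{..n}. M v i t ` F)"
    "card (SIGMA i:{..<T}. SIGMA t:{..n}. M v i t ` F) \<le> T * ((n+1) * K)" if "v \<le> V" for v
  proof -
    show "finite (SIGMA i:{..<T}. SIGMA t:{..n}. M v i t ` F)" using inner(1) that by (intro finite_SigmaI[OF _ inner(1)]) auto
    have "card (SIGMA i:{..<T}. SIGMA t:{..n}. M v i t ` F) = (\<Sum>i<T. card (SIGMA t:{..n}. M v i t ` F))"
      using inner that by (subst card_SigmaI) auto
    also have "\<dots> \<le> (\<Sum>i<T. (n+1) * K)" using inner that by (intro sum_mono) auto
    finally show "card (SIGMA i:{..<T}. SIGMA t:{..n}. M v i t ` F) \<le> T * ((n+1) * K)" by simp
  qed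
  have finSt: "finite St" unfolding St_def by (intro finite_SigmaI[OF _ mid(1)]) auto
  have "card St = (\<Sum>v\<le>V. card (SIGMA i:{..<T}. SIGMA t:{..n}. M v i t ` F))"
    unfolding St_def using mid by (subst card_SigmaI) auto
  also have "\<dots> \<le> (\<Sum>v\<le>V. T * ((n+1) * K))" using mid by (intro sum_mono) auto
  also have "\<dots> = (V+1) * T * (n+1) * K" by (simp add: algebra_simps)
  also have "\<dots> \<le> card {b::bool list. length b = s}" using space card_lists_length_eq[of "UNIV :: bool set" s] by simp
  finally have "card St \<le> card {b::bool list. length b = s}" .
  moreover have "finite {b::bool list. length b = s}"
    using finite_lists_length_eq[of "UNIV :: bool set" s] by simp
  ultimately obtain enc where enc: "enc ` St \<subseteq> {b::bool list. length b = s}" "inj_on enc St"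
    using card_le_inj[OF finSt] by blast
  define dec where "dec = inv_into St enc"
  have dec: "dec (enc z) = z" if "z \<in> St" for z using enc(2) that by (simp add: dec_def)
  \<comment> \<open>The update picks any stream that is compatible with the stored value and the
    element read; \<open>cong\<close> makes the result independent of the choice.\<close>
  define nxt where "nxt v i t a x = M v i (Suc t) (SOME X. X \<in> F \<and> M v i t X = a \<and> X t = x)" for v i t a x
  define g where "g b x = (if b \<in> enc ` St \<and> x \<in> U then
     (case dec b of (v,i,t,a) \<Rightarrow> if t < n then enc (v,i,Suc t,nxt v i t a x) else b) else b)" for b x
  \<comment> \<open>A true norm is the square root of an integer. Every other real is sent to 0,
    because \<open>uses_space\<close> quantifies over all reals.\<close>
  define vr where "vr r = (if \<exists>v\<le>V. r = sqrt (real v) then (THE v. r = sqrt (real v)) else 0)" for r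
  define A where "A = \<lparr>alg_init = (\<lambda>r. map_pmf (\<lambda>i. enc (vr r, i, 0, M (vr r) i 0 (\<lambda>_. u0))) (pmf_of_set {..<T})),
     alg_step = (\<lambda>b x. return_pmf (g b x)),
     alg_output = (\<lambda>b. return_pmf (case dec b of (v,i,t,a) \<Rightarrow> Out v i a))\<rparr>"
  have vr1: "vr r \<le> V" for r
    by (auto simp: vr_def)
  have vr2: "vr (sqrt (real v)) = v" if "v \<le> V" for v
    using that by (auto simp: vr_def)
  have pref: "M v i t X = M v i t X'" if "v \<le> V" "i < T" "X \<in> F" "X' \<in> F" "t \<le> n" "\<forall>s<t. X s = X' s" for v i t X X'
    using that by (induction t) (auto intro!: cong simp: F_def init)
  have nxt: "nxt v i t (M v i t X) (X t) = M v i (Suc t) X" if "v \<le> V" "i < T" "X \<in> F" "t < n" for v i t X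
  proof -
    define Y where "Y = (SOME Y. Y \<in> F \<and> M v i t Y = M v i t X \<and> Y t = X t)"
    have "Y \<in> F \<and> M v i t Y = M v i t X \<and> Y t = X t" unfolding Y_def
      by (rule someI[of _ X]) (use that in auto)
    then show ?thesis unfolding nxt_def Y_def[symmetric] using that by (intro cong) (auto simp: F_def)
  qed
  have nxt_in: "nxt v i t a x \<in> M v i (Suc t) ` F" if v: "v \<le> V" "i < T" "a \<in> M v i t ` F" "t < n" "x \<in> U" for v i t a x
  proof -
    from v obtain X where X: "X \<in> F" "a = M v i t X" by auto
    \<comment> \<open>The memory at time \<open>t\<close> depends on earlier elements only
      (\<open>pref\<close>), so the witness may be changed at \<open>t\<close> to read
      \<open>x\<close>.\<close>
    have X': "X(t := x) \<in> F" using X v by (auto simp: F_def)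
    have "a = M v i t (X(t:=x))" unfolding X(2) by (rule pref) (use X X' v in auto)
    then have "nxt v i t a x = M v i (Suc t) (X(t:=x))"
      using nxt[of v i "X(t:=x)" t] X' v by simp
    then show ?thesis using X' by blast
  qed
  have g_len: "length (g b x) = s" if "length b = s" for b x
  proof (cases "b \<in> enc ` St \<and> x \<in> U")
    case True
    then obtain v i t a where z: "(v,i,t,a) \<in> St" "b = enc (v,i,t,a)" by auto
    show ?thesis
    proof (cases "t < n")
      case t: True
      have "(v,i,Suc t,nxt v i t a x) \<in> St" using z t True nxt_in[of v i a t x] by (auto simp: St_def)
      then show ?thesis using True z t dec[OF z(1)] enc(1) by (auto simp: g_def)
    qed (use True z dec[OF z(1)] that in \<open>auto simp: g_def\<close>)
  qed (use that in \<open>auto simp: g_def\<close>)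
  have "uses_space U A s"
    unfolding uses_space_def
  proof (intro conjI allI ballI impI)
    fix r b assume "b \<in> set_pmf (alg_init A r)"
    then obtain i where i: "i < T" "b = enc (vr r, i, 0, M (vr r) i 0 (\<lambda>_. u0))"
      using \<open>T > 0\<close> by (auto simp: A_def set_pmf_of_set lessThan_empty_iff)
    have "(vr r, i, 0, M (vr r) i 0 (\<lambda>_. u0)) \<in> St" using i vr1 u0 by (auto simp: St_def F_def)
    then show "length b = s" using i enc(1) by auto
  next
    fix b x b' assume "length b = s" "b' \<in> set_pmf (alg_step A b x)"
    then show "length b' = s" using g_len by (auto simp: A_def)
  qed
  moreover have "run A (sqrt (real v)) xs = map_pmf (\<lambda>i. Out v i (M v i n X)) (pmf_of_set {..<T})"
    if v: "v \<le> V" "length xs = n" "\<forall>t. X t \<in> U" "\<forall>t<n. X t = xs ! t" for v xs X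
  proof -
    have XF: "X \<in> F" using v by (auto simp: F_def)
    have inSt: "(v,i,t,M v i t X) \<in> St" if "i < T" "t \<le> n" for i t using v that XF by (auto simp: St_def)
    have fold: "foldl g (enc (v,i,0,M v i 0 (\<lambda>_. u0))) (take t xs) = enc (v,i,t,M v i t X)" if "i < T" "t \<le> n" for i t
      using that(2)
    proof (induction t)
      case 0 then show ?case using init[of v i "\<lambda>_. u0" X] by simp
    next
      case (Suc t)
      have "take (Suc t) xs = take t xs @ [X t]" using v Suc.prems by (simp add: take_Suc_conv_app_nth)
      then have "foldl g (enc (v,i,0,M v i 0 (\<lambda>_. u0))) (take (Suc t) xs) = g (enc (v,i,t,M v i t X)) (X t)"
        using Suc by simp
      also have "\<dots> = enc (v,i,Suc t,M v i (Suc t) X)"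
        using inSt[OF \<open>i<T\<close>, of t] Suc.prems v(1) v(3) nxt[of v i X t] XF \<open>i<T\<close> by (simp add: g_def dec)
      finally show ?case .
    qed
    have "run A (sqrt (real v)) xs = bind_pmf (pmf_of_set {..<T})
        (\<lambda>i. return_pmf (case dec (foldl g (enc (v, i, 0, M v i 0 (\<lambda>_. u0))) xs) of (v,i,t,a) \<Rightarrow> Out v i a))"
    proof -
      have "process A xs = (\<lambda>b. return_pmf (foldl g b xs))"
        by (rule ext, rule process_deterministic) (simp add: A_def)
      then show ?thesis unfolding run_def
        by (simp add: A_def vr2 v(1) bind_map_pmf bind_return_pmf bind_assoc_pmf map_pmf_def)
    qed
    also have "\<dots> = bind_pmf (pmf_of_set {..<T}) (\<lambda>i. return_pmf (Out v i (M v i n X)))"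
    proof (rule bind_pmf_cong[OF refl])
      fix i assume "i \<in> set_pmf (pmf_of_set {..<T})"
      then have "i < T" using \<open>T > 0\<close> by (auto simp: set_pmf_of_set lessThan_empty_iff)
      from fold[OF this, of n] inSt[OF this, of n] v
      show "return_pmf (case dec (foldl g (enc (v, i, 0, M v i 0 (\<lambda>_. u0))) xs) of (v,i,t,a) \<Rightarrow> Out v i a)
         = return_pmf (Out v i (M v i n X))" by (simp add: dec)
    qed
    finally show ?thesis by (simp add: map_pmf_def)
  qed
  ultimately show ?thesis by blast
qed

section \<open>Fixing the public randomness\<close>

text \<open>Newman's argument: Hoeffding's inequality for each input and a union bound over the inputs.\<close>

lemma public_randomness_reduction:
  fixes Om :: "'w pmf" and good :: "'x \<Rightarrow> 'w \<Rightarrow> bool" and d :: real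
  assumes "finite Xs" "T > 0" "d \<ge> 0" and small: "real (card Xs) * exp (- 2 * real T * d\<^sup>2) < 1"
  shows "\<exists>ws :: nat \<Rightarrow> 'w. \<forall>x\<in>Xs.
     real T * (measure_pmf.prob Om {w. good x w} - d) \<le> real (card {i\<in>{..<T}. good x (ws i)})"
proof -
  define Q where "Q = Pi_pmf {..<T} undefined (\<lambda>_. Om)"
  define bad where "bad x = {f. real (card {i\<in>{..<T}. good x (f i)}) / T \<le> measure_pmf.prob Om {w. good x w} - d}" for x
  have one: "measure_pmf.prob Q (bad x) \<le> exp (- 2 * real T * d\<^sup>2)" for x
  proof -
    define p where "p = measure_pmf.prob Om {w. good x w}"
    interpret binomial_distribution T p by unfold_locales (simp add: p_def)
    have "map_pmf (good x) Om = bernoulli_pmf p"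
    proof (rule pmf_eqI)
      fix b show "pmf (map_pmf (good x) Om) b = pmf (bernoulli_pmf p) b"
      proof (cases b)
        case True then show ?thesis by (simp add: pmf_map p_def vimage_def)
      next
        case False
        have "measure_pmf.prob Om {w. \<not> good x w} = 1 - p"
          using measure_pmf.prob_compl[of "{w. good x w}" Om] by (simp add: p_def Compl_eq_Diff_UNIV[symmetric] Collect_neg_eq)
        then show ?thesis using False by (simp add: pmf_map p_def vimage_def)
      qed
    qed
    then have "map_pmf (\<lambda>f. good x \<circ> f) Q = Pi_pmf {..<T} (good x undefined) (\<lambda>_. bernoulli_pmf p)"
      unfolding Q_def by (subst Pi_pmf_map[symmetric, where g = "\<lambda>_. Om"]) simp_all
    note mapQ = this
    have "binomial_pmf T p = map_pmf (\<lambda>f. card {i\<in>{..<T}. f i}) (Pi_pmf {..<T} (good x undefined) (\<lambda>_. bernoulli_pmf p))"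
      by (rule binomial_pmf_altdef') (auto simp: p_def)
    also have "\<dots> = map_pmf (\<lambda>f. card {i\<in>{..<T}. good x (f i)}) Q"
      unfolding mapQ[symmetric] by (simp add: map_pmf_comp o_def)
    finally have "binomial_pmf T p = map_pmf (\<lambda>f. card {i\<in>{..<T}. good x (f i)}) Q" .
    then have "measure_pmf.prob Q (bad x) = measure_pmf.prob (binomial_pmf T p) {k. real k / T \<le> p - d}"
      by (simp add: bad_def p_def vimage_def)
    also have "\<dots> \<le> exp (- 2 * real T * d\<^sup>2)" using prob_le'[OF \<open>T > 0\<close> \<open>d \<ge> 0\<close>] by simp
    finally show ?thesis .
  qed
  have "measure_pmf.prob Q (\<Union>x\<in>Xs. bad x) \<le> (\<Sum>x\<in>Xs. measure_pmf.prob Q (bad x))"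
    using assms(1) by (intro measure_pmf.finite_measure_subadditive_finite) auto
  also have "\<dots> \<le> (\<Sum>x\<in>Xs. exp (- 2 * real T * d\<^sup>2))" by (intro sum_mono one)
  also have "\<dots> < 1" using small by simp
  finally have "(\<Union>x\<in>Xs. bad x) \<noteq> UNIV" by (metis measure_pmf.prob_space less_irrefl space_measure_pmf)
  then obtain f where "\<forall>x\<in>Xs. f \<notin> bad x" by blast
  then show ?thesis using \<open>T > 0\<close> by (intro exI[of _ f]) (auto simp: bad_def field_simps not_le intro: less_imp_le)
qed

section \<open>Random positions of heavy elements\<close>

text \<open>The range may depend on the argument, so that avoiding a set on some arguments is again
  a space of injections, with smaller ranges.\<close>

definition injections :: "'a set \<Rightarrow> ('a \<Rightarrow> 'b set) \<Rightarrow> ('a \<Rightarrow> 'b) set" where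
  "injections F V = {g \<in> Pi\<^sub>E F V. inj_on g F}"

lemma finite_injections: "finite F \<Longrightarrow> (\<And>e. e \<in> F \<Longrightarrow> finite (V e)) \<Longrightarrow> finite (injections F V)"
  unfolding injections_def by (rule finite_subset[of _ "Pi\<^sub>E F V"]) (auto intro: finite_PiE)

lemma card_injections_insert:
  assumes "finite F" "e \<notin> F" "\<And>e. finite (V e)"
  shows "card (injections (insert e F) V) = (\<Sum>g\<in>injections F V. card (V e - g ` F))"
proof -
  have "bij_betw (\<lambda>g. (restrict g F, g e)) (injections (insert e F) V) (SIGMA g:injections F V. V e - g ` F)"
  proof (rule bij_betwI[where g = "\<lambda>(g,v). g(e := v)"])
    show "(\<lambda>g. (restrict g F, g e)) \<in> injections (insert e F) V \<rightarrow> (SIGMA g:injections F V. V e - g ` F)"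
      using assms(2) by (auto simp: injections_def inj_on_def PiE_def Pi_def)
    show "(\<lambda>(g,v). g(e := v)) \<in> (SIGMA g:injections F V. V e - g ` F) \<rightarrow> injections (insert e F) V"
    proof clarsimp
      fix g v assume g: "g \<in> injections F V" "v \<in> V e" "v \<notin> g ` F"
      have "inj_on (g(e := v)) F" "(g(e := v)) ` F = g ` F"
        using g(1) assms(2) by (auto simp: injections_def inj_on_def)
      then show "g(e := v) \<in> injections (insert e F) V"
        using g assms(2) by (simp add: injections_def PiE_fun_upd)
    qed
    show "(\<lambda>(g,v). g(e := v)) (restrict g F, g e) = g" if "g \<in> injections (insert e F) V" for g
      using that assms(2) by (auto simp: injections_def PiE_def extensional_def fun_eq_iff restrict_def)
    show "(restrict ((\<lambda>(g,v). g(e := v)) z) F, (\<lambda>(g,v). g(e := v)) z e) = z"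
      if "z \<in> (SIGMA g:injections F V. V e - g ` F)" for z
      using that assms(2) by (auto simp: injections_def PiE_def extensional_def fun_eq_iff restrict_def)
  qed
  then have "card (injections (insert e F) V) = card (SIGMA g:injections F V. V e - g ` F)"
    by (rule bij_betw_same_card)
  also have "\<dots> = (\<Sum>g\<in>injections F V. card (V e - g ` F))"
    using assms by (intro card_SigmaI finite_injections) auto
  finally show ?thesis .
qed

lemma card_injections_const_insert:
  assumes "finite F" "e \<notin> F" "\<And>e. finite (V e)" "\<And>f. f \<in> F \<Longrightarrow> V f \<subseteq> V e"
  shows "card (injections (insert e F) V) = card (injections F V) * (card (V e) - card F)"
proof -
  have "card (V e - g ` F) = card (V e) - card F" if "g \<in> injections F V" for g
  proof -
    have "g ` F \<subseteq> V e" using that assms(4) by (auto simp: injections_def PiE_def Pi_def)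
    then show ?thesis using that assms by (simp add: card_Diff_subset injections_def card_image)
  qed
  then show ?thesis using assms by (subst card_injections_insert) auto
qed

text \<open>Sampling without replacement does at least as well as sampling with replacement: once
  \<open>k\<close> values outside \<open>A\<close> are used up, the fraction of free values that lie
  outside \<open>A\<close> has not grown. The inequality \<open>num\<close> says this without
  division.\<close>

lemma card_injections_avoiding:
  fixes V A :: "'b set" and E F :: "'a set"
  assumes "finite F" "E \<subseteq> F" "finite V" "A \<subseteq> V"
  shows "card {g \<in> injections F (\<lambda>_. V). \<forall>e\<in>E. g e \<notin> A} * card V ^ card E
       \<le> (card V - card A) ^ card E * card (injections F (\<lambda>_. V))"
proof -
  define W where "W e = (if e \<in> E then V - A else V)" for e
  have finW: "finite (W e)" for e using assms by (simp add: W_def)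
  have "{g \<in> injections F (\<lambda>_. V). \<forall>e\<in>E. g e \<notin> A} = injections F W"
    using assms(2) by (auto simp: injections_def W_def PiE_def Pi_def)
  moreover have "card (injections F W) * card V ^ card E \<le> (card V - card A) ^ card E * card (injections F (\<lambda>_. V))"
  proof -
    \<comment> \<open>The restricted arguments are inserted first and those with full range
      afterwards, so the ranges grow in the order of insertion, as
      \<open>card_injections_const_insert\<close> demands.\<close>
    have base: "card (injections E' W) * card V ^ card E' \<le> (card V - card A) ^ card E' * card (injections E' (\<lambda>_. V))"
      if "finite E'" "E' \<subseteq> E" for E'
      using that
    proof (induction E' rule: finite_induct)
      case empty then show ?case by (simp add: injections_def)
    next
      case (insert e E')
      have WV: "card (W e) = card V - card A"
        using insert.prems assms by (simp add: W_def card_Diff_subset finite_subset)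
      have num: "(card V - card A - k) * card V \<le> (card V - card A) * (card V - k)" for k
      proof (cases "k \<le> card V - card A")
        case True
        have le: "card A \<le> card V" using assms by (simp add: card_mono)
        then obtain r where r: "card V = card A + (k + r)" using True by (metis le_add_diff_inverse)
        show ?thesis by (simp add: r algebra_simps)
      qed simp
      have c1: "card (injections (insert e E') W) = card (injections E' W) * (card V - card A - card E')"
        using insert finW WV by (subst card_injections_const_insert) (auto simp: W_def)
      have c2: "card (injections (insert e E') (\<lambda>_. V)) = card (injections E' (\<lambda>_. V)) * (card V - card E')"
        using insert assms by (subst card_injections_const_insert) auto
      have "card (injections (insert e E') W) * card V ^ card (insert e E') =
          (card (injections E' W) * card V ^ card E') * ((card V - card A - card E') * card V)"
        using insert by (simp add: c1 algebra_simps)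
      also have "\<dots> \<le> ((card V - card A) ^ card E' * card (injections E' (\<lambda>_. V))) * ((card V - card A) * (card V - card E'))"
        using insert num[of "card E'"] by (auto intro!: mult_le_mono[OF insert.IH] simp del: diff_diff_left)
      also have "\<dots> = (card V - card A) ^ card (insert e E') * card (injections (insert e E') (\<lambda>_. V))"
        using insert by (simp add: c2 algebra_simps)
      finally show ?case .
    qed
    have "card (injections (E \<union> G) W) * card V ^ card E \<le> (card V - card A) ^ card E * card (injections (E \<union> G) (\<lambda>_. V))"
      if "finite G" "G \<inter> E = {}" for G
      using that
    proof (induction G rule: finite_induct)
      case empty then show ?case using base[of E] assms finite_subset by auto
    next
      case (insert e G)
      have finE: "finite (E \<union> G)" using insert assms finite_subset by auto
      have c1: "card (injections (insert e (E \<union> G)) W) = card (injections (E \<union> G) W) * (card V - card (E \<union> G))"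
        using insert finW finE by (subst card_injections_const_insert) (auto simp: W_def)
      have c2: "card (injections (insert e (E \<union> G)) (\<lambda>_. V)) = card (injections (E \<union> G) (\<lambda>_. V)) * (card V - card (E \<union> G))"
        using insert assms finE by (subst card_injections_const_insert) auto
      have "(card (injections (E \<union> G) W) * card V ^ card E) * (card V - card (E \<union> G)) \<le>
         ((card V - card A) ^ card E * card (injections (E \<union> G) (\<lambda>_. V))) * (card V - card (E \<union> G))"
        using insert by (intro mult_right_mono) auto
      then show ?case using c1 c2 by (simp add: algebra_simps)
    qed
    from this[of "F - E"] show ?thesis using assms by (simp add: Un_absorb1 Un_Diff_cancel Diff_disjoint Int_commute)
  qed
  ultimately show ?thesis by simp
qed

lemma prob_injection_avoiding:
  fixes V A :: "'b set" and E F :: "'a set"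
  assumes "finite F" "E \<subseteq> F" "finite V" "A \<subseteq> V" "injections F (\<lambda>_. V) \<noteq> {}" "V \<noteq> {}"
  shows "measure_pmf.prob (pmf_of_set (injections F (\<lambda>_. V))) {g. \<forall>e\<in>E. g e \<notin> A}
     \<le> exp (- real (card A) * card E / card V)"
proof -
  have fin: "finite (injections F (\<lambda>_. V))" using assms by (intro finite_injections) auto
  have v: "real (card V) > 0" using assms by (simp add: card_gt_0_iff)
  have le: "card A \<le> card V" using assms by (simp add: card_mono)
  have "measure_pmf.prob (pmf_of_set (injections F (\<lambda>_. V))) {g. \<forall>e\<in>E. g e \<notin> A}
     = real (card {g \<in> injections F (\<lambda>_. V). \<forall>e\<in>E. g e \<notin> A}) / card (injections F (\<lambda>_. V))"
    using fin assms(5) by (simp add: measure_pmf_of_set Int_def)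
  also have "\<dots> \<le> (real (card V - card A) / card V) ^ card E"
  proof -
    have "real (card {g \<in> injections F (\<lambda>_. V). \<forall>e\<in>E. g e \<notin> A}) * real (card V) ^ card E
       \<le> real (card V - card A) ^ card E * card (injections F (\<lambda>_. V))"
      using of_nat_mono[OF card_injections_avoiding[OF assms(1-4)], where 'a = real] by simp
    moreover have "real (card (injections F (\<lambda>_. V))) > 0" using fin assms(5) by (simp add: card_gt_0_iff)
    ultimately show ?thesis using v
      by (simp add: power_divide divide_le_eq pos_le_divide_eq mult.commute)
  qed
  also have "\<dots> = (1 - card A / card V) ^ card E" using le v by (simp add: of_nat_diff diff_divide_distrib)
  also have "\<dots> \<le> exp (- card A / card V) ^ card E"
    using exp_ge_add_one_self[of "- card A / card V"] le v by (intro power_mono) (auto simp: field_simps)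
  also have "\<dots> = exp (- real (card A) * card E / card V)"
    by (simp add: exp_of_nat_mult[symmetric] field_simps)
  finally show ?thesis .
qed

lemma finite_occs: "finite (occs S)"
proof -
  have "occs S = (SIGMA x:set_mset S. {..<count S x})" by (auto simp: occs_def)
  then show ?thesis by simp
qed

lemma stream_of_nth_eq_iff:
  assumes "\<pi> \<in> placements S" "t < size S"
  shows "stream_of S \<pi> ! t = x \<longleftrightarrow> (\<exists>j<count S x. \<pi> (x, j) = t)"
proof -
  have bij: "bij_betw \<pi> (occs S) {..<size S}" using assms by (simp add: placements_def)
  have "t \<in> \<pi> ` occs S" using bij assms(2) by (simp add: bij_betw_def)
  then have "inv_into (occs S) \<pi> t \<in> occs S" "\<pi> (inv_into (occs S) \<pi> t) = t"
    by (auto intro: inv_into_into f_inv_into_f)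
  moreover have "inv_into (occs S) \<pi> t = z" if "z \<in> occs S" "\<pi> z = t" for z
    using bij that by (auto simp: bij_betw_def)
  moreover have "(x, j) \<in> occs S \<longleftrightarrow> j < count S x" for j
    by (auto simp: occs_def intro: count_inI)
  moreover have "stream_of S \<pi> ! t = fst (inv_into (occs S) \<pi> t)" using assms(2) by (simp add: stream_of_def)
  ultimately show ?thesis by (metis fst_conv prod.collapse)
qed

lemma count_stream_of:
  assumes "\<pi> \<in> placements S"
  shows "card {t. t < size S \<and> stream_of S \<pi> ! t = x} = count S x"
proof -
  have bij: "bij_betw \<pi> (occs S) {..<size S}" using assms by (simp add: placements_def)
  have "{t. t < size S \<and> stream_of S \<pi> ! t = x} = (\<lambda>j. \<pi> (x, j)) ` {..<count S x}"
  proof (intro set_eqI iffI)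
    fix t assume "t \<in> (\<lambda>j. \<pi> (x, j)) ` {..<count S x}"
    then obtain j where j: "j < count S x" "t = \<pi> (x,j)" by auto
    then have "(x,j) \<in> occs S" by (auto simp: occs_def intro: count_inI)
    then have "t < size S" using bij j by (auto simp: bij_betw_def)
    then show "t \<in> {t. t < size S \<and> stream_of S \<pi> ! t = x}" using stream_of_nth_eq_iff[OF assms] j by auto
  next
    fix t assume "t \<in> {t. t < size S \<and> stream_of S \<pi> ! t = x}"
    then have "t < size S" "stream_of S \<pi> ! t = x" by auto
    then show "t \<in> (\<lambda>j. \<pi> (x, j)) ` {..<count S x}"
      using stream_of_nth_eq_iff[OF assms, of t x] by (metis imageI lessThan_iff)
  qed
  moreover have "inj_on (\<lambda>j. \<pi> (x, j)) {..<count S x}"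
  proof (rule inj_onI)
    fix i j assume ij: "i \<in> {..<count S x}" "j \<in> {..<count S x}" "\<pi> (x,i) = \<pi> (x,j)"
    then have "(x,i) \<in> occs S" "(x,j) \<in> occs S" by (auto simp: occs_def intro: count_inI)
    then show "i = j" using bij ij by (auto simp: bij_betw_def inj_on_def)
  qed
  ultimately show ?thesis by (simp add: card_image)
qed

lemma set_stream_of:
  assumes "\<pi> \<in> placements S" shows "set (stream_of S \<pi>) \<subseteq> set_mset S"
proof
  fix x assume "x \<in> set (stream_of S \<pi>)"
  then obtain t where "t < length (stream_of S \<pi>)" "stream_of S \<pi> ! t = x" unfolding in_set_conv_nth by blast
  then have "t < size S" "stream_of S \<pi> ! t = x" by (auto simp: stream_of_def)
  then obtain j where "j < count S x" using stream_of_nth_eq_iff[OF assms, of t x] by blast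
  then show "x \<in> set_mset S" by (auto intro: count_inI)
qed

definition hit :: "nat \<Rightarrow> (nat \<Rightarrow> nat) \<Rightarrow> nat \<Rightarrow> nat \<Rightarrow> bool" where
  "hit q X y \<tau> \<longleftrightarrow> (\<exists>t\<in>{\<tau> * q..<Suc \<tau> * q}. X t = y)"

text \<open>A heavy element averages at least two occurrences per tick; asking for only half of the
  ticks of each block leaves room for a tail bound exponential in \<open>D\<close>.\<close>

definition regular :: "nat \<Rightarrow> nat \<Rightarrow> nat \<Rightarrow> (nat \<Rightarrow> nat) \<Rightarrow> nat \<Rightarrow> bool" where
  "regular q D W X x \<longleftrightarrow> (\<forall>i. Suc i * D \<le> W \<longrightarrow> D \<le> 2 * card {\<tau>\<in>{i * D..<Suc i * D}. hit q X x \<tau>})"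

text \<open>Every occurrence of \<open>x\<close> is a heavy occurrence, so the event is decided by
  the restricted placement, whose law is uniform. The adversary has no say in it.\<close>

lemma prob_avoid:
  assumes pro: "partially_random_order U \<epsilon> S P" and x: "x \<in> heavy_hitters U \<epsilon> S" and A: "A \<subseteq> {..<size S}"
    and "x \<in># S"
  shows "measure_pmf.prob P {\<pi>. \<forall>t\<in>A. stream_of S \<pi> ! t \<noteq> x} \<le> exp (- real (card A) * count S x / size S)"
proof -
  define F where "F = heavy_occs U \<epsilon> S"
  define E where "E = {x} \<times> {..<count S x}"
  have finF: "finite F" by (rule finite_subset[OF _ finite_occs[of S]]) (auto simp: F_def heavy_occs_def)
  have E: "E \<subseteq> F" using x by (auto simp: E_def F_def heavy_occs_def occs_def intro: count_inI)
  have size0: "size S > 0" using assms(4) by (metis nonempty_has_size set_mset_empty empty_iff)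
  have F: "map_pmf (\<lambda>\<pi>. restrict \<pi> F) P = pmf_of_set (injections F (\<lambda>_. {..<size S}))"
    using pro by (simp add: partially_random_order_def F_def injections_def)
  have sub: "set_pmf P \<subseteq> placements S" using pro by (simp add: partially_random_order_def)
  have ne: "injections F (\<lambda>_. {..<size S}) \<noteq> {}"
  proof -
    obtain \<pi> where "\<pi> \<in> set_pmf P" using set_pmf_not_empty by fastforce
    then have "bij_betw \<pi> (occs S) {..<size S}" using sub by (auto simp: placements_def)
    then have "restrict \<pi> F \<in> injections F (\<lambda>_. {..<size S})"
      by (auto simp: injections_def bij_betw_def F_def heavy_occs_def inj_on_def)
    then show ?thesis by blast
  qed
  have "measure_pmf.prob P {\<pi>. \<forall>t\<in>A. stream_of S \<pi> ! t \<noteq> x} \<le> measure_pmf.prob P {\<pi>. \<forall>e\<in>E. restrict \<pi> F e \<notin> A}"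
  proof (rule measure_pmf.finite_measure_mono_AE[OF AE_pmfI])
    fix \<pi> assume p: "\<pi> \<in> set_pmf P"
    then have "\<pi> \<in> placements S" using sub by auto
    have "restrict \<pi> F e \<notin> A" if "\<forall>t\<in>A. stream_of S \<pi> ! t \<noteq> x" "e \<in> E" for e
    proof
      assume a: "restrict \<pi> F e \<in> A"
      obtain j where j: "e = (x, j)" "j < count S x" using \<open>e \<in> E\<close> by (auto simp: E_def)
      have r: "restrict \<pi> F e = \<pi> (x, j)" using j E \<open>e \<in> E\<close> by auto
      have "\<pi> (x, j) < size S" using a A unfolding r by auto
      then have "stream_of S \<pi> ! \<pi> (x, j) = x"
        using stream_of_nth_eq_iff[OF \<open>\<pi> \<in> placements S\<close>] j(2) by blast
      then show False using that(1) a unfolding r by blast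
    qed
    then show "\<pi> \<in> {\<pi>. \<forall>t\<in>A. stream_of S \<pi> ! t \<noteq> x} \<longrightarrow> \<pi> \<in> {\<pi>. \<forall>e\<in>E. restrict \<pi> F e \<notin> A}"
      by blast
  qed auto
  also have "\<dots> = measure_pmf.prob (map_pmf (\<lambda>\<pi>. restrict \<pi> F) P) {g. \<forall>e\<in>E. g e \<notin> A}"
    by (simp add: vimage_def)
  also have "\<dots> \<le> exp (- real (card A) * card E / card {..<size S})"
    unfolding F using finF E A ne size0 by (intro prob_injection_avoiding) auto
  finally show ?thesis by (simp add: E_def)
qed

text \<open>If more than half of the \<open>D\<close> ticks of a block are missed, some
  \<open>D / 2\<close> of them are missed together. They cover \<open>D * q / 2\<close> positions,
  and \<open>qf\<close> makes the probability of avoiding these at most exp(-\<open>D\<close>). The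
  at most \<open>2 ^ D\<close> choices of the ticks leave \<open>(2 / exp 1) ^ D\<close> per
  block.\<close>

lemma prob_irregular:
  fixes S :: "nat multiset"
  assumes pro: "partially_random_order U \<epsilon> S P" and x: "x \<in> heavy_hitters U \<epsilon> S" and "x \<in># S"
    and W: "W * q \<le> size S" and "even D" and "D > 0" and qf: "2 * size S \<le> q * count S x"
  shows "measure_pmf.prob P {\<pi>. \<not> regular q D W (\<lambda>t. stream_of S \<pi> ! t) x} \<le> real W * (2 / exp 1) ^ D"
proof -
  define bad where "bad G = {\<pi>. \<forall>t\<in>(\<Union>\<tau>\<in>G. {\<tau> * q..<Suc \<tau> * q}). stream_of S \<pi> ! t \<noteq> x}" for G
  define Fam where "Fam i = {G. G \<subseteq> {i * D..<Suc i * D} \<and> card G = D div 2}" for i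
  have size0: "size S > 0" using assms(3) by (metis nonempty_has_size set_mset_empty empty_iff)
  have bad: "measure_pmf.prob P (bad G) \<le> exp (- real D)" if G: "G \<in> Fam i" "Suc i * D \<le> W" for G i
  proof -
    define A where "A = (\<Union>\<tau>\<in>G. {\<tau> * q..<Suc \<tau> * q})"
    have finG: "finite G" using G by (auto simp: Fam_def intro: finite_subset)
    have "card A = (\<Sum>\<tau>\<in>G. card {\<tau> * q..<Suc \<tau> * q})" unfolding A_def
    proof (rule card_UN_disjoint[OF finG])
      show "\<forall>i\<in>G. \<forall>j\<in>G. i \<noteq> j \<longrightarrow> {i * q..<Suc i * q} \<inter> {j * q..<Suc j * q} = {}"
      proof (intro ballI impI)
        fix i j :: nat assume "i \<noteq> j"
        have "t div q = i" if "t \<in> {i * q..<Suc i * q}" for t i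
          using that by (intro div_nat_eqI) (auto simp: algebra_simps)
        then show "{i * q..<Suc i * q} \<inter> {j * q..<Suc j * q} = {}" using \<open>i \<noteq> j\<close> by blast
      qed
    qed auto
    then have cA: "2 * card A = D * q" using G \<open>even D\<close> by (auto simp: Fam_def)
    have "A \<subseteq> {..<size S}"
    proof
      fix t assume "t \<in> A"
      then obtain \<tau> where "\<tau> \<in> G" "t < Suc \<tau> * q" by (auto simp: A_def)
      then have "Suc \<tau> \<le> W" using G by (auto simp: Fam_def)
      then have "Suc \<tau> * q \<le> W * q" by (rule mult_le_mono1)
      then show "t \<in> {..<size S}" using W \<open>t < Suc \<tau> * q\<close> by auto
    qed
    then have "measure_pmf.prob P (bad G) \<le> exp (- real (card A) * count S x / size S)"
      unfolding bad_def A_def[symmetric] by (rule prob_avoid[OF pro x _ assms(3)])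
    also have "real (card A) * count S x / size S \<ge> D"
    proof -
      have "D * (2 * size S) \<le> D * (q * count S x)" using qf by (rule mult_le_mono2)
      also have "\<dots> = 2 * (card A * count S x)" using cA by (metis mult.assoc)
      finally have "D * size S \<le> card A * count S x" by simp
      then have "real D * size S \<le> real (card A) * count S x" by (metis of_nat_le_iff of_nat_mult)
      then show ?thesis using size0 by (simp add: field_simps)
    qed
    then have "exp (- real (card A) * count S x / size S) \<le> exp (- real D)" by simp
    finally show ?thesis .
  qed
  have card: "real (card (Fam i)) \<le> 2 ^ D" for i
  proof -
    have "card (Fam i) \<le> card (Pow {i * D..<Suc i * D})" by (intro card_mono) (auto simp: Fam_def)
    also have "\<dots> = 2 ^ D" by (simp add: card_Pow)
    finally show ?thesis by (metis of_nat_le_iff of_nat_numeral of_nat_power)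
  qed
  have finFam: "finite (Fam i)" for i by (rule finite_subset[of _ "Pow {i * D..<Suc i * D}"]) (auto simp: Fam_def)
  have "{\<pi>. \<not> regular q D W (\<lambda>t. stream_of S \<pi> ! t) x} \<subseteq> (\<Union>i\<in>{..<W}. \<Union>G\<in>(if Suc i * D \<le> W then Fam i else {}). bad G)"
  proof
    fix \<pi> assume "\<pi> \<in> {\<pi>. \<not> regular q D W (\<lambda>t. stream_of S \<pi> ! t) x}"
    then obtain i where i: "Suc i * D \<le> W" "2 * card {\<tau>\<in>{i * D..<Suc i * D}. hit q (\<lambda>t. stream_of S \<pi> ! t) x \<tau>} < D"
      by (auto simp: regular_def not_le)
    define H where "H = {\<tau>\<in>{i * D..<Suc i * D}. hit q (\<lambda>t. stream_of S \<pi> ! t) x \<tau>}"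
    have "card ({i * D..<Suc i * D} - H) = D - card H"
      by (subst card_Diff_subset) (auto simp: H_def)
    then have "D div 2 \<le> card ({i * D..<Suc i * D} - H)" using i(2) by (simp add: H_def)
    then obtain G where G: "G \<subseteq> {i * D..<Suc i * D} - H" "card G = D div 2" by (metis obtain_subset_with_card_n)
    then have "G \<in> Fam i" by (auto simp: Fam_def)
    moreover have "\<pi> \<in> bad G"
    proof -
      have "stream_of S \<pi> ! t \<noteq> x" if "\<tau> \<in> G" "t \<in> {\<tau> * q..<Suc \<tau> * q}" for \<tau> t
        using G that unfolding H_def hit_def by blast
      then show ?thesis unfolding bad_def by blast
    qed
    moreover have "i < W"
    proof -
      have "Suc i * 1 \<le> Suc i * D" using \<open>D > 0\<close> by (intro mult_le_mono2) auto
      then show ?thesis using i(1) by simp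
    qed
    ultimately show "\<pi> \<in> (\<Union>i\<in>{..<W}. \<Union>G\<in>(if Suc i * D \<le> W then Fam i else {}). bad G)" using i(1) by auto
  qed
  then have "measure_pmf.prob P {\<pi>. \<not> regular q D W (\<lambda>t. stream_of S \<pi> ! t) x} \<le>
      measure_pmf.prob P (\<Union>i\<in>{..<W}. \<Union>G\<in>(if Suc i * D \<le> W then Fam i else {}). bad G)"
    by (rule measure_pmf.finite_measure_mono) simp
  also have "\<dots> \<le> (\<Sum>i<W. measure_pmf.prob P (\<Union>G\<in>(if Suc i * D \<le> W then Fam i else {}). bad G))"
    by (intro measure_pmf.finite_measure_subadditive_finite) auto
  also have "\<dots> \<le> (\<Sum>i<W. (2 / exp 1) ^ D)"
  proof (rule sum_mono)
    fix i
    have "measure_pmf.prob P (\<Union>G\<in>(if Suc i * D \<le> W then Fam i else {}). bad G)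
        \<le> (\<Sum>G\<in>(if Suc i * D \<le> W then Fam i else {}). measure_pmf.prob P (bad G))"
      using finFam by (intro measure_pmf.finite_measure_subadditive_finite) auto
    also have "\<dots> \<le> (\<Sum>G\<in>(if Suc i * D \<le> W then Fam i else {}). exp (- real D))"
      using bad by (intro sum_mono) (auto split: if_splits)
    also have "\<dots> \<le> 2 ^ D * exp (- real D)" using card[of i] by simp
    also have "\<dots> = (2 / exp 1) ^ D" by (simp add: power_divide exp_of_nat_mult[symmetric] exp_minus field_simps)
    finally show "measure_pmf.prob P (\<Union>G\<in>(if Suc i * D \<le> W then Fam i else {}). bad G) \<le> (2 / exp 1) ^ D" .
  qed
  finally show ?thesis by simp
qed

section \<open>Good starting times\<close>

text \<open>A walk that goes up by 3 on hits and down by 1 otherwise has many times from which it never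
  drops below its current value.\<close>

lemma many_good_starts:
  fixes Y :: "nat \<Rightarrow> bool" and T :: nat
  defines "good u \<equiv> (\<forall>k. 1 \<le> k \<and> u + k \<le> T \<longrightarrow> k \<le> 4 * card {i\<in>{u..<u+k}. Y i})"
  shows "4 * card {i\<in>{..<T}. Y i} \<le> T + 3 * card {u\<in>{..<T}. good u}"
proof -
  define s where "s v w = (\<Sum>i\<in>{v..<w}. (if Y i then 3 else - 1 :: int))" for v w :: nat
  define g where "g v = card {u\<in>{v..<T}. good u}" for v
  have s_card: "s v w = 4 * int (card {i\<in>{v..<w}. Y i}) - int (w - v)" for v w
  proof -
    have "s v w = (\<Sum>i\<in>{v..<w}. 4 * (if Y i then 1 else 0) - 1 :: int)" unfolding s_def by (intro sum.cong) auto
    also have "\<dots> = 4 * (\<Sum>i\<in>{v..<w}. (if Y i then 1 else 0)) - int (w - v)"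
      by (simp add: sum_subtractf sum_distrib_left)
    also have "(\<Sum>i\<in>{v..<w}. (if Y i then 1 else 0) :: int) = int (card {i\<in>{v..<w}. Y i})"
      by (simp add: sum.If_cases Int_def)
    finally show ?thesis .
  qed
  have s_Suc: "s v w = (if Y v then 3 else - 1) + s (Suc v) w" if "v < w" for v w
    using that by (simp add: s_def sum.atLeast_Suc_lessThan)
  \<comment> \<open>Quantifying over \<open>w\<close> makes plain induction strong enough: if
    \<open>v\<close> is not good, the walk started at \<open>v\<close> is negative at some
    \<open>v + k\<close>, and the bound for \<open>w = v + k\<close> takes over. A good start pays
    for a rise of at most 3.\<close>
  have "\<forall>w. v \<le> w \<and> w \<le> T \<longrightarrow> s v T - s v w \<le> 3 * int (g v)" if "v \<le> T" for v
    using that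
  proof (induction v rule: inc_induct)
    case base then show ?case by (auto simp: s_def g_def)
  next
    case (step v)
    have split: "{u\<in>{v..<T}. good u} = (if good v then {v} else {}) \<union> {u\<in>{Suc v..<T}. good u}"
      using step.hyps by (auto simp: Suc_le_eq order_le_less)
    have gv: "g v = (if good v then 1 else 0) + g (Suc v)"
      unfolding g_def split by (subst card_Un_disjoint) auto
    show ?case
    proof (intro allI impI)
      fix w assume w: "v \<le> w \<and> w \<le> T"
      show "s v T - s v w \<le> 3 * int (g v)"
      proof (cases "w = v")
        case False
        then have "s (Suc v) T - s (Suc v) w \<le> 3 * int (g (Suc v))" using step.IH w by auto
        then show ?thesis using s_Suc[of v T] s_Suc[of v w] False w step.hyps gv by auto
      next
        case True
        show ?thesis
        proof (cases "good v")
          case g: True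
          have "s (Suc v) T - s (Suc v) (Suc v) \<le> 3 * int (g (Suc v))" using step.IH step.hyps by auto
          then show ?thesis using s_Suc[of v T] step.hyps gv g True by (auto simp: s_def)
        next
          case False
          then obtain k where k: "1 \<le> k" "v + k \<le> T" "4 * card {i\<in>{v..<v+k}. Y i} < k"
            by (auto simp: good_def not_le)
          have neg: "s v (v+k) < 0" using k by (simp add: s_card)
          have "s (Suc v) T - s (Suc v) (v+k) \<le> 3 * int (g (Suc v))" using step.IH k by auto
          then show ?thesis using s_Suc[of v T] s_Suc[of v "v+k"] step.hyps k gv neg True by (auto simp: s_def)
        qed
      qed
    qed
  qed
  from this[of 0] have "s 0 T \<le> 3 * int (g 0)" by (auto simp: s_def)
  then show ?thesis by (simp add: s_card g_def lessThan_atLeast0)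
qed

section \<open>The memory of a slot\<close>

datatype slot_memory =
    Vacant "nat option"
  | Young nat nat bool
  | Old nat nat bool "(nat set \<times> int \<times> nat) option"

text \<open>Tick \<open>\<tau>\<close> consists of the positions \<open>\<tau> * q, \<dots>, Suc \<tau> * q - 1\<close>. The randomness of a slot is a function
  \<open>w\<close> giving each element a label and a sign; an element with label \<open>l\<close> can be adopted at tick
  \<open>l div Lam\<close>, if this is below \<open>Wb\<close>. At stage \<open>s\<close> the slot keeps \<open>l div D ^ s\<close>, a cell has \<open>a s\<close> ticks,
  and \<open>p s C < m\<close> is the subblock of cell \<open>C\<close> in which the slot does its test: \<open>B\<close> parts of \<open>D ^ s\<close> ticks,
  one for each bit of the element, followed by a verification part of \<open>3 * B * D ^ s\<close> ticks. The last
  stage \<open>S\<close> ends after \<open>N\<close> cells.\<close>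

locale slots =
  fixes q m B D Lam Wb S N :: nat and U :: "nat set" and bitf :: "nat \<Rightarrow> nat \<Rightarrow> bool"
  assumes q_pos: "q > 0" and m_pos: "m > 0" and B_pos: "B > 0" and D_ge: "D \<ge> 8" and D_even: "even D"
    and Lam_pos: "Lam > 0" and S_pos: "S \<ge> 1"
    and Wb_le: "Wb + 4 * (4 * B * m * D ^ S) \<le> (N - 1) * (4 * B * m * D ^ S)"
    and sep: "\<lbrakk>y \<in> U; z \<in> U; \<And>b. b < B \<Longrightarrow> bitf y b = bitf z b\<rbrakk> \<Longrightarrow> y = z"
begin

definition a :: "nat \<Rightarrow> nat" where "a s = 4 * B * m * D ^ s"

definition cnt :: "(nat \<Rightarrow> nat) \<Rightarrow> nat \<Rightarrow> nat \<Rightarrow> nat \<Rightarrow> nat" where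
  "cnt X y i j = card {t\<in>{i..<j}. X t = y}"

definition sbi :: "nat \<Rightarrow> nat \<Rightarrow> nat \<Rightarrow> nat" where
  "sbi s C i = (C * a s + i * (4 * B * D ^ s)) * q"

text \<open>A sign sketch (tug of war) restricted to one label block and to the elements with bit
  \<open>b\<close>. The bulk cancels to the order of the square root of its second moment, while one
  dominating element remains visible in absolute value.\<close>

definition Zs :: "(nat \<Rightarrow> nat \<times> bool) \<Rightarrow> nat \<Rightarrow> nat \<Rightarrow> nat \<Rightarrow> (nat \<Rightarrow> nat) \<Rightarrow> nat \<Rightarrow> nat \<Rightarrow> int" where
  "Zs w s \<beta> b X i j = (\<Sum>t\<in>{i..<j}. if fst (w (X t)) div D ^ s = \<beta> \<and> bitf (X t) b
      then (if snd (w (X t)) then 1 else - 1) else 0)"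

text \<open>The threshold is a quarter of \<open>D ^ s\<close>: a regular element adds at least half
  of \<open>D ^ s\<close> to a part, and the noise is to stay below a quarter.\<close>

definition bits :: "(nat \<Rightarrow> nat \<times> bool) \<Rightarrow> nat \<Rightarrow> nat \<Rightarrow> nat \<Rightarrow> (nat \<Rightarrow> nat) \<Rightarrow> nat set" where
  "bits w b0 s \<beta> X = {b. b < B \<and> int (D ^ s) \<le> 4 * \<bar>Zs w s \<beta> b X (b0 + b * (D ^ s * q)) (b0 + Suc b * (D ^ s * q))\<bar>}"

definition matches :: "nat set \<Rightarrow> nat \<Rightarrow> bool" where
  "matches I y \<longleftrightarrow> (\<forall>b<B. bitf y b \<longleftrightarrow> b \<in> I)"

text \<open>One half occurrence per tick is exactly the density that \<open>regular\<close>
  guarantees.\<close>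

definition dense :: "(nat \<Rightarrow> nat) \<Rightarrow> nat \<Rightarrow> nat \<Rightarrow> nat \<Rightarrow> nat \<Rightarrow> bool" where
  "dense X s C i y \<longleftrightarrow>
     3 * B * D ^ s \<le> 2 * cnt X y (sbi s C i + B * (D ^ s * q)) (sbi s C i + 4 * B * (D ^ s * q))"

definition tst :: "(nat \<Rightarrow> nat \<times> bool) \<Rightarrow> (nat \<Rightarrow> nat \<Rightarrow> nat) \<Rightarrow> (nat \<Rightarrow> nat) \<Rightarrow> nat \<Rightarrow> nat \<Rightarrow> nat \<Rightarrow> nat \<Rightarrow> bool" where
  "tst w p X s C \<beta> y \<longleftrightarrow> y \<in> U \<and> fst (w y) div D ^ s = \<beta> \<and> dense X s C (p s C) y \<and>
     matches (bits w (sbi s C (p s C)) s \<beta> X) y"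

text \<open>The end of stage \<open>s\<close>: a boundary of cells of the next stage, between two
  and three such cells after birth. The next stage thus begins with a whole cell, and the end can be
  computed from the prefix kept at stage \<open>s\<close> (\<open>eend_block\<close>).\<close>

definition eend :: "nat \<Rightarrow> nat \<Rightarrow> nat" where
  "eend s l = (l div (Lam * a (Suc s)) + 3) * a (Suc s)"

definition stg :: "nat \<Rightarrow> nat \<Rightarrow> nat" where "stg l \<tau> = (LEAST s. s = S \<or> \<tau> < eend s l)"

text \<open>A young slot compares labels, not elements; two elements sharing a label both count,
  which is the case treated by \<open>imp0\<close>.\<close>

definition hits :: "(nat \<Rightarrow> nat \<times> bool) \<Rightarrow> nat \<Rightarrow> (nat \<Rightarrow> nat) \<Rightarrow> nat \<Rightarrow> nat \<Rightarrow> nat" where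
  "hits w l X i j = card {\<tau>\<in>{i..<j}. \<exists>t\<in>{\<tau> * q..<Suc \<tau> * q}. fst (w (X t)) = l}"

definition ok :: "(nat \<Rightarrow> nat \<times> bool) \<Rightarrow> (nat \<Rightarrow> nat \<Rightarrow> nat) \<Rightarrow> (nat \<Rightarrow> nat) \<Rightarrow> nat \<Rightarrow> nat \<Rightarrow> bool" where
  "ok w p X l \<tau> \<longleftrightarrow> (if stg l \<tau> = 0 then Suc \<tau> - l div Lam \<le> 4 * hits w l X (l div Lam) (Suc \<tau>)
     else a (stg l \<tau>) dvd Suc \<tau> \<longrightarrow> (\<exists>y. tst w p X (stg l \<tau>) (\<tau> div a (stg l \<tau>)) (l div D ^ stg l \<tau>) y))"

definition firstlab :: "(nat \<Rightarrow> nat \<times> bool) \<Rightarrow> (nat \<Rightarrow> nat) \<Rightarrow> nat \<Rightarrow> nat \<Rightarrow> nat option" where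
  "firstlab w X \<tau> j = find (\<lambda>l. l div Lam = \<tau>) (map (\<lambda>t. fst (w (X t))) [\<tau> * q..<j])"

primrec st :: "(nat \<Rightarrow> nat \<times> bool) \<Rightarrow> (nat \<Rightarrow> nat \<Rightarrow> nat) \<Rightarrow> (nat \<Rightarrow> nat) \<Rightarrow> nat \<Rightarrow> nat option" where
  "st w p X 0 = None"
| "st w p X (Suc \<tau>) = (case st w p X \<tau> of
     None \<Rightarrow> (if \<tau> < Wb then firstlab w X \<tau> (Suc \<tau> * q) else None)
   | Some l \<Rightarrow> (if ok w p X l \<tau> then Some l else None))"

section \<open>Stage ends and stage changes\<close>

lemma D_pos [simp]: "D > 0" using D_ge by simp

lemma a_pos [simp]: "a s > 0" using B_pos m_pos by (simp add: a_def)

lemma a_Suc: "a (Suc s) = D * a s" by (simp add: a_def)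

lemma a_mono: "s \<le> s' \<Longrightarrow> a s \<le> a s'"
  by (simp add: a_def) (metis D_pos One_nat_def Suc_leI power_increasing)

lemma eend_block: "eend s l = (l div D ^ s div (Lam * 4 * B * m * D) + 3) * a (Suc s)"
proof -
  have "Lam * a (Suc s) = D ^ s * (Lam * 4 * B * m * D)" by (simp add: a_def)
  then show ?thesis by (simp only: eend_def div_mult2_eq[of l "D ^ s" "Lam * 4 * B * m * D"])
qed

lemma eend_tick: "eend s l = (l div Lam div a (Suc s) + 3) * a (Suc s)"
  by (simp add: eend_def div_mult2_eq)

lemma eend_gt: "l div Lam + 2 * a (Suc s) < eend s l"
proof -
  define v where "v = l div Lam"
  have "v < (v div a (Suc s) + 1) * a (Suc s)" 
    by (metis a_pos add.commute dividend_less_times_div mult.commute plus_1_eq_Suc mult_Suc_right)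
  then show ?thesis unfolding eend_tick v_def[symmetric] by (simp add: algebra_simps)
qed

lemma eend_le: "eend s l \<le> l div Lam + 3 * a (Suc s)"
  unfolding eend_tick by (simp add: algebra_simps)

text \<open>Because \<open>D \<ge> 8\<close>, a cell of a later stage dwarfs the three cells of the
  earlier one. Successive stage ends differ by more than a cell, so no stage is skipped.\<close>

lemma eend_less: "s < s' \<Longrightarrow> eend s l + a (Suc s) < eend s' l"
proof -
  assume "s < s'"
  then have "a (Suc (Suc s)) \<le> a (Suc s')" by (intro a_mono) auto
  moreover have "8 * a (Suc s) \<le> D * a (Suc s)" using D_ge by (rule mult_le_mono1)
  ultimately have "8 * a (Suc s) \<le> a (Suc s')" unfolding a_Suc[of "Suc s"] by (rule order_trans[rotated])
  then show ?thesis using eend_le[of s l] eend_gt[of l s'] a_pos[of "Suc s"] by linarith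
qed

lemma stg_le: "stg l \<tau> \<le> S" unfolding stg_def by (rule Least_le) simp

lemma stg_less: "stg l \<tau> < S \<Longrightarrow> \<tau> < eend (stg l \<tau>) l"
  using LeastI[of "\<lambda>s. s = S \<or> \<tau> < eend s l" S] unfolding stg_def by (metis less_irrefl)

lemma stg_ge: "s < stg l \<tau> \<Longrightarrow> eend s l \<le> \<tau>"
  using not_less_Least[of s "\<lambda>s. s = S \<or> \<tau> < eend s l"] unfolding stg_def by auto

lemma stg_eqI: "\<lbrakk>s \<le> S; s < S \<Longrightarrow> \<tau> < eend s l; \<And>r. r < s \<Longrightarrow> eend r l \<le> \<tau>\<rbrakk> \<Longrightarrow> stg l \<tau> = s"
  unfolding stg_def
proof (rule Least_equality)
  fix y assume "\<And>r. r < s \<Longrightarrow> eend r l \<le> \<tau>" "y = S \<or> \<tau> < eend y l" "s \<le> S"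
  then show "s \<le> y" by (meson leD not_le order_refl order_trans)
qed (cases "s < S", auto)

lemma stg_Suc: "stg l (Suc \<tau>) = (if stg l \<tau> < S \<and> Suc \<tau> = eend (stg l \<tau>) l then Suc (stg l \<tau>) else stg l \<tau>)"
proof (cases "stg l \<tau> < S \<and> Suc \<tau> = eend (stg l \<tau>) l")
  case True
  define r where "r = stg l \<tau>"
  have r: "r < S" "Suc \<tau> = eend r l" using True by (auto simp: r_def)
  have "stg l (Suc \<tau>) = Suc r"
  proof (rule stg_eqI)
    show "Suc \<tau> < eend (Suc r) l" using eend_less[of r "Suc r" l] r by simp
    fix r' assume "r' < Suc r"
    then consider "r' = r" | "r' < r" by linarith
    then show "eend r' l \<le> Suc \<tau>"
      by cases (use r stg_ge[of r' l \<tau>] in \<open>auto simp: r_def\<close>)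
  qed (use r in simp)
  then show ?thesis using True by (simp add: r_def)
next
  case False
  have "stg l (Suc \<tau>) = stg l \<tau>"
  proof (rule stg_eqI)
    show "stg l \<tau> < S \<Longrightarrow> Suc \<tau> < eend (stg l \<tau>) l" using stg_less[of l \<tau>] False by linarith
    show "r < stg l \<tau> \<Longrightarrow> eend r l \<le> Suc \<tau>" for r using stg_ge[of r l \<tau>] by linarith
  qed (rule stg_le)
  then show ?thesis using False by simp
qed

lemma stg_block:
  assumes "stg l \<tau> = stg l' \<tau>" "l div D ^ stg l \<tau> = l' div D ^ stg l \<tau>"
  shows "stg l (Suc \<tau>) = stg l' (Suc \<tau>)"
proof -
  have "eend (stg l \<tau>) l = eend (stg l \<tau>) l'" using assms by (simp add: eend_block)
  then show ?thesis using assms by (simp add: stg_Suc)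
qed

lemma firstlab_Suc: "\<tau> * q \<le> j \<Longrightarrow> firstlab w X \<tau> (Suc j) = (case firstlab w X \<tau> j of
    Some l \<Rightarrow> Some l | None \<Rightarrow> if fst (w (X j)) div Lam = \<tau> then Some (fst (w (X j))) else None)"
proof -
  have "find P (xs @ [x]) = (case find P xs of Some l \<Rightarrow> Some l | None \<Rightarrow> if P x then Some x else None)"
    for P and xs :: "nat list" and x by (induction xs) auto
  then show "\<tau> * q \<le> j \<Longrightarrow> ?thesis" by (simp add: firstlab_def)
qed

lemma firstlab_empty [simp]: "firstlab w X \<tau> (\<tau> * q) = None" by (simp add: firstlab_def)

lemma firstlab_Some: "firstlab w X \<tau> j = Some l \<Longrightarrow> l div Lam = \<tau> \<and> (\<exists>t\<in>{\<tau> * q..<j}. fst (w (X t)) = l)"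
proof -
  have "find P xs = Some x \<Longrightarrow> P x \<and> x \<in> set xs" for P and xs :: "nat list" and x
    by (induction xs) (auto split: if_splits)
  then show "firstlab w X \<tau> j = Some l \<Longrightarrow> ?thesis" unfolding firstlab_def by fastforce
qed

lemma firstlab_None: "firstlab w X \<tau> j = None \<longleftrightarrow> (\<forall>t\<in>{\<tau> * q..<j}. fst (w (X t)) div Lam \<noteq> \<tau>)"
  by (auto simp: firstlab_def find_None_iff)

lemma st_tick: "st w p X \<tau> = Some l \<Longrightarrow> l div Lam < \<tau> \<and> l div Lam < Wb"
proof (induction \<tau>)
  case (Suc \<tau>)
  show ?case
  proof (cases "st w p X \<tau>")
    case None
    then have "\<tau> < Wb" "firstlab w X \<tau> (Suc \<tau> * q) = Some l" using Suc.prems by (simp_all split: if_splits)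
    then show ?thesis using firstlab_Some by fastforce
  next
    case (Some l')
    then show ?thesis using Suc by (auto split: if_splits)
  qed
qed simp

text \<open>The workspace of a test: the bits found so far, the current signed sum, and the number of
  occurrences of the identified element in the verification part.\<close>

definition pb :: "(nat \<Rightarrow> nat \<times> bool) \<Rightarrow> nat \<Rightarrow> nat \<Rightarrow> nat \<Rightarrow> (nat \<Rightarrow> nat) \<Rightarrow> nat \<Rightarrow> nat set" where
  "pb w b0 s \<beta> X t = {b\<in>bits w b0 s \<beta> X. b0 + Suc b * (D ^ s * q) \<le> t}"

definition pz :: "(nat \<Rightarrow> nat \<times> bool) \<Rightarrow> nat \<Rightarrow> nat \<Rightarrow> nat \<Rightarrow> (nat \<Rightarrow> nat) \<Rightarrow> nat \<Rightarrow> int" where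
  "pz w b0 s \<beta> X t = (let b = (t - b0) div (D ^ s * q) in
     if b < B then Zs w s \<beta> b X (b0 + b * (D ^ s * q)) t else 0)"

definition pv :: "(nat \<Rightarrow> nat \<times> bool) \<Rightarrow> nat \<Rightarrow> nat \<Rightarrow> nat \<Rightarrow> (nat \<Rightarrow> nat) \<Rightarrow> nat \<Rightarrow> nat" where
  "pv w b0 s \<beta> X t = card {t'\<in>{b0 + B * (D ^ s * q)..<t}. matches (bits w b0 s \<beta> X) (X t')}"

definition tact :: "(nat \<Rightarrow> nat \<times> bool) \<Rightarrow> (nat \<Rightarrow> nat \<Rightarrow> nat) \<Rightarrow> (nat \<Rightarrow> nat) \<Rightarrow> nat \<Rightarrow> nat \<Rightarrow> nat \<Rightarrow> nat \<Rightarrow>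
    (nat set \<times> int \<times> nat) option" where
  "tact w p X s C \<beta> t = (let b0 = sbi s C (p s C) in
     if b0 \<le> t \<and> t < b0 + 4 * B * (D ^ s * q) then Some (pb w b0 s \<beta> X t, pz w b0 s \<beta> X t, pv w b0 s \<beta> X t) else None)"

text \<open>The verdict reads \<open>False\<close> until the test is over, so that a cell always
  starts from a known memory (\<open>test_memory_start\<close>).\<close>

definition tres :: "(nat \<Rightarrow> nat \<times> bool) \<Rightarrow> (nat \<Rightarrow> nat \<Rightarrow> nat) \<Rightarrow> (nat \<Rightarrow> nat) \<Rightarrow> nat \<Rightarrow> nat \<Rightarrow> nat \<Rightarrow> nat \<Rightarrow> bool" where
  "tres w p X s C \<beta> t \<longleftrightarrow> sbi s C (p s C) + 4 * B * (D ^ s * q) \<le> t \<and> (\<exists>y. tst w p X s C \<beta> y)"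

definition slotmem :: "(nat \<Rightarrow> nat \<times> bool) \<Rightarrow> (nat \<Rightarrow> nat \<Rightarrow> nat) \<Rightarrow> (nat \<Rightarrow> nat) \<Rightarrow> nat \<Rightarrow> slot_memory" where
  "slotmem w p X t = (let \<tau> = t div q in case st w p X \<tau> of
     None \<Rightarrow> Vacant (if \<tau> < Wb then firstlab w X \<tau> t else None)
   | Some l \<Rightarrow> (let s = stg l \<tau> in if s = 0
       then Young l (hits w l X (l div Lam) \<tau>) (\<exists>t'\<in>{\<tau> * q..<t}. fst (w (X t')) = l)
       else Old s (l div D ^ s) (tres w p X s (\<tau> div a s) (l div D ^ s) t) (tact w p X s (\<tau> div a s) (l div D ^ s) t)))"

lemma h_pos [simp]: "D ^ s * q > 0" using q_pos by simp

lemma Zs_Suc: "i \<le> j \<Longrightarrow> Zs w s \<beta> b X i (Suc j) = Zs w s \<beta> b X i j +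
   (if fst (w (X j)) div D ^ s = \<beta> \<and> bitf (X j) b then (if snd (w (X j)) then 1 else - 1) else 0)"
  by (simp add: Zs_def)

lemma workspace_Suc:
  fixes w :: "nat \<Rightarrow> nat \<times> bool" and X :: "nat \<Rightarrow> nat" and \<beta> :: nat
  assumes t: "b0 \<le> t" and b: "b = (t - b0) div (D ^ s * q)"
  defines "z \<equiv> pz w b0 s \<beta> X t + (if fst (w (X t)) div D ^ s = \<beta> \<and> bitf (X t) b
      then (if snd (w (X t)) then 1 else - 1) else 0)"
  shows "pb w b0 s \<beta> X (Suc t) = (if b < B \<and> Suc t = b0 + Suc b * (D ^ s * q) \<and> int (D ^ s) \<le> 4 * \<bar>z\<bar>
           then insert b (pb w b0 s \<beta> X t) else pb w b0 s \<beta> X t)" (is ?A)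
    and "pz w b0 s \<beta> X (Suc t) = (if b < B \<and> Suc t \<noteq> b0 + Suc b * (D ^ s * q) then z else 0)" (is ?B)
    and "pv w b0 s \<beta> X (Suc t) = pv w b0 s \<beta> X t + (if b < B then 0 else if matches (pb w b0 s \<beta> X t) (X t) then 1 else 0)" (is ?C)
proof -
  define h where "h = D ^ s * q"
  have h: "h > 0" unfolding h_def using q_pos by simp
  have b1: "b0 + b * h \<le> t"
    using t div_times_less_eq_dividend[of "t - b0" h] unfolding b h_def[symmetric] by linarith
  have b2: "t < b0 + Suc b * h"
    using t dividend_less_div_times[OF h, of "t - b0"] unfolding b h_def[symmetric] mult_Suc by linarith
  have zb: "z = Zs w s \<beta> b X (b0 + b * h) (Suc t)" if "b < B"
    using that b1 by (simp add: z_def pz_def Let_def b[symmetric] h_def Zs_Suc)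
  \<comment> \<open>At most one part ends at time \<open>t + 1\<close>, and it is the current
    one.\<close>
  have iff: "b0 + Suc c * h \<le> Suc t \<longleftrightarrow> b0 + Suc c * h \<le> t \<or> c = b \<and> Suc t = b0 + Suc b * h" for c
  proof -
    have "c = b" if "b0 + Suc c * h = Suc t"
    proof (rule ccontr)
      assume "c \<noteq> b"
      then consider "c < b" | "c > b" by linarith
      then show False
      proof cases
        case 1 then have "Suc c * h \<le> b * h" by (intro mult_le_mono1) auto
        then show False using that b1 by simp
      next
        case 2 then have "Suc (Suc b) * h \<le> Suc c * h" by (intro mult_le_mono1) auto
        then show False using that b2 h by simp
      qed
    qed
    then show ?thesis by (auto simp: le_Suc_eq)
  qed
  show ?A
  proof -
    have "b \<in> bits w b0 s \<beta> X \<longleftrightarrow> int (D ^ s) \<le> 4 * \<bar>z\<bar>" if "b < B" "Suc t = b0 + Suc b * h"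
      using that zb by (simp add: bits_def h_def)
    then show ?thesis unfolding pb_def h_def[symmetric] using iff by (auto simp: bits_def)
  qed
  show ?B
  proof (cases "Suc t = b0 + Suc b * h")
    case True
    then have "(Suc t - b0) div h = Suc b" using h by simp
    then show ?thesis using True unfolding pz_def h_def[symmetric] Let_def by (auto simp: Zs_def)
  next
    case False
    have "(Suc t - b0) div h = b" using b1 b2 False by (intro div_nat_eqI) (auto simp: algebra_simps)
    then show ?thesis using False zb unfolding pz_def h_def[symmetric] Let_def by auto
  qed
  show ?C
  proof (cases "b < B")
    case True
    have "Suc b * h \<le> B * h" using True by (intro mult_le_mono1) auto
    then have "Suc t \<le> b0 + B * h" using b2 by simp
    then have "{t'\<in>{b0 + B * h..<Suc t}. matches (bits w b0 s \<beta> X) (X t')} = {}"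
       "{t'\<in>{b0 + B * h..<t}. matches (bits w b0 s \<beta> X) (X t')} = {}" by auto
    then show ?thesis using True unfolding pv_def h_def[symmetric] by (simp only: card.empty if_True)
  next
    case False
    then have "B * h \<le> b * h" by (intro mult_le_mono1) auto
    then have t2: "b0 + B * h \<le> t" using b1 by linarith
    \<comment> \<open>All \<open>B\<close> parts lie before the verification part, so there the bits
      decided so far are all the bits.\<close>
    have full: "pb w b0 s \<beta> X t = bits w b0 s \<beta> X"
    proof -
      have "b0 + Suc c * h \<le> t" if "c < B" for c
      proof -
        have "Suc c * h \<le> B * h" using that by (intro mult_le_mono1) auto
        then show ?thesis using t2 by linarith
      qed
      then show ?thesis unfolding pb_def h_def[symmetric] by (auto simp: bits_def)
    qed
    have "{t'\<in>{b0 + B * h..<Suc t}. matches (bits w b0 s \<beta> X) (X t')} =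
       (if matches (bits w b0 s \<beta> X) (X t) then insert t {t'\<in>{b0 + B * h..<t}. matches (bits w b0 s \<beta> X) (X t')}
        else {t'\<in>{b0 + B * h..<t}. matches (bits w b0 s \<beta> X) (X t')})"
      using t2 by (auto simp: less_Suc_eq)
    then show ?thesis using False full unfolding pv_def h_def[symmetric] by simp
  qed
qed

lemma workspace_start: "pb w b0 s \<beta> X b0 = {}" "pz w b0 s \<beta> X b0 = 0" "pv w b0 s \<beta> X b0 = 0"
  using q_pos by (auto simp: pb_def pz_def pv_def Zs_def Let_def)

text \<open>By \<open>sep\<close> only one element of \<open>U\<close> matches the bits that were
  found, so counting matches in the verification part is counting occurrences of that
  element.\<close>

lemma tst_workspace:
  assumes "\<And>t. X t \<in> U" and b0: "b0 = sbi s C (p s C)" and e: "e = b0 + 4 * B * (D ^ s * q)"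
  shows "tst w p X s C \<beta> y \<longleftrightarrow> y \<in> U \<and> fst (w y) div D ^ s = \<beta> \<and> 3 * B * D ^ s \<le> 2 * pv w b0 s \<beta> X e \<and>
    matches (pb w b0 s \<beta> X e) y"
proof -
  have full: "pb w b0 s \<beta> X e = bits w b0 s \<beta> X"
  proof -
    have "b0 + Suc c * (D ^ s * q) \<le> e" if "c < B" for c
    proof -
      have "Suc c * (D ^ s * q) \<le> 4 * B * (D ^ s * q)" using that by (intro mult_le_mono1) auto
      then show ?thesis using e by simp
    qed
    then show ?thesis unfolding pb_def by (auto simp: bits_def)
  qed
  have "cnt X y (b0 + B * (D ^ s * q)) e = pv w b0 s \<beta> X e" if "y \<in> U" "matches (bits w b0 s \<beta> X) y"
  proof -
    have "X t = y \<longleftrightarrow> matches (bits w b0 s \<beta> X) (X t)" for t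
      using that assms(1) sep[of y "X t"] by (auto simp: matches_def)
    then show ?thesis by (simp add: cnt_def pv_def)
  qed
  then show ?thesis unfolding tst_def dense_def full b0[symmetric] e[symmetric] by auto
qed

lemma sbi_ge: "C * a s * q \<le> sbi s C i" by (simp add: sbi_def algebra_simps)

lemma sbi_end: "i < m \<Longrightarrow> sbi s C i + 4 * B * (D ^ s * q) \<le> Suc C * a s * q"
proof -
  assume "i < m"
  then have "(i + 1) * (4 * B * D ^ s) \<le> m * (4 * B * D ^ s)" by (intro mult_le_mono1) auto
  then have "(C * a s + (i + 1) * (4 * B * D ^ s)) * q \<le> (C * a s + a s) * q"
    by (intro mult_le_mono1) (simp add: a_def algebra_simps)
  then show ?thesis by (simp add: sbi_def algebra_simps)
qed

section \<open>Congruence of the slot memory\<close>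

context
  fixes p :: "nat \<Rightarrow> nat \<Rightarrow> nat" and X X' :: "nat \<Rightarrow> nat" and w :: "nat \<Rightarrow> nat \<times> bool"
  assumes p_less: "\<And>s C. p s C < m" and XU: "\<And>t. X t \<in> U" and XU': "\<And>t. X' t \<in> U"
begin

lemma workspace_cong:
  assumes "b0 \<le> t" "X t = X' t" "pb w b0 s \<beta> X t = pb w b0 s \<beta> X' t"
    "pz w b0 s \<beta> X t = pz w b0 s \<beta> X' t" "pv w b0 s \<beta> X t = pv w b0 s \<beta> X' t"
  shows "pb w b0 s \<beta> X (Suc t) = pb w b0 s \<beta> X' (Suc t)"
    "pz w b0 s \<beta> X (Suc t) = pz w b0 s \<beta> X' (Suc t)" "pv w b0 s \<beta> X (Suc t) = pv w b0 s \<beta> X' (Suc t)"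
  by (simp_all only: workspace_Suc[OF assms(1) refl] assms(2-5))

lemma tst_cong_at_end:
  assumes "tact w p X s C \<beta> t = tact w p X' s C \<beta> t" "X t = X' t"
    "Suc t = sbi s C (p s C) + 4 * B * (D ^ s * q)"
  shows "tst w p X s C \<beta> y \<longleftrightarrow> tst w p X' s C \<beta> y"
proof -
  define b0 where "b0 = sbi s C (p s C)"
  have "0 < 4 * B * (D ^ s * q)" using B_pos q_pos by simp
  then have t: "b0 \<le> t" "t < b0 + 4 * B * (D ^ s * q)" using assms(3) unfolding b0_def by linarith+
  then have eqs: "pb w b0 s \<beta> X t = pb w b0 s \<beta> X' t" "pz w b0 s \<beta> X t = pz w b0 s \<beta> X' t" "pv w b0 s \<beta> X t = pv w b0 s \<beta> X' t"
    using assms(1) by (auto simp: tact_def b0_def[symmetric] Let_def)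
  note wc = workspace_cong[OF t(1) assms(2) eqs]
  have "tst w p Y s C \<beta> y \<longleftrightarrow> y \<in> U \<and> fst (w y) div D ^ s = \<beta> \<and> 3 * B * D ^ s \<le> 2 * pv w b0 s \<beta> Y (Suc t) \<and>
      matches (pb w b0 s \<beta> Y (Suc t)) y" if "\<And>t. Y t \<in> U" for Y
    by (rule tst_workspace) (use that b0_def assms(3) in auto)
  from this[of X, OF XU] this[of X', OF XU'] show ?thesis using wc by simp
qed

lemma test_memory_cong:
  assumes "tact w p X s C \<beta> t = tact w p X' s C \<beta> t" "tres w p X s C \<beta> t = tres w p X' s C \<beta> t" "X t = X' t"
  shows "tact w p X s C \<beta> (Suc t) = tact w p X' s C \<beta> (Suc t)" "tres w p X s C \<beta> (Suc t) = tres w p X' s C \<beta> (Suc t)"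
proof -
  define b0 where "b0 = sbi s C (p s C)"
  show "tact w p X s C \<beta> (Suc t) = tact w p X' s C \<beta> (Suc t)"
  proof (cases "b0 \<le> t \<and> Suc t < b0 + 4 * B * (D ^ s * q)")
    case True
    then have eqs: "pb w b0 s \<beta> X t = pb w b0 s \<beta> X' t" "pz w b0 s \<beta> X t = pz w b0 s \<beta> X' t" "pv w b0 s \<beta> X t = pv w b0 s \<beta> X' t"
      using assms(1) by (auto simp: tact_def b0_def[symmetric] Let_def)
    show ?thesis using workspace_cong[OF _ assms(3) eqs] True by (simp add: tact_def b0_def[symmetric] Let_def)
  next
    case False
    then consider "Suc t = b0" | "\<not> (b0 \<le> Suc t \<and> Suc t < b0 + 4 * B * (D ^ s * q))" by linarith
    then show ?thesis
    proof cases
      case 1 then show ?thesis unfolding tact_def b0_def[symmetric] Let_def by (simp add: workspace_start 1)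
    next
      case 2 then show ?thesis unfolding tact_def b0_def[symmetric] Let_def by auto
    qed
  qed
  show "tres w p X s C \<beta> (Suc t) = tres w p X' s C \<beta> (Suc t)"
  proof (cases "Suc t = b0 + 4 * B * (D ^ s * q)")
    case True
    then show ?thesis using tst_cong_at_end[OF assms(1) assms(3)] by (auto simp: tres_def b0_def)
  next
    case False
    then show ?thesis using assms(2) by (auto simp: tres_def b0_def le_Suc_eq)
  qed
qed

lemma test_memory_start:
  assumes "t \<le> C * a s * q"
  shows "tact w p X s C \<beta> t = tact w p X' s C \<beta> t" "tres w p X s C \<beta> t = tres w p X' s C \<beta> t"
proof -
  have le: "t \<le> sbi s C (p s C)" using sbi_ge[of C s "p s C"] assms by linarith
  show "tact w p X s C \<beta> t = tact w p X' s C \<beta> t"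
    using le by (cases "t = sbi s C (p s C)") (auto simp: tact_def Let_def workspace_start)
  have "0 < 4 * B * (D ^ s * q)" using B_pos q_pos by simp
  then have "\<not> sbi s C (p s C) + 4 * B * (D ^ s * q) \<le> t" using le by linarith
  then show "tres w p X s C \<beta> t = tres w p X' s C \<beta> t" by (simp add: tres_def)
qed

text \<open>Only the end of a tick is delicate, when the slot may adopt, discard or change stage.
  The memory suffices there because the stage change and the coarser prefix are functions of the old
  prefix (\<open>stg_block\<close>), and because a new cell starts with a blank test.\<close>

lemma slotmem_cong:
  assumes eq: "slotmem w p X t = slotmem w p X' t" and Xt: "X t = X' t"
  shows "slotmem w p X (Suc t) = slotmem w p X' (Suc t)"
proof -
  define \<tau> where "\<tau> = t div q"
  have t1: "\<tau> * q \<le> t" by (simp add: \<tau>_def)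
  have t2: "t < Suc \<tau> * q" using dividend_less_div_times[of q t] q_pos by (simp add: \<tau>_def)
  note eq' = eq[unfolded slotmem_def Let_def \<tau>_def[symmetric]]
  have ins: "{\<tau> * q..<Suc t} = insert t {\<tau> * q..<t}" using t1 by auto
  have flS: "firstlab w X \<tau> (Suc t) = firstlab w X' \<tau> (Suc t)"
    if "st w p X \<tau> = None" "st w p X' \<tau> = None" "\<tau> < Wb"
    using that eq' by (simp add: firstlab_Suc[OF t1] Xt split: option.split)
  show ?thesis
  proof (cases "Suc t = Suc \<tau> * q")
    case False
    then have tick: "Suc t div q = \<tau>" using t1 t2 by (intro div_nat_eqI) (auto simp: algebra_simps)
    show ?thesis
    proof (cases "st w p X \<tau>")
      case None
      then have None': "st w p X' \<tau> = None" using eq' by (auto split: option.splits if_splits)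
      then show ?thesis using None flS by (simp add: slotmem_def Let_def tick)
    next
      case (Some l)
      then obtain l' where Some': "st w p X' \<tau> = Some l'" using eq' by (auto split: option.splits if_splits)
      show ?thesis
      proof (cases "stg l \<tau> = 0")
        case True
        then show ?thesis using Some Some' eq' Xt by (auto simp: slotmem_def Let_def tick ins split: if_splits)
      next
        case False
        then have *: "stg l' \<tau> = stg l \<tau>" "l' div D ^ stg l \<tau> = l div D ^ stg l \<tau>"
          using Some Some' eq' by (auto split: if_splits)
        have eqs: "tact w p X (stg l \<tau>) (\<tau> div a (stg l \<tau>)) (l div D ^ stg l \<tau>) t = tact w p X' (stg l \<tau>) (\<tau> div a (stg l \<tau>)) (l div D ^ stg l \<tau>) t"
          "tres w p X (stg l \<tau>) (\<tau> div a (stg l \<tau>)) (l div D ^ stg l \<tau>) t = tres w p X' (stg l \<tau>) (\<tau> div a (stg l \<tau>)) (l div D ^ stg l \<tau>) t"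
          using Some Some' eq' False * by auto
        from test_memory_cong[OF eqs Xt] show ?thesis
          using Some Some' False * by (simp add: slotmem_def Let_def tick)
      qed
    qed
  next
    case True
    then have tick: "Suc t div q = Suc \<tau>" using q_pos by (simp del: mult_Suc)
    have emp: "{Suc \<tau> * q..<Suc t} = {}" "firstlab w Y (Suc \<tau>) (Suc t) = None" for Y
      unfolding True by (simp_all del: mult_Suc)
    have sm_None: "slotmem w p Y (Suc t) = Vacant None" if "st w p Y (Suc \<tau>) = None" for Y
      using that unfolding slotmem_def Let_def tick emp by (simp del: st.simps)
    have sm_young: "slotmem w p Y (Suc t) = Young l (hits w l Y (l div Lam) (Suc \<tau>)) False"
      if "st w p Y (Suc \<tau>) = Some l" "stg l (Suc \<tau>) = 0" for Y l
      using that unfolding slotmem_def Let_def tick emp by (simp del: st.simps)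
    have sm_old: "slotmem w p Y (Suc t) = Old s (l div D ^ s) (tres w p Y s (Suc \<tau> div a s) (l div D ^ s) (Suc t))
        (tact w p Y s (Suc \<tau> div a s) (l div D ^ s) (Suc t))"
      if "st w p Y (Suc \<tau>) = Some l" "stg l (Suc \<tau>) = s" "s \<noteq> 0" for Y l s
      using that unfolding slotmem_def Let_def tick by (simp del: st.simps)
    show ?thesis
    proof (cases "st w p X \<tau>")
      case None
      then have None': "st w p X' \<tau> = None" using eq' by (auto split: option.splits if_splits)
      have fl: "firstlab w X \<tau> (Suc \<tau> * q) = firstlab w X' \<tau> (Suc \<tau> * q)" if "\<tau> < Wb"
        unfolding True[symmetric] using None None' that by (rule flS)
      then have st_eq: "st w p X (Suc \<tau>) = st w p X' (Suc \<tau>)" using None None' by simp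
      show ?thesis
      proof (cases "st w p X (Suc \<tau>)")
        case n: None
        then show ?thesis using st_eq sm_None by (simp del: st.simps)
      next
        case (Some l)
        then have l: "firstlab w X \<tau> (Suc \<tau> * q) = Some l" "firstlab w X' \<tau> (Suc \<tau> * q) = Some l"
          using None fl by (auto split: if_splits)
        have u: "l div Lam = \<tau>" using firstlab_Some[OF l(1)] by auto
        have "Suc \<tau> < eend 0 l" using eend_gt[of l 0] u a_pos[of "Suc 0"] by linarith
        then have "stg l (Suc \<tau>) = 0" by (intro stg_eqI) auto
        moreover have "hits w l Y (l div Lam) (Suc \<tau>) = 1" if "firstlab w Y \<tau> (Suc \<tau> * q) = Some l" for Y
        proof -
          have "{\<tau>'\<in>{\<tau>..<Suc \<tau>}. \<exists>t\<in>{\<tau>' * q..<Suc \<tau>' * q}. fst (w (Y t)) = l} = {\<tau>}"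
            using firstlab_Some[OF that] by auto
          then show ?thesis by (simp add: hits_def u)
        qed
        ultimately show ?thesis using Some st_eq l sm_young by (simp del: st.simps mult_Suc)
      qed
    next
      case (Some l)
      then obtain l' where Some': "st w p X' \<tau> = Some l'" using eq' by (auto split: option.splits if_splits)
      show ?thesis
      proof (cases "stg l \<tau> = 0")
        case z: True
        then have l': "l' = l" and h: "hits w l X (l div Lam) \<tau> = hits w l X' (l div Lam) \<tau>"
          and f: "(\<exists>t'\<in>{\<tau> * q..<t}. fst (w (X t')) = l) = (\<exists>t'\<in>{\<tau> * q..<t}. fst (w (X' t')) = l)"
          using Some Some' eq' by (auto split: if_splits)
        have "l div Lam \<le> \<tau>" using st_tick[OF Some] by simp
        then have hS: "hits w l Y (l div Lam) (Suc \<tau>) = hits w l Y (l div Lam) \<tau> +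
            (if \<exists>t\<in>{\<tau> * q..<Suc \<tau> * q}. fst (w (Y t)) = l then 1 else 0)" for Y
        proof -
          assume le: "l div Lam \<le> \<tau>"
          have "{\<tau>'\<in>{l div Lam..<Suc \<tau>}. \<exists>t\<in>{\<tau>' * q..<Suc \<tau>' * q}. fst (w (Y t)) = l} =
             (if \<exists>t\<in>{\<tau> * q..<Suc \<tau> * q}. fst (w (Y t)) = l then insert \<tau> {\<tau>'\<in>{l div Lam..<\<tau>}. \<exists>t\<in>{\<tau>' * q..<Suc \<tau>' * q}. fst (w (Y t)) = l}
              else {\<tau>'\<in>{l div Lam..<\<tau>}. \<exists>t\<in>{\<tau>' * q..<Suc \<tau>' * q}. fst (w (Y t)) = l})"
            using le by (auto simp: less_Suc_eq)
          then show ?thesis by (simp add: hits_def)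
        qed
        have h2: "hits w l X (l div Lam) (Suc \<tau>) = hits w l X' (l div Lam) (Suc \<tau>)"
          unfolding hS h True[symmetric] ins using f Xt by auto
        have okeq: "ok w p X l \<tau> = ok w p X' l \<tau>" using z h2 by (simp add: ok_def)
        show ?thesis
        proof (cases "ok w p X l \<tau>")
          case False
          then show ?thesis using Some Some' okeq l' sm_None by simp
        next
          case o: True
          show ?thesis
          proof (cases "stg l (Suc \<tau>) = 0")
            case True
            then show ?thesis using o Some Some' okeq l' h2 sm_young by simp
          next
            case False
            then have s1: "stg l (Suc \<tau>) = 1" "Suc \<tau> = eend 0 l" using z by (auto simp: stg_Suc split: if_splits)
            \<comment> \<open>Stage 1 begins at a boundary of its own cells, so its first test has
              not started yet.\<close>
            then have "Suc t \<le> (Suc \<tau> div a 1) * a 1 * q" unfolding True eend_def by simp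
            note start = test_memory_start[OF this]
            have "st w p X (Suc \<tau>) = Some l" "st w p X' (Suc \<tau>) = Some l" using o Some Some' okeq l' by auto
            from sm_old[OF this(1) s1(1)] sm_old[OF this(2) s1(1)] show ?thesis by (simp only: start)
          qed
        qed
      next
        case nz: False
        define s where "s = stg l \<tau>"
        define \<beta> where "\<beta> = l div D ^ s"
        define C where "C = \<tau> div a s"
        have *: "stg l' \<tau> = s" "l' div D ^ s = \<beta>" "stg l \<tau> = s" "l div D ^ s = \<beta>" "s \<noteq> 0"
          using Some Some' eq' nz by (auto simp: s_def \<beta>_def split: if_splits)
        have eqs: "tact w p X s C \<beta> t = tact w p X' s C \<beta> t" "tres w p X s C \<beta> t = tres w p X' s C \<beta> t"
          using Some Some' eq' nz * by (auto simp: C_def)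
        note tm = test_memory_cong[OF eqs Xt]
        have stS: "stg l (Suc \<tau>) = stg l' (Suc \<tau>)" using stg_block[of l \<tau> l'] * by simp
        have okeq: "ok w p X l \<tau> = ok w p X' l' \<tau>"
        proof (cases "a s dvd Suc \<tau>")
          case dvd: True
          then have "Suc \<tau> = Suc C * a s" unfolding C_def
            by (metis dvd_div_mult_self div_Suc mod_eq_0_iff_dvd)
          \<comment> \<open>Every subblock ends inside its cell, so at the end of the cell the
            stored verdict is final.\<close>
          then have "sbi s C (p s C) + 4 * B * (D ^ s * q) \<le> Suc t" unfolding True using sbi_end[OF p_less, of s C s C] by simp
          then show ?thesis using tm(2) * by (simp add: ok_def tres_def C_def)
        qed (use * in \<open>simp add: ok_def\<close>)
        show ?thesis
        proof (cases "ok w p X l \<tau>")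
          case False
          then show ?thesis using Some Some' okeq sm_None by simp
        next
          case o: True
          define s' where "s' = stg l (Suc \<tau>)"
          \<comment> \<open>The stage rises by at most one, and the coarser prefix is a quotient of
            the stored one.\<close>
          have blk: "l div D ^ s' = l' div D ^ s'"
            unfolding s'_def stg_Suc using * by (simp add: div_mult2_eq power_Suc2 del: power_Suc)
          \<comment> \<open>Either a cell starts now and its test is blank, or stage and cell are
            unchanged and the test continues.\<close>
          have "tact w p X s' (Suc \<tau> div a s') (l div D ^ s') (Suc t) = tact w p X' s' (Suc \<tau> div a s') (l div D ^ s') (Suc t) \<and>
            tres w p X s' (Suc \<tau> div a s') (l div D ^ s') (Suc t) = tres w p X' s' (Suc \<tau> div a s') (l div D ^ s') (Suc t)"
          proof (cases "a s' dvd Suc \<tau>")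
            case dvd: True
            then have "Suc t \<le> (Suc \<tau> div a s') * a s' * q" unfolding True by simp
            from test_memory_start[OF this] show ?thesis by blast
          next
            case nd: False
            have "s' = s"
            proof (rule ccontr)
              assume "s' \<noteq> s"
              then have "s' = Suc s" "Suc \<tau> = eend s l" using * by (auto simp: s'_def stg_Suc split: if_splits)
              then show False using nd by (simp add: eend_def)
            qed
            moreover have "Suc \<tau> div a s = C" using nd \<open>s' = s\<close> by (simp add: C_def div_Suc mod_eq_0_iff_dvd)
            ultimately show ?thesis using tm * by simp
          qed
          moreover have "s' \<noteq> 0" using * by (simp add: s'_def stg_Suc)
          moreover have "st w p X (Suc \<tau>) = Some l" "st w p X' (Suc \<tau>) = Some l'" using o Some Some' okeq by auto
          moreover have "stg l (Suc \<tau>) = s'" "stg l' (Suc \<tau>) = s'" using stS by (auto simp: s'_def)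
          ultimately show ?thesis using sm_old[of X l s'] sm_old[of X' l' s'] blk by (simp del: st.simps)
        qed
      qed
    qed
  qed
qed

end

end

section \<open>Occupied slots and surviving elements\<close>

text \<open>The last stage has no end computed from the label; \<open>N \<le> D^2\<close> bounds an
  age in cells there by \<open>D^2\<close>, as the stage ends do at earlier stages.\<close>

locale slots2 = slots + assumes N_le: "N \<le> D^2"
begin

text \<open>Entering stage \<open>S\<close> takes at most three of its cells after birth. Adoptions
  stop four cells before the final cell, so in the final cell every item is in stage
  \<open>S\<close>.\<close>

lemma Wb_cells: "Wb + 4 * a S \<le> (N - 1) * a S" using Wb_le unfolding a_def .

lemma N_pos: "N > 0" using Wb_cells a_pos[of S] by (cases N) auto

lemma cnt_mono: "i' \<le> i \<Longrightarrow> j \<le> j' \<Longrightarrow> cnt X y i j \<le> cnt X y i' j'"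
  unfolding cnt_def by (intro card_mono) auto

lemma card_hit_le_cnt: "card {\<tau>\<in>{i..<j}. hit q X y \<tau>} \<le> cnt X y (i * q) (j * q)"
proof -
  have "{\<tau>\<in>{i..<j}. hit q X y \<tau>} \<subseteq> (\<lambda>t. t div q) ` {t\<in>{i * q..<j * q}. X t = y}"
  proof
    fix \<tau> assume \<tau>: "\<tau> \<in> {\<tau>\<in>{i..<j}. hit q X y \<tau>}"
    then obtain t where t: "\<tau> * q \<le> t" "t < Suc \<tau> * q" "X t = y" by (auto simp: hit_def)
    have "i * q \<le> \<tau> * q" "Suc \<tau> * q \<le> j * q" using \<tau> by (intro mult_le_mono1; auto)+
    then have "i * q \<le> t" "t < j * q" using t by linarith+
    then have "t \<in> {t\<in>{i * q..<j * q}. X t = y}" using t by auto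
    moreover have "t div q = \<tau>" using t by (intro div_nat_eqI) (auto simp: algebra_simps)
    ultimately show "\<tau> \<in> (\<lambda>t. t div q) ` {t\<in>{i * q..<j * q}. X t = y}" by (auto intro!: rev_image_eqI)
  qed
  then show ?thesis unfolding cnt_def by (rule surj_card_le[rotated]) simp
qed

text \<open>A block of \<open>D ^ s\<close> labels lies within the \<open>Lam * a s\<close> labels
  of one birth cell, so the stored prefix still reveals that cell.\<close>

lemma cell_of_block: "l div Lam div a s = l div D ^ s div (Lam * (4 * B * m))"
proof -
  have "Lam * a s = D ^ s * (Lam * (4 * B * m))" by (simp add: a_def)
  then show ?thesis by (metis div_mult2_eq)
qed

lemma block_mono: "l div D ^ s = l' div D ^ s \<Longrightarrow> s \<le> s' \<Longrightarrow> l div D ^ s' = l' div D ^ s'"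
  by (metis div_mult2_eq le_add_diff_inverse power_add)

lemma st_alive:
  "st w p X \<tau> = Some l \<Longrightarrow> (\<exists>t\<in>{l div Lam * q..<Suc (l div Lam) * q}. fst (w (X t)) = l) \<and>
     (\<forall>\<tau>'. l div Lam < \<tau>' \<and> \<tau>' < \<tau> \<longrightarrow> ok w p X l \<tau>')"
proof (induction \<tau>)
  case (Suc \<tau>)
  show ?case
  proof (cases "st w p X \<tau>")
    case None
    then have "firstlab w X \<tau> (Suc \<tau> * q) = Some l" using Suc.prems by (simp split: if_splits)
    from firstlab_Some[OF this] show ?thesis by auto
  next
    case (Some l')
    then have "l' = l" "ok w p X l \<tau>" using Suc.prems by (auto split: if_splits)
    then show ?thesis using Suc Some by (auto simp: less_Suc_eq)
  qed
qed simp

lemma st_persist: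
  assumes "st w p X u = None" "u < Wb" "firstlab w X u (Suc u * q) = Some l"
    "\<And>\<tau>. u < \<tau> \<Longrightarrow> \<tau> < T \<Longrightarrow> ok w p X l \<tau>" "u < \<tau>" "\<tau> \<le> T"
  shows "st w p X \<tau> = Some l"
  using assms(5,6)
proof (induction \<tau>)
  case (Suc \<tau>)
  show ?case
  proof (cases "\<tau> = u")
    case True then show ?thesis using assms by simp
  next
    case False then show ?thesis using Suc assms(4)[of \<tau>] by simp
  qed
qed simp

lemma eend_pred: "s \<ge> 1 \<Longrightarrow> eend (s - 1) l = (l div Lam div a s + 3) * a s"
  by (cases s) (simp_all add: eend_tick)

lemma stg_in_cell:
  assumes "1 \<le> s" "s \<le> S" "l div Lam div a s + 3 \<le> C" "s < S \<Longrightarrow> Suc C * a s \<le> eend s l"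
    "C * a s \<le> \<tau>" "\<tau> < Suc C * a s"
  shows "stg l \<tau> = s"
proof (rule stg_eqI)
  show "s < S \<Longrightarrow> \<tau> < eend s l" using assms by (meson less_le_trans)
  fix r assume "r < s"
  then consider "r = s - 1" | "r < s - 1" by linarith
  then have "eend r l \<le> eend (s - 1) l"
  proof cases
    case 2 then show ?thesis using eend_less[OF 2, of l] by linarith
  qed simp
  also have "\<dots> \<le> C * a s" unfolding eend_pred[OF assms(1)] using assms(3) by (rule mult_le_mono1)
  finally show "eend r l \<le> \<tau>" using assms(5) by simp
qed (rule assms)

text \<open>An item that outlives the last tick of a cell was \<open>ok\<close> there, so its test
  was passed, though by an element that may differ from cell to cell.\<close>

lemma passed:
  assumes "st w p X \<tau> = Some l" "1 \<le> s" "s \<le> S" "l div Lam div a s + 3 \<le> C"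
    "s < S \<Longrightarrow> Suc C * a s \<le> eend s l" "Suc C * a s \<le> \<tau>"
  shows "\<exists>y. tst w p X s C (l div D ^ s) y"
proof -
  define \<tau>' where "\<tau>' = Suc C * a s - 1"
  have \<tau>': "Suc \<tau>' = Suc C * a s" "C * a s \<le> \<tau>'" "\<tau>' < Suc C * a s"
    using a_pos[of s] by (auto simp: \<tau>'_def simp del: a_pos)
  have s: "stg l \<tau>' = s" using assms \<tau>' by (intro stg_in_cell) auto
  have "eend (s - 1) l \<le> \<tau>'"
    unfolding eend_pred[OF assms(2)] using mult_le_mono1[OF assms(4), of "a s"] \<tau>' by linarith
  then have "l div Lam < \<tau>'" using eend_gt[of l "s - 1"] by linarith
  then have "ok w p X l \<tau>'" using st_alive[OF assms(1)] \<tau>' assms(6) by auto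
  moreover have "\<tau>' div a s = C" using \<tau>' by (intro div_nat_eqI) (auto simp: algebra_simps)
  ultimately show ?thesis using s assms(2) \<tau>'(1) by (simp add: ok_def)
qed

text \<open>If a slot is occupied at tick \<open>\<tau>\<close> and its item is sustained by a single element \<open>z\<close>, born at
  tick \<open>v\<close>, then \<open>life p X v \<tau> z\<close> holds.\<close>

definition tot :: "(nat \<Rightarrow> nat) \<Rightarrow> nat \<Rightarrow> nat" where "tot X z = cnt X z 0 (N * a S * q)"

text \<open>The item is old enough for two tests of the current stage: \<open>v div a s + 3\<close>
  is the first cell tested, \<open>\<tau> div a s - 1\<close> the last one completed. The bound 6
  puts them at least two cells apart.\<close>

definition lifeA :: "(nat \<Rightarrow> nat \<Rightarrow> nat) \<Rightarrow> (nat \<Rightarrow> nat) \<Rightarrow> nat \<Rightarrow> nat \<Rightarrow> nat \<Rightarrow> nat \<Rightarrow> bool" where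
  "lifeA p X s v \<tau> z \<longleftrightarrow> v div a s + 6 \<le> \<tau> div a s \<and> \<tau> div a s < v div a s + D^2 \<and>
     dense X s (v div a s + 3) (p s (v div a s + 3)) z \<and> dense X s (\<tau> div a s - 1) (p s (\<tau> div a s - 1)) z"

text \<open>Shortly after entering stage \<open>s\<close> there are too few tests of that stage, and
  those of stage \<open>s - 1\<close> are used. The birth cell at stage \<open>s - 1\<close> is at
  most \<open>(v div a s + 1) * D - 1\<close> and tests start three cells later, whence the
  \<open>+ 2\<close>; the upper end is the end of stage \<open>s - 1\<close>.\<close>

definition lifeB :: "(nat \<Rightarrow> nat \<Rightarrow> nat) \<Rightarrow> (nat \<Rightarrow> nat) \<Rightarrow> nat \<Rightarrow> nat \<Rightarrow> nat \<Rightarrow> nat \<Rightarrow> bool" where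
  "lifeB p X s v \<tau> z \<longleftrightarrow> v div a s + 3 \<le> \<tau> div a s \<and> \<tau> div a s \<le> v div a s + 5 \<and>
     (\<forall>i\<in>{(v div a s + 1) * D + 2..<(v div a s + 3) * D}. dense X (s - 1) i (p (s - 1) i) z)"

text \<open>The 12 is 4 times 3: a quarter of the ticks of youth are hits, and the first disjunct
  serves ages up to three times the part of youth that has been checked.\<close>

definition life :: "(nat \<Rightarrow> nat \<Rightarrow> nat) \<Rightarrow> (nat \<Rightarrow> nat) \<Rightarrow> nat \<Rightarrow> nat \<Rightarrow> nat \<Rightarrow> bool" where
  "life p X v \<tau> z \<longleftrightarrow> (hit q X z v \<and> \<tau> - v \<le> 12 * tot X z) \<or> (\<exists>s\<in>{1..S}. lifeA p X s v \<tau> z) \<or>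
     (\<exists>s\<in>{2..S}. lifeB p X s v \<tau> z)"

definition occ :: "(nat \<Rightarrow> nat) \<Rightarrow> nat \<Rightarrow> nat set" where "occ X u = X ` {u * q..<(u + 3 * a 1) * q}"

definition imp0 :: "(nat \<Rightarrow> nat) \<Rightarrow> (nat \<Rightarrow> nat \<times> bool) \<Rightarrow> nat \<Rightarrow> nat \<Rightarrow> bool" where
  "imp0 X w u \<tau> \<longleftrightarrow> u < \<tau> \<and> \<tau> < u + 6 * a 1 \<and> (\<exists>y\<in>occ X u. \<exists>z\<in>occ X u. y \<noteq> z \<and> fst (w y) = fst (w z) \<and> fst (w y) div Lam = u)"

text \<open>The weakest frequency that a passed test certifies. The power is that of stage
  \<open>s - 1\<close>, so that the tests of both \<open>lifeA\<close> and \<open>lifeB\<close>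
  qualify; the window is cut off at the last cell.\<close>

definition big :: "(nat \<Rightarrow> nat) \<Rightarrow> nat \<Rightarrow> nat \<Rightarrow> nat set" where
  "big X s c = {z\<in>U. 3 * B * D ^ (s - 1) \<le> 2 * cnt X z (c * a s * q) (min ((c + D^2) * a s * q) (N * a S * q))}"

definition impS :: "(nat \<Rightarrow> nat) \<Rightarrow> (nat \<Rightarrow> nat \<times> bool) \<Rightarrow> nat \<Rightarrow> nat \<Rightarrow> nat \<Rightarrow> bool" where
  "impS X w s c \<tau> \<longleftrightarrow> c + 3 \<le> \<tau> div a s \<and> \<tau> div a s < c + D^2 \<and> (\<exists>z\<in>big X s c. \<exists>z'\<in>big X s c. z \<noteq> z' \<and>
     fst (w z) div D ^ s = fst (w z') div D ^ s \<and> fst (w z) div Lam div a s = c)"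

lemma dense_imp_cnt:
  assumes "dense X s C i z" "i < m" "lo \<le> C * a s * q" "Suc C * a s * q \<le> hi"
  shows "3 * B * D ^ s \<le> 2 * cnt X z lo hi"
proof -
  have "cnt X z (sbi s C i + B * (D ^ s * q)) (sbi s C i + 4 * B * (D ^ s * q)) \<le> cnt X z lo hi"
    using sbi_ge[of C s i] sbi_end[OF assms(2), of s C] assms(3,4) by (intro cnt_mono) auto
  then show ?thesis using assms(1) unfolding dense_def by linarith
qed

text \<open>Consider the tests that the item has passed. If the relevant ones were passed by one
  element, that element is charged; if two were passed by different elements, these share a label
  block and are both frequent, which is an imposture. In youth the same dichotomy holds for the full
  label.\<close>

lemma occupied_explained:
  assumes st: "st w p X \<tau> = Some l" and p: "\<And>s C. p s C < m" and XU: "\<And>t. X t \<in> U" and \<tau>: "\<tau> < Wb"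
  shows "(\<exists>z\<in>U. fst (w z) div Lam < \<tau> \<and> life p X (fst (w z) div Lam) \<tau> z) \<or> (\<exists>u. imp0 X w u \<tau>) \<or>
    (\<exists>s\<in>{1..S}. \<exists>c. impS X w s c \<tau>)"
proof -
  define u where "u = l div Lam"
  define s where "s = stg l \<tau>"
  have u: "u < \<tau>" "u < Wb" using st_tick[OF st] by (auto simp: u_def)
  obtain t0 where t0: "u * q \<le> t0" "t0 < Suc u * q" "fst (w (X t0)) = l"
    using st_alive[OF st] by (auto simp: u_def)
  define y where "y = X t0"
  have yU: "y \<in> U" and ly: "fst (w y) = l" using XU t0 by (auto simp: y_def)
  have hity: "hit q X y u" using t0 by (auto simp: hit_def y_def)
  have WbN: "Wb + 3 * a S \<le> N * a S"
  proof -
    have "(N - 1) * a S \<le> N * a S" by (intro mult_le_mono1) simp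
    then show ?thesis using Wb_cells by linarith
  qed
  have a1S: "a 1 \<le> a S" using S_pos by (intro a_mono)
  \<comment> \<open>\<open>k\<close> is the time for which the quarter rule is known to hold;
    \<open>\<tau> - u \<le> 3 * k\<close> lets it serve also during the first cells of stage
    1.\<close>
  have young: "\<exists>z\<in>U. fst (w z) div Lam < \<tau> \<and> life p X (fst (w z) div Lam) \<tau> z"
    if h: "k \<le> 4 * hits w l X u (u + k)" "\<tau> - u \<le> 3 * k" "k \<le> 3 * a 1" "\<tau> < u + 6 * a 1" and ni: "\<not> imp0 X w u \<tau>" for k
  proof -
    have only: "X t = y" if "t \<in> {u * q..<(u + k) * q}" "fst (w (X t)) = l" for t
    proof (rule ccontr)
      assume "X t \<noteq> y"
      have "(u + k) * q \<le> (u + 3 * a 1) * q" "Suc u * q \<le> (u + 3 * a 1) * q"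
        using h(3) a_pos[of 1] by (intro mult_le_mono1; linarith)+
      then have "t \<in> {u * q..<(u + 3 * a 1) * q}" "t0 \<in> {u * q..<(u + 3 * a 1) * q}"
        using that(1) t0 unfolding atLeastLessThan_iff by linarith+
      then have "X t \<in> occ X u" "y \<in> occ X u" unfolding occ_def y_def by blast+
      then show False using ni \<open>X t \<noteq> y\<close> that(2) ly u(1) h(4) by (auto simp: imp0_def u_def)
    qed
    have "{\<tau>'\<in>{u..<u+k}. \<exists>t\<in>{\<tau>' * q..<Suc \<tau>' * q}. fst (w (X t)) = l} \<subseteq> {\<tau>'\<in>{u..<u+k}. hit q X y \<tau>'}"
    proof safe
      fix \<tau>' t assume t: "\<tau>' \<in> {u..<u+k}" "t \<in> {\<tau>' * q..<Suc \<tau>' * q}" "l = fst (w (X t))"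
      have "u * q \<le> \<tau>' * q" "Suc \<tau>' * q \<le> (u + k) * q" using t(1) by (intro mult_le_mono1; auto)+
      then have "u * q \<le> t" "t < (u + k) * q" using t(2) unfolding atLeastLessThan_iff by linarith+
      then have "X t = y" using t by (intro only) auto
      then show "hit q X y \<tau>'" using t(2) by (auto simp: hit_def)
    qed
    then have "hits w l X u (u + k) \<le> card {\<tau>'\<in>{u..<u+k}. hit q X y \<tau>'}" unfolding hits_def by (intro card_mono) auto
    also have "\<dots> \<le> cnt X y (u * q) ((u + k) * q)" by (rule card_hit_le_cnt)
    also have "\<dots> \<le> tot X y" unfolding tot_def
    proof (rule cnt_mono)
      show "(u + k) * q \<le> N * a S * q" using h(3) u WbN a1S by (intro mult_le_mono1) linarith
    qed simp
    finally have "\<tau> - u \<le> 12 * tot X y" using h by linarith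
    then show ?thesis using yU ly u hity by (auto simp: life_def u_def)
  qed
  show ?thesis
  proof (cases "s = 0")
    case True
    have lt: "\<tau> < eend 0 l" using True stg_less[of l \<tau>] S_pos by (simp add: s_def)
    have "\<tau> - u \<le> 4 * hits w l X u (u + (\<tau> - u))"
    proof (cases "\<tau> = Suc u")
      case True
      \<comment> \<open>Right after the adoption no \<open>ok\<close> has been evaluated, and the
        adoption itself supplies the hit.\<close>
      have "u \<in> {\<tau>'\<in>{u..<u + (\<tau> - u)}. \<exists>t\<in>{\<tau>' * q..<Suc \<tau>' * q}. fst (w (X t)) = l}" using t0 u by auto
      then have "hits w l X u (u + (\<tau> - u)) \<noteq> 0" unfolding hits_def by (auto simp: card_eq_0_iff)
      then show ?thesis using True by simp
    next
      case False
      then have "u < \<tau> - 1" using u by simp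
      then have "ok w p X l (\<tau> - 1)" using st_alive[OF st] u by (auto simp: u_def)
      moreover have "stg l (\<tau> - 1) = 0" using lt by (intro stg_eqI) auto
      ultimately show ?thesis using u by (simp add: ok_def u_def)
    qed
    moreover have "\<tau> - u \<le> 3 * a 1" "\<tau> < u + 6 * a 1"
      using lt eend_le[of 0 l] a_pos[of 1] by (auto simp: u_def simp del: a_pos)
    ultimately show ?thesis using young[of "\<tau> - u"] by auto
  next
    case False
    then have s1: "1 \<le> s" "s \<le> S" using stg_le by (auto simp: s_def)
    define c where "c = u div a s"
    define C where "C = \<tau> div a s"
    have ge: "eend (s - 1) l \<le> \<tau>" using stg_ge[of "s - 1" l \<tau>] s1 by (simp add: s_def)
    have cC: "c + 3 \<le> C"
      using ge unfolding eend_pred[OF s1(1)] C_def c_def u_def by (simp add: less_eq_div_iff_mult_less_eq)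
    have Ca: "C * a s \<le> \<tau>" by (simp add: C_def)
    have lt: "s < S \<Longrightarrow> \<tau> < eend s l" using stg_less[of l \<tau>] by (simp add: s_def)
    have D3: "3 * D \<le> D^2" using D_ge by (simp add: power2_eq_square)
    have CD: "C < c + D^2"
    proof (cases "s < S")
      case True
      have "u div a (Suc s) * D \<le> c" by (simp add: a_Suc c_def mult.commute[of D] div_mult2_eq)
      have "\<tau> < (u div a (Suc s) + 3) * D * a s" using lt[OF True] by (simp add: eend_tick u_def a_Suc mult.assoc)
      then have "C < (u div a (Suc s) + 3) * D" by (simp add: C_def less_mult_imp_div_less)
      also have "\<dots> \<le> c + 3 * D" using \<open>u div a (Suc s) * D \<le> c\<close> by (simp add: algebra_simps)
      finally show ?thesis using D3 by simp
    next
      case False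
      then have "s = S" using s1 by simp
      have "\<tau> < N * a S" using \<tau> WbN by simp
      then have "C < N" using \<open>s = S\<close> by (simp add: C_def less_mult_imp_div_less)
      then show ?thesis using N_le by simp
    qed
    have blk: "fst (w z) div Lam div a s = c" if "fst (w z) div D ^ s = l div D ^ s" for z
      using that by (simp add: cell_of_block c_def u_def)
    have impI: "\<exists>s\<in>{1..S}. \<exists>c. impS X w s c \<tau>"
      if "z \<in> U" "z' \<in> U" "z \<noteq> z'" "fst (w z) div D ^ s = l div D ^ s" "fst (w z') div D ^ s = l div D ^ s"
        "3 * B * D ^ (s - 1) \<le> 2 * cnt X z (c * a s * q) (min ((c + D^2) * a s * q) (N * a S * q))"
        "3 * B * D ^ (s - 1) \<le> 2 * cnt X z' (c * a s * q) (min ((c + D^2) * a s * q) (N * a S * q))" for z z'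
    proof -
      have "z \<in> big X s c" "z' \<in> big X s c" using that by (simp_all add: big_def)
      moreover have "fst (w z) div D ^ s = fst (w z') div D ^ s" using that by simp
      ultimately have "impS X w s c \<tau>" unfolding impS_def C_def[symmetric] using cC CD that(3) blk[OF that(4)] by blast
      then show ?thesis using s1 by auto
    qed
    show ?thesis
    proof (cases "c + 6 \<le> C")
      case True
      have pre: "Suc i * a s \<le> \<tau> \<and> (s < S \<longrightarrow> Suc i * a s \<le> eend s l)" if "i < C" for i
      proof -
        have "Suc i * a s \<le> C * a s" using that by (intro mult_le_mono1) simp
        then show ?thesis using Ca lt by auto
      qed
      have ps: "\<exists>z. tst w p X s i (l div D ^ s) z" if "c + 3 \<le> i" "i < C" for i
        by (rule passed[OF st s1]) (use that pre[OF that(2)] in \<open>auto simp: c_def u_def\<close>)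
      obtain z0 where z0: "tst w p X s (c + 3) (l div D ^ s) z0" using ps[of "c + 3"] True by auto
      have "c + 3 \<le> C - 1" "C - 1 < C" using True by linarith+
      then obtain z1 where z1: "tst w p X s (C - 1) (l div D ^ s) z1" using ps by blast
      show ?thesis
      proof (cases "z0 = z1")
        case eq: True
        have "lifeA p X s (fst (w z0) div Lam) \<tau> z0"
          unfolding lifeA_def using z0 z1 eq blk[of z0] True CD by (auto simp: tst_def C_def)
        moreover have "fst (w z0) div Lam < \<tau>"
        proof -
          have "fst (w z0) div Lam div a s < \<tau> div a s" using blk[of z0] z0 True by (auto simp: tst_def C_def)
          then show ?thesis by (metis div_le_mono leD not_le)
        qed
        ultimately show ?thesis using s1 z0 by (auto simp: life_def tst_def)
      next
        case False
        have pw: "D ^ (s - 1) \<le> D ^ s" using D_ge by (intro power_increasing) auto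
        have lo: "3 * B * D ^ (s - 1) \<le> 2 * cnt X z (c * a s * q) (min ((c + D^2) * a s * q) (N * a S * q))"
          if "dense X s i (p s i) z" "c \<le> i" "i < C" for i z
        proof -
          have "3 * B * D ^ (s - 1) \<le> 3 * B * D ^ s" using pw by simp
          also have "\<dots> \<le> 2 * cnt X z (c * a s * q) (min ((c + D^2) * a s * q) (N * a S * q))"
          proof (rule dense_imp_cnt[OF that(1) p])
            show "c * a s * q \<le> i * a s * q" using that by (intro mult_le_mono1) auto
            have "Suc i * a s \<le> N * a S" using pre[OF that(3)] \<tau> WbN by linarith
            moreover have "Suc i * a s \<le> (c + D^2) * a s" using that CD by (intro mult_le_mono1) auto
            ultimately show "Suc i * a s * q \<le> min ((c + D^2) * a s * q) (N * a S * q)" by (simp only: min.bounded_iff mult_le_mono1 simp_thms)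
          qed
          finally show ?thesis .
        qed
        show ?thesis using impI[of z0 z1] lo[of "c + 3" z0] lo[of "C - 1" z1] z0 z1 False True by (auto simp: tst_def)
      qed
    next
      case False
      then have C5: "C \<le> c + 5" by simp
      have uc: "c * a s \<le> u" by (simp add: c_def)
      have uc2: "u < Suc c * a s" using dividend_less_div_times[of "a s" u] by (simp add: c_def)
      have \<tau>c: "\<tau> < Suc C * a s" using dividend_less_div_times[of "a s" \<tau>] by (simp add: C_def)
      show ?thesis
      proof (cases "s = 1")
        case True
        \<comment> \<open>Early in stage 1 the preceding stage is youth, which has no tests. Its
          quarter rule at the end \<open>e\<close> is used instead: \<open>e\<close> is more than
          \<open>2 * a 1\<close> ticks after birth, and the age is below
          \<open>6 * a 1\<close>.\<close>
        define e where "e = eend 0 l"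
        have e: "u + 2 * a 1 < e" "e \<le> u + 3 * a 1" "e \<le> \<tau>"
          using eend_gt[of l 0] eend_le[of 0 l] ge True by (auto simp: e_def u_def)
        then have "u < e - 1" "e - 1 < \<tau>" using a_pos[of 1] by linarith+
        then have "ok w p X l (e - 1)" using st_alive[OF st] by (auto simp: u_def)
        moreover have "stg l (e - 1) = 0" using e by (intro stg_eqI) (auto simp: e_def)
        ultimately have "e - u \<le> 4 * hits w l X u e" using e by (simp add: ok_def u_def)
        then have k: "e - u \<le> 4 * hits w l X u (u + (e - u))" using e by simp
        have "Suc C * a s \<le> (c + 6) * a s" using C5 by (intro mult_le_mono1) simp
        then have "\<tau> < u + 6 * a 1" using \<tau>c uc True by (simp add: algebra_simps)
        then show ?thesis using young[OF k] e by fastforce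
      next
        case False
        define s' where "s' = s - 1"
        have s': "1 \<le> s'" "s' \<le> S" "s' < S" "s = Suc s'" using s1 False by (auto simp: s'_def)
        have aD: "a s = D * a s'" by (simp add: s'(4) a_Suc)
        have "\<exists>z. tst w p X s' i (l div D ^ s') z" if i: "i \<in> {(c + 1) * D + 2..<(c + 3) * D}" for i
        proof (rule passed[OF st s'(1,2)])
          have "u < (c + 1) * D * a s'" using uc2 aD by (simp add: algebra_simps)
          then have "u div a s' < (c + 1) * D" by (simp add: less_mult_imp_div_less)
          then show "l div Lam div a s' + 3 \<le> i" using i by (simp add: u_def)
          have le: "Suc i * a s' \<le> (c + 3) * D * a s'" using i by (intro mult_le_mono1) auto
          also have eq: "(c + 3) * D * a s' = eend s' l" using eend_pred[OF s1(1), of l] aD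
            by (simp add: s'(4) c_def u_def mult.assoc a_Suc)
          finally show "Suc i * a s' \<le> eend s' l" .
          then show "Suc i * a s' \<le> \<tau>" using ge by (simp add: s'_def)
        qed
        then obtain Z where Z: "\<And>i. i \<in> {(c + 1) * D + 2..<(c + 3) * D} \<Longrightarrow> tst w p X s' i (l div D ^ s') (Z i)" by metis
        define i0 where "i0 = (c + 1) * D + 2"
        have i0: "i0 \<in> {(c + 1) * D + 2..<(c + 3) * D}" using D_ge by (simp add: i0_def algebra_simps)
        have blkZ: "fst (w (Z i)) div D ^ s = l div D ^ s" if "i \<in> {(c + 1) * D + 2..<(c + 3) * D}" for i
          using Z[OF that] block_mono[of "fst (w (Z i))" s' l s] s' by (auto simp: tst_def)
        show ?thesis
        proof (cases "\<forall>i\<in>{(c + 1) * D + 2..<(c + 3) * D}. Z i = Z i0")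
          case True
          have b: "fst (w (Z i0)) div Lam div a s = c" using blk[OF blkZ[OF i0]] .
          have "lifeB p X s (fst (w (Z i0)) div Lam) \<tau> (Z i0)"
            unfolding lifeB_def b C_def[symmetric] s'_def[symmetric] using Z True C5 cC unfolding tst_def by auto
          moreover have "fst (w (Z i0)) div Lam < \<tau>"
          proof -
            have "fst (w (Z i0)) div Lam div a s < \<tau> div a s" using b cC by (simp add: C_def)
            then show ?thesis by (metis div_le_mono leD not_le)
          qed
          moreover have "Z i0 \<in> U" using Z[OF i0] by (auto simp: tst_def)
          moreover have "s \<in> {2..S}" using s1 False by auto
          ultimately show ?thesis unfolding life_def by blast
        next
          case False
          then obtain i1 where i1: "i1 \<in> {(c + 1) * D + 2..<(c + 3) * D}" "Z i1 \<noteq> Z i0" by blast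
          have lo: "3 * B * D ^ (s - 1) \<le> 2 * cnt X (Z i) (c * a s * q) (min ((c + D^2) * a s * q) (N * a S * q))"
            if i: "i \<in> {(c + 1) * D + 2..<(c + 3) * D}" for i
            unfolding s'_def[symmetric]
          proof (rule dense_imp_cnt)
            show "dense X s' i (p s' i) (Z i)" using Z[OF i] by (simp add: tst_def)
            have "c * D \<le> i" using i by (simp add: algebra_simps)
            then have "c * D * a s' \<le> i * a s'" by (rule mult_le_mono1)
            then show "c * a s * q \<le> i * a s' * q" using aD by (intro mult_le_mono1) (simp add: mult.assoc)
            have "Suc i \<le> (c + 3) * D" using i by simp
            also have "\<dots> \<le> (c + D^2) * D" using D3 D_ge by (intro mult_le_mono1) simp
            finally have "Suc i * a s' \<le> (c + D^2) * D * a s'" by (rule mult_le_mono1)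
            then have "Suc i * a s' \<le> (c + D^2) * a s" using aD by (simp add: mult.assoc)
            moreover have "Suc i * a s' \<le> N * a S"
            proof -
              have "Suc i * a s' \<le> (c + 3) * D * a s'" using i by (intro mult_le_mono1) auto
              also have "\<dots> = eend (s - 1) l" using eend_pred[OF s1(1), of l] aD by (simp add: c_def u_def mult.assoc)
              finally show ?thesis using ge \<tau> WbN by linarith
            qed
            ultimately show "Suc i * a s' * q \<le> min ((c + D^2) * a s * q) (N * a S * q)" by (simp only: min.bounded_iff mult_le_mono1 simp_thms)
          qed (rule p)
          show ?thesis
            using impI[of "Z i1" "Z i0"] blkZ[OF i0] blkZ[OF i1(1)] lo[OF i0] lo[OF i1(1)] Z[OF i0] Z[OF i1(1)] i1(2)
            by (auto simp: tst_def)
        qed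
      qed
    qed
  qed
qed

section \<open>Survival of heavy elements and soundness of the output\<close>

definition noise :: "(nat \<Rightarrow> nat \<times> bool) \<Rightarrow> (nat \<Rightarrow> nat \<Rightarrow> nat) \<Rightarrow> (nat \<Rightarrow> nat) \<Rightarrow> nat \<Rightarrow> nat \<Rightarrow> nat \<Rightarrow> nat \<Rightarrow> nat \<Rightarrow> int" where
  "noise w p X x s C \<beta> b = (let b0 = sbi s C (p s C) in
     \<Sum>t\<in>{b0 + b * (D ^ s * q)..<b0 + Suc b * (D ^ s * q)}. if X t \<noteq> x \<and> fst (w (X t)) div D ^ s = \<beta> \<and> bitf (X t) b
      then (if snd (w (X t)) then 1 else - 1) else 0)"

lemma regular_cnt:
  assumes "regular q D W X x" "(i + k) * D \<le> W"
  shows "k * D \<le> 2 * cnt X x (i * D * q) ((i + k) * D * q)"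
proof -
  have "k * D \<le> 2 * card {\<tau>\<in>{i * D..<(i + k) * D}. hit q X x \<tau>}"
    using assms(2)
  proof (induction k)
    case (Suc k)
    have "(i + k) * D \<le> (i + Suc k) * D" by (intro mult_le_mono1) simp
    then have IH: "k * D \<le> 2 * card {\<tau>\<in>{i * D..<(i + k) * D}. hit q X x \<tau>}" using Suc by linarith
    have "D \<le> 2 * card {\<tau>\<in>{(i + k) * D..<Suc (i + k) * D}. hit q X x \<tau>}"
      using assms(1) Suc.prems by (simp add: regular_def)
    moreover have "{\<tau>\<in>{i * D..<(i + Suc k) * D}. hit q X x \<tau>} =
       {\<tau>\<in>{i * D..<(i + k) * D}. hit q X x \<tau>} \<union> {\<tau>\<in>{(i + k) * D..<Suc (i + k) * D}. hit q X x \<tau>}"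
      by (auto simp: algebra_simps)
    moreover have "card ({\<tau>\<in>{i * D..<(i + k) * D}. hit q X x \<tau>} \<union> {\<tau>\<in>{(i + k) * D..<Suc (i + k) * D}. hit q X x \<tau>}) =
       card {\<tau>\<in>{i * D..<(i + k) * D}. hit q X x \<tau>} + card {\<tau>\<in>{(i + k) * D..<Suc (i + k) * D}. hit q X x \<tau>}"
      by (intro card_Un_disjoint) auto
    ultimately show ?case using IH by simp
  qed simp
  also have "\<dots> \<le> 2 * cnt X x (i * D * q) ((i + k) * D * q)" by (intro mult_le_mono2 card_hit_le_cnt)
  finally show ?thesis .
qed

text \<open>In each part \<open>x\<close> adds at least half of \<open>D ^ s\<close> with one fixed
  sign if its bit is set, and nothing otherwise. Noise below a quarter of \<open>D ^ s\<close>
  cannot move the sum across the threshold, and regularity gives the density directly.\<close>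

lemma heavy_passes:
  assumes reg: "regular q D (N * a S) X x" and s: "1 \<le> s" and C: "Suc C * a s \<le> N * a S" and p: "\<And>s C. p s C < m"
    and x: "x \<in> U" and no: "\<And>b. b < B \<Longrightarrow> 4 * \<bar>noise w p X x s C (fst (w x) div D ^ s) b\<bar> < int (D ^ s)"
  shows "tst w p X s C (fst (w x) div D ^ s) x"
proof -
  define b0 where "b0 = C * a s + p s C * (4 * B * D ^ s)"
  have b0q: "sbi s C (p s C) = b0 * q" by (simp add: sbi_def b0_def)
  \<comment> \<open>A subblock starts at a multiple of \<open>D ^ s\<close> ticks. As
    \<open>s \<ge> 1\<close>, its parts are unions of the blocks of \<open>D\<close> ticks that
    \<open>regular\<close> speaks of.\<close>
  define g where "g = C * (4 * B * m) + p s C * (4 * B)"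
  have b0g: "b0 = g * D ^ s" by (simp add: b0_def g_def a_def algebra_simps)
  have fits: "b0 + 4 * B * D ^ s \<le> N * a S"
  proof -
    have "b0 * q + 4 * B * (D ^ s * q) \<le> Suc C * a s * q" using sbi_end[OF p, of s C s C] b0q by simp
    then have "(b0 + 4 * B * D ^ s) * q \<le> Suc C * a s * q" by (simp add: algebra_simps)
    then show ?thesis using q_pos C by (simp add: mult_le_cancel2)
  qed
  have part: "k * D ^ s \<le> 2 * cnt X x ((b0 + i * D ^ s) * q) ((b0 + (i + k) * D ^ s) * q)" if "i + k \<le> 4 * B" for i k
  proof -
    obtain r where r: "s = Suc r" using s by (cases s) auto
    have e1: "b0 + j * D ^ s = ((g + j) * D ^ r) * D" for j by (simp add: b0g r algebra_simps)
    have "(i + k) * D ^ s \<le> 4 * B * D ^ s" using that by (rule mult_le_mono1)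
    then have "b0 + (i + k) * D ^ s \<le> N * a S" using fits by linarith
    then have "(((g + i) * D ^ r) + k * D ^ r) * D \<le> N * a S" unfolding e1 by (simp add: algebra_simps)
    from regular_cnt[OF reg this] show ?thesis unfolding e1 by (simp add: r algebra_simps)
  qed
  have "dense X s C (p s C) x"
    using part[of B "3 * B"] unfolding dense_def b0q by (simp add: algebra_simps)
  moreover have "bitf x b \<longleftrightarrow> b \<in> bits w (sbi s C (p s C)) s (fst (w x) div D ^ s) X" if b: "b < B" for b
  proof -
    define I where "I = {b0 * q + b * (D ^ s * q)..<b0 * q + Suc b * (D ^ s * q)}"
    define \<beta> where "\<beta> = fst (w x) div D ^ s"
    define sg where "sg = (if snd (w x) then 1 else - 1 :: int)"
    define Zv where "Zv = Zs w s \<beta> b X (b0 * q + b * (D ^ s * q)) (b0 * q + Suc b * (D ^ s * q))"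
    define nv where "nv = noise w p X x s C \<beta> b"
    have "Zv = nv + (\<Sum>t\<in>I. if X t = x \<and> bitf x b then sg else 0)"
      unfolding Zv_def nv_def Zs_def noise_def Let_def b0q I_def[symmetric] sum.distrib[symmetric]
      by (intro sum.cong) (auto simp: \<beta>_def sg_def)
    also have "(\<Sum>t\<in>I. if X t = x \<and> bitf x b then sg else 0) = (if bitf x b then sg * int (card {t\<in>I. X t = x}) else 0)"
      by (simp add: sum.If_cases I_def Int_def)
    also have "card {t\<in>I. X t = x} = cnt X x ((b0 + b * D ^ s) * q) ((b0 + (b + 1) * D ^ s) * q)"
      by (simp add: cnt_def I_def algebra_simps)
    finally have Zv: "Zv = nv + (if bitf x b then sg * int (cnt X x ((b0 + b * D ^ s) * q) ((b0 + (b + 1) * D ^ s) * q)) else 0)" .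
    have c: "int (D ^ s) \<le> 2 * int (cnt X x ((b0 + b * D ^ s) * q) ((b0 + (b + 1) * D ^ s) * q))"
    proof -
      have "D ^ s \<le> 2 * cnt X x ((b0 + b * D ^ s) * q) ((b0 + (b + 1) * D ^ s) * q)" using part[of b 1] b by simp
      then show ?thesis using of_nat_mono[of "D ^ s" _, where 'a = int] by (metis of_nat_mult of_nat_numeral)
    qed
    have n: "4 * \<bar>nv\<bar> < int (D ^ s)" using no[OF b] by (simp add: nv_def \<beta>_def)
    have "bitf x b \<longleftrightarrow> int (D ^ s) \<le> 4 * \<bar>Zv\<bar>"
    proof (cases "bitf x b")
      case True
      then show ?thesis using Zv c n by (cases "snd (w x)") (auto simp: sg_def)
    next
      case False then show ?thesis using Zv n by auto
    qed
    then show ?thesis using b by (simp add: bits_def b0q Zv_def \<beta>_def)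
  qed
  ultimately show ?thesis using x by (auto simp: tst_def matches_def)
qed

text \<open>A superset of the cells of stage \<open>s\<close> in which an item born at
  \<open>u\<close> is tested. It depends on the tick and not on the label, which suits the union
  bound over noise events.\<close>

definition path :: "nat \<Rightarrow> nat \<Rightarrow> nat set" where
  "path s u = {C. u div a s + 3 \<le> C \<and> C < u div a s + D^2 \<and> Suc C * a s \<le> N * a S}"

text \<open>\<open>comp\<close> makes the slot adopt the label of \<open>x\<close> and no other,
  \<open>good\<close> carries it through stage 0, and the noise bounds carry it through all later
  tests, including the one in the final cell.\<close>

lemma heavy_survives:
  assumes reg: "regular q D (N * a S) X x" and p: "\<And>s C. p s C < m" and x: "x \<in> U"
    and u: "u = fst (w x) div Lam" "u < Wb"
    and free: "st w p X u = None" and hit: "hit q X x u"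
    and comp: "\<And>y. hit q X y u \<Longrightarrow> fst (w y) div Lam = u \<Longrightarrow> y = x"
    and good: "\<And>k. 1 \<le> k \<Longrightarrow> k \<le> 3 * a 1 \<Longrightarrow> k \<le> 4 * card {i\<in>{u..<u+k}. hit q X x i}"
    and no: "\<And>s C b. 1 \<le> s \<Longrightarrow> s \<le> S \<Longrightarrow> C \<in> path s u \<Longrightarrow> b < B \<Longrightarrow>
       4 * \<bar>noise w p X x s C (fst (w x) div D ^ s) b\<bar> < int (D ^ s)"
  shows "st w p X ((N - 1) * a S) = Some (fst (w x))" "tst w p X S (N - 1) (fst (w x) div D ^ S) x"
proof -
  define l where "l = fst (w x)"
  have u': "l div Lam = u" using u by (simp add: l_def)
  note Wa = Wb_cells
  have "N \<noteq> 0" using N_pos by simp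
  then have N1: "Suc (N - 1) * a S = N * a S" by simp
  have fl: "firstlab w X u (Suc u * q) = Some l"
  proof (cases "firstlab w X u (Suc u * q)")
    case None
    then show ?thesis using hit u unfolding firstlab_None hit_def by auto
  next
    case (Some l')
    from firstlab_Some[OF this] obtain t where t: "t \<in> {u * q..<Suc u * q}" "fst (w (X t)) = l'" "l' div Lam = u" by auto
    then have "hit q X (X t) u" by (auto simp: hit_def)
    then have "X t = x" using comp t by auto
    then show ?thesis using t Some by (simp add: l_def)
  qed
  have D3: "3 * D \<le> D^2" using D_ge by (simp add: power2_eq_square)
  have okl: "ok w p X l \<tau>" if \<tau>: "u < \<tau>" "\<tau> < N * a S" for \<tau>
  proof (cases "stg l \<tau> = 0")
    case True
    have "\<tau> < eend 0 l" using True stg_less[of l \<tau>] S_pos by simp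
    then have k: "Suc \<tau> - u \<le> 3 * a 1" "1 \<le> Suc \<tau> - u" using eend_le[of 0 l] u' \<tau> by auto
    have "{i\<in>{u..<u + (Suc \<tau> - u)}. hit q X x i} \<subseteq> {\<tau>'\<in>{u..<Suc \<tau>}. \<exists>t\<in>{\<tau>' * q..<Suc \<tau>' * q}. fst (w (X t)) = l}"
      unfolding hit_def l_def using \<tau> by fastforce
    then have "card {i\<in>{u..<u + (Suc \<tau> - u)}. hit q X x i} \<le> hits w l X u (Suc \<tau>)" unfolding hits_def by (intro card_mono) auto
    then show ?thesis using good[OF k(2,1)] True by (simp add: ok_def u')
  next
    case False
    define s where "s = stg l \<tau>"
    have s: "1 \<le> s" "s \<le> S" using False stg_le by (auto simp: s_def)
    define C where "C = \<tau> div a s"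
    have "tst w p X s C (l div D ^ s) x" if d: "a s dvd Suc \<tau>"
    proof -
      have eq: "Suc \<tau> = Suc C * a s" unfolding C_def using d by (metis dvd_div_mult_self div_Suc mod_eq_0_iff_dvd)
      have "a s dvd N * a S" using s by (auto simp: a_def le_imp_power_dvd)
      have fit: "Suc C * a s \<le> N * a S" using eq \<tau> by simp
      have "eend (s - 1) l \<le> \<tau>" using stg_ge[of "s - 1" l \<tau>] s by (simp add: s_def)
      then have lo: "u div a s + 3 \<le> C"
        unfolding eend_pred[OF s(1)] u' C_def by (simp add: less_eq_div_iff_mult_less_eq)
      have hi: "C < u div a s + D^2"
      proof (cases "s < S")
        case True
        have "\<tau> < (u div a (Suc s) + 3) * D * a s" using stg_less[of l \<tau>] True
          by (simp add: s_def[symmetric] eend_tick u' a_Suc mult.assoc)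
        then have "C < (u div a (Suc s) + 3) * D" by (simp add: C_def less_mult_imp_div_less)
        also have "\<dots> \<le> u div a s + 3 * D"
        proof -
          have "u div a (Suc s) * D \<le> u div a s" by (simp add: a_Suc mult.commute[of D] div_mult2_eq)
          then show ?thesis by (simp add: algebra_simps)
        qed
        finally show ?thesis using D3 by simp
      next
        case False
        then have "s = S" using s by simp
        then have "C < N" using \<tau> by (simp add: C_def less_mult_imp_div_less)
        then show ?thesis using N_le by simp
      qed
      have "C \<in> path s u" using lo hi fit by (simp add: path_def)
      then show ?thesis unfolding l_def using no s by (intro heavy_passes[OF reg s(1) fit p x]) auto
    qed
    then show ?thesis using s by (auto simp: ok_def s_def[symmetric] C_def)
  qed
  have "u < (N - 1) * a S" using u Wa by simp
  then show "st w p X ((N - 1) * a S) = Some (fst (w x))"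
    using N1 unfolding l_def[symmetric] by (intro st_persist[OF free u(2) fl okl]) auto
  have c: "u div a S + 3 \<le> N - 1"
  proof -
    have "u + 3 * a S \<le> (N - 1) * a S" using u Wa by simp
    then have "(u + 3 * a S) div a S \<le> (N - 1) * a S div a S" by (rule div_le_mono)
    then show ?thesis by simp
  qed
  have "N - 1 \<in> path S u" unfolding path_def mem_Collect_eq N1 using c N_le N_pos by auto
  then show "tst w p X S (N - 1) (fst (w x) div D ^ S) x"
    using N1 no S_pos by (intro heavy_passes[OF reg S_pos _ p x]) auto
qed

text \<open>From cell \<open>C0\<close> on every item is tested at stage \<open>S\<close>. Either
  \<open>y\<close> passed all these tests, or some other \<open>z\<close> with the same prefix
  passed one, and then both are frequent.\<close>

lemma output_sound:
  assumes st: "st w p X ((N - 1) * a S) = Some l" and t: "tst w p X S (N - 1) (l div D ^ S) y" and p: "\<And>s C. p s C < m"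
    and C0: "Wb + 3 * a S \<le> C0 * a S"
  shows "(\<forall>C\<in>{C0..<N}. dense X S C (p S C) y) \<or>
    (\<exists>z\<in>U. z \<noteq> y \<and> fst (w z) div D ^ S = fst (w y) div D ^ S \<and> 3 * B * D ^ S \<le> 2 * tot X z \<and> 3 * B * D ^ S \<le> 2 * tot X y)"
proof -
  have big: "3 * B * D ^ S \<le> 2 * tot X z" if "dense X S C (p S C) z" "C < N" for C z
    unfolding tot_def using that p by (intro dense_imp_cnt[OF that(1)] mult_le_mono1) auto
  have "N \<noteq> 0" using N_pos by simp
  have y: "dense X S (N - 1) (p S (N - 1)) y" "fst (w y) div D ^ S = l div D ^ S" using t by (auto simp: tst_def)
  have u: "l div Lam < Wb" using st_tick[OF st] by simp
  have ex: "\<exists>z. tst w p X S C (l div D ^ S) z" if "C \<in> {C0..<N - 1}" for C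
  proof (rule passed[OF st S_pos order_refl])
    have "(l div Lam + 3 * a S) div a S \<le> C0 * a S div a S" using u C0 by (intro div_le_mono) simp
    then show "l div Lam div a S + 3 \<le> C" using that by simp
    show "Suc C * a S \<le> (N - 1) * a S" using that by (intro mult_le_mono1) auto
  qed simp
  show ?thesis
  proof (cases "\<forall>C\<in>{C0..<N}. dense X S C (p S C) y")
    case False
    then obtain C where C: "C \<in> {C0..<N}" "\<not> dense X S C (p S C) y" by blast
    then have "C \<noteq> N - 1" using y by auto
    then obtain z where z: "tst w p X S C (l div D ^ S) z" using ex[of C] C(1) by fastforce
    then have "z \<noteq> y" using C by (auto simp: tst_def)
    then show ?thesis using z y big[of C z] big[of "N - 1" y] C \<open>N \<noteq> 0\<close> by (auto simp: tst_def)
  qed blast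
qed

end

section \<open>Counting memory states\<close>

text \<open>A set of at most \<open>c\<close> elements is the set of letters of a word of length
  \<open>c\<close>, padded with a letter outside \<open>U\<close>.\<close>

lemma card_small_subsets:
  fixes U :: "nat set"
  assumes "finite U"
  shows "finite {T. T \<subseteq> U \<and> card T \<le> c}" "card {T. T \<subseteq> U \<and> card T \<le> c} \<le> (card U + 1) ^ c"
proof -
  show "finite {T. T \<subseteq> U \<and> card T \<le> c}" by (rule finite_subset[of _ "Pow U"]) (use assms in auto)
  obtain z where z: "z \<notin> U" using assms ex_new_if_finite[OF infinite_UNIV_nat] by blast
  have "{T. T \<subseteq> U \<and> card T \<le> c} \<subseteq> (\<lambda>xs. set xs \<inter> U) ` {xs. set xs \<subseteq> insert z U \<and> length xs = c}"
  proof
    fix T assume T: "T \<in> {T. T \<subseteq> U \<and> card T \<le> c}"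
    then have "finite T" using assms finite_subset by auto
    then obtain ys where ys: "set ys = T" "distinct ys" using finite_distinct_list by blast
    define xs where "xs = ys @ replicate (c - length ys) z"
    have "length ys \<le> c" using T ys distinct_card[of ys] by auto
    then have "length xs = c" by (simp add: xs_def)
    moreover have "set xs \<subseteq> insert z U" using T ys by (auto simp: xs_def)
    moreover have "set xs \<inter> U = T" using T ys z by (auto simp: xs_def)
    ultimately show "T \<in> (\<lambda>xs. set xs \<inter> U) ` {xs. set xs \<subseteq> insert z U \<and> length xs = c}" by (auto intro!: rev_image_eqI)
  qed
  then have "card {T. T \<subseteq> U \<and> card T \<le> c} \<le> card {xs. set xs \<subseteq> insert z U \<and> length xs = c}"
    using assms by (intro surj_card_le) (auto intro: finite_lists_length_eq)
  also have "\<dots> = (card U + 1) ^ c" using assms z by (subst card_lists_length_eq) auto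
  finally show "card {T. T \<subseteq> U \<and> card T \<le> c} \<le> (card U + 1) ^ c" .
qed

context slots2
begin

text \<open>Strictly inside the last cell there are no adoptions, stage changes or verdicts. So the
  state at its start can be read off the slot memory at whatever time the final test ends.\<close>

lemma st_last_cell:
  assumes "(N - 1) * a S \<le> \<tau>" "\<tau> < N * a S"
  shows "st w p X \<tau> = st w p X ((N - 1) * a S)"
    and "st w p X \<tau> = Some l \<Longrightarrow> stg l \<tau> = S"
proof -
  have N1: "Suc (N - 1) = N" using N_pos by simp
  have stg: "stg l \<tau> = S" if "st w p X \<tau>' = Some l" "(N - 1) * a S \<le> \<tau>" "\<tau> < N * a S" for l \<tau> \<tau>'
  proof (rule stg_in_cell[OF S_pos order_refl, of l "N - 1"])
    have "l div Lam + 3 * a S \<le> (N - 1) * a S" using st_tick[OF that(1)] Wb_cells by linarith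
    then have "(l div Lam + 3 * a S) div a S \<le> (N - 1) * a S div a S" by (rule div_le_mono)
    then show "l div Lam div a S + 3 \<le> N - 1" by simp
  qed (use that N1 in auto)
  show "st w p X \<tau> = Some l \<Longrightarrow> stg l \<tau> = S" using stg assms by blast
  show "st w p X \<tau> = st w p X ((N - 1) * a S)"
    using assms
  proof (induction \<tau> rule: dec_induct)
    case (step \<tau>)
    have IH: "st w p X \<tau> = st w p X ((N - 1) * a S)" using step by simp
    show ?case
    proof (cases "st w p X \<tau>")
      case None
      have "\<not> \<tau> < Wb" using step Wb_cells by linarith
      then show ?thesis using None IH by simp
    next
      case (Some l)
      have "\<not> a S dvd Suc \<tau>"
      proof
        assume "a S dvd Suc \<tau>"
        then obtain k where k: "Suc \<tau> = k * a S" by (metis dvd_def mult.commute)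
        have "N - 1 < k" "k < N" using k step by (metis le_imp_less_Suc mult_less_cancel2)+
        then show False by simp
      qed
      then have "ok w p X l \<tau>" using stg[OF Some, of \<tau>] step S_pos by (simp add: ok_def)
      then show ?thesis using Some IH by simp
    qed
  qed simp
qed

section \<open>The joint memory of all slots\<close>

context
  fixes w :: "nat \<Rightarrow> nat \<Rightarrow> nat \<times> bool" and th :: "nat \<Rightarrow> nat \<Rightarrow> nat" and n cap :: nat
  assumes finU: "finite U"
begin

text \<open>All slots share one shift per cell and stage. The turns of different slots are thus
  distinct, and yet the turn of each single slot is uniform when the shift is.\<close>

definition prm :: "nat \<Rightarrow> nat \<Rightarrow> nat \<Rightarrow> nat" where "prm j s C = (j + th s C) mod m"

definition outs :: "(nat \<Rightarrow> nat) \<Rightarrow> nat \<Rightarrow> nat set" where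
  "outs X t = {y. \<exists>j<m. \<exists>l. st (w j) (prm j) X ((N - 1) * a S) = Some l \<and>
     tst (w j) (prm j) X S (N - 1) (l div D ^ S) y \<and> sbi S (N - 1) (prm j S (N - 1)) + 4 * B * (D ^ S * q) \<le> t}"

text \<open>The output grows during the last cell as the slots finish their final tests. Replacing
  an output of more than \<open>cap\<close> elements by \<open>None\<close> bounds the number of
  states on every stream.\<close>

definition gmem :: "nat \<Rightarrow> (nat \<Rightarrow> nat) \<Rightarrow> (nat \<Rightarrow> slot_memory) \<times> nat set option" where
  "gmem t X = (\<lambda>j\<in>{..<m}. slotmem (w j) (prm j) X t, if card (outs X t) \<le> cap then Some (outs X t) else None)"

lemma prm_less: "prm j s C < m" using m_pos by (simp add: prm_def)

lemma outs_U: "outs X t \<subseteq> U" by (auto simp: outs_def tst_def)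

lemma gmem_cong:
  assumes XU: "\<And>t. X t \<in> U" and XU': "\<And>t. X' t \<in> U" and eq: "gmem t X = gmem t X'" and Xt: "X t = X' t"
  shows "gmem (Suc t) X = gmem (Suc t) X'"
proof -
  have sm: "slotmem (w j) (prm j) X t = slotmem (w j) (prm j) X' t" if "j < m" for j
    using eq that unfolding gmem_def by (metis (no_types, lifting) fst_conv lessThan_iff restrict_apply')
  have sm': "slotmem (w j) (prm j) X (Suc t) = slotmem (w j) (prm j) X' (Suc t)" if "j < m" for j
    by (rule slotmem_cong[OF prm_less XU XU' sm[OF that] Xt])
  define new where "new Y = {y. \<exists>j<m. \<exists>l. st (w j) (prm j) Y ((N - 1) * a S) = Some l \<and>
     tst (w j) (prm j) Y S (N - 1) (l div D ^ S) y \<and> sbi S (N - 1) (prm j S (N - 1)) + 4 * B * (D ^ S * q) = Suc t}" for Y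
  have outs_Suc: "outs Y (Suc t) = outs Y t \<union> new Y" for Y
    unfolding outs_def new_def by (auto simp: le_Suc_eq)
  have same: "(\<exists>l. st (w j) (prm j) X ((N - 1) * a S) = Some l \<and> tst (w j) (prm j) X S (N - 1) (l div D ^ S) y) \<longleftrightarrow>
      (\<exists>l. st (w j) (prm j) X' ((N - 1) * a S) = Some l \<and> tst (w j) (prm j) X' S (N - 1) (l div D ^ S) y)"
    if j: "j < m" and e: "sbi S (N - 1) (prm j S (N - 1)) + 4 * B * (D ^ S * q) = Suc t" for j y
  proof -
    define \<tau> where "\<tau> = t div q"
    have "0 < 4 * B * (D ^ S * q)" using B_pos q_pos by simp
    then have t1: "(N - 1) * a S * q \<le> t" using e sbi_ge[of "N - 1" S "prm j S (N - 1)"] by linarith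
    have "Suc t \<le> N * a S * q" using e sbi_end[of "prm j S (N - 1)" S "N - 1", OF prm_less] N_pos by simp
    then have "\<tau> < N * a S" unfolding \<tau>_def by (simp add: less_mult_imp_div_less)
    moreover have "(N - 1) * a S \<le> \<tau>" unfolding \<tau>_def using t1 q_pos by (simp add: less_eq_div_iff_mult_less_eq)
    ultimately have \<tau>: "(N - 1) * a S \<le> \<tau>" "\<tau> < N * a S" by auto
    have C: "\<tau> div a S = N - 1" using \<tau> N_pos by (intro div_nat_eqI) (auto simp: algebra_simps)
    note sl = st_last_cell[OF \<tau>, symmetric]
    have eqm: "slotmem (w j) (prm j) X t = slotmem (w j) (prm j) X' t" using sm[OF j] .
    note eqm' = eqm[unfolded slotmem_def Let_def \<tau>_def[symmetric]]
    show ?thesis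
    proof (cases "st (w j) (prm j) X \<tau>")
      case None
      then have "st (w j) (prm j) X' \<tau> = None" using eqm' by (auto split: option.splits if_splits)
      then show ?thesis using None unfolding sl(1) by simp
    next
      case (Some l)
      then obtain l' where Some': "st (w j) (prm j) X' \<tau> = Some l'" using eqm' by (auto split: option.splits if_splits)
      have s: "stg l \<tau> = S" "stg l' \<tau> = S" using st_last_cell(2)[OF \<tau>] Some Some' by auto
      then have "l div D ^ S = l' div D ^ S"
        "tact (w j) (prm j) X S (N - 1) (l div D ^ S) t = tact (w j) (prm j) X' S (N - 1) (l div D ^ S) t"
        using eqm' Some Some' S_pos C by auto
      note same = this
      have "tst (w j) (prm j) X S (N - 1) (l div D ^ S) y \<longleftrightarrow> tst (w j) (prm j) X' S (N - 1) (l div D ^ S) y"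
        by (rule tst_cong_at_end[OF prm_less XU XU' same(2) Xt]) (use e in simp)
      then show ?thesis unfolding sl(1) using Some Some' same(1) by simp
    qed
  qed
  have new: "new X = new X'" unfolding new_def using same by blast
  have fin: "finite (outs Y s)" for Y s using outs_U finU by (rule finite_subset)
  have mono: "card (outs Y t) \<le> card (outs Y (Suc t))" for Y
    by (intro card_mono fin) (auto simp: outs_Suc)
  have "(if card (outs X (Suc t)) \<le> cap then Some (outs X (Suc t)) else None) =
        (if card (outs X' (Suc t)) \<le> cap then Some (outs X' (Suc t)) else None)"
  proof (cases "card (outs X t) \<le> cap")
    case True
    then have "outs X t = outs X' t" using eq unfolding gmem_def by (auto split: if_splits)
    then show ?thesis using new by (simp add: outs_Suc)
  next
    \<comment> \<open>Overflow is permanent because the output never shrinks.\<close>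
    case False
    then have "\<not> card (outs X' t) \<le> cap" using eq unfolding gmem_def by (auto split: if_splits)
    then show ?thesis using False mono[of X] mono[of X'] by auto
  qed
  then show ?thesis unfolding gmem_def using sm' by auto
qed

lemma gmem_init: "gmem 0 X = gmem 0 X'"
proof -
  have "outs Y 0 = {}" for Y using B_pos q_pos by (auto simp: outs_def)
  moreover have "slotmem (w j) (prm j) X 0 = slotmem (w j) (prm j) X' 0" for j
    by (simp add: slotmem_def firstlab_def)
  ultimately show ?thesis by (simp add: gmem_def)
qed

section \<open>Counting the joint states\<close>

definition active :: "nat \<Rightarrow> nat \<Rightarrow> nat \<Rightarrow> bool" where
  "active t j s \<longleftrightarrow> (let b0 = sbi s (t div q div a s) (prm j s (t div q div a s)) in b0 \<le> t \<and> t < b0 + 4 * B * (D ^ s * q))"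

text \<open>The time determines the subblock within its cell, and the cyclic shift is injective in
  the slot number.\<close>

lemma active_unique:
  assumes "active t j s" "active t j' s" "j < m" "j' < m"
  shows "j = j'"
proof -
  define C where "C = t div q div a s"
  define g where "g = 4 * B * D ^ s * q"
  have g0: "g > 0" using B_pos q_pos by (simp add: g_def)
  have *: "sbi s C i = C * a s * q + i * g" for i by (simp add: sbi_def g_def algebra_simps)
  have "(t - C * a s * q) div g = prm k s C" if "active t k s" for k
    using that unfolding active_def Let_def C_def[symmetric] *
    by (intro div_nat_eqI) (auto simp: g_def algebra_simps)
  then have "prm j s C = prm j' s C" using assms by metis
  then have eq: "(j + th s C) mod m = (j' + th s C) mod m" by (simp add: prm_def)
  have "i = i'" if "i' \<le> i" "i < m" "(i + c) mod m = (i' + c) mod m" for i i' c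
  proof -
    have "m dvd (i + c) - (i' + c)" using that mod_eq_dvd_iff_nat[of "i' + c" "i + c" m] by simp
    then show ?thesis using that by (simp add: nat_dvd_not_less le_neq_implies_less) (metis dvd_imp_le le_neq_implies_less less_imp_diff_less not_le zero_less_diff)
  qed
  then show ?thesis using eq assms(3,4) by (metis nat_le_linear)
qed

definition stateset :: "nat \<Rightarrow> nat \<Rightarrow> slot_memory set" where
  "stateset t j = (let \<tau> = t div q in
     Vacant ` insert None (Some ` {\<tau> * Lam..<Suc \<tau> * Lam}) \<union>
     (\<lambda>(l,h,b). Young l h b) ` ({(\<tau> - 3 * a 1) * Lam..<Suc \<tau> * Lam} \<times> {..3 * a 1} \<times> UNIV) \<union>
     (\<Union>s\<in>{1..S}. (\<lambda>(\<beta>,r,ac). Old s \<beta> r ac) `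
        ((if s < S then {(\<tau> - 3 * a (Suc s)) * Lam div D ^ s..Suc \<tau> * Lam div D ^ s} else {..Wb * Lam div D ^ S}) \<times> UNIV \<times>
         insert None (if \<exists>s\<in>{1..S}. active t j s then Some ` (Pow {..<B} \<times> {- int n..int n} \<times> {..n}) else {}))))"

lemma Zs_bound: "i \<le> j \<Longrightarrow> \<bar>Zs w' s \<beta> b X i j\<bar> \<le> int (j - i)"
proof -
  assume "i \<le> j"
  have "\<bar>Zs w' s \<beta> b X i j\<bar> \<le> (\<Sum>t\<in>{i..<j}. 1)" unfolding Zs_def
    by (rule order_trans[OF sum_abs]) (intro sum_mono, auto)
  then show ?thesis by simp
qed

lemma slotmem_in_stateset:
  assumes "t \<le> n"
  shows "slotmem (w j) (prm j) X t \<in> stateset t j"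
proof -
  define \<tau> where "\<tau> = t div q"
  show ?thesis
  proof (cases "st (w j) (prm j) X \<tau>")
    case None
    have "l \<in> {\<tau> * Lam..<Suc \<tau> * Lam}" if "firstlab (w j) X \<tau> t = Some l" for l
      using firstlab_Some[OF that] Lam_pos dividend_less_div_times[of Lam l] by auto
    then have "(if \<tau> < Wb then firstlab (w j) X \<tau> t else None) \<in> insert None (Some ` {\<tau> * Lam..<Suc \<tau> * Lam})"
      by (cases "firstlab (w j) X \<tau> t") auto
    then show ?thesis using None unfolding slotmem_def stateset_def Let_def \<tau>_def[symmetric] by auto
  next
    case (Some l)
    have u: "l div Lam < \<tau>" "l div Lam < Wb" using st_tick[OF Some] by auto
    have lhi: "l < Suc \<tau> * Lam"
    proof -
      have "Suc (l div Lam) * Lam \<le> Suc \<tau> * Lam" using u by (intro mult_le_mono1) auto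
      then show ?thesis using dividend_less_div_times[OF Lam_pos, of l] unfolding mult_Suc by linarith
    qed
    have llo: "(\<tau> - k) * Lam \<le> l" if "\<tau> < l div Lam + k" for k
    proof -
      have "(\<tau> - k) * Lam \<le> l div Lam * Lam" using that by (intro mult_le_mono1) auto
      also have "\<dots> \<le> l" by simp
      finally show ?thesis .
    qed
    show ?thesis
    proof (cases "stg l \<tau> = 0")
      case True
      then have e: "\<tau> < l div Lam + 3 * a 1" using stg_less[of l \<tau>] S_pos eend_le[of 0 l] by simp
      have "hits (w j) l X (l div Lam) \<tau> \<le> card {l div Lam..<\<tau>}" unfolding hits_def by (intro card_mono) auto
      then have "hits (w j) l X (l div Lam) \<tau> \<le> 3 * a 1" using e by simp
      then have "Young l (hits (w j) l X (l div Lam) \<tau>) b \<in> (\<lambda>(l,h,b). Young l h b) `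
          ({(\<tau> - 3 * a 1) * Lam..<Suc \<tau> * Lam} \<times> {..3 * a 1} \<times> UNIV)" for b
        using lhi llo[OF e] by (intro image_eqI[of _ _ "(l, hits (w j) l X (l div Lam) \<tau>, b)"]) auto
      moreover have "slotmem (w j) (prm j) X t = Young l (hits (w j) l X (l div Lam) \<tau>) (\<exists>t'\<in>{\<tau> * q..<t}. fst (w j (X t')) = l)"
        using Some True unfolding slotmem_def Let_def \<tau>_def[symmetric] by simp
      ultimately have "slotmem (w j) (prm j) X t \<in> (\<lambda>(l,h,b). Young l h b) `
          ({(\<tau> - 3 * a 1) * Lam..<Suc \<tau> * Lam} \<times> {..3 * a 1} \<times> UNIV)" by (simp only:)
      then show ?thesis unfolding stateset_def Let_def \<tau>_def[symmetric] by (rule UnI1[OF UnI2])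
    next
      case False
      define s where "s = stg l \<tau>"
      define C where "C = \<tau> div a s"
      define b0 where "b0 = sbi s C (prm j s C)"
      have s: "1 \<le> s" "s \<le> S" using False stg_le by (auto simp: s_def)
      have "l div D ^ s \<in> (if s < S then {(\<tau> - 3 * a (Suc s)) * Lam div D ^ s..Suc \<tau> * Lam div D ^ s} else {..Wb * Lam div D ^ S})"
      proof (cases "s < S")
        case True
        then have "\<tau> < l div Lam + 3 * a (Suc s)" using stg_less[of l \<tau>] eend_le[of s l] by (simp add: s_def)
        then show ?thesis using llo lhi True by (auto intro!: div_le_mono)
      next
        case False
        have "l \<le> Wb * Lam"
        proof -
          have "Suc (l div Lam) * Lam \<le> Wb * Lam" using u by (intro mult_le_mono1) auto
          then show ?thesis using dividend_less_div_times[OF Lam_pos, of l] unfolding mult_Suc by linarith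
        qed
        then show ?thesis using False s by (auto intro!: div_le_mono)
      qed
      moreover have "tact (w j) (prm j) X s C (l div D ^ s) t \<in>
         insert None (if \<exists>s\<in>{1..S}. active t j s then Some ` (Pow {..<B} \<times> {- int n..int n} \<times> {..n}) else {})"
      proof (cases "b0 \<le> t \<and> t < b0 + 4 * B * (D ^ s * q)")
        case True
        have act: "\<exists>s\<in>{1..S}. active t j s"
          using True s by (auto simp: active_def Let_def b0_def C_def \<tau>_def)
        have "pb (w j) b0 s (l div D ^ s) X t \<subseteq> {..<B}" by (auto simp: pb_def bits_def)
        moreover have "\<bar>pz (w j) b0 s (l div D ^ s) X t\<bar> \<le> int n"
        proof -
          define b where "b = (t - b0) div (D ^ s * q)"
          have "b * (D ^ s * q) \<le> t - b0" unfolding b_def by (rule div_times_less_eq_dividend)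
          then have "b0 + b * (D ^ s * q) \<le> t" using True by linarith
          then have "\<bar>Zs (w j) s (l div D ^ s) b X (b0 + b * (D ^ s * q)) t\<bar> \<le> int (t - (b0 + b * (D ^ s * q)))" by (rule Zs_bound)
          then have "\<bar>Zs (w j) s (l div D ^ s) b X (b0 + b * (D ^ s * q)) t\<bar> \<le> int n" using assms by linarith
          then show ?thesis by (simp add: pz_def Let_def b_def)
        qed
        moreover have "pv (w j) b0 s (l div D ^ s) X t \<le> n"
        proof -
          have "pv (w j) b0 s (l div D ^ s) X t \<le> card {0..<t}" unfolding pv_def by (intro card_mono) auto
          then show ?thesis using assms by simp
        qed
        ultimately have "(pb (w j) b0 s (l div D ^ s) X t, pz (w j) b0 s (l div D ^ s) X t, pv (w j) b0 s (l div D ^ s) X t)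
            \<in> Pow {..<B} \<times> {- int n..int n} \<times> {..n}" by auto
        then show ?thesis using True act by (simp add: tact_def b0_def[symmetric] Let_def)
      next
        case False
        then have "tact (w j) (prm j) X s C (l div D ^ s) t = None" unfolding tact_def b0_def[symmetric] Let_def by auto
        then show ?thesis by simp
      qed
      ultimately have "(l div D ^ s, tres (w j) (prm j) X s C (l div D ^ s) t, tact (w j) (prm j) X s C (l div D ^ s) t) \<in>
         (if s < S then {(\<tau> - 3 * a (Suc s)) * Lam div D ^ s..Suc \<tau> * Lam div D ^ s} else {..Wb * Lam div D ^ S}) \<times> UNIV \<times>
         insert None (if \<exists>s\<in>{1..S}. active t j s then Some ` (Pow {..<B} \<times> {- int n..int n} \<times> {..n}) else {})"
        by (intro SigmaI UNIV_I)
      from imageI[OF this, of "\<lambda>(\<beta>,r,ac). Old s \<beta> r ac"]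
      have "Old s (l div D ^ s) (tres (w j) (prm j) X s C (l div D ^ s) t) (tact (w j) (prm j) X s C (l div D ^ s) t) \<in> stateset t j"
        unfolding stateset_def Let_def \<tau>_def[symmetric] split using s by (intro UnI2 UN_I[of s]) auto
      then show ?thesis using Some False unfolding slotmem_def Let_def \<tau>_def[symmetric] by (simp add: s_def C_def)
    qed
  qed
qed

definition K1 :: nat where "K1 = 1 + Lam + (4 * a 1 * Lam) * (4 * a 1) * 2 + S * ((4 * B * m * Lam * D^2 + 1) * 2)"
definition Wk :: nat where "Wk = 2 ^ B * (2 * n + 1) * (n + 1)"

lemma card_stateset: "finite (stateset t j)"
  "card (stateset t j) \<le> K1 * (if \<exists>s\<in>{1..S}. active t j s then 1 + Wk else 1)"
proof -
  define \<tau> where "\<tau> = t div q"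
  define V where "V = Vacant ` insert None (Some ` {\<tau> * Lam..<Suc \<tau> * Lam})"
  define Y where "Y = (\<lambda>(l,h,b). Young l h b) ` ({(\<tau> - 3 * a 1) * Lam..<Suc \<tau> * Lam} \<times> {..3 * a 1} \<times> UNIV)"
  define Ac where "Ac = insert None (if \<exists>s\<in>{1..S}. active t j s then Some ` (Pow {..<B} \<times> {- int n..int n} \<times> {..n}) else {})"
  define Bs where "Bs s = (if s < S then {(\<tau> - 3 * a (Suc s)) * Lam div D ^ s..Suc \<tau> * Lam div D ^ s} else {..Wb * Lam div D ^ S})" for s
  define O' where "O' s = (\<lambda>(\<beta>,r,ac). Old s \<beta> r ac) ` (Bs s \<times> (UNIV :: bool set) \<times> Ac)" for s
  define A where "A = (if \<exists>s\<in>{1..S}. active t j s then 1 + Wk else 1)"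
  have dec: "stateset t j = V \<union> Y \<union> (\<Union>s\<in>{1..S}. O' s)"
    unfolding stateset_def Let_def \<tau>_def V_def Y_def O'_def Bs_def Ac_def by (rule refl)
  have finAc: "finite Ac" by (auto simp: Ac_def)
  have cAc: "card Ac \<le> A"
  proof (cases "\<exists>s\<in>{1..S}. active t j s")
    case True
    have "card (Some ` (Pow {..<B} \<times> {- int n..int n} \<times> {..n})) \<le> card (Pow {..<B} \<times> {- int n..int n} \<times> {..n})" by (rule card_image_le) auto
    also have "\<dots> = Wk"
    proof -
      have "nat (2 * int n + 1) = 2 * n + 1" by (simp add: nat_eq_iff)
      then show ?thesis by (simp add: card_cartesian_product card_Pow Wk_def algebra_simps)
    qed
    finally show ?thesis using True card_insert_le_m1 unfolding Ac_def A_def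
      by (simp add: card_insert_if)
  qed (simp add: Ac_def A_def)
  have A1: "1 \<le> A" by (simp add: A_def)
  have finB: "finite (Bs s)" for s by (simp add: Bs_def)
  have a8: "4 \<le> a 1" using D_ge B_pos m_pos by (simp add: a_def)
  have cB: "card (Bs s) \<le> 4 * B * m * Lam * D^2 + 1" if "s \<le> S" for s
  proof (cases "s < S")
    case True
    define lo where "lo = (\<tau> - 3 * a (Suc s)) * Lam"
    have "Suc \<tau> \<le> (\<tau> - 3 * a (Suc s)) + 4 * a (Suc s)" using a_pos[of "Suc s"] by linarith
    then have "Suc \<tau> * Lam \<le> ((\<tau> - 3 * a (Suc s)) + 4 * a (Suc s)) * Lam" by (rule mult_le_mono1)
    also have "\<dots> = lo + (16 * B * m * D * Lam) * D ^ s" by (simp add: lo_def a_def algebra_simps)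
    finally have "Suc \<tau> * Lam div D ^ s \<le> (lo + (16 * B * m * D * Lam) * D ^ s) div D ^ s" by (rule div_le_mono)
    also have "\<dots> = lo div D ^ s + 16 * B * m * D * Lam" by simp
    finally have "card (Bs s) \<le> 16 * B * m * D * Lam + 1" using True unfolding Bs_def lo_def[symmetric] by simp
    also have "16 * B * m * D * Lam = 4 * B * m * Lam * (4 * D)" by simp
    also have "4 * D \<le> D^2" using D_ge by (simp add: power2_eq_square)
    finally show ?thesis by simp
  next
    case False
    then have "s = S" using that by simp
    have "Wb \<le> N * a S"
    proof -
      have "(N - 1) * a S \<le> N * a S" by (intro mult_le_mono1) simp
      then show ?thesis using Wb_cells by linarith
    qed
    also have "\<dots> \<le> D^2 * a S" using N_le by (rule mult_le_mono1)
    finally have "Wb * Lam \<le> (4 * B * m * Lam * D^2) * D ^ S" by (simp add: a_def mult_le_cancel2 algebra_simps)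
    then have "Wb * Lam div D ^ S \<le> (4 * B * m * Lam * D^2) * D ^ S div D ^ S" by (rule div_le_mono)
    then show ?thesis using False by (simp add: Bs_def)
  qed
  have cV: "card V \<le> 1 + Lam"
  proof -
    have "card V \<le> card (insert None (Some ` {\<tau> * Lam..<Suc \<tau> * Lam}))" unfolding V_def by (rule card_image_le) auto
    also have "\<dots> \<le> Suc (card (Some ` {\<tau> * Lam..<Suc \<tau> * Lam}))" by (simp add: card_insert_if)
    also have "card (Some ` {\<tau> * Lam..<Suc \<tau> * Lam}) \<le> card {\<tau> * Lam..<Suc \<tau> * Lam}" by (rule card_image_le) auto
    finally show ?thesis by simp
  qed
  have cY: "card Y \<le> (4 * a 1 * Lam) * (4 * a 1) * 2"
  proof -
    have "card Y \<le> card ({(\<tau> - 3 * a 1) * Lam..<Suc \<tau> * Lam} \<times> {..3 * a 1} \<times> (UNIV :: bool set))" unfolding Y_def by (rule card_image_le) auto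
    also have "\<dots> = (Suc \<tau> * Lam - (\<tau> - 3 * a 1) * Lam) * (Suc (3 * a 1) * 2)" by (simp add: card_cartesian_product)
    also have "\<dots> \<le> (4 * a 1 * Lam) * ((4 * a 1) * 2)"
    proof (intro mult_le_mono)
      have "Suc \<tau> * Lam - (\<tau> - 3 * a 1) * Lam = (Suc \<tau> - (\<tau> - 3 * a 1)) * Lam" by (simp add: diff_mult_distrib)
      also have "\<dots> \<le> (4 * a 1) * Lam" using a8 by (intro mult_le_mono1) linarith
      finally show "Suc \<tau> * Lam - (\<tau> - 3 * a 1) * Lam \<le> 4 * a 1 * Lam" .
    qed (use a8 in auto)
    finally show ?thesis by (simp add: algebra_simps)
  qed
  have cO: "card (O' s) \<le> (4 * B * m * Lam * D^2 + 1) * 2 * A" if "s \<in> {1..S}" for s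
  proof -
    have "card (O' s) \<le> card (Bs s \<times> (UNIV :: bool set) \<times> Ac)" unfolding O'_def using finB finAc by (intro card_image_le) auto
    also have "\<dots> = card (Bs s) * (2 * card Ac)" by (simp add: card_cartesian_product)
    also have "\<dots> \<le> (4 * B * m * Lam * D^2 + 1) * (2 * A)" using cB[of s] cAc that by (intro mult_le_mono) auto
    finally show ?thesis by (simp add: algebra_simps)
  qed
  show "finite (stateset t j)" unfolding dec V_def Y_def O'_def using finB finAc by auto
  have "card (stateset t j) \<le> card V + card Y + (\<Sum>s\<in>{1..S}. card (O' s))"
    unfolding dec by (intro order_trans[OF card_Un_le] add_mono card_UN_le card_Un_le) auto
  also have "\<dots> \<le> (1 + Lam) * A + (4 * a 1 * Lam) * (4 * a 1) * 2 * A + (\<Sum>s\<in>{1..S}. (4 * B * m * Lam * D^2 + 1) * 2 * A)"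
  proof (intro add_mono sum_mono cO)
    have le: "x \<le> x * A" for x using A1 by (cases A) auto
    show "card V \<le> (1 + Lam) * A" using cV le by (rule order_trans)
    show "card Y \<le> (4 * a 1 * Lam) * (4 * a 1) * 2 * A" using cY le by (rule order_trans)
  qed
  also have "\<dots> = K1 * A" by (simp add: K1_def algebra_simps)
  finally show "card (stateset t j) \<le> K1 * (if \<exists>s\<in>{1..S}. active t j s then 1 + Wk else 1)" by (simp only: A_def)
qed

lemma gmem_card:
  assumes "t \<le> n"
  shows "finite (gmem t ` {X. \<forall>s. X s \<in> U})"
    "card (gmem t ` {X. \<forall>s. X s \<in> U}) \<le> K1 ^ m * (1 + Wk) ^ S * (1 + (card U + 1) ^ cap)"
proof -
  define Q where "Q = Pi\<^sub>E {..<m} (stateset t)"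
  define Os where "Os = insert None (Some ` {T. T \<subseteq> U \<and> card T \<le> cap})"
  have finQ: "finite Q" unfolding Q_def using card_stateset(1) by (intro finite_PiE) auto
  have finO: "finite Os" unfolding Os_def using card_small_subsets[OF finU] by simp
  have sub: "gmem t ` {X. \<forall>s. X s \<in> U} \<subseteq> Q \<times> Os"
  proof (rule image_subsetI)
    fix X
    have "(\<lambda>j\<in>{..<m}. slotmem (w j) (prm j) X t) \<in> Q" unfolding Q_def
      by (intro restrict_PiE_iff[THEN iffD2] ballI slotmem_in_stateset[OF assms])
    moreover have "(if card (outs X t) \<le> cap then Some (outs X t) else None) \<in> Os"
      unfolding Os_def using outs_U[of X t] by simp
    ultimately show "gmem t X \<in> Q \<times> Os" unfolding gmem_def by (rule SigmaI)
  qed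
  show "finite (gmem t ` {X. \<forall>s. X s \<in> U})" using sub finQ finO finite_subset by blast
  have cO: "card Os \<le> 1 + (card U + 1) ^ cap"
  proof -
    have "card Os \<le> Suc (card (Some ` {T. T \<subseteq> U \<and> card T \<le> cap}))"
      unfolding Os_def using card_small_subsets(1)[OF finU] by (simp add: card_insert_if)
    also have "card (Some ` {T. T \<subseteq> U \<and> card T \<le> cap}) \<le> card {T. T \<subseteq> U \<and> card T \<le> cap}"
      using card_small_subsets(1)[OF finU] by (rule card_image_le)
    also have "\<dots> \<le> (card U + 1) ^ cap" using card_small_subsets(2)[OF finU] .
    finally show ?thesis by simp
  qed
  define J where "J = {j\<in>{..<m}. \<exists>s\<in>{1..S}. active t j s}"
  have "card J \<le> S"
  proof -
    have "\<forall>j\<in>J. \<exists>s. s \<in> {1..S} \<and> active t j s" by (auto simp: J_def)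
    then obtain f where f: "\<And>j. j \<in> J \<Longrightarrow> f j \<in> {1..S} \<and> active t j (f j)" by metis
    have "inj_on f J"
    proof (rule inj_onI)
      fix j j' assume "j \<in> J" "j' \<in> J" "f j = f j'"
      then show "j = j'" using f[of j] f[of j'] active_unique[of t j "f j" j'] by (auto simp: J_def)
    qed
    then have "card J \<le> card {1..S}" using f by (intro card_inj_on_le[of f]) auto
    then show ?thesis by simp
  qed
  have "card Q = (\<Prod>j<m. card (stateset t j))" unfolding Q_def by (simp add: card_PiE)
  also have "\<dots> \<le> (\<Prod>j<m. K1 * (if j \<in> J then 1 + Wk else 1))"
    using card_stateset(2) by (intro prod_mono) (auto simp: J_def)
  also have "\<dots> = K1 ^ m * (1 + Wk) ^ card J"
  proof -
    have "(\<Prod>j<m. (if j \<in> J then 1 + Wk else 1)) = (1 + Wk) ^ card J"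
      by (subst prod.If_cases) (auto simp: J_def Int_def)
    then show ?thesis by (simp add: prod.distrib)
  qed
  also have "\<dots> \<le> K1 ^ m * (1 + Wk) ^ S" using \<open>card J \<le> S\<close> by (intro mult_le_mono2 power_increasing) auto
  finally have cQ: "card Q \<le> K1 ^ m * (1 + Wk) ^ S" .
  have "card (gmem t ` {X. \<forall>s. X s \<in> U}) \<le> card (Q \<times> Os)" using sub finQ finO by (intro card_mono) auto
  also have "\<dots> = card Q * card Os" by (rule card_cartesian_product)
  also have "\<dots> \<le> K1 ^ m * (1 + Wk) ^ S * (1 + (card U + 1) ^ cap)" using cQ cO by (rule mult_le_mono)
  finally show "card (gmem t ` {X. \<forall>s. X s \<in> U}) \<le> K1 ^ m * (1 + Wk) ^ S * (1 + (card U + 1) ^ cap)" .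
qed

lemma gmem_output:
  assumes "N * a S * q \<le> t"
  shows "outs X t = {y. \<exists>j<m. \<exists>l. st (w j) (prm j) X ((N - 1) * a S) = Some l \<and>
     tst (w j) (prm j) X S (N - 1) (l div D ^ S) y}"
proof -
  have "sbi S (N - 1) (prm j S (N - 1)) + 4 * B * (D ^ S * q) \<le> t" for j
    using sbi_end[of "prm j S (N - 1)" S "N - 1", OF prm_less] N_pos assms by simp
  then show ?thesis by (auto simp: outs_def)
qed

end

end

section \<open>Independent coordinates\<close>

lemma expectation_pair_mult:
  fixes f :: "'a \<Rightarrow> real" and g :: "'b \<Rightarrow> real"
  assumes "finite (set_pmf M)" "finite (set_pmf Q)"
  shows "measure_pmf.expectation (pair_pmf M Q) (\<lambda>(a,b). f a * g b) =
     measure_pmf.expectation M f * measure_pmf.expectation Q g"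
proof -
  have "measure_pmf.expectation (pair_pmf M Q) (\<lambda>(a,b). f a * g b) =
     (\<Sum>z\<in>set_pmf M \<times> set_pmf Q. (case z of (a,b) \<Rightarrow> f a * g b) * pmf (pair_pmf M Q) z)"
    by (rule integral_measure_pmf_real) (use assms in auto)
  also have "\<dots> = (\<Sum>a\<in>set_pmf M. \<Sum>b\<in>set_pmf Q. (f a * pmf M a) * (g b * pmf Q b))"
    unfolding sum.cartesian_product by (intro sum.cong) (auto simp: pmf_pair)
  also have "\<dots> = (\<Sum>a\<in>set_pmf M. f a * pmf M a) * (\<Sum>b\<in>set_pmf Q. g b * pmf Q b)"
    by (simp add: sum_product)
  also have "(\<Sum>a\<in>set_pmf M. f a * pmf M a) = measure_pmf.expectation M f"
    by (rule integral_measure_pmf_real[symmetric]) (use assms in auto)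
  also have "(\<Sum>b\<in>set_pmf Q. g b * pmf Q b) = measure_pmf.expectation Q g"
    by (rule integral_measure_pmf_real[symmetric]) (use assms in auto)
  finally show ?thesis .
qed

lemma finite_set_Pi_pmf:
  assumes "finite A" "\<And>x. x \<in> A \<Longrightarrow> finite (set_pmf (p x))"
  shows "finite (set_pmf (Pi_pmf A d p))"
  using assms by (simp add: set_Pi_pmf finite_PiE_dflt)

lemma prob_eq_expectation: "measure_pmf.prob M {x. P x} = measure_pmf.expectation M (\<lambda>x. if P x then 1 else 0)"
proof -
  have "(\<lambda>x. if P x then 1 else 0 :: real) = indicator {x. P x}" by (auto simp: indicator_def)
  then show ?thesis by simp
qed

context
  fixes A :: "'a set" and d :: 'b and p :: "'a \<Rightarrow> 'b pmf"
  assumes finA: "finite A" and finp: "\<And>x. x \<in> A \<Longrightarrow> finite (set_pmf (p x))"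
begin

text \<open>That \<open>G\<close> ignores coordinate \<open>x\<close> is expressed by invariance
  under updates at \<open>x\<close>, a condition easily checked for concrete events.\<close>

lemma expectation_coordinate:
  fixes h :: "'b \<Rightarrow> real"
  assumes x: "x \<in> A" and G: "\<And>f v. G (f(x := v)) = G f"
  shows "measure_pmf.expectation (Pi_pmf A d p) (\<lambda>f. h (f x) * G f) =
    measure_pmf.expectation (p x) h * measure_pmf.expectation (Pi_pmf A d p) G"
proof -
  define A' where "A' = A - {x}"
  have A': "A = insert x A'" "x \<notin> A'" "finite A'" using x finA by (auto simp: A'_def)
  have fin': "finite (set_pmf (Pi_pmf A' d p))" using A' finp by (intro finite_set_Pi_pmf) auto
  have gen: "measure_pmf.expectation (Pi_pmf A d p) (\<lambda>f. h (f x) * G f) =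
    measure_pmf.expectation (p x) h * measure_pmf.expectation (Pi_pmf A' d p) G" for h :: "'b \<Rightarrow> real"
  proof -
    have "measure_pmf.expectation (Pi_pmf A d p) (\<lambda>f. h (f x) * G f) =
       measure_pmf.expectation (pair_pmf (p x) (Pi_pmf A' d p)) (\<lambda>z. h ((case z of (y,f) \<Rightarrow> f(x:=y)) x) * G (case z of (y,f) \<Rightarrow> f(x:=y)))"
      unfolding A'(1) using A' by (subst Pi_pmf_insert) (auto simp: integral_map_pmf)
    also have "\<dots> = measure_pmf.expectation (pair_pmf (p x) (Pi_pmf A' d p)) (\<lambda>(y,f). h y * G f)"
      by (intro arg_cong2[where f = lebesgue_integral] refl ext) (auto simp: G split: prod.splits)
    also have "\<dots> = measure_pmf.expectation (p x) h * measure_pmf.expectation (Pi_pmf A' d p) G"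
      using finp[OF x] fin' by (rule expectation_pair_mult)
    finally show ?thesis .
  qed
  have "measure_pmf.expectation (Pi_pmf A d p) G = measure_pmf.expectation (Pi_pmf A' d p) G"
    using gen[of "\<lambda>_. 1"] by simp
  then show ?thesis using gen by simp
qed

lemma prob_coordinate:
  assumes x: "x \<in> A" and E: "\<And>f v. E (f(x := v)) = E f"
  shows "measure_pmf.prob (Pi_pmf A d p) {f. f x \<in> V \<and> E f} =
    measure_pmf.prob (p x) V * measure_pmf.prob (Pi_pmf A d p) {f. E f}"
proof -
  have "measure_pmf.prob (Pi_pmf A d p) {f. f x \<in> V \<and> E f} =
     measure_pmf.expectation (Pi_pmf A d p) (\<lambda>f. indicator V (f x) * (if E f then 1 else 0))"
    unfolding prob_eq_expectation by (intro arg_cong2[where f = lebesgue_integral] refl ext) (auto simp: indicator_def)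
  also have "\<dots> = measure_pmf.expectation (p x) (indicator V) * measure_pmf.expectation (Pi_pmf A d p) (\<lambda>f. if E f then 1 else 0)"
    by (rule expectation_coordinate) (use x E in auto)
  finally show ?thesis by (simp add: prob_eq_expectation)
qed

lemma prob_component: "x \<in> A \<Longrightarrow> measure_pmf.prob (Pi_pmf A d p) {f. f x \<in> V} = measure_pmf.prob (p x) V"
  using prob_coordinate[of x "\<lambda>_. True" V] by simp

lemma prob_two:
  assumes "x \<in> A" "y \<in> A" "x \<noteq> y"
  shows "measure_pmf.prob (Pi_pmf A d p) {f. f x \<in> V \<and> f y \<in> V'} = measure_pmf.prob (p x) V * measure_pmf.prob (p y) V'"
  using prob_coordinate[of x "\<lambda>f. f y \<in> V'" V] assms prob_component[of y V'] by simp

text \<open>The cross terms vanish: the coordinates are independent and each summand has mean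
  zero.\<close>

lemma second_moment:
  fixes g :: "'a \<Rightarrow> 'b \<Rightarrow> real"
  assumes "B \<subseteq> A" and mean: "\<And>y. y \<in> B \<Longrightarrow> measure_pmf.expectation (p y) (g y) = 0"
  shows "measure_pmf.expectation (Pi_pmf A d p) (\<lambda>f. (\<Sum>y\<in>B. g y (f y))\<^sup>2) =
    (\<Sum>y\<in>B. measure_pmf.expectation (p y) (\<lambda>v. (g y v)\<^sup>2))"
proof -
  have "finite B" using assms finA finite_subset by blast
  have int: "integrable (Pi_pmf A d p) f" for f :: "_ \<Rightarrow> real"
    using finite_set_Pi_pmf[OF finA finp] by (intro integrable_measure_pmf_finite) auto
  from \<open>finite B\<close> assms show ?thesis
  proof (induction B rule: finite_induct)
    case (insert x B)
    have "x \<in> A" using insert by auto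
    have "measure_pmf.expectation (Pi_pmf A d p) (\<lambda>f. (\<Sum>y\<in>insert x B. g y (f y))\<^sup>2) =
       measure_pmf.expectation (Pi_pmf A d p) (\<lambda>f. (g x (f x))\<^sup>2 * 1 + 2 * (g x (f x) * (\<Sum>y\<in>B. g y (f y))) + (\<Sum>y\<in>B. g y (f y))\<^sup>2)"
      using insert by (intro arg_cong2[where f = lebesgue_integral] refl ext) (simp add: power2_eq_square algebra_simps)
    also have "\<dots> = measure_pmf.expectation (Pi_pmf A d p) (\<lambda>f. (g x (f x))\<^sup>2 * 1)
        + 2 * measure_pmf.expectation (Pi_pmf A d p) (\<lambda>f. g x (f x) * (\<Sum>y\<in>B. g y (f y)))
        + measure_pmf.expectation (Pi_pmf A d p) (\<lambda>f. (\<Sum>y\<in>B. g y (f y))\<^sup>2)"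
      by (simp add: int Bochner_Integration.integral_add del: mult_1_right)
    also have "measure_pmf.expectation (Pi_pmf A d p) (\<lambda>f. (g x (f x))\<^sup>2 * 1) = measure_pmf.expectation (p x) (\<lambda>v. (g x v)\<^sup>2)"
      using expectation_coordinate[OF \<open>x \<in> A\<close>, of "\<lambda>_. 1" "\<lambda>v. (g x v)\<^sup>2"] by simp
    also have "measure_pmf.expectation (Pi_pmf A d p) (\<lambda>f. g x (f x) * (\<Sum>y\<in>B. g y (f y))) = 0"
    proof -
      have "(\<Sum>y\<in>B. g y ((f(x := v)) y)) = (\<Sum>y\<in>B. g y (f y))" for f v
        using insert.hyps by (intro sum.cong) auto
      then show ?thesis using expectation_coordinate[OF \<open>x \<in> A\<close>, of "\<lambda>f. \<Sum>y\<in>B. g y (f y)" "g x"] insert.prems by simp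
    qed
    finally show ?case using insert by simp
  qed simp
qed

lemma chebyshev_sum:
  fixes g :: "'a \<Rightarrow> 'b \<Rightarrow> real"
  assumes "B \<subseteq> A" and mean: "\<And>y. y \<in> B \<Longrightarrow> measure_pmf.expectation (p y) (g y) = 0" and "c > 0"
  shows "measure_pmf.prob (Pi_pmf A d p) {f. c \<le> \<bar>\<Sum>y\<in>B. g y (f y)\<bar>} \<le>
    (\<Sum>y\<in>B. measure_pmf.expectation (p y) (\<lambda>v. (g y v)\<^sup>2)) / c\<^sup>2"
proof -
  have int: "integrable (Pi_pmf A d p) f" for f :: "_ \<Rightarrow> real"
    using finite_set_Pi_pmf[OF finA finp] by (intro integrable_measure_pmf_finite) auto
  have "{f. c \<le> \<bar>\<Sum>y\<in>B. g y (f y)\<bar>} = {f. c\<^sup>2 \<le> (\<Sum>y\<in>B. g y (f y))\<^sup>2}"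
    using assms(3) by (auto simp: abs_le_square_iff[symmetric])
  also have "measure_pmf.prob (Pi_pmf A d p) \<dots> \<le> measure_pmf.expectation (Pi_pmf A d p) (\<lambda>f. (\<Sum>y\<in>B. g y (f y))\<^sup>2) / c\<^sup>2"
    using integral_Markov_inequality_measure[where M = "Pi_pmf A d p" and u = "\<lambda>f. (\<Sum>y\<in>B. g y (f y))\<^sup>2" and c = "c\<^sup>2" and A = UNIV]
      int assms(3) by simp
  finally show ?thesis using second_moment[OF assms(1,2)] by simp
qed

end

lemma prob_le_markov:
  fixes g :: "'a \<Rightarrow> real"
  assumes "finite (set_pmf M)" "\<And>x. g x \<ge> 0" "c > 0"
  shows "measure_pmf.prob M {x. c \<le> g x} \<le> measure_pmf.expectation M g / c"
  using integral_Markov_inequality_measure[where M = M and u = g and c = c and A = UNIV]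
    integrable_measure_pmf_finite[OF assms(1), of g] assms by simp

lemma sum_squares_le: "(\<Sum>i\<in>I. (f i :: nat)\<^sup>2) \<le> (\<Sum>i\<in>I. f i)\<^sup>2"
proof (cases "finite I")
  case True
  then show ?thesis
  proof (induction I rule: finite_induct)
    case (insert x I)
    have "(f x)\<^sup>2 + (\<Sum>i\<in>I. f i)\<^sup>2 \<le> (f x + (\<Sum>i\<in>I. f i))\<^sup>2" by (simp add: power2_sum)
    then show ?case using insert by simp
  qed simp
qed simp

section \<open>Success probability of a slot\<close>

text \<open>Labels name ticks below \<open>R\<close>, but only ticks below \<open>Wb\<close> lead to
  an adoption. Thinning the candidates by \<open>Wb / R\<close>, which is later of order \<epsilon>,
  keeps the elements of the stream together from blocking a slot.\<close>

locale random_slots = slots2 +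
  fixes R :: nat
  assumes R_pos: "R > 0" and Wb_R: "Wb \<le> R" and finite_U: "finite U"
begin

section \<open>Random labels and signs\<close>

definition lp :: "(nat \<times> bool) pmf" where "lp = pair_pmf (pmf_of_set {..<R * Lam}) (pmf_of_set UNIV)"

definition sp :: "(nat \<Rightarrow> nat \<times> bool) pmf" where "sp = Pi_pmf U (0, False) (\<lambda>_. lp)"

lemma RL_pos: "R * Lam > 0" using R_pos Lam_pos by simp

lemma finite_lp: "finite (set_pmf lp)"
  using RL_pos by (simp add: lp_def set_pmf_of_set lessThan_empty_iff)

lemma prob_lp: "measure_pmf.prob lp {v. fst v \<in> A} = real (card ({..<R * Lam} \<inter> A)) / (R * Lam)"
proof -
  have "measure_pmf.prob lp {v. fst v \<in> A} = measure_pmf.prob (map_pmf fst lp) A" by (simp add: vimage_def)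
  also have "map_pmf fst lp = pmf_of_set {..<R * Lam}" by (simp add: lp_def map_fst_pair_pmf)
  finally show ?thesis using RL_pos by (subst (asm) measure_pmf_of_set) (auto simp: lessThan_empty_iff)
qed

lemma prob_lp_le: "finite A \<Longrightarrow> card A \<le> k \<Longrightarrow> measure_pmf.prob lp {v. fst v \<in> A} \<le> real k / (R * Lam)"
proof -
  assume A: "finite A" "card A \<le> k"
  have "card ({..<R * Lam} \<inter> A) \<le> card A" using A by (intro card_mono) auto
  then have "real (card ({..<R * Lam} \<inter> A)) \<le> real k" using A by simp
  then show ?thesis unfolding prob_lp using RL_pos by (intro divide_right_mono) auto
qed

lemma tick_set: "{l. l div Lam = u} = {u * Lam..<Suc u * Lam}"
proof -
  have "l div Lam = u \<longleftrightarrow> u * Lam \<le> l \<and> l < Suc u * Lam" for l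
    using Lam_pos div_nat_eqI[of Lam u l] div_times_less_eq_dividend[of l Lam] dividend_less_div_times[of Lam l]
    by (auto simp: algebra_simps)
  then show ?thesis unfolding set_eq_iff mem_Collect_eq atLeastLessThan_iff by blast
qed

lemma prob_tick: "u < R \<Longrightarrow> measure_pmf.prob lp {v. fst v div Lam = u} = 1 / R"
proof -
  assume "u < R"
  then have "Suc u * Lam \<le> R * Lam" by (intro mult_le_mono1) auto
  then have "{..<R * Lam} \<inter> {u * Lam..<Suc u * Lam} = {u * Lam..<Suc u * Lam}" by auto
  then have "card ({..<R * Lam} \<inter> {u * Lam..<Suc u * Lam}) = Lam" by simp
  moreover have "{v :: nat \<times> bool. fst v div Lam = u} = {v. fst v \<in> {u * Lam..<Suc u * Lam}}" using tick_set[of u] by blast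
  ultimately show ?thesis using prob_lp[of "{u * Lam..<Suc u * Lam}"] Lam_pos R_pos by (simp add: field_simps)
qed

lemma prob_ticks_le: "finite V \<Longrightarrow> measure_pmf.prob lp {v. fst v div Lam \<in> V} \<le> real (card V) / R"
proof -
  assume V: "finite V"
  have eq: "{v :: nat \<times> bool. fst v div Lam \<in> V} = {v. fst v \<in> (\<Union>u\<in>V. {u * Lam..<Suc u * Lam})}"
  proof -
    have "l div Lam \<in> V \<longleftrightarrow> l \<in> (\<Union>u\<in>V. {u * Lam..<Suc u * Lam})" for l
    proof -
      have "l div Lam \<in> V \<longleftrightarrow> (\<exists>u\<in>V. l \<in> {l. l div Lam = u})" by auto
      then show ?thesis unfolding tick_set by simp
    qed
    then show ?thesis by blast
  qed
  have "card (\<Union>u\<in>V. {u * Lam..<Suc u * Lam}) \<le> (\<Sum>u\<in>V. card {u * Lam..<Suc u * Lam})"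
    using V by (rule card_UN_le)
  also have "\<dots> = card V * Lam" by simp
  finally have "measure_pmf.prob lp {v. fst v div Lam \<in> V} \<le> real (card V * Lam) / (R * Lam)"
    unfolding eq using V by (intro prob_lp_le) auto
  then show ?thesis using Lam_pos by simp
qed

lemmas sp_coord = prob_coordinate[of U "\<lambda>_. lp" _ _ "(0, False)", OF finite_U finite_lp, folded sp_def]
lemmas sp_two = prob_two[of U "\<lambda>_. lp" _ _ "(0, False)", OF finite_U finite_lp, folded sp_def]
lemmas sp_comp = prob_component[of U "\<lambda>_. lp" _ "(0, False)", OF finite_U finite_lp, folded sp_def]
lemmas sp_cheb = chebyshev_sum[of U "\<lambda>_. lp" _ _ _ "(0, False)", OF finite_U finite_lp, folded sp_def]

text \<open>Summing over the value of the first label turns a relation between two labels into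
  conditions on each alone; \<open>M l\<close> is the set of labels that collide with
  \<open>l\<close>.\<close>

lemma prob_collision:
  assumes "y \<in> U" "z \<in> U" "y \<noteq> z" "finite L" "\<And>l. l \<in> L \<Longrightarrow> finite (M l) \<and> card (M l) \<le> k"
  shows "measure_pmf.prob sp {w. fst (w y) \<in> L \<and> fst (w z) \<in> M (fst (w y))} \<le> real (card L) * k / (R * Lam)\<^sup>2"
proof -
  have "measure_pmf.prob sp {w. fst (w y) \<in> L \<and> fst (w z) \<in> M (fst (w y))} \<le>
     measure_pmf.prob sp (\<Union>l\<in>L. {w. w y \<in> {v. fst v \<in> {l}} \<and> w z \<in> {v. fst v \<in> M l}})"
    by (intro measure_pmf.finite_measure_mono) auto
  also have "\<dots> \<le> (\<Sum>l\<in>L. measure_pmf.prob sp {w. w y \<in> {v. fst v \<in> {l}} \<and> w z \<in> {v. fst v \<in> M l}})"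
    using assms by (intro measure_pmf.finite_measure_subadditive_finite) auto
  also have "\<dots> = (\<Sum>l\<in>L. measure_pmf.prob lp {v. fst v \<in> {l}} * measure_pmf.prob lp {v. fst v \<in> M l})"
    by (intro sum.cong refl sp_two) (use assms in auto)
  also have "\<dots> \<le> (\<Sum>l\<in>L. (real 1 / (R * Lam)) * (real k / (R * Lam)))"
    using assms by (intro sum_mono mult_mono prob_lp_le) auto
  also have "\<dots> = real (card L) * k / (R * Lam)\<^sup>2" by (simp add: power2_eq_square)
  finally show ?thesis .
qed

section \<open>Failure probabilities of one slot\<close>

context
  fixes X :: "nat \<Rightarrow> nat" and p :: "nat \<Rightarrow> nat \<Rightarrow> nat"
begin

text \<open>\<open>Lf\<close>, \<open>I0\<close>, \<open>IS\<close> and \<open>Ns\<close> bound the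
  failure probabilities conditional on \<open>x\<close> being labelled with tick \<open>u\<close>: a
  slot occupied by a single element, an imposture in youth, an imposture at a later stage, and too
  much noise.\<close>

definition Lf :: "nat \<Rightarrow> real" where "Lf u = (\<Sum>z\<in>U. real (card {v\<in>{..<u}. life p X v u z})) / R"

definition I0 :: "nat \<Rightarrow> real" where
  "I0 u = (\<Sum>v\<in>{v. v < u \<and> u < v + 6 * a 1}. real (card (occ X v) ^ 2) / (real R ^ 2 * Lam))"

text \<open>The cap at 1 permits replacing the quadratic term by its square root in
  \<open>IS_sum\<close>.\<close>

definition IS :: "nat \<Rightarrow> real" where
  "IS u = (\<Sum>s\<in>{1..S}. \<Sum>c\<in>{c. c + 3 \<le> u div a s \<and> u div a s < c + D^2}.
     min 1 (real (card (big X s c) ^ 2) * (real (a s) * real (D ^ s)) / (real R ^ 2 * Lam)))"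

definition part :: "nat \<Rightarrow> nat \<Rightarrow> nat \<Rightarrow> nat set" where
  "part s C b = {sbi s C (p s C) + b * (D ^ s * q)..<sbi s C (p s C) + Suc b * (D ^ s * q)}"

definition energy :: "nat \<Rightarrow> nat \<Rightarrow> nat \<Rightarrow> nat" where
  "energy s C b = (\<Sum>y\<in>U. card {t\<in>part s C b. X t = y} ^ 2)"

definition Ns :: "nat \<Rightarrow> real" where
  "Ns u = (\<Sum>s\<in>{1..S}. \<Sum>C\<in>path s u. \<Sum>b<B. 16 * real (energy s C b) / (real R * Lam * real (D ^ s)))"

context
  assumes p_less: "\<And>s C. p s C < m" and XU: "\<And>t. X t \<in> U"
begin

lemma finite_occ: "finite (occ X v)" by (simp add: occ_def)
lemma occ_U: "occ X v \<subseteq> U" using XU by (auto simp: occ_def)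
lemma finite_path: "finite (path s u)" unfolding path_def by (rule finite_subset[of _ "{..<u div a s + D^2}"]) auto

text \<open>The blocking element has an earlier tick than \<open>x\<close>, so it differs from
  \<open>x\<close> and its label is independent of that of \<open>x\<close>.\<close>

lemma prob_life:
  assumes "x \<in> U" "u < R"
  shows "measure_pmf.prob sp {w. fst (w x) div Lam = u \<and> (\<exists>z\<in>U. fst (w z) div Lam < u \<and> life p X (fst (w z) div Lam) u z)} \<le> Lf u / R"
proof -
  define V where "V z = {v\<in>{..<u}. life p X v u z}" for z
  have "measure_pmf.prob sp {w. fst (w x) div Lam = u \<and> (\<exists>z\<in>U. fst (w z) div Lam < u \<and> life p X (fst (w z) div Lam) u z)}
     \<le> measure_pmf.prob sp (\<Union>z\<in>U - {x}. {w. w x \<in> {v. fst v div Lam = u} \<and> w z \<in> {v. fst v div Lam \<in> V z}})"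
    by (intro measure_pmf.finite_measure_mono) (auto simp: V_def)
  also have "\<dots> \<le> (\<Sum>z\<in>U - {x}. measure_pmf.prob sp {w. w x \<in> {v. fst v div Lam = u} \<and> w z \<in> {v. fst v div Lam \<in> V z}})"
    using finite_U by (intro measure_pmf.finite_measure_subadditive_finite) auto
  also have "\<dots> = (\<Sum>z\<in>U - {x}. measure_pmf.prob lp {v. fst v div Lam = u} * measure_pmf.prob lp {v. fst v div Lam \<in> V z})"
    by (intro sum.cong refl sp_two) (use assms in auto)
  also have "\<dots> \<le> (\<Sum>z\<in>U - {x}. (1 / R) * (real (card (V z)) / R))"
    using assms by (intro sum_mono mult_mono prob_ticks_le) (auto simp: V_def prob_tick)
  also have "\<dots> \<le> (\<Sum>z\<in>U. (1 / R) * (real (card (V z)) / R))" using finite_U by (intro sum_mono2) auto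
  also have "\<dots> = Lf u / R" by (simp add: Lf_def V_def sum_divide_distrib sum_distrib_left)
  finally show ?thesis .
qed

text \<open>The impostors have a tick before \<open>u\<close>, so \<open>x\<close> is not among
  them. With \<open>x\<close> excluded, the imposture is independent of the label of
  \<open>x\<close>. A pair collides in one of \<open>Lam\<close> labels, each with probability
  \<open>1 / (R * Lam)\<^sup>2\<close>.\<close>

lemma prob_imp0:
  assumes "x \<in> U" "u < R"
  shows "measure_pmf.prob sp {w. fst (w x) div Lam = u \<and> (\<exists>v. imp0 X w v u)} \<le> I0 u / R"
proof -
  define Vs where "Vs = {v. v < u \<and> u < v + 6 * a 1}"
  have finV: "finite Vs" by (rule finite_subset[of _ "{..<u}"]) (auto simp: Vs_def)
  define E where "E v w \<longleftrightarrow> (\<exists>y\<in>occ X v - {x}. \<exists>z\<in>occ X v - {x}. y \<noteq> z \<and> fst (w y) = fst (w z) \<and> fst (w y) div Lam = v)"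
    for v and w :: "nat \<Rightarrow> nat \<times> bool"
  have E: "measure_pmf.prob sp {w. E v w} \<le> real (card (occ X v) ^ 2) / (real R ^ 2 * Lam)" for v
  proof -
    define P where "P = {(y,z). y \<in> occ X v \<and> z \<in> occ X v \<and> y \<noteq> z}"
    have P: "P \<subseteq> occ X v \<times> occ X v" by (auto simp: P_def)
    have finP: "finite P" using P finite_occ finite_subset by blast
    have "card P \<le> card (occ X v \<times> occ X v)" using P finite_occ by (intro card_mono) auto
    then have cP: "real (card P) \<le> real (card (occ X v) ^ 2)" by (simp add: card_cartesian_product power2_eq_square flip: of_nat_mult)
    define ev where "ev = (\<lambda>(y,z). {w :: nat \<Rightarrow> nat \<times> bool. fst (w y) \<in> {v * Lam..<Suc v * Lam} \<and> fst (w z) \<in> {fst (w y)}})"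
    have "measure_pmf.prob sp {w. E v w} \<le> measure_pmf.prob sp (\<Union>yz\<in>P. ev yz)"
    proof (intro measure_pmf.finite_measure_mono subsetI)
      fix w assume "w \<in> {w. E v w}"
      then obtain y z where h: "y \<in> occ X v" "z \<in> occ X v" "y \<noteq> z" "fst (w y) = fst (w z)" "fst (w y) div Lam = v"
        unfolding E_def by blast
      have "fst (w y) \<in> {v * Lam..<Suc v * Lam}" using h(5) tick_set[of v] by blast
      then have "w \<in> ev (y,z)" using h(4) by (simp add: ev_def)
      then show "w \<in> (\<Union>yz\<in>P. ev yz)" using h by (intro UN_I[of "(y,z)"]) (auto simp: P_def)
    qed auto
    also have "\<dots> \<le> (\<Sum>yz\<in>P. measure_pmf.prob sp (ev yz))"
      using finP by (intro measure_pmf.finite_measure_subadditive_finite) auto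
    also have "\<dots> \<le> (\<Sum>yz\<in>P. real Lam * 1 / (R * Lam)\<^sup>2)"
    proof (rule sum_mono, clarify)
      fix y z assume yz: "(y,z) \<in> P"
      have "measure_pmf.prob sp (ev (y,z)) \<le> real (card {v * Lam..<Suc v * Lam}) * real 1 / (R * Lam)\<^sup>2"
        unfolding ev_def split
        by (rule prob_collision[where M = "\<lambda>l. {l}"]) (use yz occ_U in \<open>auto simp: P_def\<close>)
      then show "measure_pmf.prob sp (ev (y,z)) \<le> real Lam * 1 / (R * Lam)\<^sup>2" by simp
    qed
    also have "\<dots> = real (card P) * (real Lam / (R * Lam)\<^sup>2)" by simp
    also have "\<dots> \<le> real (card (occ X v) ^ 2) * (real Lam / (R * Lam)\<^sup>2)" using cP by (intro mult_right_mono) auto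
    also have "\<dots> = real (card (occ X v) ^ 2) / (real R ^ 2 * Lam)" using Lam_pos R_pos by (simp add: power2_eq_square field_simps)
    finally show ?thesis .
  qed
  have Eind: "E v (w(x := r)) = E v w" for v w r by (auto simp: E_def)
  have "measure_pmf.prob sp {w. fst (w x) div Lam = u \<and> (\<exists>v. imp0 X w v u)} \<le>
     measure_pmf.prob sp (\<Union>v\<in>Vs. {w. w x \<in> {r. fst r div Lam = u} \<and> E v w})"
  proof (intro measure_pmf.finite_measure_mono subsetI)
    fix w assume "w \<in> {w. fst (w x) div Lam = u \<and> (\<exists>v. imp0 X w v u)}"
    then obtain v y z where h: "fst (w x) div Lam = u" "v < u" "u < v + 6 * a 1" "y \<in> occ X v" "z \<in> occ X v" "y \<noteq> z"
      "fst (w y) = fst (w z)" "fst (w y) div Lam = v" by (auto simp: imp0_def)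
    then have "y \<noteq> x" "z \<noteq> x" by auto
    then have "E v w" unfolding E_def using h(4-8) by blast
    moreover have "v \<in> Vs" using h by (simp add: Vs_def)
    ultimately show "w \<in> (\<Union>v\<in>Vs. {w. w x \<in> {r. fst r div Lam = u} \<and> E v w})" using h(1) by blast
  qed auto
  also have "\<dots> \<le> (\<Sum>v\<in>Vs. measure_pmf.prob sp {w. w x \<in> {r. fst r div Lam = u} \<and> E v w})"
    using finV by (intro measure_pmf.finite_measure_subadditive_finite) auto
  also have "\<dots> = (\<Sum>v\<in>Vs. (1 / R) * measure_pmf.prob sp {w. E v w})"
    by (intro sum.cong refl) (use sp_coord[where x = x and E = "E _", OF assms(1) Eind, of "{r. fst r div Lam = u}"] prob_tick[OF assms(2)] in simp)
  also have "\<dots> \<le> (\<Sum>v\<in>Vs. (1 / R) * (real (card (occ X v) ^ 2) / (real R ^ 2 * Lam)))"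
    using E by (intro sum_mono mult_left_mono) auto
  also have "\<dots> = I0 u / R" unfolding I0_def Vs_def sum_divide_distrib by (intro sum.cong refl) (simp add: mult.commute)
  finally show ?thesis .
qed

lemma finite_big: "finite (big X s c)" using finite_U by (simp add: big_def)
lemma big_U: "big X s c \<subseteq> U" by (auto simp: big_def)

lemma finite_block: "finite {l'. l' div D ^ s = l div D ^ s}" "card {l'. l' div D ^ s = l div D ^ s} \<le> D ^ s"
proof -
  have "{l'. l' div D ^ s = l div D ^ s} \<subseteq> {l div D ^ s * D ^ s..<l div D ^ s * D ^ s + D ^ s}"
  proof
    fix l' assume "l' \<in> {l'. l' div D ^ s = l div D ^ s}"
    then show "l' \<in> {l div D ^ s * D ^ s..<l div D ^ s * D ^ s + D ^ s}"
      using div_times_less_eq_dividend[of l' "D ^ s"] dividend_less_div_times[of "D ^ s" l'] by (simp add: algebra_simps)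
  qed
  then show "finite {l'. l' div D ^ s = l div D ^ s}" "card {l'. l' div D ^ s = l div D ^ s} \<le> D ^ s"
    using finite_subset card_mono[of "{l div D ^ s * D ^ s..<l div D ^ s * D ^ s + D ^ s}"] by fastforce+
qed

lemma cell_labels: "{l. l div Lam div a s = c} = {c * (Lam * a s)..<c * (Lam * a s) + Lam * a s}"
proof -
  have pos: "Lam * a s > 0" using Lam_pos by simp
  have "l div Lam div a s = c \<longleftrightarrow> c * (Lam * a s) \<le> l \<and> l < c * (Lam * a s) + Lam * a s" for l
  proof -
    have "l div Lam div a s = l div (Lam * a s)" by (simp add: div_mult2_eq)
    then show ?thesis
      using pos div_nat_eqI[of "Lam * a s" c l] div_times_less_eq_dividend[of l "Lam * a s"] dividend_less_div_times[of "Lam * a s" l]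
      by (auto simp: algebra_simps)
  qed
  then show ?thesis unfolding set_eq_iff mem_Collect_eq atLeastLessThan_iff by blast
qed

text \<open>The impostors were born in a cell at least three before that of \<open>u\<close>, so
  again \<open>x\<close> is not among them and independence applies.\<close>

lemma prob_impS:
  assumes "x \<in> U" "u < R"
  shows "measure_pmf.prob sp {w. fst (w x) div Lam = u \<and> (\<exists>s\<in>{1..S}. \<exists>c. impS X w s c u)} \<le> IS u / R"
proof -
  define Cs where "Cs s = {c. c + 3 \<le> u div a s \<and> u div a s < c + D^2}" for s
  have finC: "finite (Cs s)" for s by (rule finite_subset[of _ "{..u div a s}"]) (auto simp: Cs_def)
  define E where "E s c w \<longleftrightarrow> (\<exists>z\<in>big X s c - {x}. \<exists>z'\<in>big X s c - {x}. z \<noteq> z' \<and>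
     fst (w z) div D ^ s = fst (w z') div D ^ s \<and> fst (w z) div Lam div a s = c)" for s c and w :: "nat \<Rightarrow> nat \<times> bool"
  have E: "measure_pmf.prob sp {w. E s c w} \<le> min 1 (real (card (big X s c) ^ 2) * (real (a s) * real (D ^ s)) / (real R ^ 2 * Lam))" for s c
  proof -
    define P where "P = {(y,z). y \<in> big X s c \<and> z \<in> big X s c \<and> y \<noteq> z}"
    define L where "L = {c * (Lam * a s)..<c * (Lam * a s) + Lam * a s}"
    have P: "P \<subseteq> big X s c \<times> big X s c" by (auto simp: P_def)
    have finP: "finite P" using P finite_big finite_subset by blast
    have "card P \<le> card (big X s c \<times> big X s c)" using P finite_big by (intro card_mono) auto
    then have cP: "real (card P) \<le> real (card (big X s c) ^ 2)" by (simp add: card_cartesian_product power2_eq_square flip: of_nat_mult)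
    define ev where "ev = (\<lambda>(y,z). {w :: nat \<Rightarrow> nat \<times> bool. fst (w y) \<in> L \<and> fst (w z) \<in> {l'. l' div D ^ s = fst (w y) div D ^ s}})"
    have "measure_pmf.prob sp {w. E s c w} \<le> measure_pmf.prob sp (\<Union>yz\<in>P. ev yz)"
    proof (intro measure_pmf.finite_measure_mono subsetI)
      fix w assume "w \<in> {w. E s c w}"
      then obtain z z' where h: "z \<in> big X s c" "z' \<in> big X s c" "z \<noteq> z'" "fst (w z) div D ^ s = fst (w z') div D ^ s" "fst (w z) div Lam div a s = c"
        unfolding E_def by blast
      have "fst (w z) \<in> L" using h(5) cell_labels[of s c] unfolding L_def by blast
      then have "w \<in> ev (z, z')" using h(4) by (simp add: ev_def)
      then show "w \<in> (\<Union>yz\<in>P. ev yz)" using h by (intro UN_I[of "(z,z')"]) (auto simp: P_def)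
    qed auto
    also have "\<dots> \<le> (\<Sum>yz\<in>P. measure_pmf.prob sp (ev yz))"
      using finP by (intro measure_pmf.finite_measure_subadditive_finite) auto
    also have "\<dots> \<le> (\<Sum>yz\<in>P. real (Lam * a s) * real (D ^ s) / (R * Lam)\<^sup>2)"
    proof (rule sum_mono, clarify)
      fix y z assume yz: "(y,z) \<in> P"
      have "measure_pmf.prob sp (ev (y,z)) \<le> real (card L) * real (D ^ s) / (R * Lam)\<^sup>2"
        unfolding ev_def split
        by (rule prob_collision[where M = "\<lambda>l. {l'. l' div D ^ s = l div D ^ s}"]) (use yz big_U finite_block in \<open>auto simp: P_def L_def\<close>)
      then show "measure_pmf.prob sp (ev (y,z)) \<le> real (Lam * a s) * real (D ^ s) / (R * Lam)\<^sup>2" by (simp add: L_def)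
    qed
    also have "\<dots> = real (card P) * (real (Lam * a s) * real (D ^ s) / (R * Lam)\<^sup>2)" by simp
    also have "\<dots> \<le> real (card (big X s c) ^ 2) * (real (Lam * a s) * real (D ^ s) / (R * Lam)\<^sup>2)" using cP by (intro mult_right_mono) auto
    also have "\<dots> = real (card (big X s c) ^ 2) * (real (a s) * real (D ^ s)) / (real R ^ 2 * Lam)" using Lam_pos R_pos
      by (simp add: power2_eq_square field_simps)
    finally show ?thesis by simp
  qed
  have Eind: "E s c (w(x := r)) = E s c w" for s c w r by (auto simp: E_def)
  have "measure_pmf.prob sp {w. fst (w x) div Lam = u \<and> (\<exists>s\<in>{1..S}. \<exists>c. impS X w s c u)} \<le>
     measure_pmf.prob sp (\<Union>s\<in>{1..S}. \<Union>c\<in>Cs s. {w. w x \<in> {r. fst r div Lam = u} \<and> E s c w})"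
  proof (intro measure_pmf.finite_measure_mono subsetI)
    fix w assume "w \<in> {w. fst (w x) div Lam = u \<and> (\<exists>s\<in>{1..S}. \<exists>c. impS X w s c u)}"
    then obtain s c z z' where h: "fst (w x) div Lam = u" "s \<in> {1..S}" "c + 3 \<le> u div a s" "u div a s < c + D^2" "z \<in> big X s c" "z' \<in> big X s c" "z \<noteq> z'"
      "fst (w z) div D ^ s = fst (w z') div D ^ s" "fst (w z) div Lam div a s = c" by (auto simp: impS_def)
    have "fst (w z') div Lam div a s = c" using h(8,9) by (simp add: cell_of_block)
    then have "z \<noteq> x" "z' \<noteq> x" using h(1,3,9) by auto
    then have "E s c w" unfolding E_def using h by blast
    then show "w \<in> (\<Union>s\<in>{1..S}. \<Union>c\<in>Cs s. {w. w x \<in> {r. fst r div Lam = u} \<and> E s c w})" using h by (auto simp: Cs_def)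
  qed auto
  also have "\<dots> \<le> (\<Sum>s\<in>{1..S}. measure_pmf.prob sp (\<Union>c\<in>Cs s. {w. w x \<in> {r. fst r div Lam = u} \<and> E s c w}))"
    by (intro measure_pmf.finite_measure_subadditive_finite) auto
  also have "\<dots> \<le> (\<Sum>s\<in>{1..S}. \<Sum>c\<in>Cs s. measure_pmf.prob sp {w. w x \<in> {r. fst r div Lam = u} \<and> E s c w})"
    using finC by (intro sum_mono measure_pmf.finite_measure_subadditive_finite) auto
  also have "\<dots> = (\<Sum>s\<in>{1..S}. \<Sum>c\<in>Cs s. (1 / R) * measure_pmf.prob sp {w. E s c w})"
    by (intro sum.cong refl) (use sp_coord[where x = x and E = "E _ _", OF assms(1) Eind, of "{r. fst r div Lam = u}"] prob_tick[OF assms(2)] in simp)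
  also have "\<dots> \<le> (\<Sum>s\<in>{1..S}. \<Sum>c\<in>Cs s. (1 / R) * min 1 (real (card (big X s c) ^ 2) * (real (a s) * real (D ^ s)) / (real R ^ 2 * Lam)))"
    using E by (intro sum_mono mult_left_mono) auto
  also have "\<dots> = IS u / R" by (simp add: IS_def Cs_def sum_divide_distrib sum_distrib_left)
  finally show ?thesis .
qed

lemma card_hit_tick: "finite {y. hit q X y u}" "card {y. hit q X y u} \<le> q" "{y. hit q X y u} \<subseteq> U"
proof -
  have eq: "{y. hit q X y u} = X ` {u * q..<Suc u * q}" unfolding hit_def image_def by (intro Collect_cong bex_cong refl eq_commute)
  show "finite {y. hit q X y u}" unfolding eq by simp
  have "card {y. hit q X y u} \<le> card {u * q..<Suc u * q}" unfolding eq by (rule card_image_le) simp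
  then show "card {y. hit q X y u} \<le> q" by simp
  show "{y. hit q X y u} \<subseteq> U" unfolding eq using XU by auto
qed

lemma prob_competitor:
  assumes "x \<in> U" "u < R"
  shows "measure_pmf.prob sp {w. fst (w x) div Lam = u \<and> (\<exists>y. y \<noteq> x \<and> hit q X y u \<and> fst (w y) div Lam = u)} \<le> (real q / R) / R"
proof -
  define H where "H = {y. hit q X y u} - {x}"
  have H: "finite H" "card H \<le> q" "H \<subseteq> U"
    using card_hit_tick[of u] card_mono[of "{y. hit q X y u}" H] by (auto simp: H_def)
  have "measure_pmf.prob sp {w. fst (w x) div Lam = u \<and> (\<exists>y. y \<noteq> x \<and> hit q X y u \<and> fst (w y) div Lam = u)}
     \<le> measure_pmf.prob sp (\<Union>y\<in>H. {w. w x \<in> {v. fst v div Lam = u} \<and> w y \<in> {v. fst v div Lam = u}})"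
    by (intro measure_pmf.finite_measure_mono) (auto simp: H_def)
  also have "\<dots> \<le> (\<Sum>y\<in>H. measure_pmf.prob sp {w. w x \<in> {v. fst v div Lam = u} \<and> w y \<in> {v. fst v div Lam = u}})"
    using H by (intro measure_pmf.finite_measure_subadditive_finite) auto
  also have "\<dots> = (\<Sum>y\<in>H. measure_pmf.prob lp {v. fst v div Lam = u} * measure_pmf.prob lp {v. fst v div Lam = u})"
    by (intro sum.cong refl sp_two) (use assms H in \<open>auto simp: H_def\<close>)
  also have "\<dots> = real (card H) * ((1 / R) * (1 / R))" using assms by (simp add: prob_tick)
  also have "\<dots> \<le> real q * ((1 / R) * (1 / R))" using H by (intro mult_right_mono) auto
  finally show ?thesis by simp
qed

text \<open>Chebyshev's inequality. An element lies in the label block with probability at most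
  \<open>D ^ s / (R * Lam)\<close> and has a fair sign, so the variance is at most this factor times
  the energy of the part. The threshold \<open>D ^ s / 4\<close> contributes the 16.\<close>

lemma noise_prob:
  assumes "x \<in> U"
  shows "measure_pmf.prob sp {w. int (D ^ s) \<le> 4 * \<bar>noise w p X x s C \<beta> b\<bar>} \<le> 16 * real (energy s C b) / (real R * Lam * real (D ^ s))"
proof -
  define cn where "cn y = card {t\<in>part s C b. X t = y}" for y
  define g where "g y v = (if fst v div D ^ s = \<beta> then 1 else 0) * ((if snd v then 1 else - 1) * (if bitf y b then real (cn y) else 0))"
    for y and v :: "nat \<times> bool"
  have noise: "real_of_int (noise w p X x s C \<beta> b) = (\<Sum>y\<in>U - {x}. g y (w y))" for w
  proof -
    define F where "F y = (if y \<noteq> x \<and> fst (w y) div D ^ s = \<beta> \<and> bitf y b then (if snd (w y) then 1 else - 1) else 0 :: real)" for y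
    have "real_of_int (noise w p X x s C \<beta> b) = (\<Sum>t\<in>part s C b. F (X t))"
      unfolding noise_def Let_def part_def[symmetric] of_int_sum by (intro sum.cong) (auto simp: F_def)
    also have "\<dots> = (\<Sum>y\<in>U. \<Sum>t\<in>{t\<in>part s C b. X t = y}. F (X t))"
      using finite_U XU by (intro sum.group[symmetric]) (auto simp: part_def)
    also have "\<dots> = (\<Sum>y\<in>U. real (cn y) * F y)" by (intro sum.cong) (auto simp: cn_def)
    also have "\<dots> = (\<Sum>y\<in>U - {x}. real (cn y) * F y)" using finite_U by (intro sum.mono_neutral_right) (auto simp: F_def)
    also have "\<dots> = (\<Sum>y\<in>U - {x}. g y (w y))" by (intro sum.cong) (auto simp: F_def g_def)
    finally show ?thesis .
  qed
  have mean: "measure_pmf.expectation lp (g y) = 0" for y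
  proof -
    have "measure_pmf.expectation lp (g y) = measure_pmf.expectation lp
       (\<lambda>(l,e). (if l div D ^ s = \<beta> then 1 else 0) * ((if e then 1 else - 1) * (if bitf y b then real (cn y) else 0)))"
      by (intro arg_cong2[where f = lebesgue_integral] refl ext) (auto simp: g_def)
    also have "\<dots> = measure_pmf.expectation (pmf_of_set {..<R * Lam}) (\<lambda>l. if l div D ^ s = \<beta> then 1 else 0) *
       measure_pmf.expectation (pmf_of_set (UNIV :: bool set)) (\<lambda>e. (if e then 1 else - 1) * (if bitf y b then real (cn y) else 0))"
      unfolding lp_def using RL_pos by (intro expectation_pair_mult) (auto simp: lessThan_empty_iff)
    also have "measure_pmf.expectation (pmf_of_set (UNIV :: bool set)) (\<lambda>e. (if e then 1 else - 1) * (if bitf y b then real (cn y) else 0)) = 0"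
      by (subst integral_pmf_of_set) (auto simp: UNIV_bool)
    finally show ?thesis by simp
  qed
  have sq: "measure_pmf.expectation lp (\<lambda>v. (g y v)\<^sup>2) \<le> real (D ^ s) / (R * Lam) * real (cn y ^ 2)" for y
  proof -
    have "measure_pmf.expectation lp (\<lambda>v. (g y v)\<^sup>2) \<le> measure_pmf.expectation lp (\<lambda>v. (if fst v \<in> {l. l div D ^ s = \<beta>} then 1 else 0) * real (cn y ^ 2))"
      using finite_lp by (intro integral_mono integrable_measure_pmf_finite) (auto simp: g_def power2_eq_square)
    also have "\<dots> = measure_pmf.prob lp {v. fst v \<in> {l. l div D ^ s = \<beta>}} * real (cn y ^ 2)"
      by (simp add: prob_eq_expectation)
    also have "\<dots> \<le> (real (D ^ s) / (R * Lam)) * real (cn y ^ 2)"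
    proof (intro mult_right_mono prob_lp_le)
      have "\<beta> * D ^ s div D ^ s = \<beta>" by simp
      then show "finite {l. l div D ^ s = \<beta>}" "card {l. l div D ^ s = \<beta>} \<le> D ^ s"
        using finite_block[where s = s and l = "\<beta> * D ^ s"] by simp_all
    qed auto
    finally show ?thesis .
  qed
  have "measure_pmf.prob sp {w. int (D ^ s) \<le> 4 * \<bar>noise w p X x s C \<beta> b\<bar>} = measure_pmf.prob sp {w. real (D ^ s) / 4 \<le> \<bar>\<Sum>y\<in>U - {x}. g y (w y)\<bar>}"
  proof -
    have "int (D ^ s) \<le> 4 * \<bar>noise w p X x s C \<beta> b\<bar> \<longleftrightarrow> real (D ^ s) / 4 \<le> \<bar>\<Sum>y\<in>U - {x}. g y (w y)\<bar>" for w
    proof -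
      have "int (D ^ s) \<le> 4 * \<bar>noise w p X x s C \<beta> b\<bar> \<longleftrightarrow> real_of_int (int (D ^ s)) \<le> real_of_int (4 * \<bar>noise w p X x s C \<beta> b\<bar>)"
        by (simp only: of_int_le_iff)
      also have "\<dots> \<longleftrightarrow> real (D ^ s) \<le> 4 * \<bar>\<Sum>y\<in>U - {x}. g y (w y)\<bar>" by (simp add: noise[symmetric])
      finally show ?thesis by auto
    qed
    then show ?thesis by simp
  qed
  also have "\<dots> \<le> (\<Sum>y\<in>U - {x}. measure_pmf.expectation lp (\<lambda>v. (g y v)\<^sup>2)) / (real (D ^ s) / 4)\<^sup>2"
    using mean by (intro sp_cheb) auto
  also have "\<dots> \<le> (\<Sum>y\<in>U. real (D ^ s) / (R * Lam) * real (cn y ^ 2)) / (real (D ^ s) / 4)\<^sup>2"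
  proof (intro divide_right_mono)
    have "(\<Sum>y\<in>U - {x}. measure_pmf.expectation lp (\<lambda>v. (g y v)\<^sup>2)) \<le> (\<Sum>y\<in>U - {x}. real (D ^ s) / (R * Lam) * real (cn y ^ 2))"
      by (intro sum_mono sq)
    also have "\<dots> \<le> (\<Sum>y\<in>U. real (D ^ s) / (R * Lam) * real (cn y ^ 2))" using finite_U by (intro sum_mono2) auto
    finally show "(\<Sum>y\<in>U - {x}. measure_pmf.expectation lp (\<lambda>v. (g y v)\<^sup>2)) \<le> (\<Sum>y\<in>U. real (D ^ s) / (R * Lam) * real (cn y ^ 2))" .
  qed auto
  also have "\<dots> = 16 * real (energy s C b) / (real R * Lam * real (D ^ s))"
  proof -
    have "(\<Sum>y\<in>U. real (D ^ s) / (R * Lam) * real (cn y ^ 2)) = real (D ^ s) / (R * Lam) * real (energy s C b)"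
      by (simp add: energy_def cn_def sum_distrib_left)
    moreover have "real (D ^ s) > 0" using D_ge by simp
    ultimately show ?thesis by (simp add: power2_eq_square mult.assoc mult.commute)
  qed
  finally show ?thesis .
qed

text \<open>The block in which noise is measured depends on the label of \<open>x\<close>. The noise
  itself omits \<open>x\<close>, so once that label is fixed it is independent of it.\<close>

lemma prob_noise:
  assumes "x \<in> U" "u < R"
  shows "measure_pmf.prob sp {w. fst (w x) div Lam = u \<and> (\<exists>s\<in>{1..S}. \<exists>C\<in>path s u. \<exists>b<B.
     int (D ^ s) \<le> 4 * \<bar>noise w p X x s C (fst (w x) div D ^ s) b\<bar>)} \<le> Ns u / R"
proof -
  define E where "E l w \<longleftrightarrow> (\<exists>s\<in>{1..S}. \<exists>C\<in>path s u. \<exists>b<B. int (D ^ s) \<le> 4 * \<bar>noise w p X x s C (l div D ^ s) b\<bar>)" for l w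
  have Eind: "E l (w(x := r)) = E l w" for l w r
  proof -
    have "noise (w(x := r)) p X x s C \<beta> b = noise w p X x s C \<beta> b" for s C \<beta> b
      unfolding noise_def Let_def by (intro sum.cong) auto
    then show ?thesis by (simp add: E_def)
  qed
  have E: "measure_pmf.prob sp {w. E l w} \<le> Ns u" for l
  proof -
    have "measure_pmf.prob sp {w. E l w} \<le> measure_pmf.prob sp (\<Union>s\<in>{1..S}. \<Union>C\<in>path s u. \<Union>b\<in>{..<B}. {w. int (D ^ s) \<le> 4 * \<bar>noise w p X x s C (l div D ^ s) b\<bar>})"
      by (intro measure_pmf.finite_measure_mono) (auto simp: E_def)
    also have "\<dots> \<le> (\<Sum>s\<in>{1..S}. measure_pmf.prob sp (\<Union>C\<in>path s u. \<Union>b\<in>{..<B}. {w. int (D ^ s) \<le> 4 * \<bar>noise w p X x s C (l div D ^ s) b\<bar>}))"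
      by (intro measure_pmf.finite_measure_subadditive_finite) auto
    also have "\<dots> \<le> (\<Sum>s\<in>{1..S}. \<Sum>C\<in>path s u. measure_pmf.prob sp (\<Union>b\<in>{..<B}. {w. int (D ^ s) \<le> 4 * \<bar>noise w p X x s C (l div D ^ s) b\<bar>}))"
      using finite_path by (intro sum_mono measure_pmf.finite_measure_subadditive_finite) auto
    also have "\<dots> \<le> (\<Sum>s\<in>{1..S}. \<Sum>C\<in>path s u. \<Sum>b<B. measure_pmf.prob sp {w. int (D ^ s) \<le> 4 * \<bar>noise w p X x s C (l div D ^ s) b\<bar>})"
      by (intro sum_mono measure_pmf.finite_measure_subadditive_finite) auto
    also have "\<dots> \<le> Ns u" unfolding Ns_def using assms by (intro sum_mono noise_prob)
    finally show ?thesis .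
  qed
  define T where "T = {u * Lam..<Suc u * Lam}"
  have "measure_pmf.prob sp {w. fst (w x) div Lam = u \<and> (\<exists>s\<in>{1..S}. \<exists>C\<in>path s u. \<exists>b<B.
     int (D ^ s) \<le> 4 * \<bar>noise w p X x s C (fst (w x) div D ^ s) b\<bar>)} \<le> measure_pmf.prob sp (\<Union>l\<in>T. {w. w x \<in> {r. fst r \<in> {l}} \<and> E l w})"
  proof (intro measure_pmf.finite_measure_mono subsetI)
    fix w assume w: "w \<in> {w. fst (w x) div Lam = u \<and> (\<exists>s\<in>{1..S}. \<exists>C\<in>path s u. \<exists>b<B.
     int (D ^ s) \<le> 4 * \<bar>noise w p X x s C (fst (w x) div D ^ s) b\<bar>)}"
    then have "fst (w x) \<in> T" using tick_set[of u] unfolding T_def by blast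
    moreover have "E (fst (w x)) w" using w by (simp add: E_def)
    ultimately show "w \<in> (\<Union>l\<in>T. {w. w x \<in> {r. fst r \<in> {l}} \<and> E l w})" by blast
  qed auto
  also have "\<dots> \<le> (\<Sum>l\<in>T. measure_pmf.prob sp {w. w x \<in> {r. fst r \<in> {l}} \<and> E l w})"
    by (intro measure_pmf.finite_measure_subadditive_finite) (auto simp: T_def)
  also have "\<dots> = (\<Sum>l\<in>T. measure_pmf.prob lp {r. fst r \<in> {l}} * measure_pmf.prob sp {w. E l w})"
    by (intro sum.cong refl sp_coord) (use assms Eind in auto)
  also have "\<dots> \<le> (\<Sum>l\<in>T. (real 1 / (R * Lam)) * Ns u)"
    using E by (intro sum_mono mult_mono prob_lp_le) auto
  also have "\<dots> = Ns u / R" using Lam_pos by (simp add: T_def)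
  finally show ?thesis .
qed

text \<open>The events that \<open>x\<close> is labelled with tick \<open>u\<close> are disjoint for
  different \<open>u\<close>, and each has probability \<open>1 / R\<close>. Summed over the good
  starting ticks, what remains after the five kinds of failure adds up.\<close>

theorem slot_success:
  assumes x: "x \<in> U" and reg: "regular q D (N * a S) X x" and G: "G \<subseteq> {..<Wb}"
    and good: "\<And>u k. u \<in> G \<Longrightarrow> 1 \<le> k \<Longrightarrow> k \<le> 3 * a 1 \<Longrightarrow> k \<le> 4 * card {i\<in>{u..<u+k}. hit q X x i}"
  shows "(real (card G) - (\<Sum>u<Wb. Lf u + I0 u + IS u + real q / R + Ns u)) / R \<le>
    measure_pmf.prob sp {w. st w p X ((N - 1) * a S) = Some (fst (w x)) \<and> tst w p X S (N - 1) (fst (w x) div D ^ S) x}"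
proof -
  define win where "win w \<longleftrightarrow> st w p X ((N - 1) * a S) = Some (fst (w x)) \<and> tst w p X S (N - 1) (fst (w x) div D ^ S) x" for w
  define A where "A u = {w :: nat \<Rightarrow> nat \<times> bool. fst (w x) div Lam = u}" for u
  define bad where "bad u = Lf u + I0 u + IS u + real q / R + Ns u" for u
  have bad0: "0 \<le> bad u" for u
    unfolding bad_def Lf_def I0_def IS_def Ns_def by (intro add_nonneg_nonneg sum_nonneg divide_nonneg_nonneg) auto
  have finG: "finite G" using G finite_subset by blast
  have fail: "measure_pmf.prob sp (A u \<inter> {w. \<not> win w}) \<le> bad u / R" if u: "u \<in> G" for u
  proof -
    have uR: "u < R" "u < Wb" using u G Wb_R by auto
    have hitu: "hit q X x u"
    proof -
      have "1 \<le> 4 * card {i\<in>{u..<u+1}. hit q X x i}" using good[OF u, of 1] a_pos[of 1] by (simp del: a_pos)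
      then have "{i\<in>{u..<u+1}. hit q X x i} \<noteq> {}" by (metis card.empty mult_0_right not_one_le_zero)
      then show ?thesis by auto
    qed
    define F1 where "F1 = {w :: nat \<Rightarrow> nat \<times> bool. fst (w x) div Lam = u \<and> (\<exists>z\<in>U. fst (w z) div Lam < u \<and> life p X (fst (w z) div Lam) u z)}"
    define F2 where "F2 = {w. fst (w x) div Lam = u \<and> (\<exists>v. imp0 X w v u)}"
    define F3 where "F3 = {w. fst (w x) div Lam = u \<and> (\<exists>s\<in>{1..S}. \<exists>c. impS X w s c u)}"
    define F4 where "F4 = {w :: nat \<Rightarrow> nat \<times> bool. fst (w x) div Lam = u \<and> (\<exists>y. y \<noteq> x \<and> hit q X y u \<and> fst (w y) div Lam = u)}"
    define F5 where "F5 = {w. fst (w x) div Lam = u \<and> (\<exists>s\<in>{1..S}. \<exists>C\<in>path s u. \<exists>b<B.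
     int (D ^ s) \<le> 4 * \<bar>noise w p X x s C (fst (w x) div D ^ s) b\<bar>)}"
    have "A u \<inter> {w. \<not> win w} \<subseteq> F1 \<union> F2 \<union> F3 \<union> F4 \<union> F5"
    proof
      fix w assume w: "w \<in> A u \<inter> {w. \<not> win w}"
      then have wu: "u = fst (w x) div Lam" by (simp add: A_def)
      show "w \<in> F1 \<union> F2 \<union> F3 \<union> F4 \<union> F5"
      proof (rule ccontr)
        assume n: "w \<notin> F1 \<union> F2 \<union> F3 \<union> F4 \<union> F5"
        have free: "st w p X u = None"
        proof (cases "st w p X u")
          case (Some l)
          from occupied_explained[OF this p_less XU uR(2)] show ?thesis using n wu unfolding F1_def F2_def F3_def by blast
        qed
        have "win w" unfolding win_def
        proof
          note hs = heavy_survives[where w = w and p = p, OF reg p_less x wu uR(2) free hitu]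
          have c: "y = x" if "hit q X y u" "fst (w y) div Lam = u" for y using n wu that unfolding F4_def by blast
          have ns: "4 * \<bar>noise w p X x s C (fst (w x) div D ^ s) b\<bar> < int (D ^ s)"
            if "1 \<le> s" "s \<le> S" "C \<in> path s u" "b < B" for s C b
          proof (rule ccontr)
            assume "\<not> ?thesis"
            then have "int (D ^ s) \<le> 4 * \<bar>noise w p X x s C (fst (w x) div D ^ s) b\<bar>" by simp
            then have "w \<in> F5" using that wu unfolding F5_def mem_Collect_eq by (metis atLeastAtMost_iff)
            then show False using n by blast
          qed
          show "st w p X ((N - 1) * a S) = Some (fst (w x))" by (rule hs(1)) (use c ns good[OF u] in auto)
          show "tst w p X S (N - 1) (fst (w x) div D ^ S) x" by (rule hs(2)) (use c ns good[OF u] in auto)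
        qed
        then show False using w by simp
      qed
    qed
    then have "measure_pmf.prob sp (A u \<inter> {w. \<not> win w}) \<le> measure_pmf.prob sp (F1 \<union> F2 \<union> F3 \<union> F4 \<union> F5)"
      by (intro measure_pmf.finite_measure_mono) auto
    also have "\<dots> \<le> measure_pmf.prob sp F1 + measure_pmf.prob sp F2 + measure_pmf.prob sp F3 + measure_pmf.prob sp F4 + measure_pmf.prob sp F5"
      by (intro order_trans[OF measure_Un_le] add_mono) auto
    also have "\<dots> \<le> Lf u / R + I0 u / R + IS u / R + (real q / R) / R + Ns u / R"
      unfolding F1_def F2_def F3_def F4_def F5_def
      by (intro add_mono prob_life prob_imp0 prob_impS prob_competitor prob_noise x uR)
    also have "\<dots> = bad u / R" by (simp add: bad_def add_divide_distrib)
    finally show ?thesis .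
  qed
  \<comment> \<open>The failure terms are nonnegative, so their sum over the unknown set
    \<open>G\<close> is at most the sum over all birth ticks, which can be estimated.\<close>
  have "(real (card G) - (\<Sum>u<Wb. bad u)) / R \<le> (real (card G) - (\<Sum>u\<in>G. bad u)) / R"
    using G bad0 by (intro divide_right_mono diff_left_mono sum_mono2) auto
  also have "\<dots> = (\<Sum>u\<in>G. 1 / R - bad u / R)" by (simp add: sum_subtractf sum_divide_distrib diff_divide_distrib)
  also have "\<dots> \<le> (\<Sum>u\<in>G. measure_pmf.prob sp (A u \<inter> {w. win w}))"
  proof (rule sum_mono)
    fix u assume u: "u \<in> G"
    then have "u < R" using G Wb_R by auto
    have "A u = {w. w x \<in> {v. fst v div Lam = u}}" by (auto simp: A_def)
    then have "measure_pmf.prob sp (A u) = 1 / R" using prob_tick[OF \<open>u < R\<close>] by (simp only: sp_comp[OF x])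
    moreover have "measure_pmf.prob sp (A u) \<le> measure_pmf.prob sp (A u \<inter> {w. win w}) + measure_pmf.prob sp (A u \<inter> {w. \<not> win w})"
    proof -
      have "A u = (A u \<inter> {w. win w}) \<union> (A u \<inter> {w. \<not> win w})" by auto
      then show ?thesis using measure_Un_le[of "A u \<inter> {w. win w}" sp "A u \<inter> {w. \<not> win w}"] by simp
    qed
    ultimately show "1 / R - bad u / R \<le> measure_pmf.prob sp (A u \<inter> {w. win w})" using fail[OF u] by linarith
  qed
  also have "\<dots> = measure_pmf.prob sp (\<Union>u\<in>G. A u \<inter> {w. win w})"
    using finG by (intro measure_pmf.finite_measure_finite_Union[symmetric]) (auto simp: disjoint_family_on_def A_def)
  also have "\<dots> \<le> measure_pmf.prob sp {w. win w}" by (intro measure_pmf.finite_measure_mono) auto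
  finally show ?thesis by (simp add: bad_def win_def)
qed

end
end

end

section \<open>Bounds on the failure terms\<close>

lemma sum_card_swap:
  assumes "finite I" "finite T"
  shows "(\<Sum>c\<in>I. card {t\<in>T. P c t}) = (\<Sum>t\<in>T. card {c\<in>I. P c t})"
  using sum.swap_restrict[OF assms, of "\<lambda>_ _. 1::nat" P] by simp

text \<open>\<open>D\<close> dominates the polylogarithmic factors, and 20 factors of
  \<open>D\<close> in \<open>Lam\<close> absorb all collision and noise estimates. Adoptions use the
  first 1/64 of the cells of the last stage, which leaves the others to expose light
  elements.\<close>

locale tuned_slots = random_slots +
  assumes AD: "4 * B * m \<le> D" and LamD: "Lam = D ^ 20" and SD: "S \<le> D" and D_big: "D \<ge> 4096"
    and WbN: "Wb = (N div 64) * a S" and DN: "D \<le> N" and qR: "64 * q \<le> R" and RD: "R \<le> D ^ (S + 5)"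
begin

definition F2 :: "(nat \<Rightarrow> nat) \<Rightarrow> nat" where "F2 X = (\<Sum>z\<in>U. (tot X z)\<^sup>2)"

lemma D_ge1 [simp]: "Suc 0 \<le> D" using D_pos by linarith

lemma a_le: "a s \<le> D ^ Suc s" unfolding a_def power_Suc using AD by (rule mult_le_mono1)

text \<open>One factor of each square is bounded by the total count; the sum of the other factors
  counts each occurrence once per window containing it, hence at most \<open>K\<close>
  times.\<close>

lemma sum_cnt_squares:
  assumes I: "finite I" and hi: "\<And>c. c \<in> I \<Longrightarrow> hi c \<le> N * a S * q"
    and K: "\<And>t. card {c\<in>I. lo c \<le> t \<and> t < hi c} \<le> K"
  shows "(\<Sum>c\<in>I. (cnt X z (lo c) (hi c))\<^sup>2) \<le> K * (tot X z)\<^sup>2"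
proof -
  define Oc where "Oc = {t\<in>{0..<N * a S * q}. X t = z}"
  have fin: "finite Oc" by (simp add: Oc_def)
  have cO: "card Oc = tot X z" by (simp add: Oc_def tot_def cnt_def)
  have eq: "cnt X z (lo c) (hi c) = card {t\<in>Oc. lo c \<le> t \<and> t < hi c}" if "c \<in> I" for c
    unfolding cnt_def Oc_def using hi[OF that] by (intro arg_cong[where f = card]) auto
  have le: "cnt X z (lo c) (hi c) \<le> tot X z" if "c \<in> I" for c
    using hi[OF that] unfolding tot_def by (intro cnt_mono) auto
  have "(\<Sum>c\<in>I. (cnt X z (lo c) (hi c))\<^sup>2) \<le> (\<Sum>c\<in>I. cnt X z (lo c) (hi c) * tot X z)"
    using le by (intro sum_mono) (simp add: power2_eq_square)
  also have "\<dots> = (\<Sum>c\<in>I. card {t\<in>Oc. lo c \<le> t \<and> t < hi c}) * tot X z" by (simp add: sum_distrib_right eq)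
  also have "(\<Sum>c\<in>I. card {t\<in>Oc. lo c \<le> t \<and> t < hi c}) = (\<Sum>t\<in>Oc. card {c\<in>I. lo c \<le> t \<and> t < hi c})"
    by (rule sum_card_swap[OF I fin])
  also have "\<dots> \<le> (\<Sum>t\<in>Oc. K)" using K by (rule sum_mono)
  also have "\<dots> = K * tot X z" using cO by simp
  finally show ?thesis by (simp add: power2_eq_square mult.assoc)
qed

lemma sum_energy_le:
  assumes I: "finite I" and hi: "\<And>c. c \<in> I \<Longrightarrow> hi c \<le> N * a S * q"
    and K: "\<And>t. card {c\<in>I. lo c \<le> t \<and> t < hi c} \<le> K"
  shows "(\<Sum>c\<in>I. \<Sum>z\<in>U. (cnt X z (lo c) (hi c))\<^sup>2) \<le> K * F2 X"
proof -
  have "(\<Sum>c\<in>I. \<Sum>z\<in>U. (cnt X z (lo c) (hi c))\<^sup>2) = (\<Sum>z\<in>U. \<Sum>c\<in>I. (cnt X z (lo c) (hi c))\<^sup>2)" by (rule sum.swap)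
  also have "\<dots> \<le> (\<Sum>z\<in>U. K * (tot X z)\<^sup>2)" using sum_cnt_squares[OF I hi K] by (intro sum_mono)
  finally show ?thesis by (simp add: F2_def sum_distrib_left)
qed

section \<open>The failure terms summed over all birth ticks\<close>

context
  fixes X :: "nat \<Rightarrow> nat"
  assumes XU: "\<And>t. X t \<in> U" and F2R: "200000 * F2 X \<le> R * Wb"
begin

text \<open>Counting alone suffices: fewer than \<open>6 * a 1\<close> birth ticks matter, with at
  most \<open>3 * a 1 * q\<close> elements each. \<open>Lam\<close> exceeds the cube of
  \<open>a 1\<close>, and \<open>R\<close> exceeds \<open>64 * q\<close>.\<close>

lemma I0_le: "I0 X u \<le> 1 / 64"
proof -
  define Vs where "Vs = {v. v < u \<and> u < v + 6 * a 1}"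
  have "card Vs \<le> card {u - 6 * a 1..<u}" unfolding Vs_def by (intro card_mono) auto
  then have cV: "card Vs \<le> 6 * a 1" by simp
  have occ: "card (occ X v) \<le> 3 * a 1 * q" for v
  proof -
    have "card (occ X v) \<le> card {v * q..<(v + 3 * a 1) * q}" unfolding occ_def by (rule card_image_le) simp
    then show ?thesis by (simp add: algebra_simps)
  qed
  have cube: "54 * a 1 ^ 3 * q ^ 2 * 64 \<le> R ^ 2 * Lam"
  proof -
    have "a 1 ^ 3 \<le> (D ^ 2) ^ 3" using a_le[of 1] by (intro power_mono) (auto simp: numeral_2_eq_2)
    also have "\<dots> = D ^ 6" by (simp add: power_mult[symmetric])
    also have "\<dots> \<le> D ^ 20" by (intro power_increasing) auto
    finally have "a 1 ^ 3 \<le> Lam" by (simp add: LamD)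
    moreover have "54 * 64 * q ^ 2 \<le> R ^ 2"
    proof -
      have "54 * 64 * q ^ 2 \<le> (64 * q) ^ 2" by (simp add: power_mult_distrib)
      also have "\<dots> \<le> R ^ 2" using qR by (intro power_mono) auto
      finally show ?thesis .
    qed
    ultimately have "(54 * 64 * q ^ 2) * a 1 ^ 3 \<le> R ^ 2 * Lam" by (rule mult_le_mono[rotated])
    then show ?thesis by (simp add: mult_ac)
  qed
  have pos: "real R ^ 2 * real Lam > 0" using R_pos Lam_pos by simp
  have "I0 X u \<le> (\<Sum>v\<in>Vs. real ((3 * a 1 * q) ^ 2) / (real R ^ 2 * Lam))"
    unfolding I0_def Vs_def[symmetric] using occ by (intro sum_mono divide_right_mono of_nat_mono power_mono) auto
  also have "\<dots> = real (card Vs * (3 * a 1 * q) ^ 2) / (real R ^ 2 * Lam)" by simp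
  also have "\<dots> \<le> real (6 * a 1 * (3 * a 1 * q) ^ 2) / (real R ^ 2 * Lam)"
    using cV by (intro divide_right_mono of_nat_mono mult_le_mono1) auto
  also have "\<dots> \<le> 1 / 64"
  proof -
    have "6 * a 1 * (3 * a 1 * q) ^ 2 * 64 \<le> R ^ 2 * Lam" using cube by (simp add: power2_eq_square power3_eq_cube mult_ac)
    then have "real (6 * a 1 * (3 * a 1 * q) ^ 2 * 64) \<le> real (R ^ 2 * Lam)" by (simp only: of_nat_le_iff)
    then show ?thesis using pos by (simp add: field_simps)
  qed
  finally show ?thesis .
qed

lemma stages_le: "S * (F2 X / (R * real D ^ 2)) \<le> Wb / 64"
proof -
  have "real (200000 * F2 X) \<le> real (R * Wb)" using F2R by (simp only: of_nat_le_iff)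
  then have "real (F2 X) / R \<le> Wb / 200000" using R_pos by (simp add: field_simps)
  moreover have "real S / real D ^ 2 \<le> 1"
  proof -
    have "real S \<le> real D * 1" using SD by simp
    also have "\<dots> \<le> real D * real D" using D_ge by (intro mult_left_mono) auto
    finally show ?thesis by (simp add: power2_eq_square divide_le_eq)
  qed
  ultimately have "(real S / real D ^ 2) * (real (F2 X) / R) \<le> 1 * (Wb / 200000)" by (intro mult_mono) auto
  moreover have "S * (F2 X / (R * real D ^ 2)) = (real S / real D ^ 2) * (real (F2 X) / R)" by simp
  ultimately show ?thesis by linarith
qed

lemma big_energy: "1 \<le> s \<Longrightarrow> card (big X s c) * D ^ (2 * s) \<le>
  D^2 * (\<Sum>z\<in>U. (cnt X z (c * a s * q) (min ((c + D^2) * a s * q) (N * a S * q)))\<^sup>2)"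
proof -
  assume s: "1 \<le> s"
  define E where "E z = cnt X z (c * a s * q) (min ((c + D^2) * a s * q) (N * a S * q))" for z
  have "D ^ (s - 1) \<le> E z" if "z \<in> big X s c" for z
  proof -
    have "3 * B * D ^ (s - 1) \<le> 2 * E z" using that by (simp add: big_def E_def)
    moreover have "3 * 1 * D ^ (s - 1) \<le> 3 * B * D ^ (s - 1)" using B_pos by (intro mult_le_mono1 mult_le_mono2) auto
    ultimately show ?thesis by linarith
  qed
  then have "(\<Sum>z\<in>big X s c. (D ^ (s - 1))\<^sup>2) \<le> (\<Sum>z\<in>big X s c. (E z)\<^sup>2)" by (intro sum_mono power_mono) auto
  also have "\<dots> \<le> (\<Sum>z\<in>U. (E z)\<^sup>2)" using finite_U by (intro sum_mono2) (auto simp: big_def)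
  finally have "card (big X s c) * (D ^ (s - 1))\<^sup>2 \<le> (\<Sum>z\<in>U. (E z)\<^sup>2)" by simp
  then have "D^2 * (card (big X s c) * (D ^ (s - 1))\<^sup>2) \<le> D^2 * (\<Sum>z\<in>U. (E z)\<^sup>2)" by (rule mult_le_mono2)
  moreover have "D^2 * (card (big X s c) * (D ^ (s - 1))\<^sup>2) = card (big X s c) * D ^ (2 * s)"
  proof -
    have "D ^ (2 * s) = (D * D ^ (s - 1))\<^sup>2" using s by (simp add: power_mult[of D 2] power_even_eq flip: power_Suc)
    then show ?thesis by (simp add: power_mult_distrib)
  qed
  ultimately show ?thesis unfolding E_def by (simp only:)
qed

text \<open>Each uncapped term is at most \<open>y\<^sup>2\<close> for a \<open>y\<close> linear in
  the number of big elements, and the minimum of 1 and \<open>y\<^sup>2\<close> is at most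
  \<open>y\<close>. Big elements are paid for by the energy of their windows, and an occurrence lies
  in at most \<open>D^2\<close> windows per stage.\<close>

lemma IS_sum: "(\<Sum>u<Wb. IS X u) \<le> Wb / 64"
proof -
  define Q where "Q s c u \<longleftrightarrow> c + 3 \<le> u div a s \<and> u div a s < c + D^2" for s c u
  define E where "E s c = (\<Sum>z\<in>U. (cnt X z (c * a s * q) (min ((c + D^2) * a s * q) (N * a S * q)))\<^sup>2)" for s c
  have min: "min 1 (real (card (big X s c) ^ 2) * (real (a s) * real (D ^ s)) / (real R ^ 2 * Lam))
     \<le> real (card (big X s c)) * D ^ Suc s / (R * real D ^ 10)" for s c
  proof -
    define y where "y = real (card (big X s c)) * D ^ Suc s / (R * real D ^ 10)"
    have y0: "0 \<le> y" by (simp add: y_def)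
    have "real (a s) * real (D ^ s) \<le> (real (D ^ Suc s))\<^sup>2"
    proof -
      have "a s * D ^ s \<le> D ^ Suc s * D ^ Suc s" using a_le[of s] by (intro mult_le_mono) auto
      then have "real (a s * D ^ s) \<le> real (D ^ Suc s * D ^ Suc s)" by (simp only: of_nat_le_iff)
      then show ?thesis by (simp only: power2_eq_square of_nat_mult)
    qed
    then have "real (card (big X s c) ^ 2) * (real (a s) * real (D ^ s)) / (real R ^ 2 * Lam) \<le>
       real (card (big X s c) ^ 2) * (real (D ^ Suc s))\<^sup>2 / (real R ^ 2 * Lam)"
      by (intro divide_right_mono mult_left_mono) auto
    also have "\<dots> = y\<^sup>2"
    proof -
      have "real Lam = (real D ^ 10)\<^sup>2" by (simp add: LamD power_mult[symmetric])
      then show ?thesis by (simp add: y_def power_divide power_mult_distrib)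
    qed
    finally have le: "real (card (big X s c) ^ 2) * (real (a s) * real (D ^ s)) / (real R ^ 2 * Lam) \<le> y\<^sup>2" .
    show ?thesis
    proof (cases "y \<le> 1")
      case True
      then have "y\<^sup>2 \<le> y" using y0 by (simp add: power2_eq_square mult_left_le)
      then show ?thesis using le unfolding y_def[symmetric] min_le_iff_disj by linarith
    next
      case False
      then show ?thesis unfolding y_def[symmetric] min_le_iff_disj by linarith
    qed
  qed
  have stage: "(\<Sum>u<Wb. \<Sum>c\<in>{c\<in>{..<Wb}. Q s c u}. real (card (big X s c)) * D ^ Suc s / (R * real D ^ 10)) \<le> F2 X / (R * real D ^ 2)"
    if s: "s \<in> {1..S}" for s
  proof -
    have "(\<Sum>u<Wb. \<Sum>c\<in>{c\<in>{..<Wb}. Q s c u}. card (big X s c) * D ^ Suc s) = (\<Sum>c<Wb. \<Sum>u\<in>{u\<in>{..<Wb}. Q s c u}. card (big X s c) * D ^ Suc s)"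
      by (rule sum.swap_restrict) auto
    also have "\<dots> \<le> (\<Sum>c<Wb. D ^ 6 * E s c)"
    proof (rule sum_mono)
      fix c
      have "card {u\<in>{..<Wb}. Q s c u} \<le> card {c * a s..<(c + D^2) * a s}"
      proof (intro card_mono subsetI)
        fix u assume "u \<in> {u\<in>{..<Wb}. Q s c u}"
        then have u: "c \<le> u div a s" "u div a s < c + D^2" by (auto simp: Q_def)
        then show "u \<in> {c * a s..<(c + D^2) * a s}" by (simp add: less_eq_div_iff_mult_less_eq div_less_iff_less_mult)
      qed simp
      also have "\<dots> = D^2 * a s" by (simp add: algebra_simps)
      also have "\<dots> \<le> D^2 * D ^ Suc s" using a_le by (rule mult_le_mono2)
      finally have "card {u\<in>{..<Wb}. Q s c u} * (card (big X s c) * D ^ Suc s) \<le> (D^2 * D ^ Suc s) * (card (big X s c) * D ^ Suc s)"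
        by (rule mult_le_mono1)
      also have "\<dots> = D^4 * (card (big X s c) * D ^ (2 * s))"
        by (simp add: power_add[symmetric] mult_2 mult_ac numeral_eq_Suc)
      also have "\<dots> \<le> D^4 * (D^2 * E s c)" using big_energy[of s c] s by (intro mult_le_mono2) (simp add: E_def)
      also have "\<dots> = D^6 * E s c" by (simp add: power_add[symmetric] flip: mult.assoc)
      finally show "(\<Sum>u\<in>{u\<in>{..<Wb}. Q s c u}. card (big X s c) * D ^ Suc s) \<le> D^6 * E s c" by simp
    qed
    also have "\<dots> = D ^ 6 * (\<Sum>c<Wb. E s c)" by (simp add: sum_distrib_left)
    also have "(\<Sum>c<Wb. E s c) \<le> D^2 * F2 X"
      unfolding E_def
    proof (rule sum_energy_le)
      fix t
      have "{c\<in>{..<Wb}. c * a s * q \<le> t \<and> t < min ((c + D^2) * a s * q) (N * a S * q)} \<subseteq> {Suc (t div (a s * q)) - D^2..<Suc (t div (a s * q))}"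
      proof
        fix c assume "c \<in> {c\<in>{..<Wb}. c * a s * q \<le> t \<and> t < min ((c + D^2) * a s * q) (N * a S * q)}"
        then have "c * (a s * q) \<le> t" "t < (c + D^2) * (a s * q)" by (auto simp: mult.assoc)
        then have "c \<le> t div (a s * q)" "t div (a s * q) < c + D^2"
          using q_pos by (simp_all add: less_eq_div_iff_mult_less_eq div_less_iff_less_mult)
        then show "c \<in> {Suc (t div (a s * q)) - D^2..<Suc (t div (a s * q))}" by auto
      qed
      then have "card {c\<in>{..<Wb}. c * a s * q \<le> t \<and> t < min ((c + D^2) * a s * q) (N * a S * q)} \<le> card {Suc (t div (a s * q)) - D^2..<Suc (t div (a s * q))}"
        by (intro card_mono) auto
      then show "card {c\<in>{..<Wb}. c * a s * q \<le> t \<and> t < min ((c + D^2) * a s * q) (N * a S * q)} \<le> D^2" by simp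
    qed auto
    finally have "(\<Sum>u<Wb. \<Sum>c\<in>{c\<in>{..<Wb}. Q s c u}. card (big X s c) * D ^ Suc s) \<le> D^6 * (D^2 * F2 X)" by simp
    then have "real (\<Sum>u<Wb. \<Sum>c\<in>{c\<in>{..<Wb}. Q s c u}. card (big X s c) * D ^ Suc s) \<le> real (D^6 * (D^2 * F2 X))" by (simp only: of_nat_le_iff)
    then have "real (\<Sum>u<Wb. \<Sum>c\<in>{c\<in>{..<Wb}. Q s c u}. card (big X s c) * D ^ Suc s) / (R * real D ^ 10) \<le> real (D^6 * (D^2 * F2 X)) / (R * real D ^ 10)"
      by (intro divide_right_mono) auto
    also have "real (D^6 * (D^2 * F2 X)) / (R * real D ^ 10) = F2 X / (R * real D ^ 2)"
    proof -
      have "real D ^ 10 = real D ^ 8 * real D ^ 2" "real (D^6 * (D^2 * F2 X)) = real D ^ 8 * F2 X" by (simp_all add: power_add[symmetric] flip: mult.assoc)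
      moreover have "real D ^ 8 \<noteq> 0" by simp
      moreover have "real R * (real D ^ 8 * real D ^ 2) = real D ^ 8 * (real R * real D ^ 2)" by (simp only: mult_ac)
      ultimately show ?thesis by (simp only: nonzero_mult_divide_mult_cancel_left not_False_eq_True)
    qed
    finally show ?thesis by (simp add: sum_divide_distrib)
  qed
  have "(\<Sum>u<Wb. IS X u) \<le> (\<Sum>u<Wb. \<Sum>s\<in>{1..S}. \<Sum>c\<in>{c\<in>{..<Wb}. Q s c u}. real (card (big X s c)) * D ^ Suc s / (R * real D ^ 10))"
  proof (rule sum_mono)
    fix u assume "u \<in> {..<Wb}"
    then have lt: "u div a s < Wb" for s using le_less_trans[OF div_le_dividend[of u "a s"], of Wb] by simp
    have "{c. c + 3 \<le> u div a s \<and> u div a s < c + D^2} = {c\<in>{..<Wb}. Q s c u}" for s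
      using lt[of s] unfolding Q_def by auto
    then show "IS X u \<le> (\<Sum>s\<in>{1..S}. \<Sum>c\<in>{c\<in>{..<Wb}. Q s c u}. real (card (big X s c)) * D ^ Suc s / (R * real D ^ 10))"
      unfolding IS_def by (simp only:) (intro sum_mono min)
  qed
  also have "\<dots> = (\<Sum>s\<in>{1..S}. \<Sum>u<Wb. \<Sum>c\<in>{c\<in>{..<Wb}. Q s c u}. real (card (big X s c)) * D ^ Suc s / (R * real D ^ 10))" by (rule sum.swap)
  also have "\<dots> \<le> (\<Sum>s\<in>{1..S}. F2 X / (R * real D ^ 2))" using stage by (rule sum_mono)
  also have "\<dots> = S * (F2 X / (R * real D ^ 2))" by simp
  also have "\<dots> \<le> Wb / 64" by (rule stages_le)
  finally show ?thesis .
qed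

text \<open>A cell is on the path of at most \<open>D^2 * a s\<close> birth ticks, and the cells of
  one stage are disjoint, so their energies add up to at most \<open>F2 X\<close>. The powers of
  \<open>D\<close> in \<open>Lam\<close> absorb the rest.\<close>

lemma Ns_sum:
  assumes p: "\<And>s C. p s C < m"
  shows "(\<Sum>u<Wb. Ns X p u) \<le> Wb / 64"
proof -
  define E where "E s C = (\<Sum>z\<in>U. (cnt X z (C * a s * q) (Suc C * a s * q))\<^sup>2)" for s C
  have part_sub: "part p s C b \<subseteq> {C * a s * q..<Suc C * a s * q}" if "b < B" for s C b
  proof -
    have "Suc b * (D ^ s * q) \<le> 4 * B * (D ^ s * q)" using that by (intro mult_le_mono1) simp
    then show ?thesis using sbi_ge[of C s "p s C"] sbi_end[OF p, of s C s C] unfolding part_def ivl_subset by linarith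
  qed
  have energy: "energy X p s C b \<le> E s C" if "b < B" for s C b
    unfolding energy_def E_def cnt_def using part_sub[OF that, of s C] by (intro sum_mono power_mono card_mono) auto
  have stage: "(\<Sum>u<Wb. \<Sum>C\<in>{C\<in>{..<N * a S}. C \<in> path s u}. \<Sum>b<B. 16 * real (energy X p s C b) / (real R * Lam * real (D ^ s))) \<le> F2 X / (R * real D ^ 2)"
    if s: "s \<in> {1..S}" for s
  proof -
    have "(\<Sum>u<Wb. \<Sum>C\<in>{C\<in>{..<N * a S}. C \<in> path s u}. \<Sum>b<B. 16 * energy X p s C b) \<le> (\<Sum>u<Wb. \<Sum>C\<in>{C\<in>{..<N * a S}. C \<in> path s u}. \<Sum>b<B. 16 * E s C)"
      using energy by (intro sum_mono mult_le_mono2) auto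
    also have "\<dots> = (\<Sum>u<Wb. \<Sum>C\<in>{C\<in>{..<N * a S}. C \<in> path s u}. 16 * B * E s C)" by (simp add: mult_ac)
    also have "\<dots> = (\<Sum>C<N * a S. \<Sum>u\<in>{u\<in>{..<Wb}. C \<in> path s u}. 16 * B * E s C)"
      by (rule sum.swap_restrict) auto
    also have "\<dots> \<le> (\<Sum>C\<in>{C\<in>{..<N * a S}. Suc C * a s \<le> N * a S}. D ^ (s + 5) * E s C)"
    proof -
      have "(\<Sum>u\<in>{u\<in>{..<Wb}. C \<in> path s u}. 16 * B * E s C) \<le> (if Suc C * a s \<le> N * a S then D ^ (s + 5) * E s C else 0)" for C
      proof (cases "Suc C * a s \<le> N * a S")
        case True
        have "card {u\<in>{..<Wb}. C \<in> path s u} \<le> card {(Suc C - D^2) * a s..<Suc C * a s}"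
        proof (intro card_mono subsetI)
          fix u assume "u \<in> {u\<in>{..<Wb}. C \<in> path s u}"
          then have u: "u div a s < Suc C" "Suc C - D^2 \<le> u div a s" by (auto simp: path_def)
          then show "u \<in> {(Suc C - D^2) * a s..<Suc C * a s}" by (simp add: less_eq_div_iff_mult_less_eq div_less_iff_less_mult)
        qed simp
        also have "\<dots> = (Suc C - (Suc C - D^2)) * a s" by (simp only: card_atLeastLessThan diff_mult_distrib)
        also have "\<dots> \<le> D^2 * D ^ Suc s" using a_le by (intro mult_le_mono) auto
        finally have "card {u\<in>{..<Wb}. C \<in> path s u} * (16 * B * E s C) \<le> (D^2 * D ^ Suc s) * ((D * D) * E s C)"
          using AD D_big m_pos B_pos by (intro mult_le_mono) (auto intro: mult_le_mono order_trans[of B "4*B*m"])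
        also have "\<dots> = D ^ (s + 5) * E s C" by (simp add: power_add power2_eq_square mult_ac numeral_eq_Suc)
        finally show ?thesis using True by simp
      qed (auto simp: path_def)
      then have "(\<Sum>C<N * a S. \<Sum>u\<in>{u\<in>{..<Wb}. C \<in> path s u}. 16 * B * E s C) \<le> (\<Sum>C<N * a S. if Suc C * a s \<le> N * a S then D ^ (s + 5) * E s C else 0)"
        by (rule sum_mono)
      then show ?thesis by (simp only: sum.inter_filter[symmetric] finite_lessThan)
    qed
    also have "\<dots> = D ^ (s + 5) * (\<Sum>C\<in>{C\<in>{..<N * a S}. Suc C * a s \<le> N * a S}. E s C)" by (simp add: sum_distrib_left)
    also have "(\<Sum>C\<in>{C\<in>{..<N * a S}. Suc C * a s \<le> N * a S}. E s C) \<le> 1 * F2 X"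
      unfolding E_def
    proof (rule sum_energy_le)
      fix t
      have "{c \<in> {C\<in>{..<N * a S}. Suc C * a s \<le> N * a S}. c * a s * q \<le> t \<and> t < Suc c * a s * q} \<subseteq> {t div (a s * q)}"
      proof
        fix c assume "c \<in> {c \<in> {C\<in>{..<N * a S}. Suc C * a s \<le> N * a S}. c * a s * q \<le> t \<and> t < Suc c * a s * q}"
        then have "c * (a s * q) \<le> t" "t < Suc c * (a s * q)" by (simp_all only: mult.assoc mem_Collect_eq)
        then have "t div (a s * q) = c" using div_nat_eqI[of "a s * q" c t] by (simp only: mult.commute)
        then show "c \<in> {t div (a s * q)}" by simp
      qed
      then have "card {c \<in> {C\<in>{..<N * a S}. Suc C * a s \<le> N * a S}. c * a s * q \<le> t \<and> t < Suc c * a s * q} \<le> card {t div (a s * q)}"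
        by (intro card_mono) auto
      then show "card {c \<in> {C\<in>{..<N * a S}. Suc C * a s \<le> N * a S}. c * a s * q \<le> t \<and> t < Suc c * a s * q} \<le> 1" by simp
    qed auto
    finally have "(\<Sum>u<Wb. \<Sum>C\<in>{C\<in>{..<N * a S}. C \<in> path s u}. \<Sum>b<B. 16 * energy X p s C b) \<le> D ^ (s + 5) * F2 X" by simp
    then have "real (\<Sum>u<Wb. \<Sum>C\<in>{C\<in>{..<N * a S}. C \<in> path s u}. \<Sum>b<B. 16 * energy X p s C b) \<le> real (D ^ (s + 5) * F2 X)" by (simp only: of_nat_le_iff)
    then have "real (\<Sum>u<Wb. \<Sum>C\<in>{C\<in>{..<N * a S}. C \<in> path s u}. \<Sum>b<B. 16 * energy X p s C b) / (real R * Lam * real (D ^ s)) \<le> real (D ^ (s + 5) * F2 X) / (real R * Lam * real (D ^ s))"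
      by (intro divide_right_mono) auto
    also have "\<dots> = real (F2 X) / (real R * real D ^ 15)"
    proof -
      have "real Lam = real D ^ 5 * real D ^ 15" by (simp add: LamD power_add[symmetric])
      moreover have "real D ^ 5 * real (D ^ s) \<noteq> 0" by simp
      moreover have "real (D ^ (s + 5) * F2 X) = (real D ^ 5 * real (D ^ s)) * F2 X" by (simp add: power_add mult_ac)
      moreover have "real R * (real D ^ 5 * real D ^ 15) * real (D ^ s) = (real D ^ 5 * real (D ^ s)) * (real R * real D ^ 15)" by (simp only: mult_ac)
      ultimately show ?thesis by (simp only: nonzero_mult_divide_mult_cancel_left not_False_eq_True)
    qed
    also have "\<dots> \<le> real (F2 X) / (real R * real D ^ 2)"
      using R_pos D_ge by (intro divide_left_mono mult_left_mono power_increasing mult_pos_pos) auto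
    finally show ?thesis by (simp add: sum_divide_distrib)
  qed
  have "(\<Sum>u<Wb. Ns X p u) = (\<Sum>u<Wb. \<Sum>s\<in>{1..S}. \<Sum>C\<in>{C\<in>{..<N * a S}. C \<in> path s u}. \<Sum>b<B. 16 * real (energy X p s C b) / (real R * Lam * real (D ^ s)))"
  proof (rule sum.cong[OF refl])
    fix u
    have "path s u = {C\<in>{..<N * a S}. C \<in> path s u}" for s
    proof -
      have "C < N * a S" if "C \<in> path s u" for C
      proof -
        have "Suc C * 1 \<le> Suc C * a s" using a_pos[of s] by (intro mult_le_mono2) (simp del: a_pos)
        then show ?thesis using that by (simp add: path_def)
      qed
      then show ?thesis by auto
    qed
    then show "Ns X p u = (\<Sum>s\<in>{1..S}. \<Sum>C\<in>{C\<in>{..<N * a S}. C \<in> path s u}. \<Sum>b<B. 16 * real (energy X p s C b) / (real R * Lam * real (D ^ s)))"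
      unfolding Ns_def by (intro sum.cong) auto
  qed
  also have "\<dots> = (\<Sum>s\<in>{1..S}. \<Sum>u<Wb. \<Sum>C\<in>{C\<in>{..<N * a S}. C \<in> path s u}. \<Sum>b<B. 16 * real (energy X p s C b) / (real R * Lam * real (D ^ s)))" by (rule sum.swap)
  also have "\<dots> \<le> (\<Sum>s\<in>{1..S}. F2 X / (R * real D ^ 2))" using stage by (rule sum_mono)
  also have "\<dots> = S * (F2 X / (R * real D ^ 2))" by simp
  also have "\<dots> \<le> Wb / 64" by (rule stages_le)
  finally show ?thesis .
qed

text \<open>Regularity makes half of the first \<open>T\<close> ticks hits, and the walk then has at
  least \<open>T / 3\<close> good starts. Those among the last \<open>3 * a 1\<close> ticks are
  given up; they are at most an eighth of \<open>Wb\<close>.\<close>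

lemma card_good_starts:
  assumes reg: "regular q D (N * a S) X x"
  shows "Wb \<le> 4 * card {u\<in>{..<Wb}. \<forall>k. 1 \<le> k \<and> k \<le> 3 * a 1 \<longrightarrow> k \<le> 4 * card {i\<in>{u..<u+k}. hit q X x i}}"
proof -
  define T where "T = Wb + 3 * a 1"
  define good where "good u \<longleftrightarrow> (\<forall>k. 1 \<le> k \<and> u + k \<le> T \<longrightarrow> k \<le> 4 * card {i\<in>{u..<u+k}. hit q X x i})" for u
  have a1S: "a 1 \<le> a S" using S_pos by (intro a_mono)
  have TW: "T \<le> N * a S"
  proof -
    have "(N - 1) * a S \<le> N * a S" by (intro mult_le_mono1) simp
    then show ?thesis using Wb_cells a1S unfolding T_def by linarith
  qed
  have blocks: "j * D \<le> T \<Longrightarrow> j * D \<le> 2 * card {i\<in>{..<j * D}. hit q X x i}" for j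
  proof (induction j)
    case (Suc j)
    have "Suc j * D \<le> N * a S" using Suc.prems TW by linarith
    then have "D \<le> 2 * card {i\<in>{j * D..<Suc j * D}. hit q X x i}" using reg by (simp only: regular_def)
    moreover have "card {i\<in>{..<Suc j * D}. hit q X x i} = card {i\<in>{..<j * D}. hit q X x i} + card {i\<in>{j * D..<Suc j * D}. hit q X x i}"
      by (subst card_Un_disjoint[symmetric]) (auto intro!: arg_cong[where f = card])
    moreover have "j * D \<le> 2 * card {i\<in>{..<j * D}. hit q X x i}" using Suc by simp
    ultimately show ?case by simp
  qed simp
  have "D dvd a s" if "1 \<le> s" for s using that by (cases s) (auto simp: a_def)
  then have "D dvd T" using S_pos by (simp add: T_def WbN)
  then obtain j where j: "T = j * D" by (metis dvd_def mult.commute)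
  then have "T \<le> 2 * card {i\<in>{..<T}. hit q X x i}" using blocks[of j] by simp
  moreover have "4 * card {i\<in>{..<T}. hit q X x i} \<le> T + 3 * card {u\<in>{..<T}. good u}"
    unfolding good_def by (rule many_good_starts)
  ultimately have Tg: "T \<le> 3 * card {u\<in>{..<T}. good u}" by linarith
  have "card {u\<in>{..<T}. good u} \<le> card ({u\<in>{..<Wb}. good u} \<union> {Wb..<T})" by (intro card_mono) auto
  also have "\<dots> \<le> card {u\<in>{..<Wb}. good u} + card {Wb..<T}" by (rule card_Un_le)
  finally have "card {u\<in>{..<T}. good u} \<le> card {u\<in>{..<Wb}. good u} + 3 * a 1" by (simp add: T_def)
  moreover have "24 * a 1 \<le> Wb"
  proof -
    have "24 \<le> N div 64" using DN D_big by (simp add: less_eq_div_iff_mult_less_eq)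
    then have "24 * a S \<le> Wb" unfolding WbN by (rule mult_le_mono1)
    then show ?thesis using a1S by linarith
  qed
  ultimately have "Wb \<le> 4 * card {u\<in>{..<Wb}. good u}" using Tg T_def by linarith
  also have "card {u\<in>{..<Wb}. good u} \<le> card {u\<in>{..<Wb}. \<forall>k. 1 \<le> k \<and> k \<le> 3 * a 1 \<longrightarrow> k \<le> 4 * card {i\<in>{u..<u+k}. hit q X x i}}"
    by (intro card_mono) (auto simp: good_def T_def)
  finally show ?thesis by simp
qed

text \<open>A quarter of the \<open>Wb\<close> birth ticks are good. The failures cost 1/16 for
  \<open>Lf\<close> and 1/64 for each of the four other terms, together 1/8, so 1/8 remains.\<close>

lemma slot_success_tuned:
  assumes x: "x \<in> U" and reg: "regular q D (N * a S) X x" and p: "\<And>s C. p s C < m"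
    and Lf: "(\<Sum>u<Wb. Lf X p u) \<le> Wb / 16"
  shows "real Wb / (8 * R) \<le> measure_pmf.prob sp {w. \<exists>l. st w p X ((N - 1) * a S) = Some l \<and> tst w p X S (N - 1) (l div D ^ S) x}"
proof -
  define G where "G = {u\<in>{..<Wb}. \<forall>k. 1 \<le> k \<and> k \<le> 3 * a 1 \<longrightarrow> k \<le> 4 * card {i\<in>{u..<u+k}. hit q X x i}}"
  have "real Wb \<le> real (4 * card G)" using card_good_starts[OF reg] unfolding G_def by (simp only: of_nat_le_iff)
  then have cG: "real Wb / 4 \<le> card G" by simp
  have "(\<Sum>u<Wb. I0 X u) \<le> real (card {..<Wb}) * (1 / 64)" by (intro sum_bounded_above I0_le)
  moreover have "(\<Sum>u<Wb. real q / R) \<le> real (card {..<Wb}) * (1 / 64)"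
  proof (intro sum_bounded_above)
    have "real (64 * q) \<le> real R" using qR by (simp only: of_nat_le_iff)
    then show "real q / R \<le> 1 / 64" using R_pos by (simp add: field_simps)
  qed
  ultimately have "(\<Sum>u<Wb. Lf X p u + I0 X u + IS X u + real q / R + Ns X p u) \<le> real Wb / 8"
    using IS_sum Ns_sum[of p, OF p] Lf unfolding sum.distrib card_lessThan by linarith
  then have "real Wb / 8 / R \<le> (real (card G) - (\<Sum>u<Wb. Lf X p u + I0 X u + IS X u + real q / R + Ns X p u)) / R"
    using cG by (intro divide_right_mono) auto
  also have "\<dots> \<le> measure_pmf.prob sp {w. st w p X ((N - 1) * a S) = Some (fst (w x)) \<and> tst w p X S (N - 1) (fst (w x) div D ^ S) x}"
    by (rule slot_success[OF p XU x reg]) (auto simp: G_def)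
  also have "\<dots> \<le> measure_pmf.prob sp {w. \<exists>l. st w p X ((N - 1) * a S) = Some l \<and> tst w p X S (N - 1) (l div D ^ S) x}"
    by (intro measure_pmf.finite_measure_mono) auto
  finally show ?thesis by simp
qed

end

end

section \<open>Random subblocks\<close>

lemma expectation_card:
  assumes "finite (set_pmf M)" "finite A"
  shows "measure_pmf.expectation M (\<lambda>\<omega>. real (card {v\<in>A. Q \<omega> v})) = (\<Sum>v\<in>A. measure_pmf.prob M {\<omega>. Q \<omega> v})"
proof -
  have "(\<lambda>\<omega>. real (card {v\<in>A. Q \<omega> v})) = (\<lambda>\<omega>. \<Sum>v\<in>A. if Q \<omega> v then 1 else 0)"
    using assms by (simp add: sum.If_cases Int_def)
  then have "measure_pmf.expectation M (\<lambda>\<omega>. real (card {v\<in>A. Q \<omega> v})) = (\<Sum>v\<in>A. measure_pmf.expectation M (\<lambda>\<omega>. if Q \<omega> v then 1 else 0))"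
    using assms by (simp add: Bochner_Integration.integral_sum integrable_measure_pmf_finite)
  then show ?thesis by (simp add: prob_eq_expectation)
qed

lemma sum_div_groups: "(\<Sum>v<M * k. h (v div k)) = real k * (\<Sum>c<M. h c :: real)" if "k > 0"
proof -
  have "(\<Sum>v<M * k. h (v div k)) = (\<Sum>c<M. sum (\<lambda>v. h (v div k)) {c * k..<c * k + k})" by (rule sum.nat_group[symmetric])
  also have "\<dots> = (\<Sum>c<M. real k * h c)"
  proof (rule sum.cong[OF refl])
    fix c
    have "sum (\<lambda>v. h (v div k)) {c * k..<c * k + k} = sum (\<lambda>v. h c) {c * k..<c * k + k}"
      by (intro sum.cong refl arg_cong[where f = h] div_nat_eqI) (auto simp: algebra_simps)
    then show "sum (\<lambda>v. h (v div k)) {c * k..<c * k + k} = real k * h c" by simp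
  qed
  finally show ?thesis by (simp add: sum_distrib_left)
qed

lemma inj_on_shift_mod: "inj_on (\<lambda>r. (j + r) mod m) {..<m::nat}"
proof (rule linorder_inj_onI)
  fix r r' assume r: "r < r'" "r \<in> {..<m}" "r' \<in> {..<m}"
  show "(j + r) mod m \<noteq> (j + r') mod m"
  proof
    assume "(j + r) mod m = (j + r') mod m"
    then have "m dvd (j + r') - (j + r)" using r by (subst mod_eq_dvd_iff_nat[symmetric]) auto
    then have "m dvd r' - r" by simp
    then show False using r by (auto dest: dvd_imp_le)
  qed
qed auto

context tuned_slots
begin

definition Idx :: "(nat \<times> nat) set" where "Idx = {..S} \<times> {..<N * a S}"

definition thp :: "(nat \<times> nat \<Rightarrow> nat) pmf" where "thp = Pi_pmf Idx 0 (\<lambda>_. pmf_of_set {..<m})"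

definition pm :: "(nat \<times> nat \<Rightarrow> nat) \<Rightarrow> nat \<Rightarrow> nat \<Rightarrow> nat \<Rightarrow> nat" where "pm \<theta> j s C = (j + \<theta> (s, C)) mod m"

lemma pm_less: "pm \<theta> j s C < m" using m_pos by (simp add: pm_def)

lemma finite_Idx: "finite Idx" by (simp add: Idx_def)

lemma finite_thm: "finite (set_pmf (pmf_of_set {..<m}))" using m_pos by (subst set_pmf_of_set) (auto simp: lessThan_empty_iff)

lemma finite_thp: "finite (set_pmf thp)" unfolding thp_def using finite_Idx finite_thm by (rule finite_set_Pi_pmf)

context
  fixes X :: "nat \<Rightarrow> nat"
begin

definition cell :: "nat \<Rightarrow> nat \<Rightarrow> nat \<Rightarrow> nat" where "cell s C z = cnt X z (C * a s * q) (Suc C * a s * q)"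

text \<open>The verification parts of different subblocks are disjoint, so the occurrences in the
  cell pay for each dense subblock separately.\<close>

lemma card_dense: "card {i\<in>{..<m}. dense X s C i z} * (3 * B * D ^ s) \<le> 2 * cell s C z"
proof -
  define Oc where "Oc = {t\<in>{C * a s * q..<Suc C * a s * q}. X t = z}"
  define lo where "lo i = sbi s C i + B * (D ^ s * q)" for i
  define hi where "hi i = sbi s C i + 4 * B * (D ^ s * q)" for i
  define h where "h = 4 * B * D ^ s * q"
  have "h > 0" using B_pos q_pos by (simp add: h_def)
  have fin: "finite Oc" by (simp add: Oc_def)
  have sub: "cnt X z (lo i) (hi i) = card {t\<in>Oc. lo i \<le> t \<and> t < hi i}" if "i < m" for i
  proof -
    have "C * a s * q \<le> lo i" "hi i \<le> Suc C * a s * q" using sbi_ge[of C s i] sbi_end[OF that, of s C] by (auto simp: lo_def hi_def)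
    then show ?thesis unfolding cnt_def Oc_def by (intro arg_cong[where f = card]) auto
  qed
  have one: "card {i\<in>{..<m}. lo i \<le> t \<and> t < hi i} \<le> 1" for t
  proof -
    have "{i\<in>{..<m}. lo i \<le> t \<and> t < hi i} \<subseteq> {(t - C * a s * q) div h}"
    proof
      fix i assume "i \<in> {i\<in>{..<m}. lo i \<le> t \<and> t < hi i}"
      then have "C * a s * q + i * h \<le> t" "t < C * a s * q + i * h + h"
        by (auto simp: lo_def hi_def sbi_def h_def algebra_simps)
      then have "i * h \<le> t - C * a s * q" "t - C * a s * q < h + i * h" by linarith+
      then have "(t - C * a s * q) div h = i" using \<open>h > 0\<close> by (intro div_nat_eqI) (auto simp: algebra_simps)
      then show "i \<in> {(t - C * a s * q) div h}" by simp
    qed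
    then have "card {i\<in>{..<m}. lo i \<le> t \<and> t < hi i} \<le> card {(t - C * a s * q) div h}" by (intro card_mono) auto
    then show ?thesis by simp
  qed
  have "card {i\<in>{..<m}. dense X s C i z} * (3 * B * D ^ s) = (\<Sum>i\<in>{i\<in>{..<m}. dense X s C i z}. 3 * B * D ^ s)" by simp
  also have "\<dots> \<le> (\<Sum>i\<in>{i\<in>{..<m}. dense X s C i z}. 2 * cnt X z (lo i) (hi i))"
    by (intro sum_mono) (auto simp: dense_def lo_def hi_def)
  also have "\<dots> \<le> (\<Sum>i<m. 2 * cnt X z (lo i) (hi i))" by (intro sum_mono2) auto
  also have "\<dots> = 2 * (\<Sum>i<m. card {t\<in>Oc. lo i \<le> t \<and> t < hi i})" by (simp add: sum_distrib_left sub)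
  also have "(\<Sum>i<m. card {t\<in>Oc. lo i \<le> t \<and> t < hi i}) = (\<Sum>t\<in>Oc. card {i\<in>{..<m}. lo i \<le> t \<and> t < hi i})"
    by (rule sum_card_swap) (auto simp: fin)
  also have "\<dots> \<le> (\<Sum>t\<in>Oc. 1)" using one by (rule sum_mono)
  also have "\<dots> = cell s C z" by (simp add: Oc_def cell_def cnt_def)
  finally show ?thesis by simp
qed

text \<open>A Markov bound, possibly above 1, for a random subblock being dense. The factor 8/3 is 2
  times 4/3: the threshold is one half per tick, and verification takes three quarters of a
  subblock.\<close>

definition dn :: "nat \<Rightarrow> nat \<Rightarrow> nat \<Rightarrow> real" where "dn s C z = 8 * cell s C z / (3 * a s)"

lemma dn_nonneg: "0 \<le> dn s C z" by (simp add: dn_def)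

lemma prob_shift_dense: "measure_pmf.prob (pmf_of_set {..<m}) {r. dense X s C ((j + r) mod m) z} \<le> dn s C z"
proof -
  define V where "V = {r. dense X s C ((j + r) mod m) z}"
  have "card ({..<m} \<inter> V) = card ((\<lambda>r. (j + r) mod m) ` ({..<m} \<inter> V))"
    by (rule card_image[symmetric]) (rule inj_on_subset[OF inj_on_shift_mod], auto)
  also have "\<dots> \<le> card {i\<in>{..<m}. dense X s C i z}" using m_pos by (intro card_mono) (auto simp: V_def)
  finally have "card ({..<m} \<inter> V) * (3 * B * D ^ s) \<le> card {i\<in>{..<m}. dense X s C i z} * (3 * B * D ^ s)" by (rule mult_le_mono1)
  also have "\<dots> \<le> 2 * cell s C z" by (rule card_dense)
  finally have "real (card ({..<m} \<inter> V) * (3 * B * D ^ s)) \<le> real (2 * cell s C z)" by (simp only: of_nat_le_iff)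
  then have "real (card ({..<m} \<inter> V)) * (3 * B * real D ^ s) \<le> 2 * cell s C z" by simp
  moreover have "measure_pmf.prob (pmf_of_set {..<m}) V = real (card ({..<m} \<inter> V)) / m"
    using m_pos by (subst measure_pmf_of_set) (auto simp: lessThan_empty_iff)
  moreover define P where "P = measure_pmf.prob (pmf_of_set {..<m}) V"
  ultimately have "real m * P * (3 * B * real D ^ s) \<le> 2 * cell s C z" using m_pos by (simp add: field_simps)
  moreover have "real (a s) = 4 * B * m * real D ^ s" by (simp add: a_def)
  ultimately show ?thesis using m_pos B_pos unfolding V_def[symmetric] P_def[symmetric] dn_def by (simp add: field_simps)
qed

lemma prob_dense2:
  assumes "(s, C) \<in> Idx" "(s, E) \<in> Idx" "C \<noteq> E"
  shows "measure_pmf.prob thp {\<theta>. dense X s C (pm \<theta> j s C) z \<and> dense X s E (pm \<theta> j s E) z} \<le> dn s C z * dn s E z"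
proof -
  have "measure_pmf.prob thp {\<theta>. dense X s C (pm \<theta> j s C) z \<and> dense X s E (pm \<theta> j s E) z} =
     measure_pmf.prob thp {\<theta>. \<theta> (s, C) \<in> {r. dense X s C ((j + r) mod m) z} \<and> \<theta> (s, E) \<in> {r. dense X s E ((j + r) mod m) z}}"
    by (simp add: pm_def)
  also have "\<dots> = measure_pmf.prob (pmf_of_set {..<m}) {r. dense X s C ((j + r) mod m) z} * measure_pmf.prob (pmf_of_set {..<m}) {r. dense X s E ((j + r) mod m) z}"
    unfolding thp_def using finite_Idx finite_thm by (rule prob_two) (use assms in auto)
  also have "\<dots> \<le> dn s C z * dn s E z" by (intro mult_mono prob_shift_dense) (auto simp: dn_nonneg)
  finally show ?thesis .
qed

definition Oc :: "nat \<Rightarrow> nat set" where "Oc z = {t\<in>{0..<N * a S * q}. X t = z}"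

text \<open>An element that survives stage \<open>s\<close> is dense in two cells at distance between \<open>2\<close> and \<open>D^2\<close>. These two
  events are independent, and each has probability proportional to the number of occurrences in the
  cell. This leads to the pairs of occurrences that are near at stage \<open>s\<close>.\<close>

definition near :: "nat \<Rightarrow> nat \<times> nat \<Rightarrow> bool" where
  "near s = (\<lambda>(t, t'). t div (a s * q) + 2 \<le> t' div (a s * q) \<and> t' div (a s * q) < t div (a s * q) + D^2)"

definition prs :: "nat \<Rightarrow> nat \<Rightarrow> nat" where "prs s z = card {x \<in> Oc z \<times> Oc z. near s x}"

lemma card_Oc: "finite (Oc z)" "card (Oc z) = tot X z" by (simp_all add: Oc_def tot_def cnt_def)

text \<open>A product of two cell counts is a number of pairs of occurrences, and different pairs of
  cells yield disjoint sets of pairs.\<close>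

lemma cells_pairs:
  assumes Q: "finite Q" "\<And>e E. (e, E) \<in> Q \<Longrightarrow> e + 2 \<le> E \<and> E < e + D^2 \<and> Suc E * a s \<le> N * a S"
  shows "(\<Sum>(e,E)\<in>Q. cell s e z * cell s E z) \<le> prs s z"
proof -
  define A where "A e = {t\<in>Oc z. t div (a s * q) = e}" for e
  have finA: "finite (A e)" for e by (simp add: A_def card_Oc)
  have cellA: "cell s e z = card (A e)" if "Suc e * a s \<le> N * a S" for e
  proof -
    have le: "Suc e * (a s * q) \<le> N * a S * q" using mult_le_mono1[OF that, of q] by (simp only: mult.assoc)
    have iff: "t div (a s * q) = e \<longleftrightarrow> e * (a s * q) \<le> t \<and> t < Suc e * (a s * q)" for t
    proof -
      have "a s * q > 0" using q_pos by simp
      then have "t div (a s * q) = e \<longleftrightarrow> e \<le> t div (a s * q) \<and> t div (a s * q) < Suc e" by auto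
      then show ?thesis using \<open>a s * q > 0\<close> by (simp only: less_eq_div_iff_mult_less_eq div_less_iff_less_mult)
    qed
    have "{t\<in>{e * a s * q..<Suc e * a s * q}. X t = z} = A e"
      unfolding A_def Oc_def iff mult.assoc[of _ "a s" q] using le by auto
    then show ?thesis by (simp add: cell_def cnt_def)
  qed
  have "(\<Sum>(e,E)\<in>Q. cell s e z * cell s E z) = (\<Sum>x\<in>Q. card (A (fst x) \<times> A (snd x)))"
  proof (intro sum.cong refl, clarify)
    fix e E assume "(e, E) \<in> Q"
    then have eE: "e + 2 \<le> E" "Suc E * a s \<le> N * a S" using Q(2) by auto
    then have "Suc e * a s \<le> Suc E * a s" by (intro mult_le_mono1) auto
    then have "Suc e * a s \<le> N * a S" using eE by linarith
    then show "cell s e z * cell s E z = card (A (fst (e,E)) \<times> A (snd (e,E)))" using eE by (simp add: cellA card_cartesian_product)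
  qed
  also have "\<dots> = card (\<Union>x\<in>Q. A (fst x) \<times> A (snd x))"
    using Q(1) finA by (intro card_UN_disjoint[symmetric]) (auto simp: A_def)
  also have "\<dots> \<le> prs s z" unfolding prs_def
  proof (intro card_mono subsetI)
    fix y assume "y \<in> (\<Union>x\<in>Q. A (fst x) \<times> A (snd x))"
    then obtain e E where x: "(e, E) \<in> Q" "y \<in> A e \<times> A E" by auto
    then show "y \<in> {x \<in> Oc z \<times> Oc z. near s x}" using Q(2)[OF x(1)] by (auto simp: A_def near_def)
  qed (simp add: card_Oc)
  finally show ?thesis .
qed

text \<open>A pair that is near at stage \<open>s\<close> is more than \<open>a s * q\<close> and
  less than \<open>a (s + 2) * q\<close> positions apart. Two stages that differ by 2 or more
  exclude each other, so a pair is near at no more than two stages.\<close>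

lemma prs_stages: "(\<Sum>s\<in>{1..S}. prs s z) \<le> 2 * (tot X z)^2"
proof -
  have two: "card {s\<in>{1..S}. near s x} \<le> 2" for x
  proof -
    obtain t t' where x: "x = (t, t')" by (cases x)
    have b: "t + a s * q < t'" "t' < t + a (s + 2) * q" if "near s x" for s
    proof -
      define h where "h = a s * q"
      have "h > 0" using q_pos by (simp add: h_def)
      have nr: "t div h + 2 \<le> t' div h" "t' div h < t div h + D^2" using that by (auto simp: x near_def h_def)
      have 1: "t < Suc (t div h) * h" "t' < Suc (t' div h) * h"
        using dividend_less_div_times[OF \<open>h > 0\<close>] by (simp_all add: add.commute)
      have 2: "t div h * h \<le> t" "t' div h * h \<le> t'" by simp_all
      have 3: "(t div h + 2) * h \<le> t' div h * h" "Suc (t' div h) * h \<le> (t div h + D^2) * h" using nr by (intro mult_le_mono1; simp)+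
      show "t + a s * q < t'" using 1 2 3 unfolding h_def[symmetric] add_mult_distrib mult_Suc by linarith
      have "a (s + 2) * q = D^2 * h" by (simp add: h_def a_def power_add power2_eq_square mult_ac)
      then show "t' < t + a (s + 2) * q" using 1 2 3 unfolding add_mult_distrib mult_Suc by linarith
    qed
    have gap: "s' \<le> s + 1" if "near s x" "near s' x" for s s'
    proof (rule ccontr)
      assume "\<not> s' \<le> s + 1"
      then have "a (s + 2) \<le> a s'" by (intro a_mono) simp
      then have "a (s + 2) * q \<le> a s' * q" by (rule mult_le_mono1)
      then show False using b(2)[OF that(1)] b(1)[OF that(2)] by linarith
    qed
    show ?thesis
    proof (cases "{s\<in>{1..S}. near s x} = {}")
      case False
      define s0 where "s0 = Min {s\<in>{1..S}. near s x}"
      have s0: "s0 \<in> {s\<in>{1..S}. near s x}" unfolding s0_def using False by (intro Min_in) auto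
      have "{s\<in>{1..S}. near s x} \<subseteq> {s0, Suc s0}"
      proof
        fix s assume s: "s \<in> {s\<in>{1..S}. near s x}"
        then have "s0 \<le> s" unfolding s0_def by (intro Min_le) auto
        moreover have "s \<le> s0 + 1" using gap s s0 by auto
        ultimately show "s \<in> {s0, Suc s0}" by auto
      qed
      then have "card {s\<in>{1..S}. near s x} \<le> card {s0, Suc s0}" by (intro card_mono) auto
      then show ?thesis by simp
    qed (simp only: card.empty zero_le)
  qed
  have "(\<Sum>s\<in>{1..S}. prs s z) = (\<Sum>x\<in>Oc z \<times> Oc z. card {s\<in>{1..S}. near s x})"
    unfolding prs_def by (rule sum_card_swap) (simp_all add: card_Oc)
  also have "\<dots> \<le> (\<Sum>x\<in>Oc z \<times> Oc z. 2)" using two by (rule sum_mono)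
  also have "\<dots> = 2 * (tot X z)^2" by (simp add: card_cartesian_product card_Oc power2_eq_square)
  finally show ?thesis .
qed

lemma Wb_cells_at: "s \<le> S \<Longrightarrow> Wb = (N div 64) * D ^ (S - s) * a s" "s \<le> S \<Longrightarrow> C < (N div 64) * D ^ (S - s) \<Longrightarrow> Suc C * a s \<le> N * a S"
proof -
  show eq: "Wb = (N div 64) * D ^ (S - s) * a s" if "s \<le> S"
    using that by (simp add: WbN a_def mult_ac power_add[symmetric])
  assume s: "s \<le> S" "C < (N div 64) * D ^ (S - s)"
  have "Suc C * a s \<le> (N div 64) * D ^ (S - s) * a s" using s(2) by (intro mult_le_mono1) simp
  also have "\<dots> = (N div 64) * a S" using eq[OF s(1)] WbN by (rule trans[OF sym])
  also have "\<dots> \<le> N * a S" by (intro mult_le_mono1) simp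
  finally show "Suc C * a s \<le> N * a S" .
qed

lemma in_Idx: "s \<le> S \<Longrightarrow> Suc C * a s \<le> N * a S \<Longrightarrow> (s, C) \<in> Idx"
proof -
  assume s: "s \<le> S" "Suc C * a s \<le> N * a S"
  have "Suc C * 1 \<le> Suc C * a s" using a_pos[of s] by (intro mult_le_mono2) (simp del: a_pos)
  then show ?thesis using s by (simp add: Idx_def)
qed

text \<open>The bound depends only on the cells of \<open>v\<close> and \<open>u\<close>. Each pair
  of cells contains \<open>(a s)\<^sup>2\<close> pairs of ticks, which cancels the denominators of
  the two factors \<open>dn\<close>. The constant is 64/9, the square of 8/3, rounded up to
  8.\<close>

lemma lifeA_sum:
  assumes s: "s \<in> {1..S}"
  shows "(\<Sum>u<Wb. \<Sum>v<u. measure_pmf.prob thp {\<theta>. lifeA (pm \<theta> j) X s v u z}) \<le> 8 * real (prs s z)"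
proof -
  define M where "M = (N div 64) * D ^ (S - s)"
  have WbM: "Wb = M * a s" using s Wb_cells_at(1)[of s] by (simp add: M_def)
  define g where "g c C = (if c + 6 \<le> C \<and> C < c + D^2 then dn s (c + 3) z * dn s (C - 1) z else 0)" for c C
  have g0: "0 \<le> g c C" for c C by (simp add: g_def dn_nonneg)
  have le: "measure_pmf.prob thp {\<theta>. lifeA (pm \<theta> j) X s v u z} \<le> g (v div a s) (u div a s)" if u: "u < Wb" for u v
  proof (cases "v div a s + 6 \<le> u div a s \<and> u div a s < v div a s + D^2")
    case True
    define c C where "c = v div a s" and "C = u div a s"
    have CM: "C < M" using u by (simp add: C_def WbM div_less_iff_less_mult)
    have cC: "c + 6 \<le> C" "C < c + D^2" using True by (auto simp: c_def C_def)
    have idx: "(s, e) \<in> Idx" if "e < C" for e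
      using Wb_cells_at(2)[of s e] s that CM by (intro in_Idx) (auto simp: M_def)
    have "measure_pmf.prob thp {\<theta>. lifeA (pm \<theta> j) X s v u z} \<le>
       measure_pmf.prob thp {\<theta>. dense X s (c + 3) (pm \<theta> j s (c + 3)) z \<and> dense X s (C - 1) (pm \<theta> j s (C - 1)) z}"
      by (intro measure_pmf.finite_measure_mono) (auto simp: lifeA_def c_def C_def)
    also have "\<dots> \<le> dn s (c + 3) z * dn s (C - 1) z" using cC by (intro prob_dense2 idx) auto
    finally show ?thesis using True by (simp add: g_def c_def C_def)
  next
    case False
    then have "{\<theta>. lifeA (pm \<theta> j) X s v u z} = {}" by (auto simp: lifeA_def)
    then show ?thesis using g0 by simp
  qed
  define Q where "Q = {(c, C) \<in> {..<M} \<times> {..<M}. c + 6 \<le> C \<and> C < c + D^2}"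
  have finQ: "finite Q" unfolding Q_def by (rule finite_subset[of _ "{..<M} \<times> {..<M}"]) auto
  have "(\<Sum>u<Wb. \<Sum>v<u. measure_pmf.prob thp {\<theta>. lifeA (pm \<theta> j) X s v u z}) \<le> (\<Sum>u<Wb. \<Sum>v<Wb. g (v div a s) (u div a s))"
  proof (rule sum_mono)
    fix u assume u: "u \<in> {..<Wb}"
    have "(\<Sum>v<u. measure_pmf.prob thp {\<theta>. lifeA (pm \<theta> j) X s v u z}) \<le> (\<Sum>v<u. g (v div a s) (u div a s))"
      using u le by (intro sum_mono) auto
    also have "\<dots> \<le> (\<Sum>v<Wb. g (v div a s) (u div a s))" using u g0 by (intro sum_mono2) auto
    finally show "(\<Sum>v<u. measure_pmf.prob thp {\<theta>. lifeA (pm \<theta> j) X s v u z}) \<le> (\<Sum>v<Wb. g (v div a s) (u div a s))" .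
  qed
  also have "\<dots> = (\<Sum>u<Wb. real (a s) * (\<Sum>c<M. g c (u div a s)))"
  proof (rule sum.cong[OF refl])
    fix u
    show "(\<Sum>v<Wb. g (v div a s) (u div a s)) = real (a s) * (\<Sum>c<M. g c (u div a s))"
      unfolding WbM by (rule sum_div_groups[where h = "\<lambda>c. g c (u div a s)", OF a_pos])
  qed
  also have "\<dots> = real (a s) * (\<Sum>C<M. real (a s) * (\<Sum>c<M. g c C))"
    unfolding WbM by (rule sum_div_groups[where h = "\<lambda>C. real (a s) * (\<Sum>c<M. g c C)", OF a_pos])
  also have "\<dots> = (\<Sum>C<M. \<Sum>c<M. real (a s) ^ 2 * g c C)" by (simp add: sum_distrib_left power2_eq_square mult.assoc)
  also have "\<dots> = (\<Sum>c<M. \<Sum>C<M. real (a s) ^ 2 * g c C)" by (rule sum.swap)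
  also have "\<dots> = (\<Sum>x\<in>{..<M} \<times> {..<M}. real (a s) ^ 2 * g (fst x) (snd x))" by (simp add: sum.cartesian_product case_prod_beta)
  also have "\<dots> = (\<Sum>x\<in>Q. real (a s) ^ 2 * g (fst x) (snd x))"
    by (rule sum.mono_neutral_right) (auto simp: Q_def g_def)
  also have "\<dots> = (\<Sum>x\<in>Q. 64 / 9 * real (cell s (fst x + 3) z * cell s (snd x - 1) z))"
    using a_pos[of s] by (intro sum.cong refl) (auto simp: Q_def g_def dn_def power2_eq_square)
  also have "\<dots> = 64 / 9 * real (\<Sum>x\<in>Q. cell s (fst x + 3) z * cell s (snd x - 1) z)" by (simp add: sum_distrib_left)
  also have "(\<Sum>x\<in>Q. cell s (fst x + 3) z * cell s (snd x - 1) z) = (\<Sum>(e,E)\<in>(\<lambda>(c,C). (c + 3, C - 1)) ` Q. cell s e z * cell s E z)"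
    by (subst sum.reindex) (auto simp: Q_def inj_on_def case_prod_beta)
  also have "64 / 9 * real \<dots> \<le> 64 / 9 * real (prs s z)"
  proof (intro mult_left_mono of_nat_mono cells_pairs)
    fix e E assume "(e, E) \<in> (\<lambda>(c,C). (c + 3, C - 1)) ` Q"
    then have "e + 2 \<le> E" "E < e + D^2" "E < M" by (auto simp: Q_def)
    then show "e + 2 \<le> E \<and> E < e + D^2 \<and> Suc E * a s \<le> N * a S" using Wb_cells_at(2)[of s E] s by (simp add: M_def)
  qed (use finQ in auto)
  also have "\<dots> \<le> 8 * real (prs s z)" by simp
  finally show ?thesis .
qed

text \<open>All tests in a range are passed, so the probability is bounded by that of any two of
  them. Averaging over the \<open>(D / 2)\<^sup>2\<close> pairs of an early and a late cell gains
  \<open>4 / D\<^sup>2\<close>, which compensates for cells of stage \<open>s\<close> having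
  \<open>D\<close> times as many ticks as those of stage \<open>s - 1\<close>. With three possible
  cells for \<open>u\<close> the constant is 3 * 4 * 64/9, below 86.\<close>

lemma lifeB_sum:
  assumes s: "s \<in> {2..S}"
  shows "(\<Sum>u<Wb. \<Sum>v<u. measure_pmf.prob thp {\<theta>. lifeB (pm \<theta> j) X s v u z}) \<le> 86 * real (prs (s - 1) z)"
proof -
  define M where "M = (N div 64) * D ^ (S - s)"
  have WbM: "Wb = M * a s" using s Wb_cells_at(1)[of s] by (simp add: M_def)
  define r where "r = s - 1"
  have sr: "s = Suc r" "1 \<le> r" "r \<le> S" using s by (auto simp: r_def)
  have aD: "a s = D * a r" by (simp add: sr a_Suc)
  define H where "H = D div 2"
  have H: "D = 2 * H" "4 \<le> H" using D_even D_ge by (auto simp: H_def)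
  define G where "G c = {(c + 1) * D + 2..<(c + 1) * D + 2 + H} \<times> {(c + 2) * D + H..<(c + 3) * D}" for c
  have cG: "card (G c) = H * H" for c
  proof -
    have "(c + 3) * D - ((c + 2) * D + H) = H" by (simp add: H algebra_simps)
    then show ?thesis by (simp add: G_def card_cartesian_product del: distrib_right_numeral)
  qed
  have G: "e + 2 \<le> E \<and> E < e + D^2 \<and> E < (c + 3) * D \<and> (c + 1) * D + 2 \<le> e \<and> (c + 1) * D + 2 \<le> E \<and> e < (c + 3) * D \<and> e div D = c + 1" if "(e, E) \<in> G c" for c e E
  proof -
    have e: "(c + 1) * D + 2 \<le> e" "e < (c + 1) * D + 2 + H" "(c + 2) * D + H \<le> E" "E < (c + 3) * D" using that by (auto simp: G_def)
    have "2 * D \<le> D^2" using D_ge by (simp add: power2_eq_square)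
    moreover have "e div D = c + 1" using e H by (intro div_nat_eqI) (auto simp: algebra_simps)
    ultimately show ?thesis using e H by (auto simp: algebra_simps)
  qed
  define g where "g c = 4 / real D ^ 2 * (\<Sum>x\<in>G c. dn r (fst x) z * dn r (snd x) z)" for c
  have g0: "0 \<le> g c" for c by (simp add: g_def dn_nonneg sum_nonneg)
  have inb: "Suc E * a r \<le> N * a S" if "E < (c + 3) * D" "c + 3 < M" for c E
  proof -
    have "Suc E * a r \<le> (c + 3) * D * a r" using that by (intro mult_le_mono1) simp
    also have "\<dots> = (c + 3) * a s" by (simp add: aD mult_ac)
    also have "\<dots> \<le> Suc (c + 3) * a s" by (intro mult_le_mono1) simp
    also have "\<dots> \<le> N * a S" using s that by (intro Wb_cells_at(2)) (auto simp: M_def)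
    finally show ?thesis .
  qed
  have le: "measure_pmf.prob thp {\<theta>. lifeB (pm \<theta> j) X s v u z} \<le>
      (if v div a s + 3 \<le> u div a s \<and> u div a s \<le> v div a s + 5 then g (v div a s) else 0)" if u: "u < Wb" for u v
  proof (cases "v div a s + 3 \<le> u div a s \<and> u div a s \<le> v div a s + 5")
    case True
    define c where "c = v div a s"
    have "u div a s < M" using u by (simp add: WbM div_less_iff_less_mult)
    then have cM: "c + 3 < M" using True by (simp add: c_def)
    define P where "P = measure_pmf.prob thp {\<theta>. lifeB (pm \<theta> j) X s v u z}"
    have "P \<le> dn r (fst x) z * dn r (snd x) z" if "x \<in> G c" for x
    proof -
      obtain e E where x: "x = (e, E)" by (cases x)
      have eE: "e + 2 \<le> E" "E < (c + 3) * D" "(c + 1) * D + 2 \<le> e" "(c + 1) * D + 2 \<le> E" "e < (c + 3) * D"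
        using G[of e E c] that x by auto
      have "P \<le> measure_pmf.prob thp {\<theta>. dense X r e (pm \<theta> j r e) z \<and> dense X r E (pm \<theta> j r E) z}"
        unfolding P_def using eE by (intro measure_pmf.finite_measure_mono) (auto simp: lifeB_def c_def r_def)
      also have "\<dots> \<le> dn r e z * dn r E z" using eE inb[OF _ cM] sr by (intro prob_dense2 in_Idx) auto
      finally show ?thesis by (simp add: x)
    qed
    then have "real (card (G c)) * P \<le> (\<Sum>x\<in>G c. dn r (fst x) z * dn r (snd x) z)"
      by (intro sum_bounded_below) auto
    then have "real (H * H) * P \<le> (\<Sum>x\<in>G c. dn r (fst x) z * dn r (snd x) z)" unfolding cG .
    then have "P \<le> g c" using H by (simp add: g_def field_simps power2_eq_square)
    then show ?thesis using True by (simp add: P_def c_def)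
  next
    case False
    then have "{\<theta>. lifeB (pm \<theta> j) X s v u z} = {}" by (auto simp: lifeB_def)
    then show ?thesis by (simp add: g0)
  qed
  define f where "f c C = (if c + 3 \<le> C \<and> C \<le> c + 5 then g c else 0)" for c C :: nat
  have f0: "0 \<le> f c C" for c C using g0 by (simp add: f_def)
  have "(\<Sum>u<Wb. \<Sum>v<u. measure_pmf.prob thp {\<theta>. lifeB (pm \<theta> j) X s v u z}) \<le> (\<Sum>u<Wb. \<Sum>v<Wb. f (v div a s) (u div a s))"
  proof (rule sum_mono)
    fix u assume u: "u \<in> {..<Wb}"
    have "(\<Sum>v<u. measure_pmf.prob thp {\<theta>. lifeB (pm \<theta> j) X s v u z}) \<le> (\<Sum>v<u. f (v div a s) (u div a s))"
      using u le unfolding f_def by (intro sum_mono) auto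
    also have "\<dots> \<le> (\<Sum>v<Wb. f (v div a s) (u div a s))" using u f0 by (intro sum_mono2) auto
    finally show "(\<Sum>v<u. measure_pmf.prob thp {\<theta>. lifeB (pm \<theta> j) X s v u z}) \<le> (\<Sum>v<Wb. f (v div a s) (u div a s))" .
  qed
  also have "\<dots> = (\<Sum>u<Wb. real (a s) * (\<Sum>c<M. f c (u div a s)))"
  proof (rule sum.cong[OF refl])
    fix u
    show "(\<Sum>v<Wb. f (v div a s) (u div a s)) = real (a s) * (\<Sum>c<M. f c (u div a s))"
      unfolding WbM by (rule sum_div_groups[where h = "\<lambda>c. f c (u div a s)", OF a_pos])
  qed
  also have "\<dots> = real (a s) * (\<Sum>C<M. real (a s) * (\<Sum>c<M. f c C))"
    unfolding WbM by (rule sum_div_groups[where h = "\<lambda>C. real (a s) * (\<Sum>c<M. f c C)", OF a_pos])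
  also have "\<dots> = real (a s) ^ 2 * (\<Sum>C<M. \<Sum>c<M. f c C)" by (simp add: sum_distrib_left power2_eq_square mult.assoc)
  also have "(\<Sum>C<M. \<Sum>c<M. f c C) = (\<Sum>c<M. \<Sum>C<M. f c C)" by (rule sum.swap)
  also have "\<dots> \<le> (\<Sum>c\<in>{c. c + 3 < M}. 3 * g c)"
  proof -
    have "(\<Sum>C<M. f c C) \<le> (if c + 3 < M then 3 * g c else 0)" for c
    proof -
      have "(\<Sum>C<M. f c C) = (\<Sum>C\<in>{C\<in>{..<M}. c + 3 \<le> C \<and> C \<le> c + 5}. g c)"
        unfolding f_def by (subst sum.inter_filter) auto
      also have "\<dots> = real (card {C\<in>{..<M}. c + 3 \<le> C \<and> C \<le> c + 5}) * g c" by simp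
      also have "\<dots> \<le> (if c + 3 < M then 3 * g c else 0)"
      proof (cases "c + 3 < M")
        case True
        have "card {C\<in>{..<M}. c + 3 \<le> C \<and> C \<le> c + 5} \<le> card {c + 3..c + 5}" by (intro card_mono) auto
        then have "real (card {C\<in>{..<M}. c + 3 \<le> C \<and> C \<le> c + 5}) \<le> 3" by simp
        then show ?thesis using True g0[of c] by (auto intro: mult_right_mono)
      next
        case False
        then have "{C\<in>{..<M}. c + 3 \<le> C \<and> C \<le> c + 5} = {}" by auto
        then show ?thesis using False by (simp only: card.empty) simp
      qed
      finally show ?thesis .
    qed
    then have "(\<Sum>c<M. \<Sum>C<M. f c C) \<le> (\<Sum>c<M. if c + 3 < M then 3 * g c else 0)" by (rule sum_mono)
    also have "\<dots> = (\<Sum>c\<in>{c\<in>{..<M}. c + 3 < M}. 3 * g c)" by (subst sum.inter_filter) auto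
    also have "{c\<in>{..<M}. c + 3 < M} = {c. c + 3 < M}" by auto
    finally show ?thesis .
  qed
  also have "\<dots> = 12 / real D ^ 2 * (\<Sum>c\<in>{c. c + 3 < M}. \<Sum>x\<in>G c. dn r (fst x) z * dn r (snd x) z)"
    by (simp add: g_def sum_distrib_left)
  also have "(\<Sum>c\<in>{c. c + 3 < M}. \<Sum>x\<in>G c. dn r (fst x) z * dn r (snd x) z) = (\<Sum>x\<in>(\<Union>c\<in>{c. c + 3 < M}. G c). dn r (fst x) z * dn r (snd x) z)"
  proof (rule sum.UNION_disjoint[symmetric])
    show "finite {c. c + 3 < M}" by (rule finite_subset[of _ "{..<M}"]) auto
    show "\<forall>i\<in>{c. c + 3 < M}. finite (G i)" by (simp add: G_def)
    \<comment> \<open>The first component of a pair reveals \<open>c\<close>: divided by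
      \<open>D\<close> it gives \<open>c + 1\<close>.\<close>
    show "\<forall>i\<in>{c. c + 3 < M}. \<forall>j\<in>{c. c + 3 < M}. i \<noteq> j \<longrightarrow> G i \<inter> G j = {}"
      using G by (metis Int_iff add_right_cancel equals0I surj_pair)
  qed
  also have "\<dots> = 64 / 9 / real (a r) ^ 2 * real (\<Sum>(e,E)\<in>(\<Union>c\<in>{c. c + 3 < M}. G c). cell r e z * cell r E z)"
    by (simp add: dn_def sum_distrib_left power2_eq_square case_prod_beta)
  also have "real (a s) ^ 2 * (12 / real D ^ 2 * (64 / 9 / real (a r) ^ 2 * real (\<Sum>(e,E)\<in>(\<Union>c\<in>{c. c + 3 < M}. G c). cell r e z * cell r E z)))
     = 768 / 9 * real (\<Sum>(e,E)\<in>(\<Union>c\<in>{c. c + 3 < M}. G c). cell r e z * cell r E z)"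
  proof -
    have "real (a r) \<noteq> 0" "real D \<noteq> 0" using a_pos[of r] D_pos by (simp_all del: a_pos)
    then show ?thesis by (simp add: aD power_mult_distrib)
  qed
  also have "\<dots> \<le> 768 / 9 * real (prs r z)"
  proof (intro mult_left_mono of_nat_mono cells_pairs)
    fix e E assume "(e, E) \<in> (\<Union>c\<in>{c. c + 3 < M}. G c)"
    then obtain c where c: "c + 3 < M" "(e, E) \<in> G c" by auto
    then show "e + 2 \<le> E \<and> E < e + D^2 \<and> Suc E * a r \<le> N * a S" using G[OF c(2)] inb[of E c] by auto
  next
    have "finite {c. c + 3 < M}" by (rule finite_subset[of _ "{..<M}"]) auto
    then show "finite (\<Union>c\<in>{c. c + 3 < M}. G c)" by (auto simp: G_def)
  qed auto
  also have "\<dots> \<le> 86 * real (prs (s - 1) z)" by (simp add: r_def)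
  finally show ?thesis by simp
qed

text \<open>In youth each of at most \<open>tot X z\<close> hit ticks blocks
  \<open>12 * tot X z\<close> later ticks. The later stages contribute 8 + 86 times the near pairs,
  which number at most twice the square. The total is 200, below 300.\<close>

lemma life_sum: "(\<Sum>u<Wb. \<Sum>v<u. measure_pmf.prob thp {\<theta>. life (pm \<theta> j) X v u z}) \<le> 300 * real ((tot X z)^2)"
proof -
  define h where "h v u = (if hit q X z v \<and> u - v \<le> 12 * tot X z then 1 else 0 :: real)" for u v :: nat
  have one: "measure_pmf.prob thp {\<theta>. life (pm \<theta> j) X v u z} \<le> h v u +
     (\<Sum>s\<in>{1..S}. measure_pmf.prob thp {\<theta>. lifeA (pm \<theta> j) X s v u z}) + (\<Sum>s\<in>{2..S}. measure_pmf.prob thp {\<theta>. lifeB (pm \<theta> j) X s v u z})" for u v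
  proof -
    have "{\<theta>. life (pm \<theta> j) X v u z} \<subseteq> {\<theta>. hit q X z v \<and> u - v \<le> 12 * tot X z} \<union>
       ((\<Union>s\<in>{1..S}. {\<theta>. lifeA (pm \<theta> j) X s v u z}) \<union> (\<Union>s\<in>{2..S}. {\<theta>. lifeB (pm \<theta> j) X s v u z}))"
      by (auto simp: life_def)
    then have "measure_pmf.prob thp {\<theta>. life (pm \<theta> j) X v u z} \<le> measure_pmf.prob thp ({\<theta>. hit q X z v \<and> u - v \<le> 12 * tot X z} \<union>
       ((\<Union>s\<in>{1..S}. {\<theta>. lifeA (pm \<theta> j) X s v u z}) \<union> (\<Union>s\<in>{2..S}. {\<theta>. lifeB (pm \<theta> j) X s v u z})))"
      by (intro measure_pmf.finite_measure_mono) auto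
    also have "\<dots> \<le> measure_pmf.prob thp {\<theta>. hit q X z v \<and> u - v \<le> 12 * tot X z} +
       (measure_pmf.prob thp (\<Union>s\<in>{1..S}. {\<theta>. lifeA (pm \<theta> j) X s v u z}) + measure_pmf.prob thp (\<Union>s\<in>{2..S}. {\<theta>. lifeB (pm \<theta> j) X s v u z}))"
      by (intro order_trans[OF measure_Un_le] add_left_mono) auto
    also have "\<dots> \<le> h v u + ((\<Sum>s\<in>{1..S}. measure_pmf.prob thp {\<theta>. lifeA (pm \<theta> j) X s v u z}) + (\<Sum>s\<in>{2..S}. measure_pmf.prob thp {\<theta>. lifeB (pm \<theta> j) X s v u z}))"
      by (intro add_mono measure_pmf.finite_measure_subadditive_finite) (auto simp: h_def)
    finally show ?thesis by simp
  qed
  have "(\<Sum>u<Wb. \<Sum>v<u. measure_pmf.prob thp {\<theta>. life (pm \<theta> j) X v u z}) \<le> (\<Sum>u<Wb. \<Sum>v<u. h v u +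
     (\<Sum>s\<in>{1..S}. measure_pmf.prob thp {\<theta>. lifeA (pm \<theta> j) X s v u z}) + (\<Sum>s\<in>{2..S}. measure_pmf.prob thp {\<theta>. lifeB (pm \<theta> j) X s v u z}))"
    by (intro sum_mono one)
  also have "\<dots> = (\<Sum>u<Wb. \<Sum>v<u. h v u) + (\<Sum>u<Wb. \<Sum>v<u. \<Sum>s\<in>{1..S}. measure_pmf.prob thp {\<theta>. lifeA (pm \<theta> j) X s v u z})
     + (\<Sum>u<Wb. \<Sum>v<u. \<Sum>s\<in>{2..S}. measure_pmf.prob thp {\<theta>. lifeB (pm \<theta> j) X s v u z})" by (simp add: sum.distrib)
  also have "(\<Sum>u<Wb. \<Sum>v<u. \<Sum>s\<in>{1..S}. measure_pmf.prob thp {\<theta>. lifeA (pm \<theta> j) X s v u z}) =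
      (\<Sum>s\<in>{1..S}. \<Sum>u<Wb. \<Sum>v<u. measure_pmf.prob thp {\<theta>. lifeA (pm \<theta> j) X s v u z})"
    by (subst sum.swap[of _ "{1..S}"]) (intro sum.cong refl sum.swap)
  also have "(\<Sum>u<Wb. \<Sum>v<u. \<Sum>s\<in>{2..S}. measure_pmf.prob thp {\<theta>. lifeB (pm \<theta> j) X s v u z}) =
      (\<Sum>s\<in>{2..S}. \<Sum>u<Wb. \<Sum>v<u. measure_pmf.prob thp {\<theta>. lifeB (pm \<theta> j) X s v u z})"
    by (subst sum.swap[of _ "{2..S}"]) (intro sum.cong refl sum.swap)
  also have "(\<Sum>u<Wb. \<Sum>v<u. h v u) \<le> 12 * real ((tot X z)^2)"
  proof -
    have "(\<Sum>u<Wb. \<Sum>v<u. h v u) = (\<Sum>u<Wb. \<Sum>v\<in>{v\<in>{..<Wb}. v < u}. h v u)"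
      by (intro sum.cong refl) auto
    also have "\<dots> = (\<Sum>v<Wb. \<Sum>u\<in>{u\<in>{..<Wb}. v < u}. h v u)" by (rule sum.swap_restrict) auto
    also have "\<dots> \<le> (\<Sum>v<Wb. if hit q X z v then 12 * real (tot X z) else 0)"
    proof (rule sum_mono)
      fix v
      have "(\<Sum>u\<in>{u\<in>{..<Wb}. v < u}. h v u) = real (card {u\<in>{u\<in>{..<Wb}. v < u}. hit q X z v \<and> u - v \<le> 12 * tot X z})"
        unfolding h_def by (simp add: sum.If_cases Int_def)
      also have "\<dots> \<le> (if hit q X z v then 12 * real (tot X z) else 0)"
      proof (cases "hit q X z v")
        case True
        have "card {u\<in>{u\<in>{..<Wb}. v < u}. hit q X z v \<and> u - v \<le> 12 * tot X z} \<le> card {v<..v + 12 * tot X z}" by (intro card_mono) auto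
        then have "real (card {u\<in>{u\<in>{..<Wb}. v < u}. hit q X z v \<and> u - v \<le> 12 * tot X z}) \<le> real (12 * tot X z)" by (simp only: of_nat_le_iff card_greaterThanAtMost add_diff_cancel_left')
        then show ?thesis using True by simp
      qed simp
      finally show "(\<Sum>u\<in>{u\<in>{..<Wb}. v < u}. h v u) \<le> (if hit q X z v then 12 * real (tot X z) else 0)" .
    qed
    also have "\<dots> = 12 * real (tot X z) * real (card {v\<in>{0..<Wb}. hit q X z v})" by (simp add: sum.If_cases Int_def lessThan_atLeast0)
    also have "\<dots> \<le> 12 * real (tot X z) * real (tot X z)"
    proof (intro mult_left_mono of_nat_mono)
      have "card {v\<in>{0..<Wb}. hit q X z v} \<le> cnt X z (0 * q) (Wb * q)" by (rule card_hit_le_cnt)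
      also have "\<dots> \<le> tot X z" unfolding tot_def
      proof (rule cnt_mono)
        have "Wb \<le> N * a S" unfolding WbN by (intro mult_le_mono1) simp
        then show "Wb * q \<le> N * a S * q" by (rule mult_le_mono1)
      qed simp
      finally show "card {v\<in>{0..<Wb}. hit q X z v} \<le> tot X z" .
    qed auto
    finally show ?thesis by (simp add: power2_eq_square)
  qed
  also have "(\<Sum>s\<in>{1..S}. \<Sum>u<Wb. \<Sum>v<u. measure_pmf.prob thp {\<theta>. lifeA (pm \<theta> j) X s v u z}) \<le> (\<Sum>s\<in>{1..S}. 8 * real (prs s z))"
    by (intro sum_mono lifeA_sum)
  also have "(\<Sum>s\<in>{2..S}. \<Sum>u<Wb. \<Sum>v<u. measure_pmf.prob thp {\<theta>. lifeB (pm \<theta> j) X s v u z}) \<le> (\<Sum>s\<in>{2..S}. 86 * real (prs (s - 1) z))"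
    by (intro sum_mono lifeB_sum)
  also have "(\<Sum>s\<in>{2..S}. 86 * real (prs (s - 1) z)) \<le> (\<Sum>s\<in>{1..S}. 86 * real (prs s z))"
  proof -
    have "(\<Sum>s\<in>{2..S}. 86 * real (prs (s - 1) z)) = (\<Sum>s\<in>(\<lambda>s. s - 1) ` {2..S}. 86 * real (prs s z))"
      by (subst sum.reindex) (auto simp: inj_on_def)
    also have "\<dots> \<le> (\<Sum>s\<in>{1..S}. 86 * real (prs s z))" by (intro sum_mono2) auto
    finally show ?thesis .
  qed
  finally have "(\<Sum>u<Wb. \<Sum>v<u. measure_pmf.prob thp {\<theta>. life (pm \<theta> j) X v u z}) \<le> 12 * real ((tot X z)^2) + 94 * real (\<Sum>s\<in>{1..S}. prs s z)"
    by (simp add: sum_distrib_left[symmetric])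
  moreover have "real (\<Sum>s\<in>{1..S}. prs s z) \<le> real (2 * (tot X z)^2)" using prs_stages by (simp only: of_nat_le_iff)
  moreover have "real (2 * (tot X z)^2) = 2 * real ((tot X z)^2)" "0 \<le> real ((tot X z)^2)" by simp_all
  ultimately show ?thesis by linarith
qed

end

end

section \<open>All slots together\<close>

lemma prob_bind_ge:
  assumes "\<And>x. x \<in> set_pmf P \<Longrightarrow> x \<in> G \<Longrightarrow> c \<le> measure_pmf.prob (f x) A" "0 \<le> c"
  shows "c * measure_pmf.prob P G \<le> measure_pmf.prob (bind_pmf P f) A"
proof -
  have "ennreal (c * measure_pmf.prob P G) = (\<integral>\<^sup>+x. ennreal c * indicator G x \<partial>P)"
    using assms(2) by (simp add: nn_integral_cmult measure_pmf.emeasure_eq_measure ennreal_mult)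
  also have "\<dots> \<le> (\<integral>\<^sup>+x. emeasure (f x) A \<partial>P)"
    using assms(1) by (intro nn_integral_mono_AE) (auto simp: AE_measure_pmf_iff indicator_def measure_pmf.emeasure_eq_measure)
  also have "\<dots> = ennreal (measure_pmf.prob (bind_pmf P f) A)" by (simp add: emeasure_bind_pmf measure_pmf.emeasure_eq_measure[symmetric])
  finally show ?thesis by simp
qed

lemma prob_pair_le:
  assumes "\<And>a. measure_pmf.prob Q {b. E a b} \<le> d"
  shows "measure_pmf.prob (pair_pmf P Q) {(a, b). E a b} \<le> d"
proof -
  have d0: "0 \<le> d" using assms order_trans[OF measure_nonneg] by blast
  have "ennreal (measure_pmf.prob (pair_pmf P Q) {(a, b). E a b}) = emeasure (bind_pmf P (\<lambda>a. map_pmf (Pair a) Q)) {(a, b). E a b}"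
    by (simp add: pair_pmf_def map_pmf_def measure_pmf.emeasure_eq_measure)
  also have "\<dots> = (\<integral>\<^sup>+a. emeasure (map_pmf (Pair a) Q) {(a, b). E a b} \<partial>P)" by (rule emeasure_bind_pmf)
  also have "\<dots> \<le> (\<integral>\<^sup>+a. ennreal d \<partial>P)"
    by (intro nn_integral_mono) (use assms d0 in \<open>simp add: measure_pmf.emeasure_eq_measure vimage_def\<close>)
  also have "\<dots> = ennreal d" by (simp add: measure_pmf.emeasure_space_1[simplified])
  finally show ?thesis using d0 by simp
qed

lemma prob_pair_fst: "measure_pmf.prob (pair_pmf P Q) {(a, b). E a} = measure_pmf.prob P {a. E a}"
proof -
  have "measure_pmf.prob P {a. E a} = measure_pmf.prob (map_pmf fst (pair_pmf P Q)) {a. E a}" by (simp only: map_fst_pair_pmf)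
  moreover have "fst -` {a. E a} = {(a, b). E a}" by auto
  ultimately show ?thesis by (metis measure_map_pmf)
qed

lemma prob_pair_snd: "measure_pmf.prob (pair_pmf P Q) {(a, b). E b} = measure_pmf.prob Q {b. E b}"
proof -
  have "measure_pmf.prob Q {b. E b} = measure_pmf.prob (map_pmf snd (pair_pmf P Q)) {b. E b}" by (simp only: map_snd_pair_pmf)
  moreover have "snd -` {b. E b} = {(a, b). E b}" by auto
  ultimately show ?thesis by (metis measure_map_pmf)
qed

context tuned_slots
begin

lemma Wb_pos: "0 < Wb"
proof -
  have "0 < N div 64" using DN D_big by (simp add: div_greater_zero_iff)
  then show ?thesis by (simp add: WbN)
qed

definition wp :: "(nat \<Rightarrow> nat \<Rightarrow> nat \<times> bool) pmf" where "wp = Pi_pmf {..<m} (\<lambda>_. (0, False)) (\<lambda>_. sp)"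

lemma finite_sp: "finite (set_pmf sp)" unfolding sp_def using finite_U finite_lp by (rule finite_set_Pi_pmf)

definition found :: "(nat \<times> nat \<Rightarrow> nat) \<Rightarrow> (nat \<Rightarrow> nat \<Rightarrow> nat \<times> bool) \<Rightarrow> (nat \<Rightarrow> nat) \<Rightarrow> nat set" where
  "found \<theta> w X = {y. \<exists>j<m. \<exists>l. st (w j) (pm \<theta> j) X ((N - 1) * a S) = Some l \<and> tst (w j) (pm \<theta> j) X S (N - 1) (l div D ^ S) y}"

context
  fixes X :: "nat \<Rightarrow> nat"
  assumes XU: "\<And>t. X t \<in> U" and F2R: "200000 * F2 X \<le> R * Wb"
begin

text \<open>Markov's inequality twice. The expected blocking of a slot is at most
  \<open>3 * Wb / 2000\<close>, so it exceeds \<open>Wb / 16\<close> with probability at most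
  48/2000; then half of the slots are blocked with probability at most twice that. The slots share
  their shifts, so only expectations are added.\<close>

lemma blocked_slots:
  "measure_pmf.prob thp {\<theta>. 2 * card {j\<in>{..<m}. (\<Sum>u<Wb. Lf X (pm \<theta> j) u) \<le> Wb / 16} < m} \<le> 1 / 20"
proof -
  define LL where "LL \<theta> j = (\<Sum>u<Wb. Lf X (pm \<theta> j) u)" for \<theta> j
  have LL0: "0 \<le> LL \<theta> j" for \<theta> j unfolding LL_def Lf_def by (intro sum_nonneg divide_nonneg_nonneg) auto
  have int: "integrable thp f" for f :: "_ \<Rightarrow> real" using finite_thp by (rule integrable_measure_pmf_finite)
  have F2r: "real (F2 X) / R \<le> Wb / 200000"
  proof -
    have "real (200000 * F2 X) \<le> real (R * Wb)" using F2R by (simp only: of_nat_le_iff)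
    then show ?thesis using R_pos by (simp add: field_simps)
  qed
  have E: "measure_pmf.expectation thp (\<lambda>\<theta>. LL \<theta> j) \<le> 3 * Wb / 2000" for j
  proof -
    have "measure_pmf.expectation thp (\<lambda>\<theta>. LL \<theta> j) =
       (\<Sum>u<Wb. (\<Sum>z\<in>U. measure_pmf.expectation thp (\<lambda>\<theta>. real (card {v\<in>{..<u}. life (pm \<theta> j) X v u z}))) / R)"
      unfolding LL_def Lf_def by (simp add: Bochner_Integration.integral_sum int)
    also have "\<dots> = (\<Sum>u<Wb. (\<Sum>z\<in>U. \<Sum>v<u. measure_pmf.prob thp {\<theta>. life (pm \<theta> j) X v u z}) / R)"
      by (simp only: expectation_card[OF finite_thp finite_lessThan])
    also have "\<dots> = (\<Sum>u<Wb. \<Sum>z\<in>U. \<Sum>v<u. measure_pmf.prob thp {\<theta>. life (pm \<theta> j) X v u z}) / R" by (simp add: sum_divide_distrib)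
    also have "(\<Sum>u<Wb. \<Sum>z\<in>U. \<Sum>v<u. measure_pmf.prob thp {\<theta>. life (pm \<theta> j) X v u z}) = (\<Sum>z\<in>U. \<Sum>u<Wb. \<Sum>v<u. measure_pmf.prob thp {\<theta>. life (pm \<theta> j) X v u z})"
      by (rule sum.swap)
    also have "\<dots> / R \<le> (\<Sum>z\<in>U. 300 * real ((tot X z)^2)) / R" by (intro divide_right_mono sum_mono life_sum) auto
    also have "\<dots> = 300 * (real (F2 X) / R)" by (simp add: F2_def sum_distrib_left)
    also have "\<dots> \<le> 3 * Wb / 2000" using F2r by simp
    finally show ?thesis .
  qed
  have Pj: "measure_pmf.prob thp {\<theta>. \<not> LL \<theta> j \<le> Wb / 16} \<le> 48 / 2000" for j
  proof -
    have "measure_pmf.prob thp {\<theta>. \<not> LL \<theta> j \<le> Wb / 16} \<le> measure_pmf.prob thp {\<theta>. real Wb / 16 \<le> LL \<theta> j}"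
      by (intro measure_pmf.finite_measure_mono) auto
    also have "\<dots> \<le> measure_pmf.expectation thp (\<lambda>\<theta>. LL \<theta> j) / (real Wb / 16)"
      using Wb_pos by (intro prob_le_markov finite_thp LL0) auto
    also have "\<dots> \<le> (3 * Wb / 2000) / (real Wb / 16)" by (intro divide_right_mono E) auto
    also have "\<dots> = 48 / 2000" using Wb_pos by simp
    finally show ?thesis .
  qed
  have "measure_pmf.prob thp {\<theta>. 2 * card {j\<in>{..<m}. LL \<theta> j \<le> Wb / 16} < m} \<le>
     measure_pmf.prob thp {\<theta>. real m / 2 \<le> real (card {j\<in>{..<m}. \<not> LL \<theta> j \<le> Wb / 16})}"
  proof (intro measure_pmf.finite_measure_mono subsetI)
    fix \<theta> assume "\<theta> \<in> {\<theta>. 2 * card {j\<in>{..<m}. LL \<theta> j \<le> Wb / 16} < m}"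
    moreover have "card {j\<in>{..<m}. LL \<theta> j \<le> Wb / 16} + card {j\<in>{..<m}. \<not> LL \<theta> j \<le> Wb / 16} = m"
    proof -
      have "{..<m} = {j\<in>{..<m}. LL \<theta> j \<le> Wb / 16} \<union> {j\<in>{..<m}. \<not> LL \<theta> j \<le> Wb / 16}" by auto
      then have "card {..<m} = card ({j\<in>{..<m}. LL \<theta> j \<le> Wb / 16} \<union> {j\<in>{..<m}. \<not> LL \<theta> j \<le> Wb / 16})" by (rule arg_cong)
      also have "\<dots> = card {j\<in>{..<m}. LL \<theta> j \<le> Wb / 16} + card {j\<in>{..<m}. \<not> LL \<theta> j \<le> Wb / 16}" by (rule card_Un_disjoint) auto
      finally show ?thesis by simp
    qed
    ultimately have "m \<le> 2 * card {j\<in>{..<m}. \<not> LL \<theta> j \<le> Wb / 16}" by simp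
    then have "real m \<le> real (2 * card {j\<in>{..<m}. \<not> LL \<theta> j \<le> Wb / 16})" by (simp only: of_nat_le_iff)
    then show "\<theta> \<in> {\<theta>. real m / 2 \<le> real (card {j\<in>{..<m}. \<not> LL \<theta> j \<le> Wb / 16})}" by simp
  qed auto
  also have "\<dots> \<le> measure_pmf.expectation thp (\<lambda>\<theta>. real (card {j\<in>{..<m}. \<not> LL \<theta> j \<le> Wb / 16})) / (real m / 2)"
    using m_pos by (intro prob_le_markov finite_thp) auto
  also have "\<dots> = (\<Sum>j<m. measure_pmf.prob thp {\<theta>. \<not> LL \<theta> j \<le> Wb / 16}) / (real m / 2)"
    by (simp only: expectation_card[OF finite_thp finite_lessThan])
  also have "\<dots> \<le> (\<Sum>j<m. 48 / 2000) / (real m / 2)" by (intro divide_right_mono sum_mono Pj) auto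
  also have "\<dots> \<le> 1 / 20" using m_pos by simp
  finally show ?thesis by (simp only: LL_def)
qed

text \<open>The tests in different cells are independent, and each is passed with probability at
  most \<open>dn\<close>, hence at most \<open>exp (dn - 1)\<close>. The \<open>dn\<close> sum to at
  most \<open>(N + 2) / 2\<close> over about 63/64 of \<open>N\<close> cells, which leaves an
  exponent below -2/5 of \<open>N\<close>.\<close>

lemma light_prob:
  assumes "16 * tot X y \<le> 3 * (N + 2) * a S"
  shows "measure_pmf.prob thp {\<theta>. \<forall>C\<in>{N div 64 + 3..<N}. dense X S C (pm \<theta> j S C) y} \<le> exp (- (2 / 5) * real N)"
proof -
  define C0 where "C0 = N div 64 + 3"
  define V where "V = (\<lambda>(s, C). if s = S \<and> C0 \<le> C \<and> C < N then {r. dense X S C ((j + r) mod m) y} else UNIV)"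
  define T where "T = (\<lambda>C. (S, C)) ` {C0..<N}"
  have TI: "T \<subseteq> Idx"
  proof -
    have "N * 1 \<le> N * a S" using a_pos[of S] by (intro mult_le_mono2) (simp del: a_pos)
    then have "C < N * a S" if "C < N" for C using that by linarith
    then show ?thesis by (auto simp: T_def Idx_def)
  qed
  have "measure_pmf.prob thp {\<theta>. \<forall>C\<in>{C0..<N}. dense X S C (pm \<theta> j S C) y} \<le> measure_pmf.prob thp (Pi Idx V)"
    by (intro measure_pmf.finite_measure_mono) (auto simp: V_def pm_def)
  also have "\<dots> = (\<Prod>x\<in>Idx. measure_pmf.prob (pmf_of_set {..<m}) (V x))" unfolding thp_def by (rule measure_Pi_pmf_Pi[OF finite_Idx])
  also have "\<dots> = (\<Prod>x\<in>T. measure_pmf.prob (pmf_of_set {..<m}) (V x))"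
  proof (rule prod.mono_neutral_right[OF finite_Idx TI], rule ballI)
    fix x assume "x \<in> Idx - T"
    then have "V x = UNIV" by (auto simp: V_def T_def)
    then show "measure_pmf.prob (pmf_of_set {..<m}) (V x) = 1" by simp
  qed
  also have "\<dots> = (\<Prod>C\<in>{C0..<N}. measure_pmf.prob (pmf_of_set {..<m}) {r. dense X S C ((j + r) mod m) y})"
    unfolding T_def by (subst prod.reindex) (auto simp: inj_on_def V_def intro!: prod.cong)
  also have "\<dots> \<le> (\<Prod>C\<in>{C0..<N}. exp (dn X S C y - 1))"
  proof (rule prod_mono, safe)
    fix C
    have "measure_pmf.prob (pmf_of_set {..<m}) {r. dense X S C ((j + r) mod m) y} \<le> dn X S C y" by (rule prob_shift_dense)
    also have "\<dots> \<le> exp (dn X S C y - 1)" using exp_ge_add_one_self[of "dn X S C y - 1"] by simp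
    finally show "measure_pmf.prob (pmf_of_set {..<m}) {r. dense X S C ((j + r) mod m) y} \<le> exp (dn X S C y - 1)" .
  qed simp
  also have "\<dots> = exp (\<Sum>C\<in>{C0..<N}. dn X S C y - 1)" by (simp add: exp_sum)
  also have "\<dots> \<le> exp (- (2 / 5) * real N)"
  proof -
    have cells: "(\<Sum>C<k. cell X S C y) = cnt X y 0 (k * a S * q)" for k
    proof (induction k)
      case (Suc k)
      have "cnt X y 0 (Suc k * a S * q) = card ({t\<in>{0..<k * a S * q}. X t = y} \<union> {t\<in>{k * a S * q..<Suc k * a S * q}. X t = y})"
        unfolding cnt_def by (intro arg_cong[where f = card]) (auto simp: algebra_simps)
      also have "\<dots> = cnt X y 0 (k * a S * q) + cell X S k y"
        unfolding cell_def cnt_def by (rule card_Un_disjoint) auto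
      finally have "cnt X y 0 (Suc k * a S * q) = cnt X y 0 (k * a S * q) + cell X S k y" .
      then show ?case using Suc by simp
    qed (simp add: cnt_def)
    have "(\<Sum>C\<in>{C0..<N}. cell X S C y) \<le> (\<Sum>C<N. cell X S C y)" by (intro sum_mono2) auto
    then have "(\<Sum>C\<in>{C0..<N}. cell X S C y) \<le> tot X y" unfolding cells tot_def .
    then have "16 * (\<Sum>C\<in>{C0..<N}. cell X S C y) \<le> 3 * (N + 2) * a S" using assms by linarith
    then have "real (16 * (\<Sum>C\<in>{C0..<N}. cell X S C y)) \<le> real (3 * (N + 2) * a S)" by (simp only: of_nat_le_iff)
    then have cl: "16 * real (\<Sum>C\<in>{C0..<N}. cell X S C y) \<le> 3 * (real N + 2) * a S" by (simp add: algebra_simps)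
    have "(\<Sum>C\<in>{C0..<N}. dn X S C y) = 8 * real (\<Sum>C\<in>{C0..<N}. cell X S C y) / (3 * a S)"
      by (simp add: dn_def sum_distrib_left sum_divide_distrib)
    also have "\<dots> \<le> (real N + 2) / 2"
      using cl a_pos[of S] by (simp add: field_simps del: a_pos)
    finally have s1: "(\<Sum>C\<in>{C0..<N}. dn X S C y) \<le> (real N + 2) / 2" .
    have N: "4096 \<le> N" using DN D_big by simp
    have "real (N div 64) \<le> real N / 64" using of_nat_div_le_of_nat[of N 64] by simp
    moreover have "C0 \<le> N" using N unfolding C0_def by linarith
    ultimately have "real (N - C0) \<ge> real N * (63 / 64) - 3" by (simp add: C0_def of_nat_diff)
    moreover have "(\<Sum>C\<in>{C0..<N}. dn X S C y - 1) = (\<Sum>C\<in>{C0..<N}. dn X S C y) - real (N - C0)" by (simp add: sum_subtractf)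
    moreover have "4096 \<le> real N" using N by simp
    ultimately show ?thesis using s1 by simp
  qed
  finally show ?thesis unfolding C0_def .
qed

definition BIG :: "nat set" where "BIG = {z\<in>U. 3 * B * D ^ S \<le> 2 * tot X z}"

lemma card_BIG: "card BIG * D ^ S \<le> R * D ^ 3"
proof -
  have "D ^ S \<le> tot X z" if "z \<in> BIG" for z
  proof -
    have "3 * 1 * D ^ S \<le> 3 * B * D ^ S" using B_pos by (intro mult_le_mono1 mult_le_mono2) auto
    moreover have "3 * B * D ^ S \<le> 2 * tot X z" using that by (simp add: BIG_def)
    ultimately show ?thesis by linarith
  qed
  then have "(\<Sum>z\<in>BIG. (D ^ S)\<^sup>2) \<le> (\<Sum>z\<in>BIG. (tot X z)\<^sup>2)" by (intro sum_mono power_mono) auto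
  also have "\<dots> \<le> F2 X" unfolding F2_def using finite_U by (intro sum_mono2) (auto simp: BIG_def)
  also have "\<dots> \<le> R * Wb" using F2R by linarith
  also have "\<dots> \<le> R * (D ^ 3 * D ^ S)"
  proof (rule mult_le_mono2)
    have "Wb \<le> N * a S" unfolding WbN by (intro mult_le_mono1) simp
    also have "\<dots> \<le> D^2 * D ^ Suc S" using N_le a_le by (rule mult_le_mono)
    also have "\<dots> = D ^ 3 * D ^ S" by (simp add: power2_eq_square power3_eq_cube mult_ac)
    finally show "Wb \<le> D ^ 3 * D ^ S" .
  qed
  finally have "(card BIG * D ^ S) * D ^ S \<le> (R * D ^ 3) * D ^ S" by (simp add: power2_eq_square mult_ac)
  then show ?thesis by (rule mult_le_cancel2[THEN iffD1, THEN mp]) simp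
qed

text \<open>Each element of \<open>BIG\<close> contributes at least \<open>D ^ (2 * S)\<close> to
  the second moment, so there are few of them. With \<open>R \<le> D ^ (S + 5)\<close> the
  collisions cost at most \<open>1 / D ^ 9\<close> per slot, enough for a union over
  \<open>m \<le> D\<close> slots.\<close>

lemma impure_prob:
  "measure_pmf.prob wp {w. \<exists>j<m. \<exists>y\<in>BIG. \<exists>z\<in>BIG. y \<noteq> z \<and> fst (w j z) div D ^ S = fst (w j y) div D ^ S} \<le> 1 / 100"
proof -
  define bad where "bad w \<longleftrightarrow> (\<exists>y\<in>BIG. \<exists>z\<in>BIG. y \<noteq> z \<and> fst (w z) div D ^ S = fst (w y) div D ^ S)" for w :: "nat \<Rightarrow> nat \<times> bool"
  have finB: "finite BIG" using finite_U by (simp add: BIG_def)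
  have slot: "measure_pmf.prob sp {w. bad w} \<le> 1 / real D ^ 9"
  proof -
    define P where "P = {(y,z). y \<in> BIG \<and> z \<in> BIG \<and> y \<noteq> z}"
    have P: "P \<subseteq> BIG \<times> BIG" by (auto simp: P_def)
    have finP: "finite P" using P finB finite_subset by blast
    have "card P \<le> card (BIG \<times> BIG)" using P finB by (intro card_mono) auto
    then have cP: "card P \<le> card BIG ^ 2" by (simp add: card_cartesian_product power2_eq_square)
    define ev where "ev = (\<lambda>(y,z). {w :: nat \<Rightarrow> nat \<times> bool. fst (w z) div D ^ S = fst (w y) div D ^ S})"
    have "measure_pmf.prob sp {w. bad w} \<le> measure_pmf.prob sp (\<Union>yz\<in>P. ev yz)"
    proof (intro measure_pmf.finite_measure_mono subsetI)
      fix w assume "w \<in> {w. bad w}"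
      then obtain y z where h: "y \<in> BIG" "z \<in> BIG" "y \<noteq> z" "fst (w z) div D ^ S = fst (w y) div D ^ S"
        unfolding bad_def by blast
      then show "w \<in> (\<Union>yz\<in>P. ev yz)" by (intro UN_I[of "(y,z)"]) (auto simp: P_def ev_def)
    qed auto
    also have "\<dots> \<le> (\<Sum>yz\<in>P. measure_pmf.prob sp (ev yz))"
      using finP by (intro measure_pmf.finite_measure_subadditive_finite) auto
    also have "\<dots> \<le> (\<Sum>yz\<in>P. real (D ^ S) / (R * Lam))"
    proof (rule sum_mono, clarify)
      fix y z assume "(y,z) \<in> P"
      then have yz: "y \<in> U" "z \<in> U" "y \<noteq> z" by (auto simp: P_def BIG_def)
      \<comment> \<open>\<open>prob_collision\<close> sums over a finite set of labels; labels
        outside this range have probability zero and are split off.\<close>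
      define L where "L = {..<R * Lam}"
      have "measure_pmf.prob sp (ev (y,z)) \<le> measure_pmf.prob sp ({w. fst (w y) \<in> L \<and> fst (w z) \<in> {l'. l' div D ^ S = fst (w y) div D ^ S}} \<union> {w. w y \<in> {v. fst v \<in> - L}})"
        by (intro measure_pmf.finite_measure_mono) (auto simp: ev_def)
      also have "\<dots> \<le> measure_pmf.prob sp {w. fst (w y) \<in> L \<and> fst (w z) \<in> {l'. l' div D ^ S = fst (w y) div D ^ S}} + measure_pmf.prob sp {w. w y \<in> {v. fst v \<in> - L}}"
        by (rule measure_Un_le) auto
      also have "measure_pmf.prob sp {w. w y \<in> {v. fst v \<in> - L}} = measure_pmf.prob lp {v. fst v \<in> - L}" by (rule sp_comp[OF yz(1)])
      also have "\<dots> = 0" unfolding prob_lp L_def Compl_disjoint by simp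
      also have "measure_pmf.prob sp {w. fst (w y) \<in> L \<and> fst (w z) \<in> {l'. l' div D ^ S = fst (w y) div D ^ S}} \<le> real (card L) * real (D ^ S) / (R * Lam)\<^sup>2"
        by (rule prob_collision[where M = "\<lambda>l. {l'. l' div D ^ S = l div D ^ S}"]) (use yz finite_block[of "\<lambda>_ _. 0" X] XU m_pos in \<open>auto simp: L_def\<close>)
      also have "real (card L) * real (D ^ S) / (R * Lam)\<^sup>2 + 0 = real (D ^ S) / (R * Lam)"
        using RL_pos by (simp add: L_def power2_eq_square)
      finally show "measure_pmf.prob sp (ev (y,z)) \<le> real (D ^ S) / (R * Lam)" by simp
    qed
    also have "\<dots> = real (card P * D ^ S) / (R * Lam)" by simp
    also have "\<dots> \<le> 1 / real D ^ 9"
    proof -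
      have "(card BIG * D ^ S)\<^sup>2 \<le> (R * D ^ 3)\<^sup>2" using card_BIG by (rule power_mono) simp
      then have "card BIG ^ 2 * D ^ S * D ^ S \<le> R * R * D ^ 6" by (simp add: power_mult_distrib power2_eq_square mult_ac flip: power_add)
      also have "\<dots> \<le> R * D ^ (S + 5) * D ^ 6" using RD by (intro mult_le_mono1 mult_le_mono2)
      also have "\<dots> = (R * D ^ 11) * D ^ S" by (simp add: power_add mult_ac flip: power_Suc)
      finally have "(card BIG ^ 2 * D ^ S) * D ^ S \<le> (R * D ^ 11) * D ^ S" .
      then have "card BIG ^ 2 * D ^ S \<le> R * D ^ 11" by (rule mult_le_cancel2[THEN iffD1, THEN mp]) simp
      then have "card P * D ^ S \<le> R * D ^ 11" using cP by (meson le_trans mult_le_mono1)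
      then have "card P * D ^ S * D ^ 9 \<le> R * D ^ 11 * D ^ 9" by (rule mult_le_mono1)
      also have "\<dots> = R * Lam" by (simp add: LamD mult.assoc power_add[symmetric])
      finally have "real (card P * D ^ S * D ^ 9) \<le> real (R * Lam)" by (simp only: of_nat_le_iff)
      moreover have "0 < real (R * Lam)" "0 < real D ^ 9" using RL_pos D_pos by (simp_all only: of_nat_0_less_iff zero_less_power)
      ultimately show ?thesis by (simp add: field_simps)
    qed
    finally show ?thesis .
  qed
  have "measure_pmf.prob wp {w. \<exists>j<m. \<exists>y\<in>BIG. \<exists>z\<in>BIG. y \<noteq> z \<and> fst (w j z) div D ^ S = fst (w j y) div D ^ S} \<le>
     measure_pmf.prob wp (\<Union>j\<in>{..<m}. {w. w j \<in> {v. bad v}})"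
    by (intro measure_pmf.finite_measure_mono subsetI) (auto simp: bad_def)
  also have "\<dots> \<le> (\<Sum>j<m. measure_pmf.prob wp {w. w j \<in> {v. bad v}})" by (intro measure_pmf.finite_measure_subadditive_finite) auto
  also have "\<dots> = (\<Sum>j<m. measure_pmf.prob sp {v. bad v})"
  proof (rule sum.cong[OF refl])
    fix j assume "j \<in> {..<m}"
    then show "measure_pmf.prob wp {w. w j \<in> {v. bad v}} = measure_pmf.prob sp {v. bad v}"
      unfolding wp_def using prob_component[of "{..<m}" "\<lambda>_. sp" j "\<lambda>_. (0, False)" "{v. bad v}"] finite_sp by simp
  qed
  also have "\<dots> = real m * measure_pmf.prob sp {v. bad v}" by simp
  also have "\<dots> \<le> real m * (1 / real D ^ 9)" using slot by (rule mult_left_mono) simp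
  also have "\<dots> \<le> 1 / 100"
  proof -
    have "m \<le> D" using AD B_pos by (metis mult_le_mono1 nat_mult_1 order_trans one_le_numeral mult.assoc Suc_leI One_nat_def mult_le_mono le_trans)
    then have "real m \<le> real D" by simp
    moreover have "100 * real D \<le> real D ^ 9"
    proof -
      have "100 * real D \<le> real D * real D" using D_big by (intro mult_right_mono) auto
      also have "\<dots> = real D ^ 2" by (simp add: power2_eq_square)
      also have "\<dots> \<le> real D ^ 9" using D_big by (intro power_increasing) auto
      finally show ?thesis .
    qed
    ultimately have "100 * real m \<le> real D ^ 9" by linarith
    then show ?thesis using D_pos by (simp add: field_simps del: D_pos)
  qed
  finally show ?thesis .
qed

text \<open>For fixed turns the slots are independent, and at least half of them succeed with
  probability at least \<open>Wb / (8 * R)\<close>.\<close>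

lemma miss_prob:
  assumes x: "x \<in> U" and reg: "regular q D (N * a S) X x"
    and th: "m \<le> 2 * card {j\<in>{..<m}. (\<Sum>u<Wb. Lf X (pm \<theta> j) u) \<le> Wb / 16}"
  shows "measure_pmf.prob wp {w. x \<notin> found \<theta> w X} \<le> exp (- (real Wb * m / (16 * R)))"
proof -
  define p where "p = real Wb / (8 * R)"
  define J where "J = {j\<in>{..<m}. (\<Sum>u<Wb. Lf X (pm \<theta> j) u) \<le> Wb / 16}"
  define suc where "suc j = {v. \<exists>l. st v (pm \<theta> j) X ((N - 1) * a S) = Some l \<and> tst v (pm \<theta> j) X S (N - 1) (l div D ^ S) x}" for j
  have p: "p \<le> measure_pmf.prob sp (suc j)" if "j \<in> J" for j
    unfolding p_def suc_def by (rule slot_success_tuned[OF XU F2R x reg pm_less]) (use that in \<open>simp add: J_def\<close>)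
  have p0: "0 \<le> p" by (simp add: p_def)
  have "measure_pmf.prob wp {w. x \<notin> found \<theta> w X} = measure_pmf.prob wp (Pi {..<m} (\<lambda>j. - suc j))"
    by (intro arg_cong[where f = "measure_pmf.prob wp"]) (auto simp: found_def suc_def)
  also have "\<dots> = (\<Prod>j<m. measure_pmf.prob sp (- suc j))" unfolding wp_def by (rule measure_Pi_pmf_Pi) simp
  also have "\<dots> \<le> (\<Prod>j<m. if j \<in> J then exp (- p) else 1)"
  proof (rule prod_mono, safe)
    fix j
    have "measure_pmf.prob sp (- suc j) = 1 - measure_pmf.prob sp (suc j)"
      using measure_pmf.prob_compl[of "suc j" sp] by (simp add: Compl_eq_Diff_UNIV)
    moreover have "1 - p \<le> exp (- p)" using exp_ge_add_one_self[of "- p"] by simp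
    ultimately show "measure_pmf.prob sp (- suc j) \<le> (if j \<in> J then exp (- p) else 1)" using p[of j] by auto
  qed simp
  also have "\<dots> = exp (- p) ^ card J" 
  proof -
    have "{..<m} \<inter> {j. j \<in> J} = J" by (auto simp: J_def)
    then show ?thesis by (simp add: prod.If_cases)
  qed
  also have "\<dots> = exp (- (p * card J))" by (simp add: exp_of_nat_mult[symmetric] mult.commute)
  also have "\<dots> \<le> exp (- (real Wb * m / (16 * R)))"
  proof -
    have "real m \<le> real (2 * card J)" using th unfolding J_def by (simp only: of_nat_le_iff)
    then have "p * (real m / 2) \<le> p * card J" using p0 by (intro mult_left_mono) auto
    then show ?thesis by (simp add: p_def)
  qed
  finally show ?thesis .
qed

text \<open>The failure budget is 5 + 1 + 1 + 1 percent: blocked slots, a light element passing all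
  its tests, an imposture among frequent elements, a missed heavy element. A miss counts only for
  turns without blocking, where \<open>miss_prob\<close> applies for each fixed choice of the
  turns.\<close>

theorem stream_success:
  assumes H: "H \<subseteq> U" "\<And>x. x \<in> H \<Longrightarrow> regular q D (N * a S) X x" "card H * exp (- (real Wb * m / (16 * R))) \<le> 1 / 100"
    and Y: "Y \<subseteq> U" "\<And>y. y \<in> Y \<Longrightarrow> 16 * tot X y \<le> 3 * (N + 2) * a S" "m * card U * exp (- (2 / 5) * real N) \<le> 1 / 100"
  shows "92 / 100 \<le> measure_pmf.prob (pair_pmf thp wp) {(\<theta>, w). H \<subseteq> found \<theta> w X \<and> found \<theta> w X \<subseteq> U - Y}"
proof -
  define bl where "bl \<theta> \<longleftrightarrow> 2 * card {j\<in>{..<m}. (\<Sum>u<Wb. Lf X (pm \<theta> j) u) \<le> Wb / 16} < m" for \<theta>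
  define lt where "lt \<theta> \<longleftrightarrow> (\<exists>j<m. \<exists>y\<in>Y. \<forall>C\<in>{N div 64 + 3..<N}. dense X S C (pm \<theta> j S C) y)" for \<theta>
  define im where "im w \<longleftrightarrow> (\<exists>j<m. \<exists>y\<in>BIG. \<exists>z\<in>BIG. y \<noteq> z \<and> fst (w j z) div D ^ S = fst (w j y) div D ^ S)" for w :: "nat \<Rightarrow> nat \<Rightarrow> nat \<times> bool"
  define ms where "ms \<theta> w \<longleftrightarrow> \<not> bl \<theta> \<and> (\<exists>x\<in>H. x \<notin> found \<theta> w X)" for \<theta> w
  have finH: "finite H" using H finite_U finite_subset by blast
  have finY: "finite Y" using Y finite_U finite_subset by blast
  have 1: "measure_pmf.prob thp {\<theta>. bl \<theta>} \<le> 1 / 20" unfolding bl_def by (rule blocked_slots)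
  have 2: "measure_pmf.prob thp {\<theta>. lt \<theta>} \<le> 1 / 100"
  proof -
    have "measure_pmf.prob thp {\<theta>. lt \<theta>} \<le> measure_pmf.prob thp (\<Union>j\<in>{..<m}. \<Union>y\<in>Y. {\<theta>. \<forall>C\<in>{N div 64 + 3..<N}. dense X S C (pm \<theta> j S C) y})"
      by (intro measure_pmf.finite_measure_mono) (auto simp: lt_def)
    also have "\<dots> \<le> (\<Sum>j<m. measure_pmf.prob thp (\<Union>y\<in>Y. {\<theta>. \<forall>C\<in>{N div 64 + 3..<N}. dense X S C (pm \<theta> j S C) y}))"
      by (intro measure_pmf.finite_measure_subadditive_finite) auto
    also have "\<dots> \<le> (\<Sum>j<m. \<Sum>y\<in>Y. measure_pmf.prob thp {\<theta>. \<forall>C\<in>{N div 64 + 3..<N}. dense X S C (pm \<theta> j S C) y})"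
      using finY by (intro sum_mono measure_pmf.finite_measure_subadditive_finite) auto
    also have "\<dots> \<le> (\<Sum>j<m. \<Sum>y\<in>Y. exp (- (2 / 5) * real N))" by (intro sum_mono light_prob Y)
    also have "\<dots> = real m * (real (card Y) * exp (- (2 / 5) * real N))" by simp
    also have "\<dots> \<le> real m * (real (card U) * exp (- (2 / 5) * real N))"
      using card_mono[OF finite_U Y(1)] by (intro mult_left_mono mult_right_mono) auto
    also have "\<dots> \<le> 1 / 100" using Y(3) by (simp add: mult.assoc)
    finally show ?thesis .
  qed
  have 4: "measure_pmf.prob (pair_pmf thp wp) {(\<theta>, w). ms \<theta> w} \<le> 1 / 100"
  proof (rule prob_pair_le)
    fix \<theta>
    show "measure_pmf.prob wp {w. ms \<theta> w} \<le> 1 / 100"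
    proof (cases "bl \<theta>")
      case False
      then have th: "m \<le> 2 * card {j\<in>{..<m}. (\<Sum>u<Wb. Lf X (pm \<theta> j) u) \<le> Wb / 16}" unfolding bl_def by linarith
      have "measure_pmf.prob wp {w. ms \<theta> w} \<le> measure_pmf.prob wp (\<Union>x\<in>H. {w. x \<notin> found \<theta> w X})"
        by (intro measure_pmf.finite_measure_mono) (auto simp: ms_def)
      also have "\<dots> \<le> (\<Sum>x\<in>H. measure_pmf.prob wp {w. x \<notin> found \<theta> w X})"
        using finH by (intro measure_pmf.finite_measure_subadditive_finite) auto
      also have "\<dots> \<le> (\<Sum>x\<in>H. exp (- (real Wb * m / (16 * R))))" using H th by (intro sum_mono miss_prob) auto
      also have "\<dots> \<le> 1 / 100" using H(3) by simp
      finally show ?thesis .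
    qed (simp add: ms_def)
  qed
  let ?Om = "pair_pmf thp wp"
  have sound: "H \<subseteq> found \<theta> w X \<and> found \<theta> w X \<subseteq> U - Y" if "\<not> bl \<theta>" "\<not> lt \<theta>" "\<not> im w" "\<not> ms \<theta> w" for \<theta> w
  proof
    show "H \<subseteq> found \<theta> w X" using that by (auto simp: ms_def)
    show "found \<theta> w X \<subseteq> U - Y"
    proof
      fix y assume "y \<in> found \<theta> w X"
      then obtain j l where j: "j < m" and f: "st (w j) (pm \<theta> j) X ((N - 1) * a S) = Some l"
        "tst (w j) (pm \<theta> j) X S (N - 1) (l div D ^ S) y" by (auto simp: found_def)
      have yU: "y \<in> U" using f by (simp add: tst_def)
      have "Wb + 3 * a S \<le> (N div 64 + 3) * a S" by (simp add: WbN algebra_simps)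
      from output_sound[OF f pm_less this] have "\<forall>C\<in>{N div 64 + 3..<N}. dense X S C (pm \<theta> j S C) y"
      proof
        assume "\<exists>z\<in>U. z \<noteq> y \<and> fst (w j z) div D ^ S = fst (w j y) div D ^ S \<and> 3 * B * D ^ S \<le> 2 * tot X z \<and> 3 * B * D ^ S \<le> 2 * tot X y"
        then obtain z where "z \<in> BIG" "y \<in> BIG" "y \<noteq> z" "fst (w j z) div D ^ S = fst (w j y) div D ^ S"
          using yU unfolding BIG_def by auto
        then have "im w" using j unfolding im_def by blast
        then show ?thesis using that by simp
      qed
      then have "y \<notin> Y" using \<open>\<not> lt \<theta>\<close> j by (auto simp: lt_def)
      then show "y \<in> U - Y" using yU by simp
    qed
  qed
  have "1 = measure_pmf.prob ?Om UNIV" by simp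
  also have "\<dots> \<le> measure_pmf.prob ?Om ({(\<theta>, w). H \<subseteq> found \<theta> w X \<and> found \<theta> w X \<subseteq> U - Y} \<union>
     ({(\<theta>, w). bl \<theta>} \<union> ({(\<theta>, w). lt \<theta>} \<union> ({(\<theta>, w). im w} \<union> {(\<theta>, w). ms \<theta> w}))))"
    using sound by (intro measure_pmf.finite_measure_mono) auto
  also have "\<dots> \<le> measure_pmf.prob ?Om {(\<theta>, w). H \<subseteq> found \<theta> w X \<and> found \<theta> w X \<subseteq> U - Y} +
     (measure_pmf.prob ?Om {(\<theta>, w). bl \<theta>} + (measure_pmf.prob ?Om {(\<theta>, w). lt \<theta>} + (measure_pmf.prob ?Om {(\<theta>, w). im w} + measure_pmf.prob ?Om {(\<theta>, w). ms \<theta> w})))"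
    by (intro order_trans[OF measure_Un_le] add_left_mono order_refl) auto
  also have "\<dots> \<le> measure_pmf.prob ?Om {(\<theta>, w). H \<subseteq> found \<theta> w X \<and> found \<theta> w X \<subseteq> U - Y} + (1 / 20 + (1 / 100 + (1 / 100 + 1 / 100)))"
    using 1 2 4 impure_prob unfolding prob_pair_fst prob_pair_snd im_def by (intro add_left_mono add_mono) auto
  finally show ?thesis by simp
qed

end

end

section \<open>The scheme for one norm\<close>

definition freq :: "nat \<Rightarrow> (nat \<Rightarrow> nat) \<Rightarrow> nat \<Rightarrow> nat" where "freq n X y = card {t. t < n \<and> X t = y}"

lemma card_frequent:
  fixes c :: real and g :: "'a \<Rightarrow> nat"
  assumes "finite U" "(\<Sum>y\<in>U. (g y)\<^sup>2) = v" "0 < c" "0 < v"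
  shows "real (card {x\<in>U. c * v \<le> (real (g x))\<^sup>2}) \<le> 1 / c"
proof -
  define H where "H = {x\<in>U. c * v \<le> (real (g x))\<^sup>2}"
  have "real (card H) * (c * v) \<le> (\<Sum>x\<in>H. (real (g x))\<^sup>2)" by (rule sum_bounded_below) (simp add: H_def)
  also have "\<dots> \<le> (\<Sum>x\<in>U. (real (g x))\<^sup>2)" using assms by (intro sum_mono2) (auto simp: H_def)
  also have "\<dots> = real v" unfolding assms(2)[symmetric] by simp
  finally have "real (card H) * c * real v \<le> 1 * real v" by (simp add: mult.assoc)
  then have "real (card H) * c \<le> 1" using assms(4) by (simp add: mult_le_cancel_right)
  then show ?thesis using assms(3) by (simp add: H_def field_simps)
qed

text \<open>Streams as functions, continued by the constant \<open>u0\<close>; the set is finite, as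
  the union bound over inputs requires.\<close>

definition streams :: "nat \<Rightarrow> nat \<Rightarrow> nat set \<Rightarrow> (nat \<Rightarrow> nat) set" where
  "streams n u0 U = (\<lambda>xs t. if t < n then xs ! t else u0) ` {xs. set xs \<subseteq> U \<and> length xs = n}"

lemma streams: "finite U \<Longrightarrow> finite (streams n u0 U)" "finite U \<Longrightarrow> card (streams n u0 U) \<le> card U ^ n"
  "u0 \<in> U \<Longrightarrow> X \<in> streams n u0 U \<Longrightarrow> X t \<in> U"
proof -
  assume U: "finite U"
  then show "finite (streams n u0 U)" by (simp add: streams_def finite_lists_length_eq)
  have "card (streams n u0 U) \<le> card {xs. set xs \<subseteq> U \<and> length xs = n}"
    unfolding streams_def by (rule card_image_le) (simp add: finite_lists_length_eq U)
  then show "card (streams n u0 U) \<le> card U ^ n" using U by (simp add: card_lists_length_eq)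
next
  assume "u0 \<in> U" "X \<in> streams n u0 U"
  then show "X t \<in> U" by (auto simp: streams_def subset_iff)
qed

definition out_set :: "'a \<times> nat set option \<Rightarrow> nat set" where
  "out_set z = (case snd z of Some Z \<Rightarrow> Z | None \<Rightarrow> {})"

context tuned_slots
begin

lemma K1_le: "K1 \<le> D ^ 26"
proof -
  have a1: "a 1 \<le> D^2" using a_le[of 1] by (simp add: numeral_2_eq_2)
  have p: "D ^ i \<le> D ^ j" if "i \<le> j" for i j using that by (intro power_increasing) auto
  have "(4 * a 1 * Lam) * (4 * a 1) * 2 \<le> (4 * D^2 * D ^ 20) * (4 * D^2) * 2"
    using a1 unfolding LamD by (intro mult_le_mono) auto
  also have "\<dots> = 32 * D ^ 24" by (simp add: power_add[symmetric] mult_ac flip: mult.assoc)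
  finally have 1: "(4 * a 1 * Lam) * (4 * a 1) * 2 \<le> 32 * D ^ 24" .
  have "S * ((4 * B * m * Lam * D^2 + 1) * 2) \<le> D * ((D * D ^ 20 * D^2 + D ^ 23) * 2)"
    using SD AD unfolding LamD by (intro mult_le_mono add_mono) (auto simp: Suc_leI)
  also have "\<dots> = 4 * D ^ 24"
  proof -
    have "D * D ^ 20 * D^2 = D ^ 23" by (simp only: power_Suc[symmetric] power_add[symmetric]) simp
    moreover have "D * ((D ^ 23 + D ^ 23) * 2) = 4 * (D * D ^ 23)" by simp
    moreover have "D * D ^ 23 = D ^ 24" by (simp only: power_Suc[symmetric]) simp
    ultimately show ?thesis by (simp only:)
  qed
  finally have 2: "S * ((4 * B * m * Lam * D^2 + 1) * 2) \<le> 4 * D ^ 24" .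
  have "K1 \<le> D ^ 24 + D ^ 24 + 32 * D ^ 24 + 4 * D ^ 24"
    unfolding K1_def[OF finite_U] using 1 2 p[of 0 24] p[of 20 24] by (intro add_mono) (auto simp: LamD)
  also have "\<dots> = 38 * D ^ 24" by simp
  also have "\<dots> \<le> D^2 * D ^ 24"
  proof (rule mult_le_mono1)
    have "38 \<le> D * 1" using D_big by simp
    also have "\<dots> \<le> D * D" by (intro mult_le_mono2) simp
    finally show "38 \<le> D^2" by (simp add: power2_eq_square)
  qed
  also have "\<dots> = D ^ 26" by (simp add: power_add[symmetric])
  finally show ?thesis .
qed

lemma found_eq_outs: "N * a S * q \<le> t \<Longrightarrow> outs w (\<lambda>s C. \<theta> (s, C)) X t = found \<theta> w X"
proof -
  assume "N * a S * q \<le> t"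
  moreover have "prm (\<lambda>s C. \<theta> (s, C)) j = pm \<theta> j" for j by (intro ext) (simp add: prm_def[OF finite_U] pm_def)
  ultimately show ?thesis by (simp add: gmem_output[OF finite_U] found_def)
qed

theorem norm_scheme:
  fixes \<epsilon> :: real and n v cap T u0 :: nat
  assumes u0: "u0 \<in> U" and n: "N * a S * q \<le> n" and \<epsilon>: "0 < \<epsilon>" and v: "0 < v" "200000 * v \<le> R * Wb"
    and miss: "1 / \<epsilon> * exp (- (real Wb * m / (16 * R))) \<le> 1 / 100"
    and light: "\<And>c :: nat. (real c)\<^sup>2 < \<epsilon> / 256 * v \<Longrightarrow> 16 * c \<le> 3 * (N + 2) * a S"
    and few: "m * card U * exp (- (2 / 5) * real N) \<le> 1 / 100"
    and cap: "256 / \<epsilon> < real cap + 1"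
    and T: "T > 0" "real (card U ^ n) * exp (- 2 * real T * (1 / 100)\<^sup>2) < 1"
  shows "\<exists>M :: nat \<Rightarrow> nat \<Rightarrow> (nat \<Rightarrow> nat) \<Rightarrow> (nat \<Rightarrow> slot_memory) \<times> nat set option.
    (\<forall>i X X'. M i 0 X = M i 0 X') \<and>
    (\<forall>i t X X'. (\<forall>s. X s \<in> U) \<longrightarrow> (\<forall>s. X' s \<in> U) \<longrightarrow> M i t X = M i t X' \<longrightarrow> X t = X' t \<longrightarrow> M i (Suc t) X = M i (Suc t) X') \<and>
    (\<forall>i t. t \<le> n \<longrightarrow> finite (M i t ` {X. \<forall>s. X s \<in> U}) \<and>
       card (M i t ` {X. \<forall>s. X s \<in> U}) \<le> (D ^ 26) ^ m * (1 + 2 ^ B * (2 * n + 1) * (n + 1)) ^ S * (1 + (card U + 1) ^ cap)) \<and>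
    (\<forall>X\<in>streams n u0 U. (\<Sum>y\<in>U. (freq n X y)\<^sup>2) = v \<longrightarrow>
       (\<forall>x\<in>U. \<epsilon> * v \<le> (real (freq n X x))\<^sup>2 \<longrightarrow> regular q D (N * a S) X x) \<longrightarrow>
       91 / 100 * real T \<le> real (card {i\<in>{..<T}. {x\<in>U. \<epsilon> * v \<le> (real (freq n X x))\<^sup>2} \<subseteq> out_set (M i n X) \<and>
          out_set (M i n X) \<subseteq> {x\<in>U. \<epsilon> / 256 * v \<le> (real (freq n X x))\<^sup>2}}))"
proof -
  define hv where "hv c X = {x\<in>U. c * v \<le> (real (freq n X x))\<^sup>2}" for c :: real and X
  define ok where "ok X \<longleftrightarrow> (\<Sum>y\<in>U. (freq n X y)\<^sup>2) = v \<and> (\<forall>x\<in>hv \<epsilon> X. regular q D (N * a S) X x)" for X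
  \<comment> \<open>Streams outside the promise \<open>ok\<close> count as good, so that the union
    bound may run over all of \<open>streams n u0 U\<close>.\<close>
  define good where "good X = (\<lambda>(\<theta>, w). ok X \<longrightarrow> hv \<epsilon> X \<subseteq> found \<theta> w X \<and> found \<theta> w X \<subseteq> hv (\<epsilon> / 256) X)" for X
  have tot_le: "tot X y \<le> freq n X y" for X y
    unfolding tot_def cnt_def freq_def using n by (intro card_mono) auto
  have prob: "92 / 100 \<le> measure_pmf.prob (pair_pmf thp wp) {\<omega>. good X \<omega>}" if X: "X \<in> streams n u0 U" for X
  proof (cases "ok X")
    case True
    then have sum: "(\<Sum>y\<in>U. (freq n X y)\<^sup>2) = v" and reg: "\<And>x. x \<in> hv \<epsilon> X \<Longrightarrow> regular q D (N * a S) X x" by (auto simp: ok_def)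
    have XU: "X t \<in> U" for t using streams(3)[OF u0 X] .
    have "F2 X \<le> v" unfolding F2_def sum[symmetric] using tot_le by (intro sum_mono power_mono) auto
    then have F2R: "200000 * F2 X \<le> R * Wb" using v(2) by linarith
    have cH: "real (card (hv \<epsilon> X)) \<le> 1 / \<epsilon>" unfolding hv_def by (rule card_frequent[OF finite_U sum \<epsilon> v(1)])
    have "92 / 100 \<le> measure_pmf.prob (pair_pmf thp wp) {(\<theta>, w). hv \<epsilon> X \<subseteq> found \<theta> w X \<and> found \<theta> w X \<subseteq> U - (U - hv (\<epsilon> / 256) X)}"
    proof (rule stream_success[OF XU F2R])
      show "hv \<epsilon> X \<subseteq> U" by (auto simp: hv_def)
      have "real (card (hv \<epsilon> X)) * exp (- (real Wb * m / (16 * R))) \<le> 1 / \<epsilon> * exp (- (real Wb * m / (16 * R)))"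
        using cH by (intro mult_right_mono) auto
      then show "real (card (hv \<epsilon> X)) * exp (- (real Wb * m / (16 * R))) \<le> 1 / 100" using miss by linarith
      show "16 * tot X y \<le> 3 * (N + 2) * a S" if "y \<in> U - hv (\<epsilon> / 256) X" for y
      proof -
        have "16 * freq n X y \<le> 3 * (N + 2) * a S" using that by (intro light) (auto simp: hv_def)
        then show ?thesis using tot_le[of X y] by linarith
      qed
    qed (use reg few in auto)
    also have "{(\<theta>, w). hv \<epsilon> X \<subseteq> found \<theta> w X \<and> found \<theta> w X \<subseteq> U - (U - hv (\<epsilon> / 256) X)} = {\<omega>. good X \<omega>}"
      using True by (auto simp: good_def hv_def)
    finally show ?thesis .
  next
    case False
    then have "{\<omega>. good X \<omega>} = UNIV" by (auto simp: good_def)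
    then show ?thesis by simp
  qed
  have "real (card (streams n u0 U)) * exp (- 2 * real T * (1 / 100)\<^sup>2) < 1"
  proof -
    have "real (card (streams n u0 U)) \<le> real (card U ^ n)" using streams(2)[OF finite_U] by (simp only: of_nat_le_iff)
    then have "real (card (streams n u0 U)) * exp (- 2 * real T * (1 / 100)\<^sup>2) \<le> real (card U ^ n) * exp (- 2 * real T * (1 / 100)\<^sup>2)"
      by (intro mult_right_mono) auto
    then show ?thesis using T(2) by linarith
  qed
  then obtain ws where ws: "\<And>X. X \<in> streams n u0 U \<Longrightarrow>
      real T * (measure_pmf.prob (pair_pmf thp wp) {\<omega>. good X \<omega>} - 1 / 100) \<le> real (card {i\<in>{..<T}. good X (ws i)})"
    using public_randomness_reduction[OF streams(1)[OF finite_U] T(1), of "1/100" n u0 "pair_pmf thp wp" good] by auto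
  define M where "M i t X = gmem (snd (ws i)) (\<lambda>s C. fst (ws i) (s, C)) cap t X" for i t X
  show ?thesis
  proof (intro exI[of _ M] conjI allI impI ballI)
    show "M i 0 X = M i 0 X'" for i X X' unfolding M_def by (rule gmem_init[OF finite_U])
    show "M i (Suc t) X = M i (Suc t) X'" if "\<forall>s. X s \<in> U" "\<forall>s. X' s \<in> U" "M i t X = M i t X'" "X t = X' t" for i t X X'
      using that unfolding M_def by (intro gmem_cong[OF finite_U]) auto
    show "finite (M i t ` {X. \<forall>s. X s \<in> U})" if "t \<le> n" for i t
      unfolding M_def using gmem_card(1)[OF finite_U that] by simp
    show "card (M i t ` {X. \<forall>s. X s \<in> U}) \<le> (D ^ 26) ^ m * (1 + 2 ^ B * (2 * n + 1) * (n + 1)) ^ S * (1 + (card U + 1) ^ cap)"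
      if t: "t \<le> n" for i t
    proof -
      have "card (M i t ` {X. \<forall>s. X s \<in> U}) \<le> K1 ^ m * (1 + Wk n) ^ S * (1 + (card U + 1) ^ cap)"
        unfolding M_def using gmem_card(2)[OF finite_U t] by simp
      also have "\<dots> \<le> (D ^ 26) ^ m * (1 + Wk n) ^ S * (1 + (card U + 1) ^ cap)"
        using K1_le by (intro mult_le_mono1 power_mono) auto
      finally show ?thesis by (simp only: Wk_def[OF finite_U])
    qed
    fix X assume X: "X \<in> streams n u0 U" and sum: "(\<Sum>y\<in>U. (freq n X y)\<^sup>2) = v"
      and reg: "\<forall>x\<in>U. \<epsilon> * v \<le> (real (freq n X x))\<^sup>2 \<longrightarrow> regular q D (N * a S) X x"
    have okX: "ok X" using sum reg by (auto simp: ok_def hv_def)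
    have out: "hv \<epsilon> X \<subseteq> out_set (M i n X) \<and> out_set (M i n X) \<subseteq> hv (\<epsilon> / 256) X" if "good X (ws i)" for i
    proof -
      obtain \<theta> w where w: "ws i = (\<theta>, w)" by (cases "ws i")
      have f: "hv \<epsilon> X \<subseteq> found \<theta> w X" "found \<theta> w X \<subseteq> hv (\<epsilon> / 256) X" using that okX by (auto simp: good_def w)
      have fin: "finite (hv (\<epsilon> / 256) X)" using finite_U by (simp add: hv_def)
      \<comment> \<open>At most \<open>256 / \<epsilon>\<close> elements reach the lower threshold,
        so a correct output never overflows.\<close>
      have "real (card (hv (\<epsilon> / 256) X)) \<le> 1 / (\<epsilon> / 256)"
        unfolding hv_def using \<epsilon> by (intro card_frequent[OF finite_U sum _ v(1)]) auto
      then have "real (card (hv (\<epsilon> / 256) X)) < real cap + 1" using cap by simp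
      then have "card (found \<theta> w X) \<le> cap" using card_mono[OF fin f(2)] by linarith
      then have "out_set (M i n X) = found \<theta> w X"
        by (simp add: out_set_def M_def gmem_def[OF finite_U] w found_eq_outs[OF n])
      then show ?thesis using f by simp
    qed
    \<comment> \<open>Fixing the seeds costs one of the 92 percent.\<close>
    have "91 / 100 * real T \<le> real T * (measure_pmf.prob (pair_pmf thp wp) {\<omega>. good X \<omega>} - 1 / 100)"
      using prob[OF X] by (subst mult.commute) (intro mult_left_mono, auto)
    also have "\<dots> \<le> real (card {i\<in>{..<T}. good X (ws i)})" by (rule ws[OF X])
    also have "\<dots> \<le> real (card {i\<in>{..<T}. hv \<epsilon> X \<subseteq> out_set (M i n X) \<and> out_set (M i n X) \<subseteq> hv (\<epsilon> / 256) X})"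
      using out by (intro of_nat_mono card_mono) auto
    finally show "91 / 100 * real T \<le> real (card {i\<in>{..<T}. {x\<in>U. \<epsilon> * v \<le> (real (freq n X x))\<^sup>2} \<subseteq> out_set (M i n X) \<and>
          out_set (M i n X) \<subseteq> {x\<in>U. \<epsilon> / 256 * v \<le> (real (freq n X x))\<^sup>2}})" by (simp only: hv_def)
  qed
qed

end

section \<open>Choice of parameters\<close>

lemma large_exp_bound: "x * exp (- x / 5) \<le> 1 / 100" if "x \<ge> 5000" for x :: real
proof -
  have "x / 5 * (x / 5) / 2 \<le> exp (x / 5)" using exp_lower_Taylor_quadratic[of "x / 5"] that by (simp add: power2_eq_square)
  moreover have "100 * x \<le> x / 5 * (x / 5) / 2"
  proof -
    have "5000 * x \<le> x * x" using that by (intro mult_right_mono) auto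
    then show ?thesis by simp
  qed
  ultimately have "100 * x \<le> exp (x / 5)" by linarith
  then have "x * 100 \<le> exp (x / 5)" by simp
  then show ?thesis by (simp add: exp_minus field_simps)
qed

text \<open>Everything is measured in \<open>f\<close>, the least frequency of a heavy element for
  the given norm: there are of order \<open>f\<close> ticks, of order \<open>f\<close> birth ticks,
  and \<open>R\<close> is of order \<open>f / \<epsilon>\<close>.\<close>

theorem norm_parameters:
  fixes n v m B D :: nat and \<epsilon> Lr :: real and U :: "nat set"
  assumes \<epsilon>: "0 < \<epsilon>" "\<epsilon> \<le> 1" and nv: "n \<le> v" "v \<le> n\<^sup>2" and U: "finite U" "card U \<le> 2 ^ B"
    and sep: "\<And>y z. y \<in> U \<Longrightarrow> z \<in> U \<Longrightarrow> (\<And>b. b < B \<Longrightarrow> bitf y b = bitf z b) \<Longrightarrow> y = z"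
    and D: "5000 \<le> D" "even D" "4 * B * m \<le> D" "D ^ 30 \<le> n" "540000000 / \<epsilon> \<le> D" "log 2 n \<le> D"
    and B: "B > 0" and m: "100 \<le> m" "576000000000 * Lr \<le> \<epsilon> * m" and Lr: "1 / \<epsilon> * exp (- Lr) \<le> 1 / 100"
  obtains q Wb S N R where "tuned_slots q m B D (D ^ 20) Wb S N U bitf R" "N * (4 * B * m * D ^ S) * q \<le> n"
    "200000 * v \<le> R * Wb" "1 / \<epsilon> * exp (- (real Wb * real m / real (16 * R))) \<le> 1 / 100"
    "\<And>c :: nat. (real c)\<^sup>2 < \<epsilon> / 256 * v \<Longrightarrow> 16 * c \<le> 3 * (N + 2) * (4 * B * m * D ^ S)"
    "real (m * card U) * exp (- (2 / 5) * real N) \<le> 1 / 100" "D ^ S \<le> n"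
    "\<And>c :: nat. \<epsilon> * v \<le> (real c)\<^sup>2 \<Longrightarrow> 2 * n \<le> q * c" "q > 0"
proof -
  define f where "f = sqrt (\<epsilon> * v)"
  have Dr: "5000 \<le> real D" using D(1) by simp
  have n0: "0 < n" using D(1,4) by (metis D(1) gr0I le_zero_eq not_numeral_le_zero power_eq_0_iff)
  have eD: "1 / \<epsilon> \<le> D"
  proof -
    have "1 / \<epsilon> \<le> 540000000 / \<epsilon>" using \<epsilon> by (intro divide_right_mono) auto
    then show ?thesis using D(5) by linarith
  qed
  have f2: "f * f = \<epsilon> * v" using \<epsilon> by (simp add: f_def)
  have f0: "0 \<le> f" using \<epsilon> by (simp add: f_def)
  have fn: "f \<le> n"
  proof -
    have "\<epsilon> * v \<le> 1 * real (n\<^sup>2)" using \<epsilon> nv by (intro mult_mono) (auto simp only: of_nat_le_iff)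
    then have "f \<le> sqrt ((real n)\<^sup>2)" unfolding f_def by (intro real_sqrt_le_mono) simp
    then show ?thesis by simp
  qed
  have fD: "real D ^ 14 \<le> f"
  proof -
    have "real D ^ 30 \<le> real n" using D(4) by (metis of_nat_le_iff of_nat_power)
    also have "\<dots> \<le> real v" using nv by simp
    also have "\<dots> = \<epsilon> * v * (1 / \<epsilon>)" using \<epsilon> by simp
    also have "\<dots> \<le> \<epsilon> * v * D" using eD \<epsilon> by (intro mult_left_mono) auto
    finally have "real D ^ 28 * real D ^ 2 \<le> \<epsilon> * v * D" by (simp add: power_add[symmetric])
    moreover have "real D ^ 28 * real D \<le> real D ^ 28 * real D ^ 2" using Dr by (intro mult_left_mono) (auto simp: power2_eq_square)
    ultimately have "real D ^ 28 * real D \<le> \<epsilon> * v * D" by linarith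
    then have "real D ^ 28 \<le> \<epsilon> * v" using Dr by simp
    then have "sqrt ((real D ^ 14)\<^sup>2) \<le> f" unfolding f_def by (intro real_sqrt_le_mono) (simp add: power_mult[symmetric])
    then show ?thesis by (simp only: real_sqrt_abs abs_of_nonneg zero_le_power of_nat_0_le_iff)
  qed
  have D14: "real D ^ 3 * 5000 \<le> real D ^ 14"
  proof -
    have "real D ^ 3 * 5000 \<le> real D ^ 3 * real D ^ 11"
      using Dr order_trans[OF Dr self_le_power[of "real D" 11]] by (intro mult_left_mono) auto
    then show ?thesis by (simp add: power_add[symmetric])
  qed
  have D3: "1 \<le> real D ^ 3" using Dr by (intro one_le_power) auto
  have f5: "5000 \<le> f" using fD D14 D3 by linarith
  have fpos: "0 < f" using f5 by linarith
  \<comment> \<open>This length gives an element of frequency \<open>f\<close> two occurrences per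
    tick on average.\<close>
  define q where "q = nat \<lceil>2 * real n / f\<rceil>"
  have q1: "2 * real n / f \<le> q" unfolding q_def by (rule real_nat_ceiling_ge)
  have q2: "real q \<le> 3 * n / f"
  proof -
    have "0 \<le> 2 * real n / f" using fpos by simp
    then have "real q \<le> 2 * n / f + 1" unfolding q_def by linarith
    moreover have "1 \<le> n / f" using fn fpos by simp
    ultimately show ?thesis by (simp add: add_divide_distrib[symmetric])
  qed
  have "0 < real q" using q1 n0 fpos by (intro less_le_trans[OF _ q1]) simp
  then have q0: "q > 0" by simp
  define W where "W = n div q"
  have Wq: "W * q \<le> n" by (simp add: W_def)
  have W1: "f < 3 * (real W + 1)"
  proof -
    have "n < (W + 1) * q" using dividend_less_div_times[OF q0, of n] by (simp add: W_def)
    then have "real n < real ((W + 1) * q)" by (simp only: of_nat_less_iff)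
    also have "\<dots> = (real W + 1) * q" by (simp add: algebra_simps)
    also have "\<dots> \<le> (real W + 1) * (3 * n / f)" using q2 by (intro mult_left_mono) auto
    finally have "real n * f < real n * (3 * (real W + 1))" using fpos by (simp add: field_simps)
    then show ?thesis using n0 by simp
  qed
  have W2: "real W \<le> f / 2"
  proof -
    have "real (W * q) \<le> real n" using Wq by (simp only: of_nat_le_iff)
    then have "real W * (2 * n / f) \<le> n" using q1 mult_left_mono[OF q1, of "real W"] by simp
    then have "real n * real W \<le> real n * (f / 2)" using fpos by (simp add: field_simps)
    then show ?thesis using n0 by simp
  qed
  have W4: "f \<le> 4 * real W"
  proof -
    have "f < 3 * real W + 3" using W1 by simp
    then show ?thesis using f5 by linarith
  qed
  have WD: "D ^ 3 \<le> W"
  proof -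
    have "real D ^ 3 \<le> real W" using fD D14 W4 by linarith
    then show ?thesis by (metis of_nat_le_iff of_nat_power)
  qed
  have Wn: "W \<le> n" by (simp add: W_def)
  \<comment> \<open>The last stage is the largest whose cells still fit \<open>D\<close> times. Its
    maximality gives \<open>N \<le> D\<^sup>2\<close>.\<close>
  define Ss where "Ss = {s. 1 \<le> s \<and> D * (4 * B * m * D ^ s) \<le> W}"
  have Bm: "1 \<le> 4 * B * m" using B m by simp
  have pw: "D ^ s \<le> D * (4 * B * m * D ^ s)" for s
  proof -
    have "1 * D ^ s \<le> (D * (4 * B * m)) * D ^ s" using Bm D(1) by (intro mult_le_mono1) simp
    then show ?thesis by (simp add: mult_ac)
  qed
  have lt: "s < D ^ s" for s using D(1) by (intro less_le_trans[OF less_exp power_mono]) auto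
  have finS: "finite Ss"
  proof (rule finite_subset)
    show "Ss \<subseteq> {..W}"
    proof
      fix s assume "s \<in> Ss"
      then have "D * (4 * B * m * D ^ s) \<le> W" by (simp add: Ss_def)
      then show "s \<in> {..W}" using pw[of s] lt[of s] unfolding atMost_iff by linarith
    qed
  qed simp
  have "1 \<in> Ss"
  proof -
    have "D * (4 * B * m * D ^ 1) \<le> D * (D * D)" using D(3) by (intro mult_le_mono2) simp
    also have "\<dots> = D ^ 3" by (simp add: power3_eq_cube)
    finally show ?thesis using WD by (simp add: Ss_def)
  qed
  define S where "S = Max Ss"
  have "S \<in> Ss" unfolding S_def using \<open>1 \<in> Ss\<close> by (intro Max_in[OF finS]) auto
  then have S1: "1 \<le> S" and SW: "D * (4 * B * m * D ^ S) \<le> W" by (auto simp: Ss_def)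
  define aS where "aS = 4 * B * m * D ^ S"
  have DS: "D ^ S \<le> aS" using Bm by (simp add: aS_def)
  have aSpos: "0 < aS" using Bm D(1) by (simp add: aS_def)
  have DaS: "D * aS \<le> W" using SW by (simp add: aS_def)
  have WDD: "W < D * D * aS"
  proof -
    have "Suc S \<notin> Ss" using Max_ge[OF finS, of "Suc S"] by (auto simp: S_def)
    then show ?thesis by (simp add: Ss_def aS_def mult_ac not_le)
  qed
  define N where "N = W div aS"
  have DN: "D \<le> N" using DaS aSpos by (simp add: N_def less_eq_div_iff_mult_less_eq)
  have ND: "N \<le> D\<^sup>2"
  proof -
    have "N < D * D" using WDD aSpos by (simp add: N_def div_less_iff_less_mult)
    then show ?thesis by (simp add: power2_eq_square)
  qed
  have NaW: "N * aS \<le> W" by (simp add: N_def)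
  have WN: "W < (N + 1) * aS" using dividend_less_div_times[OF aSpos, of W] by (simp add: N_def)
  define Wb where "Wb = (N div 64) * aS"
  have Nb: "5000 \<le> N" using DN D(1) by simp
  have "N + 1 \<le> 75 * (N div 64)" using Nb by linarith
  then have "(N + 1) * aS \<le> 75 * (N div 64) * aS" by (rule mult_le_mono1)
  then have "W \<le> 75 * Wb" using WN by (simp add: Wb_def)
  then have "real W \<le> real (75 * Wb)" by (simp only: of_nat_le_iff)
  then have Wbf: "f / 300 \<le> Wb" using W4 by simp
  have "(N div 64 + 4) * aS \<le> (N - 1) * aS" using Nb by (intro mult_le_mono1) linarith
  then have Wble: "Wb + 4 * aS \<le> (N - 1) * aS" by (simp add: Wb_def algebra_simps)
  \<comment> \<open>With \<open>Wb\<close> at least \<open>f / 300\<close>, the constant 60000000 =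
    200000 * 300 yields \<open>200000 * v \<le> R * Wb\<close>. The ceiling at most doubles it, and
    576000000000 = 300 * 16 * 120000000 is what \<open>t4\<close> then requires of
    \<open>m\<close>.\<close>
  define R where "R = nat \<lceil>60000000 * f / \<epsilon>\<rceil>"
  have R1: "60000000 * f / \<epsilon> \<le> R" unfolding R_def by (rule real_nat_ceiling_ge)
  have fe: "f \<le> f / \<epsilon>" using \<epsilon> fpos by (simp add: field_simps mult_left_le)
  have R2: "real R \<le> 120000000 * f / \<epsilon>"
  proof -
    have "0 \<le> 60000000 * f / \<epsilon>" using fpos \<epsilon> by simp
    then have "real R \<le> 60000000 * f / \<epsilon> + 1" unfolding R_def by linarith
    moreover have "1 \<le> 60000000 * f / \<epsilon>" using fe f5 by simp
    ultimately show ?thesis by (simp add: add_divide_distrib[symmetric])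
  qed
  have "0 < 60000000 * f / \<epsilon>" using fpos \<epsilon> by simp
  then have "0 < real R" using R1 by linarith
  then have R0: "0 < R" by simp
  have qR: "64 * q \<le> R"
  proof -
    have "64 * real q \<le> 192 * n / f" using q2 by simp
    also have "\<dots> \<le> 60000000 * v / f" using nv fpos by (intro divide_right_mono) auto
    also have "\<dots> = 60000000 * f / \<epsilon>" using f2 fpos \<epsilon> by (simp add: field_simps)
    finally have "real (64 * q) \<le> real R" using R1 by simp
    then show ?thesis by (simp only: of_nat_le_iff)
  qed
  have WbR: "Wb \<le> R"
  proof -
    have "Wb \<le> N * aS" unfolding Wb_def by (intro mult_le_mono1) simp
    then have "Wb \<le> W" using NaW by linarith
    then have "real Wb \<le> real W" by simp
    also have "\<dots> \<le> R"
    proof -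
      have "60000000 * (f / \<epsilon>) \<le> R" using R1 by simp
      then show ?thesis using W2 fe fpos by linarith
    qed
    finally show ?thesis by simp
  qed
  have vR: "200000 * v \<le> R * Wb"
  proof -
    have "200000 * real v = (60000000 * f / \<epsilon>) * (f / 300)" using f2 \<epsilon> by (simp add: field_simps)
    also have "\<dots> \<le> real R * real Wb" using R1 Wbf fpos by (intro mult_mono) auto
    finally have "real (200000 * v) \<le> real (R * Wb)" by simp
    then show ?thesis by (simp only: of_nat_le_iff)
  qed
  have SD: "S \<le> D"
  proof -
    have "2 ^ S \<le> D ^ S" using D(1) by (intro power_mono) auto
    also have "\<dots> \<le> n" using pw[of S] SW Wn by linarith
    finally have "real (2 ^ S) \<le> real n" by (simp only: of_nat_le_iff)
    then have "log 2 (2 powr S) \<le> log 2 n" using n0 by (subst log_le_cancel_iff) (auto simp: powr_realpow)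
    then have "real S \<le> real D" using D(6) by simp
    then show ?thesis by simp
  qed
  have RD: "R \<le> D ^ (S + 5)"
  proof -
    have "aS \<le> D * D ^ S" unfolding aS_def using D(3) by (rule mult_le_mono1)
    then have "D * D * aS \<le> D * D * (D * D ^ S)" by (rule mult_le_mono2)
    then have "W \<le> D * D * (D * D ^ S)" using WDD by linarith
    then have "real W \<le> real (D * D * (D * D ^ S))" by (simp only: of_nat_le_iff)
    then have "f \<le> 4 * real D ^ (S + 3)" using W4 by (simp add: power_add power3_eq_cube mult_ac)
    then have "120000000 * f / \<epsilon> \<le> 480000000 / \<epsilon> * real D ^ (S + 3)" using \<epsilon> by (simp add: divide_right_mono)
    also have "\<dots> \<le> real D * real D ^ (S + 3)"
    proof (rule mult_right_mono)
      have "480000000 / \<epsilon> \<le> 540000000 / \<epsilon>" using \<epsilon> by (intro divide_right_mono) auto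
      then show "480000000 / \<epsilon> \<le> real D" using D(5) by linarith
    qed simp
    also have "\<dots> = real D ^ (S + 4)" by (simp add: numeral_eq_Suc)
    also have "\<dots> \<le> real D ^ (S + 5)" using Dr by (intro power_increasing) auto
    finally have "real R \<le> real (D ^ (S + 5))" using R2 unfolding of_nat_power by linarith
    then show ?thesis by (simp only: of_nat_le_iff)
  qed
  have slots: "slots q m B D (D ^ 20) Wb S N U bitf"
    using q0 m B D(1,2) S1 sep Wble by unfold_locales (auto simp: aS_def)
  have t1: "tuned_slots q m B D (D ^ 20) Wb S N U bitf R"
  proof -
    interpret slots q m B D "D ^ 20" Wb S N U bitf by (rule slots)
    have aeq: "a S = aS" by (simp add: a_def aS_def)
    show ?thesis
      using ND R0 WbR U D(1,3) SD DN qR RD by unfold_locales (auto simp: Wb_def aeq)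
  qed
  have t2: "N * (4 * B * m * D ^ S) * q \<le> n"
  proof -
    have "N * aS * q \<le> W * q" using NaW by (rule mult_le_mono1)
    then show ?thesis using Wq unfolding aS_def by linarith
  qed
  have t4: "1 / \<epsilon> * exp (- (real Wb * m / (16 * R))) \<le> 1 / 100"
  proof -
    have "Lr \<le> \<epsilon> * m / 576000000000" using m(2) by simp
    also have "\<dots> \<le> real Wb * m / (16 * R)"
    proof -
      have "real R * \<epsilon> \<le> 120000000 * f" using R2 \<epsilon> by (simp add: field_simps)
      also have "\<dots> \<le> 36000000000 * real Wb" using Wbf by simp
      finally have "(real R * \<epsilon>) * real m \<le> (36000000000 * real Wb) * real m" by (rule mult_right_mono) simp
      then show ?thesis using R0 by (simp add: field_simps)
    qed
    finally have "1 / \<epsilon> * exp (- (real Wb * m / (16 * R))) \<le> 1 / \<epsilon> * exp (- Lr)" using \<epsilon> by (intro mult_left_mono) auto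
    then show ?thesis using Lr by linarith
  qed
  \<comment> \<open>The 256 is the square of 16. As \<open>f < 3 * (W + 1)\<close>, a frequency
    below \<open>f / 16\<close> means about 3/16 per tick or less.\<close>
  have t5: "16 * c \<le> 3 * (N + 2) * (4 * B * m * D ^ S)" if "(real c)\<^sup>2 < \<epsilon> / 256 * v" for c :: nat
  proof -
    have "(16 * real c)\<^sup>2 < f\<^sup>2" using that f2 by (simp add: power2_eq_square)
    then have "16 * real c < f" using f0 by (rule power_less_imp_less_base)
    moreover have "real (W + 1) \<le> real ((N + 1) * aS)" using WN by (simp only: of_nat_le_iff)
    ultimately have "real (16 * c) \<le> real (3 * ((N + 1) * aS))" using W1 by simp
    then have "16 * c \<le> 3 * ((N + 1) * aS)" by (simp only: of_nat_le_iff)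
    also have "\<dots> \<le> 3 * (N + 2) * aS" by (simp add: algebra_simps)
    finally show ?thesis by (simp add: aS_def)
  qed
  have t6: "m * card U * exp (- (2 / 5) * real N) \<le> 1 / 100"
  proof -
    have "1 * m \<le> 4 * B * m" using B by (intro mult_le_mono1) simp
    then have mD: "m \<le> D" using D(3) by linarith
    have "4 * B * 100 \<le> 4 * B * m" using m by (intro mult_le_mono2)
    then have "400 * B \<le> D" using D(3) by linarith
    then have BD: "real B \<le> D / 400" by simp
    have "real (card U) \<le> 2 ^ B" using U by (metis of_nat_le_iff of_nat_numeral of_nat_power)
    also have "(2::real) ^ B \<le> exp 1 ^ B" using exp_ge_add_one_self[of 1] by (intro power_mono) auto
    also have "\<dots> = exp (real B)" by (simp add: exp_of_nat_mult[symmetric])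
    also have "\<dots> \<le> exp (D / 400)" using BD by simp
    finally have cU: "real (card U) \<le> exp (D / 400)" .
    have "real (m * card U) * exp (- (2 / 5) * real N) \<le> (real D * exp (D / 400)) * exp (- (2 / 5) * real D)"
      using mD cU DN by (simp, intro mult_mono) auto
    also have "\<dots> = real D * exp (D / 400 + - (2 / 5) * real D)" unfolding exp_add by simp
    also have "\<dots> \<le> real D * exp (- real D / 5)" by (intro mult_left_mono) auto
    also have "\<dots> \<le> 1 / 100" using Dr by (rule large_exp_bound)
    finally show ?thesis .
  qed
  have t7: "D ^ S \<le> n" using pw[of S] SW Wn by linarith
  have t8: "2 * n \<le> q * c" if "\<epsilon> * v \<le> (real c)\<^sup>2" for c :: nat
  proof -
    have "f \<le> sqrt ((real c)\<^sup>2)" unfolding f_def using that by (rule real_sqrt_le_mono)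
    then have "f \<le> c" by simp
    have "2 * real n = 2 * real n / f * f" using fpos by simp
    also have "\<dots> \<le> q * real c" using q1 \<open>f \<le> c\<close> fpos by (intro mult_mono) auto
    finally have "real (2 * n) \<le> real (q * c)" by simp
    then show ?thesis by (simp only: of_nat_le_iff)
  qed
  show thesis by (rule that[of q Wb S N R], rule t1, rule t2, rule vR, rule t4, erule t5, rule t6, rule t7, erule t8, rule q0)
qed

text \<open>The bits are the binary digits of the index of an element in an enumeration of
  \<open>U\<close>.\<close>

lemma separating_bits:
  fixes U :: "nat set"
  assumes "finite U" "card U \<le> 2 ^ B"
  obtains bitf :: "nat \<Rightarrow> nat \<Rightarrow> bool" where "\<And>y z. y \<in> U \<Longrightarrow> z \<in> U \<Longrightarrow> (\<And>b. b < B \<Longrightarrow> bitf y b = bitf z b) \<Longrightarrow> y = z"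
proof -
  obtain idx where idx: "bij_betw idx U {0..<card U}" using ex_bij_betw_finite_nat[OF assms(1)] by blast
  show thesis
  proof (rule that[of "\<lambda>y b. bit (idx y) b"])
    fix y z assume yz: "y \<in> U" "z \<in> U" and eq: "\<And>b. b < B \<Longrightarrow> bit (idx y) b = bit (idx z) b"
    have "idx y < card U" "idx z < card U" using bij_betwE[OF idx] yz by auto
    then have "idx y < 2 ^ B" "idx z < 2 ^ B" using assms(2) by linarith+
    then have "take_bit B (idx y) = idx y" "take_bit B (idx z) = idx z" by (simp_all add: take_bit_nat_eq_self)
    moreover have "take_bit B (idx y) = take_bit B (idx z)" using eq by (intro bit_eqI) (auto simp: bit_take_bit_iff)
    ultimately have "idx y = idx z" by metis
    then show "y = z" using idx yz by (auto simp: bij_betw_def inj_on_def)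
  qed
qed

text \<open>\<open>d\<close> is about \<open>8 * l / Lr\<close> and \<open>m\<close> is of order
  \<open>Lr / \<epsilon>\<close>, so that \<open>Lr\<close> cancels in the space
  \<open>d * m\<close>. The lower bound on \<epsilon> gives \<open>Lr \<le> X\<close>, hence
  \<open>d \<ge> 7 * X\<close> and \<open>2 ^ d \<ge> p ^ 7\<close>, which beats
  \<open>1 / \<epsilon>\<close> and the powers of \<open>X\<close> that occur.\<close>

theorem scale_parameters:
  fixes n k :: nat and \<epsilon> :: real
  assumes n0: "0 < n" and x: "real k + 100 \<le> sqrt (log 2 n)" and \<epsilon>: "0 < \<epsilon>" "\<epsilon> \<le> 1" "2 ^ 240 * (1 / 2 powr sqrt (log 2 n)) \<le> \<epsilon>"
  obtains d m e :: nat and Lr :: real where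
    "0 < d" "5000 \<le> (2::nat) ^ d" "4 * (k * e + 1) * m \<le> 2 ^ d" "((2::nat) ^ d) ^ 30 \<le> n" "540000000 / \<epsilon> \<le> real (2 ^ d)"
    "1000 * log 2 n \<le> real (2 ^ d)" "100 \<le> m" "576000000000 * Lr \<le> \<epsilon> * m" "1 / \<epsilon> * exp (- Lr) \<le> 1 / 100"
    "n \<le> 2 ^ e" "real e \<le> 2 * log 2 n" "real (d * m) \<le> 9216000000000 * (log 2 n / \<epsilon>)" "real e \<le> 121 / \<epsilon> * d"
proof -
  define X where "X = sqrt (log 2 n)"
  define l where "l = log 2 (real n)"
  have X100: "100 \<le> X" and kX: "real k + 1 \<le> X" using x by (auto simp: X_def)
  have "0 < sqrt (log 2 n)" using X100 unfolding X_def by linarith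
  then have l0: "0 < l" by (simp add: l_def)
  then have lX: "l = X * X" by (simp add: X_def l_def)
  have nl: "real n = 2 powr l" using n0 by (simp add: l_def)
  have l1: "1 \<le> l" using X100 mult_mono[of 1 X 1 X] by (simp add: lX)
  define p where "p = 2 powr X"
  have p100: "2 ^ 100 \<le> p"
  proof -
    have "(2::real) powr 100 \<le> p" unfolding p_def using X100 by (intro powr_mono) auto
    then show ?thesis by (simp add: powr_realpow[symmetric])
  qed
  have p1: "1 \<le> p" using p100 by (rule order_trans[rotated]) simp
  have Xp: "X \<le> p"
  proof -
    have "X / 2 \<le> X * ln 2" using X100 ln2_ge_two_thirds by (simp add: mult_left_mono)
    then have "exp (X / 2) \<le> p" unfolding p_def powr_def by simp
    moreover have "X / 2 * (X / 2) / 2 \<le> exp (X / 2)" using exp_lower_Taylor_quadratic[of "X / 2"] X100 by (simp add: power2_eq_square)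
    moreover have "8 * X \<le> X * X" using X100 by (intro mult_right_mono) auto
    ultimately show ?thesis by simp
  qed
  have ip: "2 ^ 240 / \<epsilon> \<le> p"
  proof -
    have "2 ^ 240 \<le> \<epsilon> * p" using \<epsilon>(3) unfolding X_def[symmetric] p_def[symmetric] using p1 by (simp add: field_simps)
    then show ?thesis using \<epsilon> by (simp add: field_simps)
  qed
  have i1: "1 \<le> 1 / \<epsilon>" using \<epsilon> by simp
  \<comment> \<open>The offset matches the factor \<open>2 ^ 240\<close> in the hypothesis, so that
    \<open>Lr \<le> X\<close>; from \<open>Lr \<ge> 240\<close> and 8/240 = 1/30 also
    \<open>D ^ 30 \<le> n\<close> follows.\<close>
  define Lr where "Lr = log 2 (1 / \<epsilon>) + 240"
  have Lr240: "240 \<le> Lr" using zero_le_log_cancel_iff[of 2 "1 / \<epsilon>"] i1 \<epsilon> by (simp add: Lr_def)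
  have LrX: "Lr \<le> X"
  proof -
    have "2 powr Lr = 2 ^ 240 / \<epsilon>" using \<epsilon> by (simp add: Lr_def powr_add powr_realpow[symmetric])
    then have "2 powr Lr \<le> 2 powr X" using ip by (simp add: p_def)
    then show ?thesis by simp
  qed
  have Lre: "Lr \<le> 242 / \<epsilon>"
  proof -
    have "log 2 (1 / \<epsilon>) = ln (1 / \<epsilon>) / ln 2" by (simp add: log_def)
    also have "\<dots> \<le> ln (1 / \<epsilon>) / (2 / 3)" using ln2_ge_two_thirds i1 by (intro divide_left_mono) auto
    also have "\<dots> \<le> (1 / \<epsilon>) / (2 / 3)" using i1 ln_le_minus_one[of "1 / \<epsilon>"] \<epsilon> by (intro divide_right_mono) auto
    finally have "log 2 (1 / \<epsilon>) \<le> 3 / 2 * (1 / \<epsilon>)" by simp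
    then have "Lr \<le> 3 / 2 * (1 / \<epsilon>) + 240 * (1 / \<epsilon>)" using i1 unfolding Lr_def by linarith
    also have "\<dots> = 483 / 2 * (1 / \<epsilon>)" by simp
    also have "\<dots> \<le> 242 * (1 / \<epsilon>)" using \<epsilon> by (intro mult_right_mono) auto
    finally show ?thesis by simp
  qed
  have Lexp: "1 / \<epsilon> * exp (- Lr) \<le> 1 / 100"
  proof -
    have "ln (1 / \<epsilon>) * ln 2 \<le> ln (1 / \<epsilon>) * 1" using i1 ln_2_less_1 by (intro mult_left_mono) auto
    then have "ln (1 / \<epsilon>) \<le> log 2 (1 / \<epsilon>)" unfolding log_def by (simp add: field_simps)
    then have "exp (- Lr) \<le> exp (- ln (1 / \<epsilon>) - 240)" by (simp add: Lr_def)
    also have "\<dots> = \<epsilon> * exp (- 240)" using \<epsilon> by (simp add: exp_diff exp_minus ln_div divide_inverse)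
    finally have "1 / \<epsilon> * exp (- Lr) \<le> 1 / \<epsilon> * (\<epsilon> * exp (- 240))" using \<epsilon> by (intro mult_left_mono) auto
    also have "\<dots> = 1 / exp 240" using \<epsilon> by (simp add: exp_minus field_simps)
    also have "\<dots> \<le> 1 / 100" using exp_ge_add_one_self[of 240] by (intro divide_left_mono) auto
    finally show ?thesis .
  qed
  define r where "r = 8 * l / Lr"
  define d where "d = nat \<lfloor>r\<rfloor>"
  have r8: "8 * X \<le> r"
  proof -
    have "8 * X * Lr \<le> 8 * X * X" using LrX X100 by (intro mult_left_mono) auto
    then show ?thesis using Lr240 by (simp add: r_def lX field_simps)
  qed
  have dr: "real d \<le> r" "r < real d + 1" using r8 X100 unfolding d_def by linarith+
  have d7: "7 * X \<le> d" using dr r8 X100 by linarith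
  have d0: "0 < d" using d7 X100 by (simp add: d_def) linarith
  have D: "real (2 ^ d) = 2 powr real d" by (simp add: powr_realpow)
  have pD: "p ^ 7 \<le> real (2 ^ d)"
  proof -
    have "p ^ 7 = 2 powr (7 * X)" unfolding p_def by (simp add: powr_power)
    then show ?thesis unfolding D using d7 by (simp add: powr_mono)
  qed
  have pp: "p ^ i \<le> real (2 ^ d)" if "i \<le> 7" for i
    using order_trans[OF power_increasing[OF that p1] pD] .
  have D30: "((2::nat) ^ d) ^ 30 \<le> n"
  proof -
    have "30 * real d \<le> 30 * r" using dr by simp
    also have "\<dots> \<le> l" 
    proof -
      have "240 * l \<le> Lr * l" using Lr240 l0 by (intro mult_right_mono) auto
      then show ?thesis using Lr240 by (simp add: r_def field_simps)
    qed
    finally have "2 powr (30 * real d) \<le> 2 powr l" by simp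
    moreover have "2 powr (30 * real d) = real (((2::nat) ^ d) ^ 30)"
      by (simp add: powr_realpow[symmetric] powr_powr power_mult[symmetric] mult.commute)
    ultimately have "real (((2::nat) ^ d) ^ 30) \<le> real n" using nl by simp
    then show ?thesis by (simp only: of_nat_le_iff)
  qed
  define m where "m = nat \<lceil>576000000000 * Lr / \<epsilon>\<rceil>"
  have m1: "576000000000 * Lr / \<epsilon> \<le> m" unfolding m_def by (rule real_nat_ceiling_ge)
  have mL: "1 \<le> Lr / \<epsilon>" using mult_mono[of 1 Lr 1 "1 / \<epsilon>"] Lr240 i1 by simp
  have m2: "real m \<le> 1152000000000 * (Lr / \<epsilon>)"
  proof -
    have "0 \<le> 576000000000 * Lr / \<epsilon>" using Lr240 \<epsilon> by simp
    then have "real m \<le> 576000000000 * Lr / \<epsilon> + 1" unfolding m_def by linarith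
    then show ?thesis using mL by simp
  qed
  have "576000000000 * (Lr / \<epsilon>) \<le> m" using m1 by simp
  then have "real 100 \<le> real m" using mL by simp
  then have m100: "100 \<le> m" by (simp only: of_nat_le_iff)
  have mX: "real m \<le> X * p"
  proof -
    have "1152000000000 * (Lr / \<epsilon>) \<le> Lr * (2 ^ 240 / \<epsilon>)" using Lr240 \<epsilon> by (simp add: field_simps)
    also have "\<dots> \<le> X * p" using LrX ip X100 Lr240 \<epsilon> by (intro mult_mono) auto
    finally show ?thesis using m2 by linarith
  qed
  define e where "e = nat \<lceil>l\<rceil>"
  have e1: "l \<le> e" unfolding e_def by (rule real_nat_ceiling_ge)
  have e2: "real e \<le> l + 1" using l0 unfolding e_def by linarith
  have el: "real e \<le> 2 * l" using e2 l1 by linarith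
  have ne: "n \<le> 2 ^ e"
  proof -
    have "real n \<le> 2 powr real e" using nl e1 by simp
    then have "real n \<le> real (2 ^ e)" by (simp add: powr_realpow)
    then show ?thesis by (simp only: of_nat_le_iff)
  qed
  \<comment> \<open>Here the universe exponent is absorbed: \<open>k + 1 \<le> X\<close>, because
    \<open>n\<close> is large in terms of \<open>k\<close>.\<close>
  have BmD: "4 * (k * e + 1) * m \<le> 2 ^ d"
  proof -
    have "real (k * e + 1) \<le> real k * (X * X + 1) + 1 * (X * X + 1)"
    proof -
      have "real k * real e \<le> real k * (X * X + 1)" using e2 lX by (intro mult_left_mono) auto
      moreover have "0 \<le> X * X" by simp
      ultimately show ?thesis unfolding of_nat_add of_nat_mult of_nat_1 mult_1 by linarith
    qed
    also have "\<dots> = (real k + 1) * (X * X + 1)" by (simp add: algebra_simps)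
    also have "\<dots> \<le> X * (2 * (X * X))" using kX l1 lX by (intro mult_mono) auto
    finally have "real (k * e + 1) \<le> 2 * X ^ 3" by (simp add: power3_eq_cube)
    then have "4 * real (k * e + 1) * m \<le> 4 * (2 * X ^ 3) * (X * p)" using mX X100 p1 by (intro mult_mono) auto
    also have "\<dots> = 8 * X ^ 4 * p" by (simp add: power3_eq_cube power4_eq_xxxx)
    also have "\<dots> \<le> p * p ^ 4 * p"
      using Xp X100 p100 by (intro mult_mono power_mono) auto
    also have "\<dots> = p ^ 6" by (simp add: numeral_eq_Suc)
    also have "\<dots> \<le> real (2 ^ d)" by (rule pp) simp
    finally have "real (4 * (k * e + 1) * m) \<le> real (2 ^ d)" by simp
    then show ?thesis by (simp only: of_nat_le_iff)
  qed
  have t2: "5000 \<le> (2::nat) ^ d"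
  proof -
    have "real 5000 \<le> real (2 ^ d)" using pp[of 1] p100 by simp
    then show ?thesis by (simp only: of_nat_le_iff)
  qed
  have t5: "540000000 / \<epsilon> \<le> real (2 ^ d)"
  proof -
    have "540000000 / \<epsilon> \<le> 2 ^ 240 / \<epsilon>" using \<epsilon> by (intro divide_right_mono) auto
    then show ?thesis using ip pp[of 1] by simp
  qed
  have t6: "1000 * log 2 n \<le> real (2 ^ d)"
  proof -
    have "1000 * (X * X) \<le> p * (p * p)" using Xp X100 p100 by (intro mult_mono) auto
    then show ?thesis using pp[of 3] lX by (simp add: l_def power3_eq_cube)
  qed
  have t8: "576000000000 * Lr \<le> \<epsilon> * m" using m1 \<epsilon> by (simp add: field_simps)
  have t12: "real (d * m) \<le> 9216000000000 * (log 2 n / \<epsilon>)"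
  proof -
    have "real d * real m \<le> r * (1152000000000 * (Lr / \<epsilon>))" using dr m2 mL by (intro mult_mono) auto
    also have "\<dots> = 9216000000000 * (l / \<epsilon>)" using Lr240 by (simp add: r_def)
    finally show ?thesis by (simp add: l_def)
  qed
  have t13: "real e \<le> 121 / \<epsilon> * d"
  proof -
    have "r \<le> 2 * real d" using dr d7 X100 by linarith
    then have "4 * l \<le> real d * Lr" using Lr240 by (simp add: r_def field_simps)
    also have "\<dots> \<le> real d * (242 / \<epsilon>)" using Lre by (intro mult_left_mono) auto
    also have "\<dots> = 2 * (121 / \<epsilon> * d)" by simp
    finally have "2 * l \<le> 121 / \<epsilon> * d" by linarith
    then show ?thesis using el by linarith
  qed
  show thesis
    by (rule that[OF d0 t2 BmD D30 t5 t6 m100 t8 Lexp ne _ t12 t13]) (use el in \<open>simp add: l_def\<close>)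
qed

lemma regular_cong:
  assumes "W * q \<le> n" "\<And>t. t < n \<Longrightarrow> X t = X' t"
  shows "regular q D W X x = regular q D W X' x"
proof -
  have hit: "hit q X x \<tau> = hit q X' x \<tau>" if "\<tau> < W" for \<tau>
  proof -
    have "Suc \<tau> * q \<le> W * q" using that by (intro mult_le_mono1) simp
    then have "t < n" if "t < Suc \<tau> * q" for t using that assms(1) by linarith
    then show ?thesis unfolding hit_def using assms(2) by (metis atLeastLessThan_iff)
  qed
  have "{\<tau>\<in>{i * D..<Suc i * D}. hit q X x \<tau>} = {\<tau>\<in>{i * D..<Suc i * D}. hit q X' x \<tau>}" if "Suc i * D \<le> W" for i
  proof (intro Collect_cong conj_cong refl)
    fix \<tau> assume "\<tau> \<in> {i * D..<Suc i * D}"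
    then have "\<tau> < W" using that unfolding atLeastLessThan_iff by linarith
    then show "hit q X x \<tau> = hit q X' x \<tau>" by (rule hit)
  qed
  then show ?thesis unfolding regular_def by (metis (no_types, lifting))
qed

section \<open>From the random placement to the success probability\<close>

context
  fixes U :: "nat set" and S :: "nat multiset" and n :: nat
  assumes finU: "finite U" and SU: "set_mset S \<subseteq> U" and sz: "size S = n"
begin

lemma sum_count: "(\<Sum>y\<in>U. count S y) = n"
proof -
  have "n = (\<Sum>y\<in>set_mset S. count S y)" using sz by (simp add: size_multiset_overloaded_eq)
  also have "\<dots> = (\<Sum>y\<in>U. count S y)" using finU SU by (intro sum.mono_neutral_left) (auto simp: not_in_iff)
  finally show ?thesis by simp
qed

lemma square_norm: "n \<le> (\<Sum>y\<in>U. (count S y)\<^sup>2)" "(\<Sum>y\<in>U. (count S y)\<^sup>2) \<le> n\<^sup>2"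
  "l2_norm U S = sqrt (real (\<Sum>y\<in>U. (count S y)\<^sup>2))"
  "heavy_hitters U c S = {x\<in>U. c * real (\<Sum>y\<in>U. (count S y)\<^sup>2) \<le> (real (count S x))\<^sup>2}"
proof -
  have "(\<Sum>y\<in>U. count S y) \<le> (\<Sum>y\<in>U. (count S y)\<^sup>2)" by (intro sum_mono) (simp add: power2_eq_square)
  then show "n \<le> (\<Sum>y\<in>U. (count S y)\<^sup>2)" by (simp add: sum_count)
  have "(\<Sum>y\<in>U. (count S y)\<^sup>2) \<le> (\<Sum>y\<in>U. count S y)\<^sup>2" by (rule sum_squares_le)
  then show "(\<Sum>y\<in>U. (count S y)\<^sup>2) \<le> n\<^sup>2" by (simp add: sum_count)
  show l2: "l2_norm U S = sqrt (real (\<Sum>y\<in>U. (count S y)\<^sup>2))" by (simp add: l2_norm_def)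
  show "heavy_hitters U c S = {x\<in>U. c * real (\<Sum>y\<in>U. (count S y)\<^sup>2) \<le> (real (count S x))\<^sup>2}"
    unfolding heavy_hitters_def l2 by (simp add: sum_nonneg)
qed

text \<open>\<open>G\<close> is the promise on the placement. Wherever it holds, the success
  probability is the fraction of good seeds, at least \<open>c\<close>; the two sources of
  randomness are independent, so the probabilities multiply.\<close>

lemma heavy_run:
  fixes A :: "nat stream_alg" and O1 :: "nat \<Rightarrow> (nat \<Rightarrow> nat) \<Rightarrow> nat set" and \<epsilon> c \<delta> :: real
  assumes u0: "u0 \<in> U" and pro: "partially_random_order U \<epsilon> S P" and T: "T > 0"
    and v: "v = (\<Sum>y\<in>U. (count S y)\<^sup>2)"
    and run: "\<And>xs X. length xs = n \<Longrightarrow> \<forall>t. X t \<in> U \<Longrightarrow> \<forall>t<n. X t = xs ! t \<Longrightarrow>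
        run A (sqrt (real v)) xs = map_pmf (\<lambda>i. O1 i X) (pmf_of_set {..<T})"
    and succ: "\<And>X. X \<in> streams n u0 U \<Longrightarrow> (\<Sum>y\<in>U. (freq n X y)\<^sup>2) = v \<Longrightarrow> G X \<Longrightarrow>
        c * real T \<le> real (card {i\<in>{..<T}. {x\<in>U. \<epsilon> * v \<le> (real (freq n X x))\<^sup>2} \<subseteq> O1 i X \<and>
          O1 i X \<subseteq> {x\<in>U. \<epsilon> / 256 * v \<le> (real (freq n X x))\<^sup>2}})"
    and G: "measure_pmf.prob P {\<pi>. \<not> G (\<lambda>t. if t < n then stream_of S \<pi> ! t else u0)} \<le> \<delta>" and c: "0 \<le> c"
  shows "c * (1 - \<delta>) \<le> measure_pmf.prob (bind_pmf P (\<lambda>\<pi>. run A (l2_norm U S) (stream_of S \<pi>)))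
     {T. heavy_hitters U \<epsilon> S \<subseteq> T \<and> T \<subseteq> heavy_hitters U (\<epsilon> / 256) S}"
proof -
  define X where "X \<pi> t = (if t < n then stream_of S \<pi> ! t else u0)" for \<pi> t
  have "1 - \<delta> \<le> measure_pmf.prob P {\<pi>. G (X \<pi>)}"
  proof -
    have "{\<pi>. G (X \<pi>)} = UNIV - {\<pi>. \<not> G (X \<pi>)}" by auto
    then have "measure_pmf.prob P {\<pi>. G (X \<pi>)} = 1 - measure_pmf.prob P {\<pi>. \<not> G (X \<pi>)}"
      using measure_pmf.prob_compl[of "{\<pi>. \<not> G (X \<pi>)}" P] by simp
    then show ?thesis using G unfolding X_def by simp
  qed
  then have "c * (1 - \<delta>) \<le> c * measure_pmf.prob P {\<pi>. G (X \<pi>)}" using c by (intro mult_left_mono) auto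
  also have "\<dots> \<le> measure_pmf.prob (bind_pmf P (\<lambda>\<pi>. run A (l2_norm U S) (stream_of S \<pi>)))
     {T. heavy_hitters U \<epsilon> S \<subseteq> T \<and> T \<subseteq> heavy_hitters U (\<epsilon> / 256) S}"
  proof (rule prob_bind_ge[OF _ c])
    fix \<pi> assume "\<pi> \<in> set_pmf P" and GX: "\<pi> \<in> {\<pi>. G (X \<pi>)}"
    then have pl: "\<pi> \<in> placements S" using pro by (auto simp: partially_random_order_def)
    have len: "length (stream_of S \<pi>) = n" by (simp add: stream_of_def sz)
    have sub: "set (stream_of S \<pi>) \<subseteq> U" using set_stream_of[OF pl] SU by blast
    have XU: "\<forall>t. X \<pi> t \<in> U" using sub u0 len by (auto simp: X_def subset_iff)
    have Xs: "X \<pi> \<in> streams n u0 U" unfolding streams_def X_def using sub len by (intro image_eqI[of _ _ "stream_of S \<pi>"]) auto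
    have fr: "freq n (X \<pi>) y = count S y" for y
      unfolding freq_def count_stream_of[OF pl, symmetric] sz by (intro arg_cong[where f = card]) (auto simp: X_def)
    define g where "g i \<longleftrightarrow> {x\<in>U. \<epsilon> * v \<le> (real (freq n (X \<pi>) x))\<^sup>2} \<subseteq> O1 i (X \<pi>) \<and> O1 i (X \<pi>) \<subseteq> {x\<in>U. \<epsilon> / 256 * v \<le> (real (freq n (X \<pi>) x))\<^sup>2}" for i
    have "c * real T \<le> real (card {i\<in>{..<T}. g i})" unfolding g_def
      using GX v by (intro succ[OF Xs]) (simp_all add: fr)
    then have "c \<le> real (card {i\<in>{..<T}. g i}) / T" using T by (simp add: field_simps)
    also have "\<dots> = measure_pmf.prob (pmf_of_set {..<T}) {i. g i}"
      using T by (subst measure_pmf_of_set) (auto simp: lessThan_empty_iff Int_def)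
    also have "\<dots> = measure_pmf.prob (run A (l2_norm U S) (stream_of S \<pi>)) {T. heavy_hitters U \<epsilon> S \<subseteq> T \<and> T \<subseteq> heavy_hitters U (\<epsilon> / 256) S}"
    proof -
      have "run A (l2_norm U S) (stream_of S \<pi>) = map_pmf (\<lambda>i. O1 i (X \<pi>)) (pmf_of_set {..<T})"
        unfolding square_norm(3) v[symmetric] by (rule run[OF len XU]) (simp add: X_def)
      then show ?thesis by (simp add: vimage_def g_def square_norm(4) v fr)
    qed
    finally show "c \<le> measure_pmf.prob (run A (l2_norm U S) (stream_of S \<pi>)) {T. heavy_hitters U \<epsilon> S \<subseteq> T \<and> T \<subseteq> heavy_hitters U (\<epsilon> / 256) S}" .
  qed
  finally show ?thesis .
qed

text \<open>There are at most \<open>1 / \<epsilon> \<le> D\<close> heavy elements and fewer than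
  \<open>n + 1\<close> blocks each. As 2/e is at most exp(-1/4) and \<open>n\<close> is at most
  exp(\<open>D\<close> / 20), what remains is \<open>D\<close> times exp(-\<open>D\<close> /
  5).\<close>

lemma irregular_prob:
  fixes \<epsilon> :: real
  assumes pro: "partially_random_order U \<epsilon> S P" and \<epsilon>: "0 < \<epsilon>" "1 / \<epsilon> \<le> D" and W: "W * q \<le> n" and D: "even D" "5000 \<le> D" "1000 * log 2 n \<le> D"
    and q: "q > 0" and n: "0 < n" and qc: "\<And>c :: nat. \<epsilon> * real (\<Sum>y\<in>U. (count S y)\<^sup>2) \<le> (real c)\<^sup>2 \<Longrightarrow> 2 * n \<le> q * c"
  shows "measure_pmf.prob P {\<pi>. \<exists>x\<in>heavy_hitters U \<epsilon> S. \<not> regular q D W (\<lambda>t. stream_of S \<pi> ! t) x} \<le> 1 / 100"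
proof -
  define H where "H = heavy_hitters U \<epsilon> S"
  have finH: "finite H" using finU by (simp add: H_def heavy_hitters_def)
  have v0: "0 < (\<Sum>y\<in>U. (count S y)\<^sup>2)" using square_norm(1) n by linarith
  have cH: "real (card H) \<le> 1 / \<epsilon>" unfolding H_def square_norm(4) by (rule card_frequent[OF finU refl \<epsilon>(1) v0])
  have Wn: "W \<le> n" using W q by (metis le_trans mult.commute mult_le_mono1 nat_mult_1 Suc_leI One_nat_def)
  have one: "measure_pmf.prob P {\<pi>. \<not> regular q D W (\<lambda>t. stream_of S \<pi> ! t) x} \<le> real n * exp (- real D / 4)" if x: "x \<in> H" for x
  proof -
    have qx: "2 * n \<le> q * count S x" using x by (intro qc) (simp add: H_def square_norm(4))
    then have "0 < count S x" using n by (metis gr0I mult_is_0 not_less zero_neq_numeral le_zero_eq)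
    then have "x \<in># S" by (simp add: count_greater_zero_iff)
    have "measure_pmf.prob P {\<pi>. \<not> regular q D W (\<lambda>t. stream_of S \<pi> ! t) x} \<le> real W * (2 / exp 1) ^ D"
      using D qx W by (intro prob_irregular[OF pro _ \<open>x \<in># S\<close>]) (use x in \<open>auto simp: H_def sz\<close>)
    also have "\<dots> \<le> real n * exp (- real D / 4)"
    proof (rule mult_mono)
      have "(2::real) \<le> exp (3 / 4)" using exp_lower_Taylor_quadratic[of "3/4 :: real"] by (simp add: power2_eq_square)
      then have "2 / exp 1 \<le> exp (3 / 4) / exp (1::real)" by (intro divide_right_mono) auto
      also have "\<dots> = exp (- (1 / 4))" by (simp add: exp_diff[symmetric])
      finally have "(2 / exp 1) ^ D \<le> exp (- (1 / 4) :: real) ^ D" by (intro power_mono) auto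
      also have "\<dots> = exp (- real D / 4)" by (simp add: exp_of_nat_mult[symmetric])
      finally show "(2 / exp 1) ^ D \<le> exp (- real D / 4)" .
    qed (use Wn in auto)
    finally show ?thesis .
  qed
  have "measure_pmf.prob P {\<pi>. \<exists>x\<in>H. \<not> regular q D W (\<lambda>t. stream_of S \<pi> ! t) x} \<le> measure_pmf.prob P (\<Union>x\<in>H. {\<pi>. \<not> regular q D W (\<lambda>t. stream_of S \<pi> ! t) x})"
    by (intro measure_pmf.finite_measure_mono) auto
  also have "\<dots> \<le> (\<Sum>x\<in>H. measure_pmf.prob P {\<pi>. \<not> regular q D W (\<lambda>t. stream_of S \<pi> ! t) x})"
    using finH by (intro measure_pmf.finite_measure_subadditive_finite) auto
  also have "\<dots> \<le> (\<Sum>x\<in>H. real n * exp (- real D / 4))" using one by (rule sum_mono)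
  also have "\<dots> = real (card H) * (real n * exp (- real D / 4))" by simp
  also have "\<dots> \<le> real D * (exp (real D / 20) * exp (- real D / 4))"
  proof (intro mult_mono)
    have "real n = exp (log 2 n * ln 2)" using n by (simp add: log_def)
    also have "\<dots> \<le> exp (real D / 20)"
    proof -
      have l0: "0 \<le> log 2 n" using n by (simp add: zero_le_log_cancel_iff)
      then have "log 2 n * ln 2 \<le> log 2 n * 1" using ln_2_less_1 by (intro mult_left_mono) auto
      then have "log 2 n * ln 2 \<le> real D / 20" using D(3) l0 by linarith
      then show ?thesis by simp
    qed
    finally show "real n \<le> exp (real D / 20)" .
  qed (use cH \<epsilon> in auto)
  also have "\<dots> = real D * exp (- real D / 5)" by (simp add: exp_add[symmetric])
  also have "\<dots> \<le> 1 / 100" using D(2) by (intro large_exp_bound) simp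
  finally show ?thesis by (simp only: H_def)
qed

end

section \<open>Assembly\<close>

definition solves :: "nat set \<Rightarrow> real \<Rightarrow> nat \<Rightarrow> nat stream_alg \<Rightarrow> bool" where
  "solves U \<epsilon> n A \<longleftrightarrow> (\<forall>S P. set_mset S \<subseteq> U \<longrightarrow> size S = n \<longrightarrow> partially_random_order U \<epsilon> S P \<longrightarrow>
     measure_pmf.prob (bind_pmf P (\<lambda>\<pi>. run A (l2_norm U S) (stream_of S \<pi>)))
       {T. heavy_hitters U \<epsilon> S \<subseteq> T \<and> T \<subseteq> heavy_hitters U (\<epsilon> / 256) S} \<ge> 9 / 10)"

lemma store_everything:
  fixes U :: "nat set" and \<epsilon> :: real
  assumes U: "finite U" and u0: "u0 \<in> U" and \<epsilon>: "0 < \<epsilon>" and s: "(n\<^sup>2 + 1) * 1 * (n + 1) * (card U + 1) ^ n \<le> 2 ^ s"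
  shows "\<exists>A. uses_space U A s \<and> solves U \<epsilon> n A"
proof -
  define M :: "nat \<Rightarrow> nat \<Rightarrow> nat \<Rightarrow> (nat \<Rightarrow> nat) \<Rightarrow> nat list" where "M v i t X = map X [0..<t]" for v i t X
  define Out :: "nat \<Rightarrow> nat \<Rightarrow> nat list \<Rightarrow> nat set" where "Out v i l = {x\<in>U. \<epsilon> * v \<le> (real (card {t. t < length l \<and> l ! t = x}))\<^sup>2}" for v i l
  have sub: "M v i t ` {X. \<forall>s. X s \<in> U} \<subseteq> {xs. set xs \<subseteq> U \<and> length xs = t}" for v i t by (auto simp: M_def)
  have fin: "finite {xs. set xs \<subseteq> U \<and> length xs = t}" for t using U by (rule finite_lists_length_eq)
  have "\<exists>A. uses_space U A s \<and>
    (\<forall>v xs X. v \<le> n\<^sup>2 \<longrightarrow> length xs = n \<longrightarrow> (\<forall>t. X t \<in> U) \<longrightarrow> (\<forall>t<n. X t = xs ! t) \<longrightarrow>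
       run A (sqrt (real v)) xs = map_pmf (\<lambda>i. Out v i (M v i n X)) (pmf_of_set {..<1}))"
  proof (rule streaming_realization[where M = M and Out = Out and V = "n\<^sup>2" and T = 1 and K = "(card U + 1) ^ n"])
    show "U \<noteq> {}" using u0 by auto
    show "finite (M v i t ` {X. \<forall>s. X s \<in> U})" for v i t using finite_subset[OF sub fin] .
    show "card (M v i t ` {X. \<forall>s. X s \<in> U}) \<le> (card U + 1) ^ n" if "t \<le> n" for v i t
    proof -
      have "card (M v i t ` {X. \<forall>s. X s \<in> U}) \<le> card U ^ t" using card_mono[OF fin sub] U by (simp add: card_lists_length_eq)
      also have "\<dots> \<le> (card U + 1) ^ t" by (intro power_mono) auto
      also have "\<dots> \<le> (card U + 1) ^ n" using that by (intro power_increasing) auto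
      finally show ?thesis .
    qed
  qed (use s in \<open>auto simp: M_def\<close>)
  then obtain A where A: "uses_space U A s" and run: "\<And>v xs X. v \<le> n\<^sup>2 \<Longrightarrow> length xs = n \<Longrightarrow> \<forall>t. X t \<in> U \<Longrightarrow> \<forall>t<n. X t = xs ! t \<Longrightarrow>
       run A (sqrt (real v)) xs = map_pmf (\<lambda>i. Out v i (M v i n X)) (pmf_of_set {..<1})" by blast
  have fr: "card {t. t < length (M v i n X) \<and> M v i n X ! t = x} = freq n X x" for v i X x
    unfolding freq_def M_def by (intro arg_cong[where f = card]) auto
  have "solves U \<epsilon> n A" unfolding solves_def
  proof (intro allI impI)
    fix S P assume S: "set_mset S \<subseteq> U" "size S = n" and pro: "partially_random_order U \<epsilon> S P"
    define v where "v = (\<Sum>y\<in>U. (count S y)\<^sup>2)"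
    have "1 * (1 - 0) \<le> measure_pmf.prob (bind_pmf P (\<lambda>\<pi>. run A (l2_norm U S) (stream_of S \<pi>)))
       {T. heavy_hitters U \<epsilon> S \<subseteq> T \<and> T \<subseteq> heavy_hitters U (\<epsilon> / 256) S}"
    proof (rule heavy_run[OF U S u0 pro _ v_def, where T = 1 and G = "\<lambda>_. True" and ?O1.0 = "\<lambda>i X. Out v i (M v i n X)"])
      show "run A (sqrt (real v)) xs = map_pmf (\<lambda>i. Out v i (M v i n X)) (pmf_of_set {..<1})"
        if "length xs = n" "\<forall>t. X t \<in> U" "\<forall>t<n. X t = xs ! t" for xs X
        using that square_norm(2)[OF U S] by (intro run) (auto simp: v_def)
      fix X
      have "\<epsilon> / 256 * v \<le> \<epsilon> * v" using \<epsilon> by (simp add: mult_right_mono)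
      then have "{i\<in>{..<1::nat}. {x\<in>U. \<epsilon> * v \<le> (real (freq n X x))\<^sup>2} \<subseteq> Out v i (M v i n X) \<and>
          Out v i (M v i n X) \<subseteq> {x\<in>U. \<epsilon> / 256 * v \<le> (real (freq n X x))\<^sup>2}} = {0}"
        unfolding Out_def fr by auto
      then show "1 * real 1 \<le> real (card {i\<in>{..<1}. {x\<in>U. \<epsilon> * v \<le> (real (freq n X x))\<^sup>2} \<subseteq> Out v i (M v i n X) \<and>
          Out v i (M v i n X) \<subseteq> {x\<in>U. \<epsilon> / 256 * v \<le> (real (freq n X x))\<^sup>2}})" by simp
    qed auto
    then show "9 / 10 \<le> measure_pmf.prob (bind_pmf P (\<lambda>\<pi>. run A (l2_norm U S) (stream_of S \<pi>)))
       {T. heavy_hitters U \<epsilon> S \<subseteq> T \<and> T \<subseteq> heavy_hitters U (\<epsilon> / 256) S}" by (rule order_trans[rotated]) simp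
  qed
  then show ?thesis using A by blast
qed

text \<open>Since 2 * 5001 exceeds 100 squared, the exponential is smaller than exp(-(k + 1) n^2),
  while there are at most n^(k n) \<le> exp(k n^2) streams. The seed index costs a number of bits
  logarithmic in \<open>n\<close> for fixed \<open>k\<close>.\<close>

lemma seeds_suffice:
  fixes U :: "nat set"
  assumes "0 < n" "card U \<le> n ^ k"
  shows "real (card U ^ n) * exp (- 2 * real (5001 * (k + 1) * n\<^sup>2) * (1 / 100)\<^sup>2) < 1"
proof -
  have "card U ^ n \<le> (n ^ k) ^ n" using assms(2) by (rule power_mono) simp
  then have "real (card U ^ n) \<le> real ((n ^ k) ^ n)" by (simp only: of_nat_le_iff)
  also have "\<dots> = real n ^ (k * n)" by (simp add: power_mult)
  also have "\<dots> = exp (real (k * n) * ln n)" using assms(1) by (simp only: exp_of_nat_mult) simp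
  also have "\<dots> \<le> exp (real (k * n) * n)" using assms(1) ln_le_minus_one[of n] by (simp add: mult_left_mono)
  finally have "real (card U ^ n) * exp (- 2 * real (5001 * (k + 1) * n\<^sup>2) * (1 / 100)\<^sup>2) \<le>
     exp (real (k * n) * n) * exp (- 2 * real (5001 * (k + 1) * n\<^sup>2) * (1 / 100)\<^sup>2)" by (rule mult_right_mono) simp
  also have "\<dots> = exp (real (k * n) * n - 2 * real (5001 * (k + 1) * n\<^sup>2) * (1 / 100)\<^sup>2)" by (simp add: exp_add[symmetric])
  also have "\<dots> < 1"
  proof -
    have "real (k * n) * n = real k * (real n)\<^sup>2" by (simp add: power2_eq_square)
    moreover have "2 * real (5001 * (k + 1) * n\<^sup>2) * (1 / 100)\<^sup>2 = 10002 / 10000 * ((real k + 1) * (real n)\<^sup>2)"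
      by (simp add: power2_eq_square)
    moreover have "real k * (real n)\<^sup>2 < (real k + 1) * (real n)\<^sup>2" using assms(1) by simp
    moreover have "(real k + 1) * (real n)\<^sup>2 \<le> 10002 / 10000 * ((real k + 1) * (real n)\<^sup>2)" by simp
    ultimately have "real (k * n) * n - 2 * real (5001 * (k + 1) * n\<^sup>2) * (1 / 100)\<^sup>2 < 0" by linarith
    then show ?thesis by (simp only: exp_less_one_iff)
  qed
  finally show ?thesis .
qed

lemma main_regime:
  fixes U :: "nat set" and \<epsilon> :: real
  assumes n: "2 \<le> n" and U: "finite U" "card U \<le> n ^ k" and u0: "u0 \<in> U"
    and x: "real k + 100 \<le> sqrt (log 2 n)" and \<epsilon>: "0 < \<epsilon>" "\<epsilon> \<le> 1" "2 ^ 240 * (1 / 2 powr sqrt (log 2 n)) \<le> \<epsilon>"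
  shows "\<exists>A s. uses_space U A s \<and> real s \<le> (300000000000000 + 1000 * real k) * (log 2 n / \<epsilon>) \<and> solves U \<epsilon> n A"
proof -
  have n0: "0 < n" using n by simp
  obtain d m e :: nat and Lr where d0: "0 < d" and D5: "5000 \<le> (2::nat) ^ d" and BmD: "4 * (k * e + 1) * m \<le> 2 ^ d"
    and D30: "((2::nat) ^ d) ^ 30 \<le> n" and De: "540000000 / \<epsilon> \<le> real (2 ^ d)" and Dl: "1000 * log 2 n \<le> real (2 ^ d)"
    and m: "100 \<le> m" "576000000000 * Lr \<le> \<epsilon> * m" and Lr: "1 / \<epsilon> * exp (- Lr) \<le> 1 / 100"
    and ne: "n \<le> 2 ^ e" and el: "real e \<le> 2 * log 2 n" and dm: "real (d * m) \<le> 9216000000000 * (log 2 n / \<epsilon>)"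
    and ed: "real e \<le> 121 / \<epsilon> * d"
    by (rule scale_parameters[OF n0 x \<epsilon>])
  define D where "D = (2::nat) ^ d"
  \<comment> \<open>As \<open>n \<le> 2 ^ e\<close>, already \<open>k * e\<close> bits separate the
    universe; the additional one keeps \<open>B\<close> positive for \<open>k = 0\<close>.\<close>
  define B where "B = k * e + 1"
  define T where "T = 5001 * (k + 1) * n\<^sup>2"
  define cap where "cap = nat \<lfloor>256 / \<epsilon>\<rfloor>"
  \<comment> \<open>A bound on the number of stages that does not depend on the norm, so that one
    bound \<open>K\<close> on the states serves all norms.\<close>
  define SM where "SM = e div d"
  define K where "K = (D ^ 26) ^ m * (1 + 2 ^ B * (2 * n + 1) * (n + 1)) ^ SM * (1 + (card U + 1) ^ cap)"
  have l1: "1 \<le> log 2 n" using n by (simp add: le_log_iff)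
  have UB: "card U \<le> 2 ^ B"
  proof -
    have "card U \<le> (2 ^ e) ^ k" using U(2) power_mono[OF ne, of k] by linarith
    also have "\<dots> = 2 ^ (k * e)" by (simp add: power_mult[symmetric] mult.commute)
    also have "\<dots> \<le> 2 ^ B" unfolding B_def by (intro power_increasing) auto
    finally show ?thesis .
  qed
  obtain bitf :: "nat \<Rightarrow> nat \<Rightarrow> bool" where sep: "\<And>y z. y \<in> U \<Longrightarrow> z \<in> U \<Longrightarrow> (\<And>b. b < B \<Longrightarrow> bitf y b = bitf z b) \<Longrightarrow> y = z"
    using separating_bits[OF U(1) UB] by blast
  have T0: "T > 0" using n by (simp add: T_def)
  have TU: "real (card U ^ n) * exp (- 2 * real T * (1 / 100)\<^sup>2) < 1" unfolding T_def by (rule seeds_suffice[OF n0 U(2)])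
  have cap1: "256 / \<epsilon> < real cap + 1" "real cap \<le> 256 / \<epsilon>"
  proof -
    have "0 \<le> 256 / \<epsilon>" using \<epsilon> by simp
    then show "256 / \<epsilon> < real cap + 1" "real cap \<le> 256 / \<epsilon>" unfolding cap_def by linarith+
  qed
  define Q where "Q v M q W \<longleftrightarrow> q > 0 \<and> W * q \<le> n \<and> (\<forall>c::nat. \<epsilon> * v \<le> (real c)\<^sup>2 \<longrightarrow> 2 * n \<le> q * c) \<and>
    (\<forall>i X X'. M i 0 X = M i 0 X') \<and>
    (\<forall>i t X X'. (\<forall>s. X s \<in> U) \<longrightarrow> (\<forall>s. X' s \<in> U) \<longrightarrow> M i t X = M i t X' \<longrightarrow> X t = X' t \<longrightarrow> M i (Suc t) X = M i (Suc t) X') \<and>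
    (\<forall>i t. t \<le> n \<longrightarrow> finite (M i t ` {X. \<forall>s. X s \<in> U}) \<and> card (M i t ` {X. \<forall>s. X s \<in> U}) \<le> K) \<and>
    (\<forall>X\<in>streams n u0 U. (\<Sum>y\<in>U. (freq n X y)\<^sup>2) = v \<longrightarrow>
       (\<forall>x\<in>U. \<epsilon> * v \<le> (real (freq n X x))\<^sup>2 \<longrightarrow> regular q D W X x) \<longrightarrow>
       91 / 100 * real T \<le> real (card {i\<in>{..<T}. {x\<in>U. \<epsilon> * v \<le> (real (freq n X x))\<^sup>2} \<subseteq> out_set (M i n X) \<and>
          out_set (M i n X) \<subseteq> {x\<in>U. \<epsilon> / 256 * v \<le> (real (freq n X x))\<^sup>2}}))"
    for v :: nat and M :: "nat \<Rightarrow> nat \<Rightarrow> (nat \<Rightarrow> nat) \<Rightarrow> (nat \<Rightarrow> slot_memory) \<times> nat set option" and q W :: nat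
  have ex: "\<exists>M q W. n \<le> v \<longrightarrow> v \<le> n\<^sup>2 \<longrightarrow> Q v M q W" for v
  proof (cases "n \<le> v \<and> v \<le> n\<^sup>2")
    case True
    have Dl': "log 2 n \<le> D" using Dl l1 unfolding D_def by linarith
    obtain q Wb S N R where tuned: "tuned_slots q m B D (D ^ 20) Wb S N U bitf R" and Nq: "N * (4 * B * m * D ^ S) * q \<le> n"
      and vR: "200000 * v \<le> R * Wb" and miss: "1 / \<epsilon> * exp (- (real Wb * real m / real (16 * R))) \<le> 1 / 100"
      and light: "\<And>c :: nat. (real c)\<^sup>2 < \<epsilon> / 256 * v \<Longrightarrow> 16 * c \<le> 3 * (N + 2) * (4 * B * m * D ^ S)"
      and few: "real (m * card U) * exp (- (2 / 5) * real N) \<le> 1 / 100" and DS: "D ^ S \<le> n"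
      and qc: "\<And>c :: nat. \<epsilon> * v \<le> (real c)\<^sup>2 \<Longrightarrow> 2 * n \<le> q * c" and q0: "q > 0"
    proof (rule norm_parameters[of \<epsilon> n v U B bitf D m Lr])
      show "even D" using d0 by (simp add: D_def)
    qed (use \<epsilon> True U(1) UB sep D5 BmD D30 De Dl' m Lr in \<open>auto simp: D_def B_def\<close>)
    interpret tuned_slots q m B D "D ^ 20" Wb S N U bitf R by (rule tuned)
    have aS: "4 * B * m * D ^ S = a S" by (simp add: a_def)
    have v0: "0 < v" using True n by linarith
    have "S \<le> SM"
    proof -
      have "2 ^ (d * S) \<le> (2::nat) ^ e" using order_trans[OF DS ne] by (simp only: D_def power_mult)
      then have "d * S \<le> e" by simp
      then show ?thesis using d0 by (simp add: SM_def less_eq_div_iff_mult_less_eq mult.commute)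
    qed
    then have SK: "(D ^ 26) ^ m * (1 + 2 ^ B * (2 * n + 1) * (n + 1)) ^ S * (1 + (card U + 1) ^ cap) \<le> K"
      unfolding K_def by (intro mult_le_mono1 mult_le_mono2 power_increasing) auto
    obtain M :: "nat \<Rightarrow> nat \<Rightarrow> (nat \<Rightarrow> nat) \<Rightarrow> (nat \<Rightarrow> slot_memory) \<times> nat set option" where M:
      "\<forall>i X X'. M i 0 X = M i 0 X'"
      "\<forall>i t X X'. (\<forall>s. X s \<in> U) \<longrightarrow> (\<forall>s. X' s \<in> U) \<longrightarrow> M i t X = M i t X' \<longrightarrow> X t = X' t \<longrightarrow> M i (Suc t) X = M i (Suc t) X'"
      "\<forall>i t. t \<le> n \<longrightarrow> finite (M i t ` {X. \<forall>s. X s \<in> U}) \<and>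
         card (M i t ` {X. \<forall>s. X s \<in> U}) \<le> (D ^ 26) ^ m * (1 + 2 ^ B * (2 * n + 1) * (n + 1)) ^ S * (1 + (card U + 1) ^ cap)"
      "\<forall>X\<in>streams n u0 U. (\<Sum>y\<in>U. (freq n X y)\<^sup>2) = v \<longrightarrow>
         (\<forall>x\<in>U. \<epsilon> * v \<le> (real (freq n X x))\<^sup>2 \<longrightarrow> regular q D (N * a S) X x) \<longrightarrow>
         91 / 100 * real T \<le> real (card {i\<in>{..<T}. {x\<in>U. \<epsilon> * v \<le> (real (freq n X x))\<^sup>2} \<subseteq> out_set (M i n X) \<and>
            out_set (M i n X) \<subseteq> {x\<in>U. \<epsilon> / 256 * v \<le> (real (freq n X x))\<^sup>2}})"
      using norm_scheme[OF u0 Nq[unfolded aS] \<epsilon>(1) v0 vR miss light[unfolded aS] few cap1(1) T0 TU] by blast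
    have "Q v M q (N * a S)" unfolding Q_def
    proof (intro conjI)
      show "\<forall>i t. t \<le> n \<longrightarrow> finite (M i t ` {X. \<forall>s. X s \<in> U}) \<and> card (M i t ` {X. \<forall>s. X s \<in> U}) \<le> K"
        using M(3) SK order_trans by blast
    qed (use M q0 Nq qc in \<open>auto simp only: aS\<close>)
    then show ?thesis by blast
  qed auto
  obtain M q W where Q: "\<And>v. n \<le> v \<Longrightarrow> v \<le> n\<^sup>2 \<Longrightarrow> Q v (M v) (q v) (W v)" using ex by metis
  have Qinit: "\<forall>i X X'. M v i 0 X = M v i 0 X'" if "n \<le> v" "v \<le> n\<^sup>2" for v
    using Q[OF that] unfolding Q_def by (elim conjE)
  have Qcong: "\<forall>i t X X'. (\<forall>s. X s \<in> U) \<longrightarrow> (\<forall>s. X' s \<in> U) \<longrightarrow> M v i t X = M v i t X' \<longrightarrow> X t = X' t \<longrightarrow>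
      M v i (Suc t) X = M v i (Suc t) X'" if "n \<le> v" "v \<le> n\<^sup>2" for v
    using Q[OF that] unfolding Q_def by (elim conjE)
  have Qcard: "\<forall>i t. t \<le> n \<longrightarrow> finite (M v i t ` {X. \<forall>s. X s \<in> U}) \<and> card (M v i t ` {X. \<forall>s. X s \<in> U}) \<le> K"
    if "n \<le> v" "v \<le> n\<^sup>2" for v
    using Q[OF that] unfolding Q_def by (elim conjE)
  \<comment> \<open>A stream of length \<open>n\<close> has its squared norm between
    \<open>n\<close> and \<open>n\<^sup>2\<close>. For other values the memory is constant, which
    keeps the space bound valid.\<close>
  define M' where "M' v i t X = (if n \<le> v \<and> v \<le> n\<^sup>2 then M v i t X else (\<lambda>_. Vacant None, None))" for v i t X
  \<comment> \<open>The summands pay, in this order, for the norm, the seed, the clock, the slots,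
    the workspaces and the output.\<close>
  define s where "s = (2 * e + 1) + (13 + k + 2 * e) + (e + 1) + (26 * (d * m) + (B + 2 * e + 4) * SM + ((B + 1) * cap + 1))"
  have K1: "1 \<le> K" using D5 by (simp add: K_def D_def Suc_leI)
  have space: "(n\<^sup>2 + 1) * T * (n + 1) * K \<le> 2 ^ s"
  proof -
    have n2: "n\<^sup>2 \<le> 2 ^ (2 * e)" using power_mono[OF ne, of 2] by (simp add: power_mult[symmetric] mult.commute)
    have e1: "(1::nat) \<le> 2 ^ j" for j by simp
    have dbl: "(2::nat) ^ (j + 1) = 2 * 2 ^ j" "(2::nat) ^ (j + 2) = 4 * 2 ^ j" for j by simp_all
    have 1: "n\<^sup>2 + 1 \<le> 2 ^ (2 * e + 1)" using n2 e1[of "2 * e"] unfolding dbl by linarith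
    have 2: "T \<le> 2 ^ (13 + k + 2 * e)"
    proof -
      have "k + 1 \<le> 2 ^ k" using Suc_leI[OF less_exp[of k]] by (simp only: Suc_eq_plus1)
      then have "5001 * (k + 1) * n\<^sup>2 \<le> 2 ^ 13 * 2 ^ k * 2 ^ (2 * e)" using n2 by (intro mult_le_mono) auto
      then show ?thesis by (simp add: T_def power_add)
    qed
    have 3: "n + 1 \<le> 2 ^ (e + 1)" using ne e1[of e] unfolding dbl by linarith
    have 4: "(D ^ 26) ^ m = 2 ^ (26 * (d * m))" by (simp add: D_def power_mult[symmetric] mult_ac)
    have 5: "(1 + 2 ^ B * (2 * n + 1) * (n + 1)) ^ SM \<le> 2 ^ ((B + 2 * e + 4) * SM)"
    proof -
      have "2 * n + 1 \<le> 2 ^ (e + 2)" using ne e1[of e] unfolding dbl by linarith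
      then have "2 ^ B * (2 * n + 1) * (n + 1) \<le> 2 ^ B * 2 ^ (e + 2) * 2 ^ (e + 1)" using 3 by (intro mult_le_mono) auto
      also have "\<dots> = 2 ^ (B + (e + 2) + (e + 1))" by (simp only: power_add)
      also have "B + (e + 2) + (e + 1) = B + 2 * e + 3" by simp
      finally have "1 + 2 ^ B * (2 * n + 1) * (n + 1) \<le> 2 * 2 ^ (B + 2 * e + 3)" using e1[of "B + 2 * e + 3"] by linarith
      also have "\<dots> = 2 ^ (B + 2 * e + 3 + 1)" by (simp only: dbl)
      also have "B + 2 * e + 3 + 1 = B + 2 * e + 4" by simp
      finally have "(1 + 2 ^ B * (2 * n + 1) * (n + 1)) ^ SM \<le> (2 ^ (B + 2 * e + 4)) ^ SM" by (rule power_mono) simp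
      then show ?thesis by (simp only: power_mult)
    qed
    have 6: "1 + (card U + 1) ^ cap \<le> 2 ^ ((B + 1) * cap + 1)"
    proof -
      have "card U + 1 \<le> 2 ^ (B + 1)" using UB e1[of B] unfolding dbl by linarith
      then have "(card U + 1) ^ cap \<le> (2 ^ (B + 1)) ^ cap" by (rule power_mono) simp
      then have "(card U + 1) ^ cap \<le> 2 ^ ((B + 1) * cap)" by (simp only: power_mult)
      then show ?thesis using e1[of "(B + 1) * cap"] unfolding dbl by linarith
    qed
    have "(n\<^sup>2 + 1) * T * (n + 1) * K \<le> 2 ^ (2 * e + 1) * 2 ^ (13 + k + 2 * e) * 2 ^ (e + 1) *
       (2 ^ (26 * (d * m)) * 2 ^ ((B + 2 * e + 4) * SM) * 2 ^ ((B + 1) * cap + 1))"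
      unfolding K_def 4 by (intro mult_le_mono 1 2 3 5 6 order_refl)
    also have "\<dots> = 2 ^ s" unfolding s_def by (simp only: power_add)
    finally show ?thesis .
  qed
  have "\<exists>A. uses_space U A s \<and>
    (\<forall>v xs X. v \<le> n\<^sup>2 \<longrightarrow> length xs = n \<longrightarrow> (\<forall>t. X t \<in> U) \<longrightarrow> (\<forall>t<n. X t = xs ! t) \<longrightarrow>
       run A (sqrt (real v)) xs = map_pmf (\<lambda>i. out_set (M' v i n X)) (pmf_of_set {..<T}))"
  proof (rule streaming_realization[where M = M' and Out = "\<lambda>v i. out_set" and K = K and V = "n\<^sup>2"])
    show "U \<noteq> {}" using u0 by auto
    show "T > 0" by (rule T0)
    show "M' v i 0 X = M' v i 0 X'" for v i X X'
    proof (cases "n \<le> v \<and> v \<le> n\<^sup>2")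
      case True
      then have eq: "M' v i 0 X = M v i 0 X" for X by (simp add: M'_def)
      show ?thesis unfolding eq using Qinit True by blast
    qed (auto simp: M'_def)
    show "M' v i (Suc t) X = M' v i (Suc t) X'" if "\<And>s. X s \<in> U" "\<And>s. X' s \<in> U" "M' v i t X = M' v i t X'" "X t = X' t" for v i t X X'
    proof (cases "n \<le> v \<and> v \<le> n\<^sup>2")
      case True
      then have eq: "M' v i t X = M v i t X" for t X by (simp add: M'_def)
      have "M v i t X = M v i t X'" using that(3) unfolding eq .
      then have "M v i (Suc t) X = M v i (Suc t) X'" using Qcong True that(1,2,4) by blast
      then show ?thesis unfolding eq .
    next
      case False
      then show ?thesis by (auto simp: M'_def)
    qed
    have fc: "finite (M' v i t ` {X. \<forall>s. X s \<in> U}) \<and> card (M' v i t ` {X. \<forall>s. X s \<in> U}) \<le> K" if "t \<le> n" for v i t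
    proof (cases "n \<le> v \<and> v \<le> n\<^sup>2")
      case True
      then have "M' v i t = M v i t" by (intro ext) (simp add: M'_def)
      moreover have "finite (M v i t ` {X. \<forall>s. X s \<in> U}) \<and> card (M v i t ` {X. \<forall>s. X s \<in> U}) \<le> K" using Qcard True that by blast
      ultimately show ?thesis by (simp only:)
    next
      case False
      then have sub: "M' v i t ` {X. \<forall>s. X s \<in> U} \<subseteq> {(\<lambda>_. Vacant None, None)}" by (auto simp: M'_def)
      then have "card (M' v i t ` {X. \<forall>s. X s \<in> U}) \<le> 1" using card_mono[OF _ sub] by simp
      then show ?thesis using K1 finite_subset[OF sub] by simp
    qed
    show "finite (M' v i t ` {X. \<forall>s. X s \<in> U})" if "t \<le> n" for v i t using fc that by blast
    show "card (M' v i t ` {X. \<forall>s. X s \<in> U}) \<le> K" if "t \<le> n" for v i t using fc that by blast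
    show "(n\<^sup>2 + 1) * T * (n + 1) * K \<le> 2 ^ s" by (rule space)
  qed
  then obtain A where A: "uses_space U A s" and run: "\<And>v xs X. v \<le> n\<^sup>2 \<Longrightarrow> length xs = n \<Longrightarrow> \<forall>t. X t \<in> U \<Longrightarrow> \<forall>t<n. X t = xs ! t \<Longrightarrow>
       run A (sqrt (real v)) xs = map_pmf (\<lambda>i. out_set (M' v i n X)) (pmf_of_set {..<T})" by blast
  have sol: "solves U \<epsilon> n A" unfolding solves_def
  proof (intro allI impI)
    fix S P assume S: "set_mset S \<subseteq> U" "size S = n" and pro: "partially_random_order U \<epsilon> S P"
    define v where "v = (\<Sum>y\<in>U. (count S y)\<^sup>2)"
    have nv: "n \<le> v" "v \<le> n\<^sup>2" using square_norm(1,2)[OF U(1) S] by (auto simp: v_def)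
    have Qv: "Q v (M v) (q v) (W v)" using Q[OF nv] .
    have MM: "M' v = M v" using nv by (intro ext) (simp add: M'_def)
    have hh: "heavy_hitters U \<epsilon> S = {x\<in>U. \<epsilon> * v \<le> (real (count S x))\<^sup>2}" unfolding v_def by (rule square_norm(4)[OF U(1) S])
    have Wq: "W v * q v \<le> n" using Qv unfolding Q_def by (elim conjE)
    have q0: "q v > 0" using Qv unfolding Q_def by (elim conjE)
    have qc: "\<forall>c::nat. \<epsilon> * v \<le> (real c)\<^sup>2 \<longrightarrow> 2 * n \<le> q v * c" using Qv unfolding Q_def by (elim conjE)
    have Qsucc: "\<forall>X\<in>streams n u0 U. (\<Sum>y\<in>U. (freq n X y)\<^sup>2) = v \<longrightarrow>
       (\<forall>x\<in>U. \<epsilon> * v \<le> (real (freq n X x))\<^sup>2 \<longrightarrow> regular (q v) D (W v) X x) \<longrightarrow>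
       91 / 100 * real T \<le> real (card {i\<in>{..<T}. {x\<in>U. \<epsilon> * v \<le> (real (freq n X x))\<^sup>2} \<subseteq> out_set (M v i n X) \<and>
          out_set (M v i n X) \<subseteq> {x\<in>U. \<epsilon> / 256 * v \<le> (real (freq n X x))\<^sup>2}})" using Qv unfolding Q_def by (elim conjE)
    \<comment> \<open>The product is 0.9009: the seeds succeed with 91 percent, and the placement is
      irregular with at most one percent.\<close>
    have "91 / 100 * (1 - 1 / 100) \<le> measure_pmf.prob (bind_pmf P (\<lambda>\<pi>. run A (l2_norm U S) (stream_of S \<pi>)))
       {T. heavy_hitters U \<epsilon> S \<subseteq> T \<and> T \<subseteq> heavy_hitters U (\<epsilon> / 256) S}"
    proof (rule heavy_run[OF U(1) S u0 pro T0 v_def,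
        where G = "\<lambda>X. \<forall>x\<in>U. \<epsilon> * v \<le> (real (freq n X x))\<^sup>2 \<longrightarrow> regular (q v) D (W v) X x" and ?O1.0 = "\<lambda>i X. out_set (M' v i n X)"])
      show "run A (sqrt (real v)) xs = map_pmf (\<lambda>i. out_set (M' v i n X)) (pmf_of_set {..<T})"
        if "length xs = n" "\<forall>t. X t \<in> U" "\<forall>t<n. X t = xs ! t" for xs X
        using that nv by (intro run) auto
      show "91 / 100 * real T \<le> real (card {i\<in>{..<T}. {x\<in>U. \<epsilon> * v \<le> (real (freq n X x))\<^sup>2} \<subseteq> out_set (M' v i n X) \<and>
          out_set (M' v i n X) \<subseteq> {x\<in>U. \<epsilon> / 256 * v \<le> (real (freq n X x))\<^sup>2}})"
        if "X \<in> streams n u0 U" "(\<Sum>y\<in>U. (freq n X y)\<^sup>2) = v" "\<forall>x\<in>U. \<epsilon> * v \<le> (real (freq n X x))\<^sup>2 \<longrightarrow> regular (q v) D (W v) X x" for X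
        unfolding MM using Qsucc that by blast
      let ?X = "\<lambda>\<pi> t. if t < n then stream_of S \<pi> ! t else u0"
      have "measure_pmf.prob P {\<pi>. \<not> (\<forall>x\<in>U. \<epsilon> * v \<le> (real (freq n (?X \<pi>) x))\<^sup>2 \<longrightarrow> regular (q v) D (W v) (?X \<pi>) x)} =
          measure_pmf.prob P ({\<pi>. \<not> (\<forall>x\<in>U. \<epsilon> * v \<le> (real (freq n (?X \<pi>) x))\<^sup>2 \<longrightarrow> regular (q v) D (W v) (?X \<pi>) x)} \<inter> set_pmf P)"
        by (rule measure_Int_set_pmf[symmetric])
      also have "\<dots> \<le> measure_pmf.prob P {\<pi>. \<exists>x\<in>heavy_hitters U \<epsilon> S. \<not> regular (q v) D (W v) (\<lambda>t. stream_of S \<pi> ! t) x}"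
      proof (intro measure_pmf.finite_measure_mono subsetI)
        fix \<pi> assume \<pi>: "\<pi> \<in> {\<pi>. \<not> (\<forall>x\<in>U. \<epsilon> * v \<le> (real (freq n (?X \<pi>) x))\<^sup>2 \<longrightarrow> regular (q v) D (W v) (?X \<pi>) x)} \<inter> set_pmf P"
        then have pl: "\<pi> \<in> placements S" using pro by (auto simp: partially_random_order_def)
        have fr: "freq n (?X \<pi>) y = count S y" for y
          unfolding freq_def count_stream_of[OF pl, symmetric] S(2) by (intro arg_cong[where f = card]) auto
        have rc: "regular (q v) D (W v) (?X \<pi>) x = regular (q v) D (W v) (\<lambda>t. stream_of S \<pi> ! t) x" for x
          by (rule regular_cong[OF Wq]) simp
        show "\<pi> \<in> {\<pi>. \<exists>x\<in>heavy_hitters U \<epsilon> S. \<not> regular (q v) D (W v) (\<lambda>t. stream_of S \<pi> ! t) x}"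
        proof -
          obtain x where "x \<in> U" "\<epsilon> * v \<le> (real (freq n (?X \<pi>) x))\<^sup>2" "\<not> regular (q v) D (W v) (?X \<pi>) x"
            using \<pi> by blast
          then show ?thesis unfolding fr rc hh by blast
        qed
      qed auto
      also have "\<dots> \<le> 1 / 100"
      proof (rule irregular_prob[OF U(1) S pro \<epsilon>(1) _ Wq])
        have "1 / \<epsilon> \<le> 540000000 / \<epsilon>" using \<epsilon> by (intro divide_right_mono) auto
        then show "1 / \<epsilon> \<le> real D" using De unfolding D_def by linarith
        show "even D" using d0 by (simp add: D_def)
        show "2 * n \<le> q v * c" if "\<epsilon> * real (\<Sum>y\<in>U. (count S y)\<^sup>2) \<le> (real c)\<^sup>2" for c
          using qc that unfolding v_def by blast
      qed (use q0 D5 Dl n0 in \<open>simp_all only: D_def\<close>)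
      finally show "measure_pmf.prob P {\<pi>. \<not> (\<forall>x\<in>U. \<epsilon> * v \<le> (real (freq n (?X \<pi>) x))\<^sup>2 \<longrightarrow> regular (q v) D (W v) (?X \<pi>) x)} \<le> 1 / 100" .
    qed simp
    then show "9 / 10 \<le> measure_pmf.prob (bind_pmf P (\<lambda>\<pi>. run A (l2_norm U S) (stream_of S \<pi>)))
       {T. heavy_hitters U \<epsilon> S \<subseteq> T \<and> T \<subseteq> heavy_hitters U (\<epsilon> / 256) S}" by (rule order_trans[rotated]) simp
  qed
  have "real s \<le> (300000000000000 + 1000 * real k) * (log 2 n / \<epsilon>)"
  proof -
    define l where "l = log 2 (real n)"
    define Y where "Y = l / \<epsilon>"
    have l1': "1 \<le> l" using l1 by (simp add: l_def)
    have lY: "l \<le> Y" using \<epsilon> l1' by (simp add: Y_def field_simps mult_left_le)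
    have e2: "real e \<le> 2 * l" using el by (simp add: l_def)
    have ke: "real k * real e \<le> real k * (2 * l)" using e2 by (intro mult_left_mono) auto
    have kl: "real k * 1 \<le> real k * l" using l1' by (intro mult_left_mono) auto
    have kY: "real k * l \<le> real k * Y" using lY by (intro mult_left_mono) auto
    have SMr: "real SM \<le> 121 / \<epsilon>"
    proof -
      have "real SM * real d \<le> real e" unfolding SM_def by (simp flip: of_nat_mult)
      also have "\<dots> \<le> 121 / \<epsilon> * d" by (rule ed)
      finally show ?thesis by (rule mult_right_le_imp_le) (use d0 in simp)
    qed
    have "(real B + 2 * e + 4) * SM \<le> ((2 * real k + 9) * l) * (121 / \<epsilon>)"
    proof (rule mult_mono)
      show "real B + 2 * e + 4 \<le> (2 * real k + 9) * l" using ke e2 l1' by (simp add: B_def algebra_simps)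
    qed (use SMr l1' in auto)
    also have "\<dots> = 121 * (2 * real k + 9) * Y" by (simp add: Y_def)
    finally have s1: "(real B + 2 * e + 4) * SM \<le> 242 * (real k * Y) + 1089 * Y" by (simp add: algebra_simps)
    have "(real B + 1) * cap \<le> ((2 * real k + 2) * l) * (256 / \<epsilon>)"
    proof (rule mult_mono)
      show "real B + 1 \<le> (2 * real k + 2) * l" using ke l1' by (simp add: B_def algebra_simps)
    qed (use cap1 l1' in auto)
    also have "\<dots> = 256 * (2 * real k + 2) * Y" by (simp add: Y_def)
    finally have s2: "(real B + 1) * cap \<le> 512 * (real k * Y) + 512 * Y" by (simp add: algebra_simps)
    have s3: "26 * real (d * m) \<le> 239616000000000 * Y" using dm by (simp add: Y_def l_def)
    have "real s = 5 * real e + 16 + real k + (26 * real (d * m) + (real B + 2 * e + 4) * SM + (real B + 1) * cap)"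
      unfolding s_def by (simp add: algebra_simps)
    also have "\<dots> \<le> 10 * Y + 16 * Y + real k * Y + (239616000000000 * Y + (242 * (real k * Y) + 1089 * Y) + (512 * (real k * Y) + 512 * Y))"
    proof -
      have "5 * real e + 16 + real k \<le> 10 * Y + 16 * Y + real k * Y" using e2 lY l1' kl kY by linarith
      then show ?thesis using s1 s2 s3 by linarith
    qed
    also have "\<dots> \<le> 300000000000000 * Y + 1000 * (real k * Y)"
    proof -
      have "0 \<le> Y" "0 \<le> real k * Y" using lY l1' by auto
      then show ?thesis by linarith
    qed
    also have "\<dots> = (300000000000000 + 1000 * real k) * (log 2 n / \<epsilon>)" by (simp add: Y_def l_def algebra_simps)
    finally show ?thesis .
  qed
  then show ?thesis using A sol by blast
qed

lemma no_streams: "U = {} \<Longrightarrow> 0 < n \<Longrightarrow> \<exists>A. uses_space U A 0 \<and> solves U \<epsilon> n A"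
proof -
  assume U: "U = {}" "0 < n"
  define A :: "nat stream_alg" where "A = \<lparr>alg_init = \<lambda>_. return_pmf [], alg_step = \<lambda>_ _. return_pmf [], alg_output = \<lambda>_. return_pmf {}\<rparr>"
  have "uses_space U A 0" by (simp add: uses_space_def A_def)
  moreover have "solves U \<epsilon> n A" using U by (auto simp: solves_def)
  ultimately show ?thesis by blast
qed

theorem theorem1p4:
  "\<exists>n0 c0 :: nat. \<forall>k :: nat. \<exists>C :: real.
     \<forall>n \<ge> n0. \<forall>\<epsilon> :: real. \<forall>U :: nat set.
       0 < \<epsilon> \<longrightarrow> \<epsilon> \<le> 1 \<longrightarrow> \<epsilon> \<ge> real c0 * (1 / 2 powr sqrt (log 2 (real n))) \<longrightarrow>
       finite U \<longrightarrow> card U \<le> n ^ k \<longrightarrow>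
       (\<exists>(A :: nat stream_alg) s.
          uses_space U A s \<and> real s \<le> C * (log 2 (real n) / \<epsilon>) \<and>
          (\<forall>S P. set_mset S \<subseteq> U \<longrightarrow> size S = n \<longrightarrow> partially_random_order U \<epsilon> S P \<longrightarrow>
             measure_pmf.prob (bind_pmf P (\<lambda>\<pi>. run A (l2_norm U S) (stream_of S \<pi>)))
               {T. heavy_hitters U \<epsilon> S \<subseteq> T \<and> T \<subseteq> heavy_hitters U (\<epsilon> / 256) S} \<ge> 9 / 10))"
  unfolding solves_def[symmetric]
proof (rule exI[of _ 2], rule exI[of _ "2 ^ 240"], rule allI)
  fix k :: nat
  \<comment> \<open>The threshold of \<open>main_regime\<close> depends on \<open>k\<close> while
    \<open>n0\<close> must not. Below \<open>N1\<close> the stream is stored, and the constant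
    \<open>C\<close>, which may depend on \<open>k\<close>, pays the \<open>s1\<close> bits for
    it.\<close>
  define N1 :: nat where "N1 = 2 ^ ((k + 100)\<^sup>2)"
  define s1 where "s1 = (N1\<^sup>2 + 1) * 1 * (N1 + 1) * (N1 ^ k + 1) ^ N1"
  define C where "C = max (300000000000000 + 1000 * real k) (real s1)"
  have C0: "0 \<le> C" by (simp add: C_def)
  show "\<exists>C. \<forall>n\<ge>2. \<forall>\<epsilon> U. 0 < \<epsilon> \<longrightarrow> \<epsilon> \<le> 1 \<longrightarrow> real (2 ^ 240) * (1 / 2 powr sqrt (log 2 (real n))) \<le> \<epsilon> \<longrightarrow> finite U \<longrightarrow> card U \<le> n ^ k \<longrightarrow>
     (\<exists>A s. uses_space U A s \<and> real s \<le> C * (log 2 (real n) / \<epsilon>) \<and> solves U \<epsilon> n A)"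
  proof (rule exI[of _ C], intro allI impI)
    fix n :: nat and \<epsilon> :: real and U :: "nat set"
    assume n: "2 \<le> n" and \<epsilon>: "0 < \<epsilon>" "\<epsilon> \<le> 1" "real (2 ^ 240) * (1 / 2 powr sqrt (log 2 (real n))) \<le> \<epsilon>"
      and U: "finite U" "card U \<le> n ^ k"
    have l1: "1 \<le> log 2 n" using n by (simp add: le_log_iff)
    have Y1: "1 \<le> log 2 n / \<epsilon>" using mult_mono[of 1 "log 2 n" 1 "1 / \<epsilon>"] l1 \<epsilon> by simp
    consider "U = {}" | u0 where "u0 \<in> U" by blast
    then show "\<exists>A s. uses_space U A s \<and> real s \<le> C * (log 2 (real n) / \<epsilon>) \<and> solves U \<epsilon> n A"
    proof cases
      case 1
      have "0 \<le> C * (log 2 (real n) / \<epsilon>)" using C0 Y1 by (intro mult_nonneg_nonneg) linarith+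
      then show ?thesis using no_streams[OF 1, of n \<epsilon>] n by (metis gr0I not_numeral_le_zero of_nat_0)
    next
      case 2
      show ?thesis
      proof (cases "real k + 100 \<le> sqrt (log 2 n)")
        case True
        obtain A s where As: "uses_space U A s" "real s \<le> (300000000000000 + 1000 * real k) * (log 2 n / \<epsilon>)" "solves U \<epsilon> n A"
          using main_regime[OF n U 2 True \<epsilon>(1,2)] \<epsilon>(3) by auto
        have "(300000000000000 + 1000 * real k) * (log 2 n / \<epsilon>) \<le> C * (log 2 n / \<epsilon>)"
          using Y1 by (intro mult_right_mono) (auto simp: C_def)
        then show ?thesis using As by (meson order_trans)
      next
        case False
        have nN: "n \<le> N1"
        proof -
          have "sqrt (log 2 n) < real (k + 100)" using False by simp
          then have "log 2 n < (real (k + 100))\<^sup>2" using l1 by (metis abs_of_nat not_le real_sqrt_abs real_sqrt_le_mono)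
          then have "log 2 n \<le> real ((k + 100)\<^sup>2)" by simp
          then have "real n \<le> 2 powr real ((k + 100)\<^sup>2)" using n by (subst (asm) log_le_iff) auto
          then have "real n \<le> real N1" unfolding N1_def by (simp add: powr_realpow del: of_nat_add of_nat_power)
          then show ?thesis by simp
        qed
        have "(n\<^sup>2 + 1) * 1 * (n + 1) * (card U + 1) ^ n \<le> s1"
        proof -
          have "card U \<le> N1 ^ k" using U(2) power_mono[OF nN, of k] by simp
          then have "(card U + 1) ^ n \<le> (N1 ^ k + 1) ^ n" by (intro power_mono) auto
          also have "\<dots> \<le> (N1 ^ k + 1) ^ N1" using nN by (intro power_increasing) auto
          finally have cU: "(card U + 1) ^ n \<le> (N1 ^ k + 1) ^ N1" .
          have "n\<^sup>2 \<le> N1\<^sup>2" using nN by (rule power_mono) simp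
          then show ?thesis unfolding s1_def using nN cU by (intro mult_le_mono add_mono) auto
        qed
        also have "s1 \<le> 2 ^ s1" by (rule less_imp_le[OF less_exp])
        finally obtain A where A: "uses_space U A s1" "solves U \<epsilon> n A" using store_everything[OF U(1) 2 \<epsilon>(1)] by blast
        have "real s1 * 1 \<le> C * (log 2 (real n) / \<epsilon>)" using Y1 C0 by (intro mult_mono) (auto simp: C_def)
        then show ?thesis using A by auto
      qed
    qed
  qed
qed

end
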